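(* Let $(J^s)_{s\in(1/2,1)}$ be a family of kernels satisfying Hypothesis (H1) below. For any $\varepsilon\in(0,1)$, $s\in(1/2,1)$ and $k\in(0,1]$: (i) there exists a unique probability equilibrium $F^s_\varepsilon\in L^1_k(\mathbb{R}^d)$ of the equation $$\partial_t u=\frac{1}{\varepsilon^{2s}}\big(J^s_\varepsilon*u-u\big)+\mathrm{div}(xu);\qquad (\mathrm{DFFP})$$ (ii) for any probability density $u_0\in L^1_k(\mathbb{R}^d)$ there exist constants $C,\lambda>0$ such that the solution $u(t)$ of (DFFP) with $u(0)=u_0$ satisfies $$\|u(t,\cdot)-F^s_\varepsilon\|_{L^1_k}\le Ce^{-\lambda t}\|u_0-F^s_\varepsilon\|_{L^1_k}\quad\text{for all }t\ge0;$$ (iii) the constants $C$ and $\lambda$ can be chosen independently of $s$ and $\varepsilon$.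
   Context: Notation: $\langle x\rangle=(1+|x|^2)^{1/2}$; for $k\ge0$, $L^1_k(\mathbb{R}^d)$ is the space of measurable $f$ with $\|f\|_{L^1_k}=\int_{\mathbb{R}^d}\langle x\rangle^k|f(x)|\,dx<\infty$. The Fourier transform is $\hat f(\xi)=\int e^{-ix\cdot\xi}f(x)\,dx$. For $\varepsilon>0$, $J^s_\varepsilon(x)=\varepsilon^{-d}J^s(x/\varepsilon)$. Hypothesis (H1): $(J^s)_{s\in(1/2,1)}$ is a family of probability densities on $\mathbb{R}^d$ with $J^s\in L^1\cap L^p$ for some $p\in(1,\infty]$, such that (i) $\int\min\{1,|y|^2\}J^s(y)\,dy<\infty$; (ii) there exist $\delta>0$, $C_0>0$ independent of $s$ with $\hat J^s(\xi)=1-|\xi|^{2s}+R_s(\xi)$ and $|R_s(\xi)|\le C_0|\xi|^{2s+\delta}$ for $|\xi|\le1$; (iii) there exist $C,R>0$ and a function $\Psi\in L^1_2$ with $\int x\Psi(x)\,dx=0$, all independent of $s$, such that $J^s(x)\le C(1-s)|x|^{-d-2s}+\Psi(x)$ for all $|x|\ge R$. Solutions of (DFFP) are mild solutions $u\in C([0,\infty);L^1_k)$, i.e. $u(t)=T_tu_0+\varepsilon^{-2s}\int_0^tT_{t-\tau}[J^s_\varepsilon*u(\tau)]\,d\tau$ with $T_tf(x)=e^{(d-\varepsilon^{-2s})t}f(e^tx)$. An equilibrium of (DFFP) is a probability density $F\in L^1$ solving $\varepsilon^{-2s}(J^s_\varepsilon*F-F)+\mathrm{div}(xF)=0$ in the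 weak sense. *)

theory Defs
  imports "HOL-Analysis.Analysis"
begin

definition jbr :: "'a::euclidean_space \<Rightarrow> real" where
  "jbr x = sqrt (1 + norm x ^ 2)"

definition L1k :: "real \<Rightarrow> ('a::euclidean_space \<Rightarrow> real) \<Rightarrow> bool" where
  "L1k k f \<longleftrightarrow> f \<in> borel_measurable lborel \<and>
     integrable lborel (\<lambda>x. jbr x powr k * \<bar>f x\<bar>)"

definition normL1k :: "real \<Rightarrow> ('a::euclidean_space \<Rightarrow> real) \<Rightarrow> real" where
  "normL1k k f = (\<integral>x. jbr x powr k * \<bar>f x\<bar> \<partial>lborel)"

definition prob_density :: "('a::euclidean_space \<Rightarrow> real) \<Rightarrow> bool" where
  "prob_density f \<longleftrightarrow> f \<in> borel_measurable lborel \<and> (\<forall>x. 0 \<le> f x) \<and>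
     integrable lborel f \<and> (\<integral>x. f x \<partial>lborel) = 1"

definition in_Lp_some_p_gt1 :: "('a::euclidean_space \<Rightarrow> real) \<Rightarrow> bool" where
  "in_Lp_some_p_gt1 f \<longleftrightarrow> f \<in> borel_measurable lborel \<and>
     ((\<exists>p::real. p > 1 \<and> integrable lborel (\<lambda>x. \<bar>f x\<bar> powr p)) \<or>
      (\<exists>M. AE x in lborel. \<bar>f x\<bar> \<le> M))"

definition fourier :: "('a::euclidean_space \<Rightarrow> real) \<Rightarrow> 'a \<Rightarrow> complex" where
  "fourier f \<xi> = (\<integral>x. cis (- (x \<bullet> \<xi>)) * complex_of_real (f x) \<partial>lborel)"

definition conv :: "('a::euclidean_space \<Rightarrow> real) \<Rightarrow> ('a \<Rightarrow> real) \<Rightarrow> 'a \<Rightarrow> real" where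
  "conv f g x = (\<integral>y. f (x - y) * g y \<partial>lborel)"

definition resc :: "real \<Rightarrow> ('a::euclidean_space \<Rightarrow> real) \<Rightarrow> 'a \<Rightarrow> real" where
  "resc \<epsilon> J x = \<epsilon> powr (- real DIM('a)) * J ((1 / \<epsilon>) *\<^sub>R x)"

definition H1 :: "(real \<Rightarrow> 'a::euclidean_space \<Rightarrow> real) \<Rightarrow> bool" where
  "H1 J \<longleftrightarrow>
    (\<forall>s\<in>{1/2<..<1}. prob_density (J s) \<and> in_Lp_some_p_gt1 (J s)) \<and>
    (\<forall>s\<in>{1/2<..<1}. integrable lborel (\<lambda>y. min 1 (norm y ^ 2) * J s y)) \<and>
    (\<exists>\<delta>>0. \<exists>C0>0. \<forall>s\<in>{1/2<..<1}. \<forall>\<xi>::'a. norm \<xi> \<le> 1 \<longrightarrow>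
        norm (fourier (J s) \<xi> - complex_of_real (1 - norm \<xi> powr (2 * s)))
          \<le> C0 * norm \<xi> powr (2 * s + \<delta>)) \<and>
    (\<exists>C>0. \<exists>R>0. \<exists>\<Psi>::'a \<Rightarrow> real. L1k 2 \<Psi> \<and>
        integrable lborel (\<lambda>x. \<Psi> x *\<^sub>R x) \<and> (\<integral>x. \<Psi> x *\<^sub>R x \<partial>lborel) = 0 \<and>
        (\<forall>s\<in>{1/2<..<1}. \<forall>x. norm x \<ge> R \<longrightarrow>
           J s x \<le> C * (1 - s) * norm x powr (- real DIM('a) - 2 * s) + \<Psi> x))"

fun Ck :: "nat \<Rightarrow> ('a::euclidean_space \<Rightarrow> real) \<Rightarrow> bool" where
  "Ck 0 f = continuous_on UNIV f"
| "Ck (Suc n) f = ((\<forall>x. f differentiable (at x)) \<and>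
      (\<forall>i\<in>Basis. Ck n (\<lambda>x. frechet_derivative f (at x) i)))"

definition test_fun :: "('a::euclidean_space \<Rightarrow> real) \<Rightarrow> bool" where
  "test_fun \<phi> \<longleftrightarrow> (\<forall>n. Ck n \<phi>) \<and> compact (closure {x. \<phi> x \<noteq> 0})"

text \<open>Equilibrium: probability density F with
  eps^(-2s) (J_eps * F - F) + div(x F) = 0 in the sense of distributions.\<close>
definition equilibrium :: "real \<Rightarrow> ('a::euclidean_space \<Rightarrow> real) \<Rightarrow> ('a \<Rightarrow> real) \<Rightarrow> real \<Rightarrow> bool" where
  "equilibrium \<epsilon> J F s \<longleftrightarrow> prob_density F \<and>
     (\<forall>\<phi>. test_fun \<phi> \<longrightarrow>
        (\<integral>x. \<epsilon> powr (- 2 * s) * (conv (resc \<epsilon> J) F x - F x) * \<phi> x \<partial>lborel)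
        - (\<integral>x. F x * frechet_derivative \<phi> (at x) x \<partial>lborel) = 0)"

definition Tsg :: "real \<Rightarrow> real \<Rightarrow> real \<Rightarrow> ('a::euclidean_space \<Rightarrow> real) \<Rightarrow> 'a \<Rightarrow> real" where
  "Tsg \<epsilon> s t f x = exp ((real DIM('a) - \<epsilon> powr (- 2 * s)) * t) * f (exp t *\<^sub>R x)"

definition mild_solution :: "real \<Rightarrow> real \<Rightarrow> ('a::euclidean_space \<Rightarrow> real) \<Rightarrow> real
     \<Rightarrow> ('a \<Rightarrow> real) \<Rightarrow> (real \<Rightarrow> 'a \<Rightarrow> real) \<Rightarrow> bool" where
  "mild_solution \<epsilon> s J k u0 u \<longleftrightarrow>
     (\<forall>t\<ge>0. L1k k (u t)) \<and>
     (\<forall>t0\<ge>0. ((\<lambda>t. normL1k k (\<lambda>x. u t x - u t0 x)) \<longlongrightarrow> 0) (at t0 within {0..})) \<and>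
     (\<forall>t\<ge>0. AE x in lborel. u t x = Tsg \<epsilon> s t u0 x +
         \<epsilon> powr (- 2 * s) *
           (LINT \<tau>:{0..t}|lborel. Tsg \<epsilon> s (t - \<tau>) (conv (resc \<epsilon> J) (u \<tau>)) x))"

end

theory Submission
  imports Defs "HOL-Probability.Characteristic_Functions" "HOL-Probability.Sinc_Integral"
begin

text \<open>
  Put \<open>a = \<epsilon> powr (- 2 * s)\<close> and \<open>j = resc \<epsilon> (J s)\<close>. On the Fourier side the equation is solved along
  characteristics: writing a function and its transform alike,
  \<open>u(t)\<close> is \<open>\<xi> \<mapsto> u\<^sub>0(e\<^sup>-\<^sup>t \<xi>) exp (- A t \<xi>)\<close>, where \<open>A t \<xi>\<close> is \<open>a\<close> times the
  integral of \<open>1 - j(e\<^sup>-\<^sup>\<tau> \<xi>)\<close> over \<open>0 \<le> \<tau> \<le> t\<close>. Mild solutions and weak equilibria are both characterised by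
  this formula. The solution operator is a dilation followed by convolution with a compound Poisson law, and
  the expansion of the transform of \<open>J s\<close> at the origin bounds the moments of that law of order below
  \<open>2 s\<close>, uniformly in \<open>\<epsilon>\<close> and, for a fixed order below 1, in \<open>s\<close>.

  The contraction is of Harris type. The same expansion forces \<open>J s\<close> to charge, in every direction, one of
  finitely many small balls with a mass independent of \<open>s\<close>. The part of the Poisson law in which every such
  ball is used many times has a transform that decays like a large power of \<open>1 / |\<xi>|\<close>, because the dilations
  spread each jump along a ray and the resulting oscillatory integrals decay. This gives a minorant of the
  Poisson law that is Hoelder continuous under translations in \<open>L\<^sup>1\<close>, hence exponential decay of mean-zero data in
  \<open>L\<^sup>1\<close> at the cost of a small moment. Existence and uniqueness follow, and one more step of the
  semigroup upgrades the decay to the weighted norm.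
\<close>

section \<open>Convolution and the Fourier transform on integrable functions\<close>

text \<open>What shapes the proof is uniformity. As \<open>s\<close> tends to 1/2, the available
  bound on the moment of order \<open>k = 1\<close> of the jumps degenerates. Hence Harris' argument
  is run with a moment of order at most \<open>k / 2\<close>, where the bounds are uniform, and in
  the weighted estimate the moment of order \<open>k\<close> of the jumps is bounded by twice that
  of the equilibrium. If the latter is large, the equilibrium is far from \<open>u0\<close> in the
  weighted norm, so the right-hand side of the claim is large as well; this is how the constant
  comes to depend on \<open>u0\<close> but not on the equilibrium. As \<open>\<epsilon>\<close>
  tends to 0, the expansion at the origin controls only frequencies up to order
  \<open>1 / \<epsilon>\<close>, where it makes \<open>Re (A t \<xi>)\<close> grow at least linearly
  in \<open>norm \<xi>\<close>. Beyond them the oscillatory integrals gain powers of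
  \<open>1 / (\<epsilon> * norm \<xi>)\<close>, and the resulting powers of
  \<open>1 / \<epsilon>\<close> are absorbed by a factor \<open>exp (- c / \<epsilon>)\<close>,
  which is there because the jump rate is at least \<open>1 / \<epsilon>\<close>.\<close>

abbreviation nrm1 :: "('a::euclidean_space \<Rightarrow> real) \<Rightarrow> real" where
  "nrm1 f \<equiv> (\<integral>x. \<bar>f x\<bar> \<partial>lborel)"

section \<open>Affine changes of variables\<close>

lemma integral_affine:
  fixes f :: "'a::euclidean_space \<Rightarrow> 'b::{banach,second_countable_topology}"
  assumes [measurable]: "f \<in> borel_measurable borel" and c: "c \<noteq> 0"
  shows "(\<integral>x. f (t + c *\<^sub>R x) \<partial>lborel) = (1 / \<bar>c\<bar>^DIM('a)) *\<^sub>R (\<integral>x. f x \<partial>lborel)"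
proof -
  have "(\<integral>x. f x \<partial>lborel) = \<bar>c\<bar>^DIM('a) *\<^sub>R (\<integral>x. f (t + c *\<^sub>R x) \<partial>lborel)"
    by (subst lborel_affine[OF c, of t], subst integral_density)
       (auto simp: integral_distr)
  then show ?thesis using c by simp
qed

lemma integrable_affine:
  fixes f :: "'a::euclidean_space \<Rightarrow> 'b::{banach,second_countable_topology}"
  assumes f: "integrable lborel f" and c: "c \<noteq> 0"
  shows "integrable lborel (\<lambda>x. f (t + c *\<^sub>R x))"
proof -
  have [measurable]: "f \<in> borel_measurable borel" using f by auto
  have "integrable (density (distr lborel borel (\<lambda>x. t + c *\<^sub>R x)) (\<lambda>_. \<bar>c\<bar>^DIM('a))) f"
    using f by (subst (asm) lborel_affine[OF c, of t]) 
  then have "integrable lborel (\<lambda>x. \<bar>c\<bar>^DIM('a) *\<^sub>R f (t + c *\<^sub>R x))"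
    by (subst (asm) integrable_density) (auto simp: integrable_distr_eq)
  from integrable_scaleR_right[OF this, of "1 / \<bar>c\<bar>^DIM('a)"] show ?thesis using c by simp
qed

lemma AE_affine:
  fixes P :: "'a::euclidean_space \<Rightarrow> bool"
  assumes P: "AE x in lborel. P x" and c: "c \<noteq> 0"
  shows "AE x in lborel. P (t + c *\<^sub>R x)"
proof -
  have "AE x in density (distr lborel borel (\<lambda>x. t + c *\<^sub>R x)) (\<lambda>_. \<bar>c\<bar>^DIM('a)). P x"
    using P by (subst (asm) lborel_affine[OF c, of t]) 
  then have "AE x in distr lborel borel (\<lambda>x. t + c *\<^sub>R x). P x"
    using c by (subst (asm) AE_density) auto
  then show ?thesis by (rule AE_distrD[rotated]) simp
qed

lemma lborel_integral_shift:
  fixes f :: "'a::euclidean_space \<Rightarrow> 'b::{banach,second_countable_topology}"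
  assumes "f \<in> borel_measurable borel"
  shows "(\<integral>y. f (y - x) \<partial>lborel) = (\<integral>y. f y \<partial>lborel)"
  using integral_affine[OF assms, of "1" "-x"] by simp

lemma lborel_integrable_shift:
  fixes f :: "'a::euclidean_space \<Rightarrow> 'b::{banach,second_countable_topology}"
  assumes "integrable lborel f"
  shows "integrable lborel (\<lambda>y. f (y - x))"
  using integrable_affine[OF assms, of "1" "-x"] by simp

lemma AE_reflect:
  fixes P :: "'a::euclidean_space \<Rightarrow> bool"
  assumes P: "AE x in lborel. P x"
  shows "AE y in lborel. P (x - y)"
  using AE_affine[OF assms, of "-1" x] by simp

section \<open>Convolution in L1\<close>

lemma conv_pair_integrable:
  fixes f g :: "'a::euclidean_space \<Rightarrow> real"
  assumes f: "integrable lborel f" and g: "integrable lborel g"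
  shows "integrable (lborel \<Otimes>\<^sub>M lborel) (\<lambda>(y,x). f (x - y) * g y)"
proof -
  have [measurable]: "f \<in> borel_measurable borel" "g \<in> borel_measurable borel" using f g by auto
  show ?thesis
  proof (rule lborel_pair.Fubini_integrable)
    show "(\<lambda>(y, x). f (x - y) * g y) \<in> borel_measurable (lborel \<Otimes>\<^sub>M lborel)" by measurable
    have "(\<integral>x. norm (case (y,x) of (y, x) \<Rightarrow> f (x - y) * g y) \<partial>lborel) = nrm1 f * \<bar>g y\<bar>" for y
      using lborel_integral_shift[of "\<lambda>x. \<bar>f x\<bar>" y] by (simp add: abs_mult)
    then show "integrable lborel (\<lambda>y. \<integral>x. norm (case (y,x) of (y, x) \<Rightarrow> f (x - y) * g y) \<partial>lborel)"
      using g by simp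
    show "AE y in lborel. integrable lborel (\<lambda>x. case (y,x) of (y, x) \<Rightarrow> f (x - y) * g y)"
      using lborel_integrable_shift[OF f] by simp
  qed
qed

lemma conv_AE_integrable:
  fixes f g :: "'a::euclidean_space \<Rightarrow> real"
  assumes f: "integrable lborel f" and g: "integrable lborel g"
  shows "AE x in lborel. integrable lborel (\<lambda>y. f (x - y) * g y)"
  using lborel_pair.AE_integrable_snd[OF conv_pair_integrable[OF f g]] .

lemma conv_integrable:
  fixes f g :: "'a::euclidean_space \<Rightarrow> real"
  assumes f: "integrable lborel f" and g: "integrable lborel g"
  shows "integrable lborel (conv f g)"
  using lborel_pair.integrable_snd[OF conv_pair_integrable[OF f g]] 
  unfolding conv_def by simp

lemma conv_integral:
  fixes f g :: "'a::euclidean_space \<Rightarrow> real"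
  assumes f: "integrable lborel f" and g: "integrable lborel g"
  shows "(\<integral>x. conv f g x \<partial>lborel) = (\<integral>x. f x \<partial>lborel) * (\<integral>x. g x \<partial>lborel)"
proof -
  have [measurable]: "f \<in> borel_measurable borel" using f by auto
  show ?thesis unfolding conv_def
    by (subst lborel_pair.Fubini_integral[OF conv_pair_integrable[OF f g]]) (simp add: lborel_integral_shift)
qed

lemma conv_measurable [measurable]:
  fixes f g :: "'a::euclidean_space \<Rightarrow> real"
  assumes [measurable]: "f \<in> borel_measurable borel" "g \<in> borel_measurable borel"
  shows "conv f g \<in> borel_measurable borel"
proof -
  have "(\<lambda>x. \<integral>y. f (x - y) * g y \<partial>lborel) \<in> borel_measurable lborel"
    by (rule lborel.borel_measurable_lebesgue_integral) measurable
  then show ?thesis unfolding conv_def[abs_def] by simp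
qed

lemma conv_nonneg: "(\<And>x. 0 \<le> f x) \<Longrightarrow> (\<And>x. 0 \<le> g x) \<Longrightarrow> 0 \<le> conv f g x"
  unfolding conv_def by simp

lemma conv_abs_le: "\<bar>conv f g x\<bar> \<le> conv (\<lambda>x. \<bar>f x\<bar>) (\<lambda>x. \<bar>g x\<bar>) x"
  unfolding conv_def using integral_norm_bound[of lborel "\<lambda>y. f (x - y) * g y"] by (simp add: abs_mult)

lemma nrm1_conv_le:
  fixes f g :: "'a::euclidean_space \<Rightarrow> real"
  assumes f: "integrable lborel f" and g: "integrable lborel g"
  shows "nrm1 (conv f g) \<le> nrm1 f * nrm1 g"
proof -
  have "nrm1 (conv f g) \<le> (\<integral>x. conv (\<lambda>x. \<bar>f x\<bar>) (\<lambda>x. \<bar>g x\<bar>) x \<partial>lborel)"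
    using f g by (intro integral_mono conv_integrable integrable_abs conv_abs_le)
  then show ?thesis using f g by (simp add: conv_integral)
qed

text \<open>Only almost everywhere: at a point where the larger integrand is not integrable its
  Bochner integral is 0, and the inequality can fail there.\<close>

lemma conv_mono_AE:
  fixes f g :: "'a::euclidean_space \<Rightarrow> real"
  assumes int: "integrable lborel f'" "integrable lborel g'"
    "integrable lborel f" "integrable lborel g"
    and le: "AE x in lborel. 0 \<le> f x \<and> f x \<le> f' x" "AE x in lborel. 0 \<le> g x \<and> g x \<le> g' x"
  shows "AE x in lborel. conv f g x \<le> conv f' g' x"
  using conv_AE_integrable[OF int(1,2)] conv_AE_integrable[OF int(3,4)]
proof eventually_elim
  case (elim x)
  show ?case unfolding conv_def
  proof (rule integral_mono_AE[OF elim(2,1)])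
    show "AE y in lborel. f (x - y) * g y \<le> f' (x - y) * g' y"
      using AE_reflect[OF le(1), of x] le(2) by eventually_elim (auto intro: mult_mono)
  qed
qed

text \<open>Equality holds at every \<open>x\<close>, since for fixed \<open>x\<close> the
  integrands differ on a null set of \<open>y\<close>. This later allows a curve to be replaced by a
  jointly measurable version without changing the mild formula at any point.\<close>

lemma conv_cong_AE_right:
  fixes f g :: "'a::euclidean_space \<Rightarrow> real"
  assumes [measurable]: "f \<in> borel_measurable borel" "g' \<in> borel_measurable borel" "g \<in> borel_measurable borel"
    and "AE x in lborel. g x = g' x"
  shows "conv f g x = conv f g' x"
  unfolding conv_def using assms(4) by (intro integral_cong_AE) auto

lemma conv_add_left_AE:
  fixes f g :: "'a::euclidean_space \<Rightarrow> real"
  assumes "integrable lborel f" "integrable lborel f'" "integrable lborel g"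
  shows "AE x in lborel. conv (\<lambda>x. f x + f' x) g x = conv f g x + conv f' g x"
  using conv_AE_integrable[OF assms(1,3)] conv_AE_integrable[OF assms(2,3)]
  by eventually_elim (simp add: conv_def distrib_right)

section \<open>Fourier transform of integrable functions\<close>

lemma cis_measurable[measurable (raw)]: "f \<in> borel_measurable M \<Longrightarrow> (\<lambda>x. cis (f x)) \<in> borel_measurable M"
  by (rule borel_measurable_continuous_on[of cis]) (auto intro!: continuous_intros)

lemma fourier_integrable:
  fixes f :: "'a::euclidean_space \<Rightarrow> real"
  assumes f: "integrable lborel f"
  shows "integrable lborel (\<lambda>x. cis (- (x \<bullet> \<xi>)) * complex_of_real (f x))"
proof -
  have [measurable]: "f \<in> borel_measurable borel" using f by auto
  show ?thesis by (rule Bochner_Integration.integrable_bound[OF f]) (auto simp: norm_mult)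
qed

lemma fourier_norm_le:
  fixes f :: "'a::euclidean_space \<Rightarrow> real"
  shows "norm (fourier f \<xi>) \<le> nrm1 f"
  unfolding fourier_def using integral_norm_bound[of lborel "\<lambda>x. cis (- (x \<bullet> \<xi>)) * complex_of_real (f x)"] by (simp add: norm_mult)

lemma fourier_zero: "fourier f 0 = complex_of_real (\<integral>x. f x \<partial>lborel)"
  unfolding fourier_def by simp

lemma fourier_cong_AE:
  fixes f :: "'a::euclidean_space \<Rightarrow> real"
  assumes [measurable]: "f \<in> borel_measurable borel" "g \<in> borel_measurable borel"
    and "AE x in lborel. f x = g x"
  shows "fourier f \<xi> = fourier g \<xi>"
  unfolding fourier_def using assms(3) by (intro integral_cong_AE) auto

lemma fourier_add:
  fixes f :: "'a::euclidean_space \<Rightarrow> real"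
  assumes f: "integrable lborel f" and g: "integrable lborel g"
  shows "fourier (\<lambda>x. f x + g x) \<xi> = fourier f \<xi> + fourier g \<xi>"
  unfolding fourier_def using fourier_integrable[OF f, of \<xi>] fourier_integrable[OF g, of \<xi>]
  by (simp add: distrib_left)

lemma fourier_diff:
  fixes f :: "'a::euclidean_space \<Rightarrow> real"
  assumes f: "integrable lborel f" and g: "integrable lborel g"
  shows "fourier (\<lambda>x. f x - g x) \<xi> = fourier f \<xi> - fourier g \<xi>"
  unfolding fourier_def using fourier_integrable[OF f, of \<xi>] fourier_integrable[OF g, of \<xi>]
  by (simp add: right_diff_distrib)

lemma fourier_cmult:
  fixes f :: "'a::euclidean_space \<Rightarrow> real"
  shows "fourier (\<lambda>x. c * f x) \<xi> = of_real c * fourier f \<xi>"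
proof -
  have "cis (- (x \<bullet> \<xi>)) * complex_of_real (c * f x) = of_real c * (cis (- (x \<bullet> \<xi>)) * complex_of_real (f x))" for x
    by simp
  then show ?thesis unfolding fourier_def by (simp only: integral_mult_right_zero)
qed

lemma fourier_Re:
  fixes f :: "'a::euclidean_space \<Rightarrow> real"
  assumes f: "integrable lborel f"
  shows "Re (fourier f \<xi>) = (\<integral>x. cos (x \<bullet> \<xi>) * f x \<partial>lborel)"
  unfolding fourier_def integral_Re[OF fourier_integrable[OF f], symmetric] by simp

text \<open>The defect of the transform from its value at 0 is an integral of a nonnegative weight.
  It translates the behaviour near the origin into moment bounds (from above,
  \<open>fourier_moment\<close>) and into mass in a given direction (from below,
  \<open>direction_mass\<close>).\<close>

lemma fourier_mass_diff:
  fixes f :: "'a::euclidean_space \<Rightarrow> real"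
  assumes f: "integrable lborel f"
  shows "integrable lborel (\<lambda>x. (1 - cos (x \<bullet> \<xi>)) * f x)"
    "(\<integral>x. (1 - cos (x \<bullet> \<xi>)) * f x \<partial>lborel) = (\<integral>x. f x \<partial>lborel) - Re (fourier f \<xi>)"
proof -
  have [measurable]: "f \<in> borel_measurable borel" using f by auto
  have i: "integrable lborel (\<lambda>x. cos (x \<bullet> \<xi>) * f x)"
    by (rule Bochner_Integration.integrable_bound[OF f]) (auto simp: abs_mult mult_left_le_one_le)
  show "integrable lborel (\<lambda>x. (1 - cos (x \<bullet> \<xi>)) * f x)"
    using f i by (simp add: left_diff_distrib)
  show "(\<integral>x. (1 - cos (x \<bullet> \<xi>)) * f x \<partial>lborel) = (\<integral>x. f x \<partial>lborel) - Re (fourier f \<xi>)"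
    using f i by (simp add: left_diff_distrib fourier_Re)
qed

lemma fourier_conv:
  fixes f g :: "'a::euclidean_space \<Rightarrow> real"
  assumes f: "integrable lborel f" and g: "integrable lborel g"
  shows "fourier (conv f g) \<xi> = fourier f \<xi> * fourier g \<xi>"
proof -
  have [measurable]: "f \<in> borel_measurable borel" "g \<in> borel_measurable borel" using f g by auto
  have int: "integrable (lborel \<Otimes>\<^sub>M lborel) (\<lambda>(y,x). cis (- (x \<bullet> \<xi>)) * complex_of_real (f (x - y) * g y))"
    by (rule Bochner_Integration.integrable_bound[OF conv_pair_integrable[OF f g]]) (auto simp: norm_mult)
  have "fourier (conv f g) \<xi> = (\<integral>x. (\<integral>y. cis (- (x \<bullet> \<xi>)) * complex_of_real (f (x - y) * g y) \<partial>lborel) \<partial>lborel)"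
    unfolding fourier_def conv_def by (simp flip: integral_complex_of_real)
  also have "\<dots> = (\<integral>y. (\<integral>x. cis (- (x \<bullet> \<xi>)) * complex_of_real (f (x - y) * g y) \<partial>lborel) \<partial>lborel)"
    by (rule lborel_pair.Fubini_integral[OF int])
  also have "\<dots> = (\<integral>y. fourier f \<xi> * (cis (- (y \<bullet> \<xi>)) * complex_of_real (g y)) \<partial>lborel)"
  proof (rule Bochner_Integration.integral_cong[OF refl])
    fix y
    have cis: "cis (- (x \<bullet> \<xi>)) = cis (- ((x - y) \<bullet> \<xi>)) * cis (- (y \<bullet> \<xi>))" for x
      by (simp add: cis_mult inner_diff_left)
    have "(\<integral>x. cis (- (x \<bullet> \<xi>)) * complex_of_real (f (x - y) * g y) \<partial>lborel)
      = (\<integral>x. cis (- ((x - y) \<bullet> \<xi>)) * complex_of_real (f (x - y)) * (cis (- (y \<bullet> \<xi>)) * g y) \<partial>lborel)"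
      by (intro Bochner_Integration.integral_cong refl) (subst cis, simp add: mult_ac)
    also have "\<dots> = (\<integral>x. cis (- ((x - y) \<bullet> \<xi>)) * complex_of_real (f (x - y)) \<partial>lborel) * (cis (- (y \<bullet> \<xi>)) * g y)"
      by simp
    also have "(\<integral>x. cis (- ((x - y) \<bullet> \<xi>)) * complex_of_real (f (x - y)) \<partial>lborel) = fourier f \<xi>"
      unfolding fourier_def by (rule lborel_integral_shift[of "\<lambda>x. cis (- (x \<bullet> \<xi>)) * complex_of_real (f x)"]) simp
    finally show "(\<integral>x. cis (- (x \<bullet> \<xi>)) * complex_of_real (f (x - y) * g y) \<partial>lborel)
       = fourier f \<xi> * (cis (- (y \<bullet> \<xi>)) * complex_of_real (g y))" .
  qed
  also have "\<dots> = fourier f \<xi> * fourier g \<xi>" unfolding fourier_def[of g] by simp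
  finally show ?thesis .
qed

lemma fourier_continuous:
  fixes f :: "'a::euclidean_space \<Rightarrow> real"
  assumes f: "integrable lborel f"
  shows "continuous_on S (fourier f)"
proof -
  have [measurable]: "f \<in> borel_measurable borel" using f by auto
  have "fourier f \<midarrow>\<xi>\<rightarrow> fourier f \<xi>" for \<xi>
    unfolding tendsto_at_iff_sequentially comp_def
  proof (intro allI impI)
    fix X assume X: "X \<longlonglongrightarrow> \<xi>"
    show "(\<lambda>n. fourier f (X n)) \<longlonglongrightarrow> fourier f \<xi>" unfolding fourier_def
    proof (rule integral_dominated_convergence[where w="\<lambda>x. \<bar>f x\<bar>"])
      show "AE x in lborel. (\<lambda>i. cis (- (x \<bullet> X i)) * complex_of_real (f x)) \<longlonglongrightarrow> cis (- (x \<bullet> \<xi>)) * complex_of_real (f x)"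
        unfolding cis_conv_exp by (intro AE_I2 tendsto_intros X)
    qed (use f in \<open>auto simp: norm_mult\<close>)
  qed
  then show ?thesis unfolding continuous_on_def by (meson UNIV_I tendsto_within_subset subset_UNIV)
qed

lemma integrable_pair_mult:
  fixes f :: "'a::euclidean_space \<Rightarrow> 'c::{banach,second_countable_topology,real_normed_field}"
    and g :: "'b::euclidean_space \<Rightarrow> 'c"
  assumes f: "integrable lborel f" and g: "integrable lborel g"
  shows "integrable (lborel \<Otimes>\<^sub>M lborel) (\<lambda>(x,y). f x * g y)"
proof (rule lborel_pair.Fubini_integrable)
  have [measurable]: "f \<in> borel_measurable borel" "g \<in> borel_measurable borel" using f g by auto
  show "(\<lambda>(x, y). f x * g y) \<in> borel_measurable (lborel \<Otimes>\<^sub>M lborel)" by measurable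
  show "integrable lborel (\<lambda>x. \<integral>y. norm (case (x, y) of (x, y) \<Rightarrow> f x * g y) \<partial>lborel)"
    using f g by (auto simp: norm_mult)
  show "AE x in lborel. integrable lborel (\<lambda>y. case (x, y) of (x, y) \<Rightarrow> f x * g y)"
    using g by simp
qed

text \<open>Lebesgue measure on \<open>'a\<close> is the image of a product of one-dimensional ones,
  so tensor products integrate factor by factor; applied to the Gaussian and to
  \<open>bump_weight\<close>.\<close>

lemma lborel_prod_integral:
  fixes f :: "'a::euclidean_space \<Rightarrow> real \<Rightarrow> 'c::{real_normed_field,banach,second_countable_topology}"
  assumes int: "\<And>b. b \<in> Basis \<Longrightarrow> integrable lborel (f b)"
  shows "integrable lborel (\<lambda>x::'a. \<Prod>b\<in>Basis. f b (x \<bullet> b))"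
    and "(\<integral>x. (\<Prod>b\<in>(Basis::'a set). f b (x \<bullet> b)) \<partial>lborel) = (\<Prod>b\<in>Basis. \<integral>u. f b u \<partial>lborel)"
proof -
  interpret product_sigma_finite "\<lambda>_::'a. lborel :: real measure" ..
  have [measurable]: "f b \<in> borel_measurable borel" if "b \<in> Basis" for b using int[OF that] by auto
  have m: "(\<lambda>x::'a. \<Prod>b\<in>Basis. f b (x \<bullet> b)) \<in> borel_measurable borel" by measurable
  have m2: "(\<lambda>f::'a\<Rightarrow>real. \<Sum>b\<in>Basis. f b *\<^sub>R b) \<in> measurable (\<Pi>\<^sub>M b\<in>Basis. lborel) borel"
    by measurable
  have eq: "(\<Prod>b\<in>Basis. f b ((\<Sum>b\<in>Basis. g b *\<^sub>R b) \<bullet> b)) = (\<Prod>b\<in>Basis. f b (g b))" for g :: "'a \<Rightarrow> real"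
    by (rule prod.cong) auto
  show "integrable lborel (\<lambda>x::'a. \<Prod>b\<in>Basis. f b (x \<bullet> b))"
    unfolding lborel_eq[where 'a='a] integrable_distr_eq[OF m2 m] eq
    by (rule product_integrable_prod) (auto intro: int)
  show "(\<integral>x. (\<Prod>b\<in>(Basis::'a set). f b (x \<bullet> b)) \<partial>lborel) = (\<Prod>b\<in>Basis. \<integral>u. f b u \<partial>lborel)"
    unfolding lborel_eq[where 'a='a] integral_distr[OF m2 m] eq
    by (rule product_integral_prod) (auto intro: int)
qed

section \<open>Gaussian regularisation and injectivity of the Fourier transform\<close>

text \<open>Left unnormalised, so that its transform is \<open>sqrt (2 * pi) ^ DIM('a)\<close> times
  itself.\<close>

definition gauss :: "'a::euclidean_space \<Rightarrow> real" where
  "gauss x = exp (- (norm x)\<^sup>2 / 2)"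

lemma gauss_measurable [measurable]: "gauss \<in> borel_measurable borel"
  unfolding gauss_def[abs_def] by measurable

lemma gauss_pos: "0 < gauss x" and gauss_nonneg: "0 \<le> gauss x"
  by (simp_all add: gauss_def)

lemma gauss_prod: "gauss x = (\<Prod>b\<in>Basis. exp (- (x \<bullet> b)\<^sup>2 / 2))"
proof -
  have "(norm x)\<^sup>2 = (\<Sum>b\<in>Basis. (x \<bullet> b)\<^sup>2)"
    unfolding power2_norm_eq_inner by (subst euclidean_inner) (simp only: power2_eq_square)
  then show ?thesis unfolding gauss_def
    by (simp add: sum_negf sum_divide_distrib flip: exp_sum)
qed

lemma gauss_fourier_real:
  shows "integrable lborel (\<lambda>u::real. exp (- u\<^sup>2 / 2))"
    and "integrable lborel (\<lambda>u. cis (t * u) * complex_of_real (exp (- u\<^sup>2 / 2)))"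
    and "(\<integral>u. cis (t * u) * complex_of_real (exp (- u\<^sup>2 / 2)) \<partial>lborel) = of_real (sqrt (2 * pi) * exp (- t\<^sup>2 / 2))"
proof -
  have d: "exp (- u\<^sup>2 / 2) = sqrt (2 * pi) * std_normal_density u" for u :: real
    by (simp add: std_normal_density_def)
  show i: "integrable lborel (\<lambda>u::real. exp (- u\<^sup>2 / 2))"
    unfolding d by (intro integrable_mult_right) (auto intro: integrable_normal_density)
  show "integrable lborel (\<lambda>u. cis (t * u) * complex_of_real (exp (- u\<^sup>2 / 2)))"
    by (rule Bochner_Integration.integrable_bound[OF i]) (auto simp: norm_mult)
  have "complex_of_real (exp (- (t^2) / 2)) = (\<integral>u. std_normal_density u *\<^sub>R iexp (t * u) \<partial>lborel)"
    unfolding char_std_normal_distribution[THEN fun_cong, symmetric] char_def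
    by (subst integral_density) (auto simp: normal_density_nonneg)
  moreover have "(\<integral>u. cis (t * u) * complex_of_real (exp (- u\<^sup>2 / 2)) \<partial>lborel)
     = (\<integral>u. of_real (sqrt (2 * pi)) * (std_normal_density u *\<^sub>R iexp (t * u)) \<partial>lborel)"
    by (intro Bochner_Integration.integral_cong refl, subst d) (simp add: cis_conv_exp scaleR_conv_of_real mult_ac)
  ultimately show "(\<integral>u. cis (t * u) * complex_of_real (exp (- u\<^sup>2 / 2)) \<partial>lborel) = of_real (sqrt (2 * pi) * exp (- t\<^sup>2 / 2))"
    by (simp only: integral_mult_right_zero of_real_mult)
qed

lemma cis_sum: "finite A \<Longrightarrow> cis (sum f A) = (\<Prod>a\<in>A. cis (f a))"
  by (induction A rule: finite_induct) (auto simp: cis_mult[symmetric])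

lemma gauss_fourier:
  fixes z :: "'a::euclidean_space"
  shows "(\<integral>\<xi>. cis (z \<bullet> \<xi>) * complex_of_real (gauss \<xi>) \<partial>lborel) = of_real (sqrt (2 * pi) ^ DIM('a) * gauss z)"
    and "integrable lborel (gauss :: 'a \<Rightarrow> real)"
    and "(\<integral>x. gauss (x::'a) \<partial>lborel) = sqrt (2 * pi) ^ DIM('a)"
proof -
  have *: "(\<integral>\<xi>. cis (z \<bullet> \<xi>) * complex_of_real (gauss \<xi>) \<partial>lborel) = of_real (sqrt (2 * pi) ^ DIM('a) * gauss z)"
    for z :: 'a
  proof -
    have "cis (z \<bullet> \<xi>) * complex_of_real (gauss \<xi>)
      = (\<Prod>b\<in>Basis. cis ((z \<bullet> b) * (\<xi> \<bullet> b)) * complex_of_real (exp (- (\<xi> \<bullet> b)\<^sup>2 / 2)))" for \<xi> :: 'a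
      by (simp add: euclidean_inner[of z \<xi>] cis_sum gauss_prod prod.distrib)
    then have "(\<integral>\<xi>. cis (z \<bullet> \<xi>) * complex_of_real (gauss \<xi>) \<partial>lborel)
      = (\<integral>\<xi>. (\<Prod>b\<in>Basis. cis ((z \<bullet> b) * (\<xi> \<bullet> b)) * complex_of_real (exp (- (\<xi> \<bullet> b)\<^sup>2 / 2))) \<partial>lborel)"
      by simp
    also have "\<dots> = (\<Prod>b\<in>Basis. complex_of_real (sqrt (2 * pi) * exp (- (z \<bullet> b)\<^sup>2 / 2)))"
      by (subst lborel_prod_integral(2)) (simp_all only: gauss_fourier_real)
    also have "\<dots> = of_real (sqrt (2 * pi) ^ DIM('a) * gauss z)"
      unfolding of_real_prod[symmetric] prod.distrib gauss_prod by simp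
    finally show ?thesis .
  qed
  show "(\<integral>\<xi>. cis (z \<bullet> \<xi>) * complex_of_real (gauss \<xi>) \<partial>lborel) = of_real (sqrt (2 * pi) ^ DIM('a) * gauss z)"
    by (rule *)
  show "integrable lborel (gauss :: 'a \<Rightarrow> real)"
    unfolding gauss_prod[abs_def] by (rule lborel_prod_integral(1)) (rule gauss_fourier_real)
  have "complex_of_real (\<integral>x. gauss (x::'a) \<partial>lborel) = of_real (sqrt (2 * pi) ^ DIM('a))"
    using *[of 0] by (simp add: gauss_def)
  then show "(\<integral>x. gauss (x::'a) \<partial>lborel) = sqrt (2 * pi) ^ DIM('a)"
    by (simp only: of_real_eq_iff)
qed

text \<open>The mollified value is, up to the constant, the inverse Fourier integral of
  \<open>fourier f\<close> damped by \<open>gauss (\<sigma> *\<^sub>R \<xi>)\<close>. The damping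
  makes the double integral over frequency and space absolutely convergent, so Fubini applies; the
  resulting bound is independent of \<open>\<sigma>\<close>.\<close>

lemma gauss_mollify_bound:
  fixes f :: "'a::euclidean_space \<Rightarrow> real"
  assumes f: "integrable lborel f" and b: "integrable lborel b"
    and le: "\<And>\<xi>. norm (fourier f \<xi>) \<le> b \<xi>" and s: "0 < \<sigma>"
  shows "\<bar>\<integral>z. f (x - \<sigma> *\<^sub>R z) * gauss z \<partial>lborel\<bar> * sqrt (2 * pi) ^ DIM('a) \<le> (\<integral>\<xi>. b \<xi> \<partial>lborel)"
proof -
  let ?c = "sqrt (2 * pi) ^ DIM('a)"
  have [measurable]: "f \<in> borel_measurable borel" using f by auto
  have fm[measurable]: "fourier f \<in> borel_measurable borel"
    using borel_measurable_continuous_onI[OF fourier_continuous[OF f]] .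
  have g: "integrable lborel (\<lambda>\<xi>::'a. gauss (\<sigma> *\<^sub>R \<xi>))"
    using integrable_affine[OF gauss_fourier(2), of \<sigma> 0] s by simp
  have sc: "(\<integral>\<xi>. cis (z \<bullet> \<xi>) * complex_of_real (gauss (\<sigma> *\<^sub>R \<xi>)) \<partial>lborel)
     = of_real (?c / \<sigma>^DIM('a) * gauss ((1/\<sigma>) *\<^sub>R z))" for z :: 'a
    using integral_affine[of "\<lambda>\<xi>. cis (((1/\<sigma>) *\<^sub>R z) \<bullet> \<xi>) * complex_of_real (gauss \<xi>)" \<sigma> 0] s
      gauss_fourier(1)[of "(1/\<sigma>) *\<^sub>R z"]
    by (simp add: scaleR_conv_of_real)
  have int: "integrable (lborel \<Otimes>\<^sub>M lborel) (\<lambda>(\<xi>,y). cis ((x - y) \<bullet> \<xi>) * complex_of_real (gauss (\<sigma> *\<^sub>R \<xi>)) * complex_of_real (f y))"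
    by (rule Bochner_Integration.integrable_bound[OF integrable_pair_mult[OF g f]]) (auto simp: norm_mult)
  have "(\<integral>\<xi>. cis (x \<bullet> \<xi>) * complex_of_real (gauss (\<sigma> *\<^sub>R \<xi>)) * fourier f \<xi> \<partial>lborel)
    = (\<integral>\<xi>. (\<integral>y. cis ((x - y) \<bullet> \<xi>) * complex_of_real (gauss (\<sigma> *\<^sub>R \<xi>)) * complex_of_real (f y) \<partial>lborel) \<partial>lborel)"
  proof (rule Bochner_Integration.integral_cong[OF refl])
    fix \<xi>
    have e: "cis ((x - y) \<bullet> \<xi>) = cis (x \<bullet> \<xi>) * cis (- (y \<bullet> \<xi>))" for y
      by (simp add: cis_mult inner_diff_left)
    have "cis (x \<bullet> \<xi>) * complex_of_real (gauss (\<sigma> *\<^sub>R \<xi>)) * fourier f \<xi>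
      = (\<integral>y. cis (x \<bullet> \<xi>) * complex_of_real (gauss (\<sigma> *\<^sub>R \<xi>)) * (cis (- (y \<bullet> \<xi>)) * complex_of_real (f y)) \<partial>lborel)"
      unfolding fourier_def by (rule integral_mult_right_zero[symmetric])
    also have "\<dots> = (\<integral>y. cis ((x - y) \<bullet> \<xi>) * complex_of_real (gauss (\<sigma> *\<^sub>R \<xi>)) * complex_of_real (f y) \<partial>lborel)"
      unfolding e by (simp only: mult_ac)
    finally show "cis (x \<bullet> \<xi>) * complex_of_real (gauss (\<sigma> *\<^sub>R \<xi>)) * fourier f \<xi> =
      (\<integral>y. cis ((x - y) \<bullet> \<xi>) * complex_of_real (gauss (\<sigma> *\<^sub>R \<xi>)) * complex_of_real (f y) \<partial>lborel)" .
  qed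
  also have "\<dots> = (\<integral>y. (\<integral>\<xi>. cis ((x - y) \<bullet> \<xi>) * complex_of_real (gauss (\<sigma> *\<^sub>R \<xi>)) * complex_of_real (f y) \<partial>lborel) \<partial>lborel)"
    by (rule lborel_pair.Fubini_integral[OF int, symmetric])
  also have "\<dots> = (\<integral>y. complex_of_real (?c / \<sigma>^DIM('a) * (f y * gauss ((1/\<sigma>) *\<^sub>R (x - y)))) \<partial>lborel)"
    unfolding integral_mult_left_zero sc by (intro Bochner_Integration.integral_cong refl) simp
  also have "\<dots> = complex_of_real (?c / \<sigma>^DIM('a) * (\<integral>y. f y * gauss ((1/\<sigma>) *\<^sub>R (x - y)) \<partial>lborel))"
    by (subst integral_complex_of_real, subst integral_mult_right_zero) simp
  also have "(\<integral>y. f y * gauss ((1/\<sigma>) *\<^sub>R (x - y)) \<partial>lborel) = \<sigma>^DIM('a) * (\<integral>z. f (x - \<sigma> *\<^sub>R z) * gauss z \<partial>lborel)"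
    using integral_affine[of "\<lambda>y. f y * gauss ((1/\<sigma>) *\<^sub>R (x - y))" "-\<sigma>" x] s by simp
  finally have eq: "(\<integral>\<xi>. cis (x \<bullet> \<xi>) * complex_of_real (gauss (\<sigma> *\<^sub>R \<xi>)) * fourier f \<xi> \<partial>lborel)
    = complex_of_real (?c * (\<integral>z. f (x - \<sigma> *\<^sub>R z) * gauss z \<partial>lborel))" using s by simp
  have g1: "gauss z \<le> 1" for z :: 'a by (simp add: gauss_def)
  have b0: "0 \<le> b \<xi>" for \<xi> using le[of \<xi>] norm_ge_zero order_trans by blast
  have nb: "norm (cis (x \<bullet> \<xi>) * complex_of_real (gauss (\<sigma> *\<^sub>R \<xi>)) * fourier f \<xi>) \<le> b \<xi>" for \<xi>
  proof -
    have "norm (cis (x \<bullet> \<xi>) * complex_of_real (gauss (\<sigma> *\<^sub>R \<xi>)) * fourier f \<xi>) = gauss (\<sigma> *\<^sub>R \<xi>) * norm (fourier f \<xi>)"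
      by (simp add: norm_mult gauss_nonneg)
    also have "\<dots> \<le> 1 * b \<xi>" by (intro mult_mono g1 le) (auto simp: gauss_nonneg)
    finally show ?thesis by simp
  qed
  have "norm (\<integral>\<xi>. cis (x \<bullet> \<xi>) * complex_of_real (gauss (\<sigma> *\<^sub>R \<xi>)) * fourier f \<xi> \<partial>lborel) \<le> (\<integral>\<xi>. b \<xi> \<partial>lborel)"
    by (rule Bochner_Integration.integral_norm_bound_integral[OF _ b nb], rule Bochner_Integration.integrable_bound[OF b])
       (use nb b0 in auto)
  then have "?c * \<bar>\<integral>z. f (x - \<sigma> *\<^sub>R z) * gauss z \<partial>lborel\<bar> \<le> (\<integral>\<xi>. b \<xi> \<partial>lborel)"
    unfolding eq norm_of_real abs_mult[of ?c] by simp
  then show ?thesis by (simp only: mult.commute)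
qed

lemma abs_mult_le_left: "0 \<le> q \<Longrightarrow> q \<le> 1 \<Longrightarrow> \<bar>a * q\<bar> \<le> \<bar>a :: real\<bar>"
  by (simp add: abs_mult mult_left_le)

text \<open>Fubini moves the mollification from \<open>f\<close> onto \<open>\<psi>\<close>, where
  it is removed by letting \<open>\<sigma>\<close> tend to 0; this uses the continuity of
  \<open>\<psi>\<close>. One factor \<open>sqrt (2 * pi) ^ DIM('a)\<close> comes from Fourier
  inversion, the other is the mass of \<open>gauss\<close>.\<close>

lemma gauss_test_bound:
  fixes f \<psi> :: "'a::euclidean_space \<Rightarrow> real"
  assumes f: "integrable lborel f" and b: "integrable lborel b"
    and le: "\<And>\<xi>. norm (fourier f \<xi>) \<le> b \<xi>"
    and \<psi>: "continuous_on UNIV \<psi>" "\<And>x. 0 \<le> \<psi> x" "\<And>x. \<psi> x \<le> 1" "integrable lborel \<psi>"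
  shows "\<bar>\<integral>x. f x * \<psi> x \<partial>lborel\<bar> * (2 * pi) ^ DIM('a) \<le> (\<integral>\<xi>. b \<xi> \<partial>lborel) * (\<integral>x. \<psi> x \<partial>lborel)"
proof -
  let ?c = "sqrt (2 * pi) ^ DIM('a)"
  let ?B = "\<integral>\<xi>. b \<xi> \<partial>lborel"
  have c0: "0 < ?c" by simp
  have c2: "?c * ?c = (2 * pi) ^ DIM('a)"
    unfolding power_mult_distrib[symmetric] by (simp only: real_sqrt_mult_self, simp)
  have [measurable]: "f \<in> borel_measurable borel" using f by auto
  have [measurable]: "\<psi> \<in> borel_measurable borel" using \<psi>(4) by auto
  define I where "I = (\<lambda>n::nat. \<integral>y. f y * (\<integral>z. gauss z * \<psi> (y + (1 / Suc n) *\<^sub>R z) \<partial>lborel) \<partial>lborel)"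
  have bound: "\<bar>I n\<bar> * ?c \<le> ?B * (\<integral>x. \<psi> x \<partial>lborel)" for n
  proof -
    define \<sigma> where "\<sigma> = 1 / real (Suc n)"
    have s: "0 < \<sigma>" by (simp add: \<sigma>_def)
    have int1: "integrable (lborel \<Otimes>\<^sub>M lborel) (\<lambda>(y,z). f y * gauss z * \<psi> (y + \<sigma> *\<^sub>R z))"
      by (rule Bochner_Integration.integrable_bound[OF integrable_pair_mult[OF f gauss_fourier(2)]])
         (auto intro!: AE_I2 abs_mult_le_left \<psi>)
    have int2: "integrable (lborel \<Otimes>\<^sub>M lborel) (\<lambda>(z,x). f (x - \<sigma> *\<^sub>R z) * gauss z * \<psi> x)"
    proof (rule lborel_pair.Fubini_integrable)
      show "(\<lambda>(z, x). f (x - \<sigma> *\<^sub>R z) * gauss z * \<psi> x) \<in> borel_measurable (lborel \<Otimes>\<^sub>M lborel)" by measurable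
      have ii: "integrable lborel (\<lambda>x. f (x - \<sigma> *\<^sub>R z) * gauss z * \<psi> x)" for z
        by (rule Bochner_Integration.integrable_bound[OF integrable_mult_left[OF lborel_integrable_shift[OF f, of "\<sigma> *\<^sub>R z"], of "gauss z"]])
           (auto intro!: AE_I2 abs_mult_le_left \<psi>)
      then show "AE z in lborel. integrable lborel (\<lambda>x. case (z, x) of (z, x) \<Rightarrow> f (x - \<sigma> *\<^sub>R z) * gauss z * \<psi> x)" by simp
      show "integrable lborel (\<lambda>z. \<integral>x. norm (case (z, x) of (z, x) \<Rightarrow> f (x - \<sigma> *\<^sub>R z) * gauss z * \<psi> x) \<partial>lborel)"
      proof (rule Bochner_Integration.integrable_bound[OF integrable_mult_right[OF gauss_fourier(2), of "nrm1 f"]])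
        show "(\<lambda>z. \<integral>x. norm (case (z, x) of (z, x) \<Rightarrow> f (x - \<sigma> *\<^sub>R z) * gauss z * \<psi> x) \<partial>lborel) \<in> borel_measurable lborel"
          by measurable
        show "AE z in lborel. norm (\<integral>x. norm (case (z, x) of (z, x) \<Rightarrow> f (x - \<sigma> *\<^sub>R z) * gauss z * \<psi> x) \<partial>lborel) \<le> norm (nrm1 f * gauss z)"
        proof (rule AE_I2)
          fix z :: 'a
          have "(\<integral>x. \<bar>f (x - \<sigma> *\<^sub>R z) * gauss z * \<psi> x\<bar> \<partial>lborel) \<le> (\<integral>x. \<bar>f (x - \<sigma> *\<^sub>R z)\<bar> * gauss z \<partial>lborel)"
            using ii[of z] lborel_integrable_shift[OF f, of "\<sigma> *\<^sub>R z"]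
            by (intro integral_mono integrable_abs integrable_mult_left)
               (auto simp: abs_mult gauss_nonneg \<psi> mult_left_le)
          also have "\<dots> = nrm1 f * gauss z"
            using lborel_integral_shift[of "\<lambda>x. \<bar>f x\<bar>" "\<sigma> *\<^sub>R z"] by simp
          finally show "norm (\<integral>x. norm (case (z, x) of (z, x) \<Rightarrow> f (x - \<sigma> *\<^sub>R z) * gauss z * \<psi> x) \<partial>lborel) \<le> norm (nrm1 f * gauss z)"
            by (simp add: gauss_nonneg)
        qed
      qed
    qed
    have "I n = (\<integral>y. (\<integral>z. f y * gauss z * \<psi> (y + \<sigma> *\<^sub>R z) \<partial>lborel) \<partial>lborel)"
      unfolding I_def \<sigma>_def by (simp add: mult.assoc)
    also have "\<dots> = (\<integral>z. (\<integral>y. f y * gauss z * \<psi> (y + \<sigma> *\<^sub>R z) \<partial>lborel) \<partial>lborel)"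
      by (rule lborel_pair.Fubini_integral[OF int1, symmetric])
    also have "\<dots> = (\<integral>z. (\<integral>x. f (x - \<sigma> *\<^sub>R z) * gauss z * \<psi> x \<partial>lborel) \<partial>lborel)"
    proof (rule Bochner_Integration.integral_cong[OF refl])
      fix z :: 'a
      show "(\<integral>y. f y * gauss z * \<psi> (y + \<sigma> *\<^sub>R z) \<partial>lborel) = (\<integral>x. f (x - \<sigma> *\<^sub>R z) * gauss z * \<psi> x \<partial>lborel)"
        using lborel_integral_shift[of "\<lambda>y. f y * gauss z * \<psi> (y + \<sigma> *\<^sub>R z)" "\<sigma> *\<^sub>R z"] by simp
    qed
    also have "\<dots> = (\<integral>x. (\<integral>z. f (x - \<sigma> *\<^sub>R z) * gauss z * \<psi> x \<partial>lborel) \<partial>lborel)"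
      by (rule lborel_pair.Fubini_integral[OF int2, symmetric])
    also have "\<dots> = (\<integral>x. (\<integral>z. f (x - \<sigma> *\<^sub>R z) * gauss z \<partial>lborel) * \<psi> x \<partial>lborel)"
      by simp
    finally have In: "I n = \<dots>" .
    have intx: "integrable lborel (\<lambda>x. (\<integral>z. f (x - \<sigma> *\<^sub>R z) * gauss z \<partial>lborel) * \<psi> x)"
      using lborel_pair.integrable_snd[OF int2] by simp
    have "\<bar>I n\<bar> \<le> (\<integral>x. \<bar>(\<integral>z. f (x - \<sigma> *\<^sub>R z) * gauss z \<partial>lborel) * \<psi> x\<bar> \<partial>lborel)"
      unfolding In by (rule integral_abs_bound)
    also have "\<dots> \<le> (\<integral>x. ?B / ?c * \<psi> x \<partial>lborel)"
    proof (rule integral_mono)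
      fix x
      show "\<bar>(\<integral>z. f (x - \<sigma> *\<^sub>R z) * gauss z \<partial>lborel) * \<psi> x\<bar> \<le> ?B / ?c * \<psi> x"
        unfolding abs_mult abs_of_nonneg[OF \<psi>(2)]
        by (rule mult_right_mono[OF _ \<psi>(2)])
           (simp only: pos_le_divide_eq[OF c0] gauss_mollify_bound[OF f b le s, of x])
    qed (use intx \<psi> in auto)
    finally have "\<bar>I n\<bar> \<le> ?B / ?c * (\<integral>x. \<psi> x \<partial>lborel)" by simp
    then show ?thesis using c0 by (simp add: field_simps)
  qed
  have lim: "I \<longlonglongrightarrow> (\<integral>y. f y * (?c * \<psi> y) \<partial>lborel)" unfolding I_def
  proof (rule integral_dominated_convergence[where w="\<lambda>y. \<bar>f y\<bar> * ?c"])
    show "AE y in lborel. (\<lambda>n. f y * (\<integral>z. gauss z * \<psi> (y + (1 / Suc n) *\<^sub>R z) \<partial>lborel)) \<longlonglongrightarrow> f y * (?c * \<psi> y)"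
    proof (intro AE_I2 tendsto_mult_left)
      fix y :: 'a
      have "(\<lambda>n. \<integral>z. gauss z * \<psi> (y + (1 / Suc n) *\<^sub>R z) \<partial>lborel) \<longlonglongrightarrow> (\<integral>z. gauss (z::'a) * \<psi> y \<partial>lborel)"
      proof (rule integral_dominated_convergence[where w="gauss :: 'a \<Rightarrow> real"])
        show "AE z in lborel. (\<lambda>n. gauss z * \<psi> (y + (1 / Suc n) *\<^sub>R z)) \<longlonglongrightarrow> gauss z * \<psi> y"
        proof (intro AE_I2 tendsto_mult_left)
          fix z :: 'a
          have "(\<lambda>n. y + (1 / Suc n) *\<^sub>R z) \<longlonglongrightarrow> y + 0 *\<^sub>R z"
            by (intro tendsto_intros LIMSEQ_Suc[OF lim_1_over_n])
          then have "(\<lambda>n. y + (1 / Suc n) *\<^sub>R z) \<longlonglongrightarrow> y" by simp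
          moreover have "isCont \<psi> y" using \<psi>(1) by (simp add: continuous_on_eq_continuous_at)
          ultimately show "(\<lambda>n. \<psi> (y + (1 / Suc n) *\<^sub>R z)) \<longlonglongrightarrow> \<psi> y"
            by (rule isCont_tendsto_compose[rotated])
        qed
      qed (auto simp: gauss_fourier(2) abs_mult gauss_nonneg \<psi> mult_left_le)
      then show "(\<lambda>n. \<integral>z. gauss z * \<psi> (y + (1 / Suc n) *\<^sub>R z) \<partial>lborel) \<longlonglongrightarrow> ?c * \<psi> y"
        by (simp add: gauss_fourier(3))
    qed
    show "AE y in lborel. norm (f y * (\<integral>z. gauss z * \<psi> (y + (1 / Suc n) *\<^sub>R z) \<partial>lborel)) \<le> \<bar>f y\<bar> * ?c" for n
    proof (rule AE_I2)
      fix y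
      have "(\<integral>z. gauss z * \<psi> (y + (1 / Suc n) *\<^sub>R z) \<partial>lborel) \<le> (\<integral>z. gauss (z::'a) \<partial>lborel)"
        by (rule integral_mono') (auto simp: gauss_fourier(2) gauss_nonneg \<psi> mult_left_le)
      moreover have "0 \<le> (\<integral>z. gauss z * \<psi> (y + (1 / Suc n) *\<^sub>R z) \<partial>lborel)"
        by (simp add: gauss_nonneg \<psi>)
      ultimately show "norm (f y * (\<integral>z. gauss z * \<psi> (y + (1 / Suc n) *\<^sub>R z) \<partial>lborel)) \<le> \<bar>f y\<bar> * ?c"
        by (simp add: abs_mult gauss_fourier(3) mult_left_mono)
    qed
  qed (use f in auto)
  have "\<bar>\<integral>y. f y * (?c * \<psi> y) \<partial>lborel\<bar> * ?c \<le> ?B * (\<integral>x. \<psi> x \<partial>lborel)"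
    by (rule LIMSEQ_le_const2[OF tendsto_mult_right[OF tendsto_rabs[OF lim]]]) (use bound in auto)
  also have "(\<integral>y. f y * (?c * \<psi> y) \<partial>lborel) = ?c * (\<integral>y. f y * \<psi> y \<partial>lborel)"
    by (subst integral_mult_right_zero[symmetric]) (simp add: mult_ac)
  finally show ?thesis unfolding c2[symmetric] by (simp add: abs_mult mult_ac)
qed


lemma gauss_compact_bound:
  fixes f :: "'a::euclidean_space \<Rightarrow> real"
  assumes f: "integrable lborel f" and b: "integrable lborel b"
    and le: "\<And>\<xi>. norm (fourier f \<xi>) \<le> b \<xi>" and C: "compact C"
  shows "\<bar>\<integral>x. f x * indicator C x \<partial>lborel\<bar> * (2 * pi) ^ DIM('a) \<le> (\<integral>\<xi>. b \<xi> \<partial>lborel) * measure lborel C"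
proof (cases "C = {}")
  case False
  have [measurable]: "f \<in> borel_measurable borel" "C \<in> sets borel" using f borel_closed[OF compact_imp_closed[OF C]] by auto
  \<comment> \<open>Continuous functions that decrease to the indicator of \<open>C\<close>: equal
    to 1 on \<open>C\<close> and to 0 at distance at least \<open>1 / Suc n\<close> from it.\<close>
  define \<psi> where "\<psi> = (\<lambda>(n::nat) x. max 0 (1 - Suc n * infdist x C))"
  have cont: "continuous_on UNIV (\<psi> n)" for n
    unfolding \<psi>_def by (intro continuous_intros)
  then have [measurable]: "\<psi> n \<in> borel_measurable borel" for n by (rule borel_measurable_continuous_onI)
  have nn: "0 \<le> \<psi> n x" "\<psi> n x \<le> 1" for n x unfolding \<psi>_def by (auto simp: infdist_nonneg)
  obtain R where R: "\<And>x. x \<in> C \<Longrightarrow> norm x \<le> R" using C compact_imp_bounded bounded_iff by metis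
  have supp: "\<psi> n x \<le> indicator (cball 0 (R + 1)) x" for n x
  proof (cases "\<psi> n x = 0")
    case False
    then have "Suc n * infdist x C < 1" by (auto simp: \<psi>_def split: if_splits)
    moreover have "infdist x C \<le> Suc n * infdist x C" 
      using mult_right_mono[of 1 "real (Suc n)" "infdist x C"] infdist_nonneg[of x C] by simp
    ultimately have "infdist x C < 1" by linarith
    then obtain y where "y \<in> C" "dist x y < 1"
      using \<open>C \<noteq> {}\<close> by (metis C compact_imp_closed infdist_attains_inf)
    then have "norm x \<le> R + 1" using R[of y] norm_triangle_ineq2[of x y] by (simp add: dist_norm)
    then show ?thesis using nn by simp
  qed (simp)
  have iball: "integrable lborel (indicator (cball 0 (R + 1)) :: 'a \<Rightarrow> real)"
    using emeasure_compact_finite[OF compact_cball, of "0::'a" "R+1"] by (auto simp: less_top)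
  have int: "integrable lborel (\<psi> n)" for n
    by (rule Bochner_Integration.integrable_bound[OF iball]) (use nn supp in auto)
  have lim: "(\<lambda>n. \<psi> n x) \<longlonglongrightarrow> indicator C x" for x
  proof (cases "x \<in> C")
    case True
    then have "\<psi> n x = 1" for n by (simp add: \<psi>_def)
    then show ?thesis using True by simp
  next
    case False
    then have d: "0 < infdist x C"
      using C \<open>C \<noteq> {}\<close> by (metis compact_imp_closed in_closed_iff_infdist_zero infdist_nonneg less_eq_real_def)
    obtain N where N: "1 < real N * infdist x C" using reals_Archimedean3[OF d] by auto
    have "\<psi> n x = 0" if "n \<ge> N" for n
    proof -
      have "real N * infdist x C \<le> Suc n * infdist x C" using that d by (intro mult_right_mono) auto
      then show ?thesis unfolding \<psi>_def using N by auto
    qed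
    then have "\<forall>\<^sub>F n in sequentially. \<psi> n x = 0" by (auto simp: eventually_sequentially)
    then show ?thesis using False by (simp add: tendsto_eventually)
  qed
  have l1: "(\<lambda>n. \<integral>x. f x * \<psi> n x \<partial>lborel) \<longlonglongrightarrow> (\<integral>x. f x * indicator C x \<partial>lborel)"
    by (rule integral_dominated_convergence[where w="\<lambda>x. \<bar>f x\<bar>"])
       (use f in \<open>auto intro!: AE_I2 tendsto_mult_left lim abs_mult_le_left nn\<close>)
  have l2: "(\<lambda>n. \<integral>x. \<psi> n x \<partial>lborel) \<longlonglongrightarrow> (\<integral>x. indicator C x \<partial>lborel)"
    by (rule integral_dominated_convergence[OF _ _ iball])
       (use nn supp in \<open>auto intro!: AE_I2 lim\<close>)
  have "\<bar>\<integral>x. f x * indicator C x \<partial>lborel\<bar> * (2 * pi) ^ DIM('a) \<le> (\<integral>\<xi>. b \<xi> \<partial>lborel) * (\<integral>x. indicator C x \<partial>lborel)"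
    by (rule LIMSEQ_le[OF tendsto_mult_right[OF tendsto_rabs[OF l1]] tendsto_mult_left[OF l2]])
       (use gauss_test_bound[OF f b le cont nn int] in auto)
  then show ?thesis by simp
qed simp

text \<open>A weak form of Fourier inversion; the case \<open>b = 0\<close> is injectivity of the Fourier transform.\<close>
theorem fourier_sup_bound:
  fixes f :: "'a::euclidean_space \<Rightarrow> real"
  assumes f: "integrable lborel f" and b: "integrable lborel b"
    and le: "\<And>\<xi>. norm (fourier f \<xi>) \<le> b \<xi>"
  shows "AE x in lborel. f x \<le> (\<integral>\<xi>. b \<xi> \<partial>lborel) / (2 * pi) ^ DIM('a)"
proof -
  define B where "B = (\<integral>\<xi>. b \<xi> \<partial>lborel) / (2 * pi) ^ DIM('a)"
  have [measurable]: "f \<in> borel_measurable borel" using f by auto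
  \<comment> \<open>If the bound \<open>B\<close> failed on a set of positive measure, it would fail
    there by some margin \<open>1 / Suc n\<close> inside some ball.\<close>
  define S where "S = (\<lambda>n::nat. {x. B + 1 / Suc n < f x} \<inter> cball 0 n)"
  have Sm: "S n \<in> sets borel" for n unfolding S_def by measurable
  have "emeasure lborel (S n) = 0" for n
  proof (rule ccontr)
    assume ne: "emeasure lborel (S n) \<noteq> 0"
    have "emeasure lborel (S n) \<le> emeasure lborel (cball (0::'a) n)"
      by (rule emeasure_mono) (auto simp: S_def)
    also have "\<dots> < \<infinity>" using emeasure_compact_finite[OF compact_cball] by (auto simp: less_top)
    finally have fin: "emeasure lborel (S n) < \<infinity>" .
    define m where "m = measure lborel (S n)"
    have m0: "0 < m" using ne fin by (auto simp: m_def measure_def enn2real_positive_iff top.not_eq_extremum zero_less_iff_neq_zero)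
    have em: "emeasure lborel (S n) = ennreal m" using fin by (simp add: m_def emeasure_eq_ennreal_measure)
    have Sl: "S n \<in> sets lebesgue" using Sm by auto
    \<comment> \<open>The tolerance \<open>m\<close> is the measure of \<open>S n\<close> itself, so
      the compact set \<open>T\<close> has positive measure; the average of \<open>f\<close> over
      \<open>T\<close> would exceed \<open>B\<close>.\<close>
    obtain T where T: "closed T" "T \<subseteq> S n" "S n - T \<in> lmeasurable" "emeasure lebesgue (S n - T) < ennreal m"
      using sets_lebesgue_inner_closed[OF Sl m0] by blast
    have cT: "compact T" using T(1,2) by (auto simp: compact_eq_bounded_closed S_def intro: bounded_subset[OF bounded_cball[of 0 "real n"]])
    have [measurable]: "T \<in> sets borel" using T(1) by auto
    have Tm: "emeasure lborel T \<noteq> 0"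
    proof
      assume z: "emeasure lborel T = 0"
      have "emeasure lborel (S n) \<le> emeasure lborel (S n - T) + emeasure lborel T"
        by (rule order_trans[OF emeasure_mono emeasure_subadditive]) (use Sm in auto)
      also have "\<dots> < ennreal m" using T(4) z Sm by simp
      finally show False using em by simp
    qed
    have Tf: "emeasure lborel T < \<infinity>" using emeasure_compact_finite[OF cT] by (auto simp: less_top)
    have mT: "0 < measure lborel T" using Tm Tf by (auto simp: measure_def enn2real_positive_iff top.not_eq_extremum zero_less_iff_neq_zero)
    have iT: "integrable lborel (indicator T :: 'a \<Rightarrow> real)" using Tf by simp
    have "(B + 1 / Suc n) * measure lborel T = (\<integral>x. (B + 1 / Suc n) * indicator T x \<partial>lborel)" by simp
    also have "\<dots> \<le> (\<integral>x. f x * indicator T x \<partial>lborel)"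
    proof (rule integral_mono)
      show "integrable lborel (\<lambda>x. f x * indicator T x)" using f by (rule integrable_real_mult_indicator[rotated]) simp
      show "(B + 1 / Suc n) * indicator T x \<le> f x * indicator T x" for x
        using T(2) by (auto simp: S_def split: split_indicator)
    qed (use iT in simp)
    also have "\<dots> \<le> B * measure lborel T"
    proof -
      have "(\<integral>x. f x * indicator T x \<partial>lborel) * (2 * pi) ^ DIM('a) \<le> (\<integral>\<xi>. b \<xi> \<partial>lborel) * measure lborel T"
        using gauss_compact_bound[OF f b le cT] by (rule order_trans[rotated]) (intro mult_right_mono, auto)
      then show ?thesis by (simp add: B_def pos_le_divide_eq)
    qed
    finally show False using mT by (simp add: field_simps)
  qed
  then have "AE x in lborel. \<forall>n. x \<notin> S n"
    by (subst AE_all_countable) (auto intro!: AE_not_in null_setsI Sm)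
  then show ?thesis
  proof eventually_elim
    case (elim x)
    show ?case
    proof (rule ccontr)
      assume "\<not> f x \<le> (\<integral>\<xi>. b \<xi> \<partial>lborel) / (2 * pi) ^ DIM('a)"
      then have "0 < f x - B" by (simp add: B_def)
      then obtain n1 where n1: "1 / Suc n1 < f x - B" using nat_approx_posE by blast
      obtain n2 where n2: "norm x \<le> real n2" using real_arch_simple by blast
      have "1 / Suc (max n1 n2) \<le> 1 / Suc n1" by (simp add: frac_le)
      then have "x \<in> S (max n1 n2)" using n1 n2 unfolding S_def by auto
      then show False using elim by blast
    qed
  qed
qed

corollary fourier_inject:
  fixes f g :: "'a::euclidean_space \<Rightarrow> real"
  assumes f: "integrable lborel f" and g: "integrable lborel g" and eq: "\<And>\<xi>. fourier f \<xi> = fourier g \<xi>"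
  shows "AE x in lborel. f x = g x"
proof -
  have "AE x in lborel. f x - g x \<le> 0"
    using fourier_sup_bound[of "\<lambda>x. f x - g x" "\<lambda>_. 0"] f g eq by (simp add: fourier_diff)
  moreover have "AE x in lborel. g x - f x \<le> 0"
    using fourier_sup_bound[of "\<lambda>x. g x - f x" "\<lambda>_. 0"] f g eq by (simp add: fourier_diff)
  ultimately show ?thesis by eventually_elim simp
qed

section \<open>Dilations, time averages and compound Poisson laws\<close>

text \<open>If \<open>f\<close> is the density of a random vector X, then \<open>dil t f\<close> is
  the density of \<open>exp (- t)\<close> times X: the flow of the drift term over time
  \<open>t\<close>.\<close>

definition dil :: "real \<Rightarrow> ('a::euclidean_space \<Rightarrow> real) \<Rightarrow> 'a \<Rightarrow> real" where
  "dil t f x = exp (real DIM('a) * t) * f (exp t *\<^sub>R x)"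

lemma dil_measurable [measurable]:
  assumes [measurable]: "f \<in> borel_measurable borel"
  shows "dil t f \<in> borel_measurable borel"
  unfolding dil_def[abs_def] by measurable

lemma integral_dil:
  fixes f :: "'a::euclidean_space \<Rightarrow> real" and h :: "'a \<Rightarrow> 'b::{banach,second_countable_topology}"
  assumes [measurable]: "f \<in> borel_measurable borel" "h \<in> borel_measurable borel"
  shows "(\<integral>x. dil t f x *\<^sub>R h x \<partial>lborel) = (\<integral>x. f x *\<^sub>R h (exp (-t) *\<^sub>R x) \<partial>lborel)"
proof -
  have "(\<integral>x. f (exp t *\<^sub>R x) *\<^sub>R h (exp (-t) *\<^sub>R exp t *\<^sub>R x) \<partial>lborel)
     = (1 / exp t ^ DIM('a)) *\<^sub>R (\<integral>x. f x *\<^sub>R h (exp (-t) *\<^sub>R x) \<partial>lborel)"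
    using integral_affine[of "\<lambda>x. f x *\<^sub>R h (exp (-t) *\<^sub>R x)" "exp t" 0] by simp
  then have "exp (real DIM('a) * t) *\<^sub>R (\<integral>x. f (exp t *\<^sub>R x) *\<^sub>R h x \<partial>lborel)
     = (\<integral>x. f x *\<^sub>R h (exp (-t) *\<^sub>R x) \<partial>lborel)"
    by (simp add: exp_of_nat_mult flip: exp_add)
  then show ?thesis unfolding dil_def by (simp flip: scaleR_scaleR)
qed

lemma dil_integrable: "integrable lborel f \<Longrightarrow> integrable lborel (dil t f)"
  unfolding dil_def[abs_def] using integrable_affine[of f "exp t" 0] by simp

lemma dil_abs: "\<bar>dil t f x\<bar> = dil t (\<lambda>x. \<bar>f x\<bar>) x" by (simp add: dil_def abs_mult)

lemma dil_nonneg: "(\<And>x. 0 \<le> f x) \<Longrightarrow> 0 \<le> dil t f x" by (simp add: dil_def)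

lemma integral_dil_1: "f \<in> borel_measurable borel \<Longrightarrow> (\<integral>x. dil t f x \<partial>lborel) = (\<integral>x. f x \<partial>lborel)"
  using integral_dil[of f "\<lambda>_. 1::real" t] by simp

lemma nrm1_dil: "f \<in> borel_measurable borel \<Longrightarrow> nrm1 (dil t f) = nrm1 f"
  unfolding dil_abs by (rule integral_dil_1) simp

lemma fourier_alt: "fourier f \<xi> = (\<integral>x. f x *\<^sub>R cis (- (x \<bullet> \<xi>)) \<partial>lborel)"
  unfolding fourier_def by (simp add: scaleR_conv_of_real mult.commute)

lemma fourier_dil: "f \<in> borel_measurable borel \<Longrightarrow> fourier (dil t f) \<xi> = fourier f (exp (-t) *\<^sub>R \<xi>)"
  unfolding fourier_alt by (subst integral_dil) auto

lemma resc_eq_dil: "0 < \<epsilon> \<Longrightarrow> resc \<epsilon> f = dil (- ln \<epsilon>) f"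
  by (auto simp: resc_def dil_def fun_eq_iff powr_def exp_minus inverse_eq_divide)

lemma Tsg_eq_dil: "Tsg \<epsilon> s t f x = exp (- (\<epsilon> powr (- 2 * s)) * t) * dil t f x"
  by (simp add: Tsg_def dil_def exp_add[symmetric] algebra_simps)

text \<open>Fubini on \<open>{0..t}\<close> times space, tested against a bounded \<open>h\<close>.
  Joint measurability is a hypothesis because measurability of each slice does not provide it. It
  serves both the averaged jump density and the Duhamel integral, with \<open>h\<close> a constant,
  a character or a test function.\<close>

lemma time_integral:
  fixes \<phi> :: "real \<Rightarrow> 'a::euclidean_space \<Rightarrow> real" and h :: "'a \<Rightarrow> 'b::{banach,second_countable_topology}"
  assumes m: "(\<lambda>p. \<phi> (fst p) (snd p)) \<in> borel_measurable (lborel \<Otimes>\<^sub>M lborel)"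
    and int: "\<And>\<tau>. \<tau> \<in> {0..t} \<Longrightarrow> integrable lborel (\<phi> \<tau>)"
    and le: "\<And>\<tau>. \<tau> \<in> {0..t} \<Longrightarrow> nrm1 (\<phi> \<tau>) \<le> M"
  shows time_integral_integrable: "integrable lborel (\<lambda>x. LINT \<tau>:{0..t}|lborel. \<phi> \<tau> x)"
    and time_integral_AE: "AE x in lborel. set_integrable lborel {0..t} (\<lambda>\<tau>. \<phi> \<tau> x)"
    and time_integral_test: "h \<in> borel_measurable borel \<Longrightarrow> (\<And>x. norm (h x) \<le> C) \<Longrightarrow>
      (\<integral>x. (LINT \<tau>:{0..t}|lborel. \<phi> \<tau> x) *\<^sub>R h x \<partial>lborel) = (LINT \<tau>:{0..t}|lborel. (\<integral>x. \<phi> \<tau> x *\<^sub>R h x \<partial>lborel))"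
    and time_integral_test_integrable: "h \<in> borel_measurable borel \<Longrightarrow> (\<And>x. norm (h x) \<le> C) \<Longrightarrow>
      set_integrable lborel {0..t} (\<lambda>\<tau>. (\<integral>x. \<phi> \<tau> x *\<^sub>R h x \<partial>lborel))"
proof -
  note [measurable] = m
  define F where "F = (\<lambda>(\<tau>,x). indicator {0..t} \<tau> *\<^sub>R \<phi> \<tau> x)"
  have Fm[measurable]: "F \<in> borel_measurable (lborel \<Otimes>\<^sub>M lborel)"
    unfolding F_def split_beta' by measurable
  have iF: "integrable (lborel \<Otimes>\<^sub>M lborel) F"
  proof (rule lborel_pair.Fubini_integrable)
    show "AE \<tau> in lborel. integrable lborel (\<lambda>x. F (\<tau>, x))"
      unfolding F_def using int by (auto simp: indicator_def)
    show "integrable lborel (\<lambda>\<tau>. \<integral>x. norm (F (\<tau>, x)) \<partial>lborel)"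
    proof (rule Bochner_Integration.integrable_bound[of _ "\<lambda>\<tau>. indicator {0..t} \<tau> * M"])
      show "AE \<tau> in lborel. norm (\<integral>x. norm (F (\<tau>, x)) \<partial>lborel) \<le> norm (indicator {0..t} \<tau> * M)"
      proof (rule AE_I2)
        fix \<tau>
        show "norm (\<integral>x. norm (F (\<tau>, x)) \<partial>lborel) \<le> norm (indicator {0..t} \<tau> * M)"
          using le[of \<tau>] by (auto simp: F_def indicator_def)
      qed
    next
      have "integrable lborel (indicator {0..t} :: real \<Rightarrow> real)"
        by (rule integrable_real_indicator) (auto simp: emeasure_lborel_Icc_eq)
      then show "integrable lborel (\<lambda>\<tau>. indicator {0..t} \<tau> * M)" by (rule integrable_mult_left)
    qed measurable
  qed fact
  show "AE x in lborel. set_integrable lborel {0..t} (\<lambda>\<tau>. \<phi> \<tau> x)"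
    using lborel_pair.AE_integrable_snd[of "\<lambda>\<tau> x. F (\<tau>, x)"] iF by (simp add: F_def set_integrable_def)
  show "integrable lborel (\<lambda>x. LINT \<tau>:{0..t}|lborel. \<phi> \<tau> x)"
    using lborel_pair.integrable_snd[of "\<lambda>\<tau> x. F (\<tau>, x)"] iF by (simp add: F_def set_lebesgue_integral_def)
  assume [measurable]: "h \<in> borel_measurable borel" and hC: "\<And>x. norm (h x) \<le> C"
  have "integrable (lborel \<Otimes>\<^sub>M lborel) (\<lambda>(\<tau>,x). F (\<tau>,x) *\<^sub>R h x)"
    by (rule Bochner_Integration.integrable_bound[OF integrable_mult_left[OF iF, of C]])
       (auto simp: abs_mult intro!: AE_I2 mult_left_mono order_trans[OF hC])
  note * = lborel_pair.Fubini_integral[OF this] lborel_pair.integrable_fst[OF this]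
  have 1: "(\<integral>\<tau>. F (\<tau>,x) *\<^sub>R h x \<partial>lborel) = (LINT \<tau>:{0..t}|lborel. \<phi> \<tau> x) *\<^sub>R h x" if "integrable lborel (\<lambda>\<tau>. F (\<tau>,x))" for x
    using that by (subst integral_scaleR_left) (auto simp: F_def set_lebesgue_integral_def)
  have 2: "(\<integral>x. F (\<tau>,x) *\<^sub>R h x \<partial>lborel) = indicator {0..t} \<tau> *\<^sub>R (\<integral>x. \<phi> \<tau> x *\<^sub>R h x \<partial>lborel)" for \<tau>
    by (auto simp: F_def indicator_def)
  show "(\<integral>x. (LINT \<tau>:{0..t}|lborel. \<phi> \<tau> x) *\<^sub>R h x \<partial>lborel) = (LINT \<tau>:{0..t}|lborel. (\<integral>x. \<phi> \<tau> x *\<^sub>R h x \<partial>lborel))"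
  proof -
    have "(\<integral>x. (LINT \<tau>:{0..t}|lborel. \<phi> \<tau> x) *\<^sub>R h x \<partial>lborel) = (\<integral>x. (\<integral>\<tau>. F (\<tau>,x) *\<^sub>R h x \<partial>lborel) \<partial>lborel)"
    proof (rule integral_cong_AE)
      show "AE x in lborel. (LINT \<tau>:{0..t}|lborel. \<phi> \<tau> x) *\<^sub>R h x = (\<integral>\<tau>. F (\<tau>,x) *\<^sub>R h x \<partial>lborel)"
      proof -
        have "AE x in lborel. integrable lborel (\<lambda>\<tau>. F (\<tau>,x))"
          using lborel_pair.AE_integrable_snd[of "\<lambda>\<tau> x. F (\<tau>, x)"] iF by simp
        then show ?thesis by eventually_elim (rule 1[symmetric])
      qed
    next
      have [measurable]: "(\<lambda>x. LINT \<tau>:{0..t}|lborel. \<phi> \<tau> x) \<in> borel_measurable borel"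
        using lborel_pair.integrable_snd[of "\<lambda>\<tau> x. F (\<tau>, x)"] iF by (simp add: F_def set_lebesgue_integral_def)
      show "(\<lambda>x. (LINT \<tau>:{0..t}|lborel. \<phi> \<tau> x) *\<^sub>R h x) \<in> borel_measurable lborel" by measurable
      have "(\<lambda>(x,\<tau>). F (\<tau>,x) *\<^sub>R h x) \<in> borel_measurable (lborel \<Otimes>\<^sub>M lborel)" by measurable
      then show "(\<lambda>x. \<integral>\<tau>. F (\<tau>,x) *\<^sub>R h x \<partial>lborel) \<in> borel_measurable lborel"
        by (rule lborel.borel_measurable_lebesgue_integral)
    qed
    then show ?thesis using *(1) by (simp add: 2 set_lebesgue_integral_def)
  qed
  show "set_integrable lborel {0..t} (\<lambda>\<tau>. (\<integral>x. \<phi> \<tau> x *\<^sub>R h x \<partial>lborel))"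
    using *(2) by (simp add: 2 set_integrable_def)
qed

text \<open>By monotone convergence the sum of the \<open>\<bar>f n x\<bar>\<close> has a finite
  integral, hence is finite almost everywhere.\<close>

lemma L1_series_AE:
  fixes f :: "nat \<Rightarrow> 'a::euclidean_space \<Rightarrow> real"
  assumes int: "\<And>n. integrable lborel (f n)" and s: "summable (\<lambda>n. nrm1 (f n))"
  shows "AE x in lborel. summable (\<lambda>n. \<bar>f n x\<bar>)"
proof -
  have [measurable]: "f n \<in> borel_measurable borel" for n using int[of n] by auto
  have "(\<integral>\<^sup>+x. (\<Sum>n. ennreal \<bar>f n x\<bar>) \<partial>lborel) = (\<Sum>n. \<integral>\<^sup>+x. ennreal \<bar>f n x\<bar> \<partial>lborel)"
    by (rule nn_integral_suminf) simp
  also have "\<dots> = (\<Sum>n. ennreal (nrm1 (f n)))"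
  proof -
    have "(\<integral>\<^sup>+x. ennreal \<bar>f n x\<bar> \<partial>lborel) = ennreal (nrm1 (f n))" for n
      by (rule nn_integral_eq_integral[OF integrable_abs[OF int]]) simp
    then show ?thesis by simp
  qed
  also have "\<dots> \<noteq> \<infinity>" unfolding infinity_ennreal_def by (rule ennreal_suminf_neq_top[OF s]) simp
  finally have "AE x in lborel. (\<Sum>n. ennreal \<bar>f n x\<bar>) \<noteq> \<infinity>"
    by (intro nn_integral_PInf_AE) auto
  then show ?thesis
  proof eventually_elim
    case (elim x)
    show ?case by (rule summable_suminf_not_top) (use elim in \<open>simp_all add: infinity_ennreal_def\<close>)
  qed
qed

text \<open>The index is shifted: \<open>cpow K n\<close> is the convolution of \<open>n + 1\<close>
  copies of \<open>K\<close>, as the zeroth convolution power would be an atom and not a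
  function.\<close>

definition cpow :: "('a::euclidean_space \<Rightarrow> real) \<Rightarrow> nat \<Rightarrow> 'a \<Rightarrow> real" where
  "cpow K n = (conv K ^^ n) K"

text \<open>The compound Poisson law of intensity \<open>K\<close> is \<open>exp (- \<integral>K) \<delta>\<^sub>0 + cpd K\<close>.
  The \<open>max\<close> guards against the null set where the series diverges.\<close>
definition cpd :: "('a::euclidean_space \<Rightarrow> real) \<Rightarrow> 'a \<Rightarrow> real" where
  "cpd K x = exp (- (\<integral>y. K y \<partial>lborel)) * max 0 (\<Sum>n. cpow K n x / fact (Suc n))"

lemma cpow_0: "cpow K 0 = K" and cpow_Suc: "cpow K (Suc n) = conv K (cpow K n)"
  by (simp_all add: cpow_def)

context
  fixes K :: "'a::euclidean_space \<Rightarrow> real"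
  assumes K: "integrable lborel K" and K0: "\<And>x. 0 \<le> K x"
begin

lemma cpow_integrable: "integrable lborel (cpow K n)"
  by (induction n) (auto simp: cpow_0 cpow_Suc K intro!: conv_integrable)

lemma cpow_nonneg: "0 \<le> cpow K n x"
  by (induction n arbitrary: x) (auto simp: cpow_0 cpow_Suc K0 intro!: conv_nonneg)

lemma cpow_integral: "(\<integral>x. cpow K n x \<partial>lborel) = (\<integral>x. K x \<partial>lborel) ^ Suc n"
  by (induction n) (auto simp: cpow_0 cpow_Suc conv_integral K cpow_integrable)

lemma cpow_fourier: "fourier (cpow K n) \<xi> = fourier K \<xi> ^ Suc n"
  by (induction n) (auto simp: cpow_0 cpow_Suc fourier_conv K cpow_integrable)

lemma exp_series_Suc:
  fixes z :: "'b::{banach,real_normed_field}"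
  shows "(\<lambda>n. z ^ Suc n / fact (Suc n)) sums (exp z - 1)"
proof -
  have "(\<lambda>n. z ^ n / fact n) sums exp z" using exp_converges[of z] by (simp add: scaleR_conv_of_real field_simps)
  then show ?thesis by (subst sums_Suc_iff) simp
qed

lemma cpd_aux:
  shows cpd_summable: "AE x in lborel. summable (\<lambda>n. cpow K n x / fact (Suc n))"
    and cpd_AE: "AE x in lborel. cpd K x = exp (- (\<integral>y. K y \<partial>lborel)) * (\<Sum>n. cpow K n x / fact (Suc n))"
proof -
  have "nrm1 (\<lambda>x. cpow K n x / fact (Suc n)) = (\<integral>x. K x \<partial>lborel) ^ Suc n / fact (Suc n)" for n
    using cpow_nonneg by (simp add: cpow_integral del: fact_Suc power_Suc)
  then have "summable (\<lambda>n. nrm1 (\<lambda>x. cpow K n x / fact (Suc n)))"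
    using exp_series_Suc[of "\<integral>x. K x \<partial>lborel"] by (simp add: sums_iff del: fact_Suc power_Suc)
  from L1_series_AE[OF _ this] have "AE x in lborel. summable (\<lambda>n. \<bar>cpow K n x / fact (Suc n)\<bar>)"
    using cpow_integrable by simp
  then show *: "AE x in lborel. summable (\<lambda>n. cpow K n x / fact (Suc n))"
    by eventually_elim (use cpow_nonneg in simp)
  show "AE x in lborel. cpd K x = exp (- (\<integral>y. K y \<partial>lborel)) * (\<Sum>n. cpow K n x / fact (Suc n))"
    using * by eventually_elim (simp add: cpd_def cpow_nonneg suminf_nonneg)
qed

lemma cpd_measurable [measurable]: "cpd K \<in> borel_measurable borel"
proof -
  have [measurable]: "cpow K n \<in> borel_measurable borel" for n using cpow_integrable[of n] by auto
  show ?thesis unfolding cpd_def[abs_def] by measurable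
qed

lemma cpd_nonneg: "0 \<le> cpd K x" by (simp add: cpd_def)

text \<open>Termwise integration by dominated convergence. The condition
  \<open>norm (h x) = 1\<close> allows the integrability of \<open>cpd K\<close> to be read off from
  that of its product with \<open>h\<close>.\<close>

lemma cpd_series:
  fixes h :: "'a \<Rightarrow> complex"
  assumes h[measurable]: "h \<in> borel_measurable borel" and h1: "\<And>x. norm (h x) = 1"
  shows "integrable lborel (cpd K)"
    and "(\<lambda>n. exp (- (\<integral>y. K y \<partial>lborel)) *\<^sub>R (\<integral>x. cpow K n x *\<^sub>R h x \<partial>lborel) /\<^sub>R fact (Suc n)) sums (\<integral>x. cpd K x *\<^sub>R h x \<partial>lborel)"
proof -
  have [measurable]: "cpow K n \<in> borel_measurable borel" for n using cpow_integrable[of n] by auto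
  let ?e = "exp (- (\<integral>y. K y \<partial>lborel))"
  define f where "f = (\<lambda>n x. (?e * cpow K n x / fact (Suc n)) *\<^sub>R h x)"
  have nf: "norm (f n x) = ?e * cpow K n x / fact (Suc n)" for n x
    using cpow_nonneg[of n x] by (simp add: f_def h1 del: fact_Suc)
  have fi: "integrable lborel (f n)" for n
    by (rule Bochner_Integration.integrable_bound[OF integrable_mult_right[OF cpow_integrable[of n], of "?e / fact (Suc n)"]])
       (auto simp: f_def h1 abs_mult cpow_nonneg simp del: fact_Suc)
  have s1: "AE x in lborel. summable (\<lambda>n. norm (f n x))"
    using cpd_summable unfolding nf by eventually_elim (auto dest: summable_mult[of _ ?e] simp del: fact_Suc)
  have "(\<integral>x. norm (f n x) \<partial>lborel) = ?e * ((\<integral>x. K x \<partial>lborel) ^ Suc n / fact (Suc n))" for n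
    unfolding nf by (simp add: cpow_integral del: fact_Suc power_Suc)
  then have s2: "summable (\<lambda>n. \<integral>x. norm (f n x) \<partial>lborel)"
    by (simp only:) (intro summable_mult sums_summable[OF exp_series_Suc])
  have eq: "AE x in lborel. (\<Sum>n. f n x) = cpd K x *\<^sub>R h x"
    using cpd_AE cpd_summable
  proof eventually_elim
    case (elim x)
    have "(\<lambda>n. (?e * (cpow K n x / fact (Suc n))) *\<^sub>R h x) sums ((?e * (\<Sum>n. cpow K n x / fact (Suc n))) *\<^sub>R h x)"
      by (intro sums_scaleR_left sums_mult summable_sums elim)
    then show ?case unfolding f_def elim(1) by (simp add: sums_iff del: fact_Suc)
  qed
  have i: "integrable lborel (\<lambda>x. cpd K x *\<^sub>R h x)"
    using integrable_suminf[OF fi s1 s2] by (rule integrable_cong_AE_imp) (use eq in \<open>auto elim: eventually_mono\<close>)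
  show "integrable lborel (cpd K)"
    using integrable_norm[OF i] by (simp add: h1 cpd_nonneg)
  have "(\<lambda>n. \<integral>x. f n x \<partial>lborel) sums (\<integral>x. (\<Sum>n. f n x) \<partial>lborel)"
    by (rule sums_integral[OF fi s1 s2])
  also have "(\<integral>x. (\<Sum>n. f n x) \<partial>lborel) = (\<integral>x. cpd K x *\<^sub>R h x \<partial>lborel)"
    by (rule integral_cong_AE) (use eq in \<open>auto simp: f_def\<close>)
  also have "(\<lambda>n. \<integral>x. f n x \<partial>lborel) = (\<lambda>n. exp (- (\<integral>y. K y \<partial>lborel)) *\<^sub>R (\<integral>x. cpow K n x *\<^sub>R h x \<partial>lborel) /\<^sub>R fact (Suc n))"
  proof
    fix n
    have "f n = (\<lambda>x. (?e / fact (Suc n)) *\<^sub>R (cpow K n x *\<^sub>R h x))"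
      by (simp add: f_def fun_eq_iff del: fact_Suc)
    then have "(\<integral>x. f n x \<partial>lborel) = (?e / fact (Suc n)) *\<^sub>R (\<integral>x. cpow K n x *\<^sub>R h x \<partial>lborel)"
      by (simp only: integral_scaleR_right)
    then show "(\<integral>x. f n x \<partial>lborel) = exp (- (\<integral>y. K y \<partial>lborel)) *\<^sub>R (\<integral>x. cpow K n x *\<^sub>R h x \<partial>lborel) /\<^sub>R fact (Suc n)"
      by (simp add: field_simps del: fact_Suc)
  qed
  finally show "(\<lambda>n. exp (- (\<integral>y. K y \<partial>lborel)) *\<^sub>R (\<integral>x. cpow K n x *\<^sub>R h x \<partial>lborel) /\<^sub>R fact (Suc n)) sums (\<integral>x. cpd K x *\<^sub>R h x \<partial>lborel)" .
qed

lemma cpd_integrable: "integrable lborel (cpd K)"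
  by (rule cpd_series(1)[of "\<lambda>_. 1"]) auto

lemma cpd_fourier:
  "fourier (cpd K) \<xi> = exp (fourier K \<xi> - of_real (\<integral>x. K x \<partial>lborel)) - of_real (exp (- (\<integral>x. K x \<partial>lborel)))"
proof -
  let ?e = "exp (- (\<integral>y. K y \<partial>lborel))"
  have "(\<lambda>n. ?e *\<^sub>R (fourier K \<xi> ^ Suc n) /\<^sub>R fact (Suc n)) sums fourier (cpd K) \<xi>"
    using cpd_series(2)[of "\<lambda>x. cis (- (x \<bullet> \<xi>))"] by (simp only: flip: cpow_fourier fourier_alt, simp)
  moreover have "(\<lambda>n. ?e *\<^sub>R (fourier K \<xi> ^ Suc n / fact (Suc n))) sums (?e *\<^sub>R (exp (fourier K \<xi>) - 1))"
    by (intro sums_scaleR_right exp_series_Suc)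
  ultimately have "fourier (cpd K) \<xi> = ?e *\<^sub>R (exp (fourier K \<xi>) - 1)"
    by (intro sums_unique2) (simp_all add: scaleR_conv_of_real field_simps del: fact_Suc power_Suc)
  also have "\<dots> = exp (fourier K \<xi> - of_real (\<integral>x. K x \<partial>lborel)) - of_real ?e"
    by (simp add: exp_diff exp_minus scaleR_conv_of_real field_simps exp_of_real)
  finally show ?thesis .
qed

lemma cpd_integral: "(\<integral>x. cpd K x \<partial>lborel) = 1 - exp (- (\<integral>x. K x \<partial>lborel))"
proof -
  have "complex_of_real (\<integral>x. cpd K x \<partial>lborel) = of_real (1 - exp (- (\<integral>x. K x \<partial>lborel)))"
    using cpd_fourier[of 0] by (simp add: fourier_zero)
  then show ?thesis by (simp only: of_real_eq_iff)
qed

lemma cpd_ge_cpow: "AE x in lborel. exp (- (\<integral>x. K x \<partial>lborel)) * (cpow K n x / fact (Suc n)) \<le> cpd K x"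
  using cpd_AE cpd_summable
proof eventually_elim
  case (elim x)
  have "sum (\<lambda>n. cpow K n x / fact (Suc n)) {n} \<le> (\<Sum>n. cpow K n x / fact (Suc n))"
    by (rule sum_le_suminf[OF elim(2)]) (auto simp: cpow_nonneg simp del: fact_Suc)
  then show ?case unfolding elim(1) by (intro mult_left_mono) (auto simp del: fact_Suc)
qed

end

section \<open>Fractional moments\<close>

text \<open>The shares of \<open>x\<close> and \<open>y\<close> in \<open>x + y\<close> lie between
  0 and 1, where raising to a power \<open>k \<le> 1\<close> increases them; the shares sum to
  1.\<close>

lemma powr_subadd:
  fixes x y k :: real
  assumes "0 \<le> x" "0 \<le> y" "0 < k" "k \<le> 1"
  shows "(x + y) powr k \<le> x powr k + y powr k"
proof (cases "x + y = 0")
  case False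
  then have s: "0 < x + y" using assms by linarith
  have *: "u / (x + y) * (x + y) powr k \<le> u powr k" if u: "0 \<le> u" "u \<le> x + y" for u
  proof (cases "u = 0")
    case False
    have "u / (x + y) \<le> (u / (x + y)) powr k"
      using powr_mono'[of k 1 "u / (x + y)"] assms u s False by simp
    also have "\<dots> = u powr k / (x + y) powr k" using u s by (simp add: powr_divide)
    finally show ?thesis using s by (simp add: field_simps)
  qed simp
  have "(x + y) powr k = x / (x + y) * (x + y) powr k + y / (x + y) * (x + y) powr k"
    unfolding distrib_right[symmetric] add_divide_distrib[symmetric] using s by simp
  also have "\<dots> \<le> x powr k + y powr k" using assms by (intro add_mono *) auto
  finally show ?thesis .
qed (use assms in auto)

lemma norm_powr_subadd:
  fixes x y :: "'a::real_normed_vector"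
  assumes "0 < k" "k \<le> 1"
  shows "norm (x + y) powr k \<le> norm x powr k + norm y powr k"
  using powr_subadd[of "norm x" "norm y" k] assms powr_mono2[of k "norm (x + y)" "norm x + norm y"]
  by (simp add: norm_triangle_ineq)

lemma norm_powr_le_sum:
  fixes x :: "'a::euclidean_space"
  assumes "0 < k" "k \<le> 1"
  shows "norm x powr k \<le> (\<Sum>b\<in>Basis. \<bar>x \<bullet> b\<bar> powr k)"
proof -
  have "(\<Sum>b\<in>B. \<bar>x \<bullet> b\<bar>) powr k \<le> (\<Sum>b\<in>B. \<bar>x \<bullet> b\<bar> powr k)" if "finite B" for B
    using that
  proof (induction B rule: finite_induct)
    case (insert b B)
    then show ?case using powr_subadd[of "\<bar>x \<bullet> b\<bar>" "\<Sum>b\<in>B. \<bar>x \<bullet> b\<bar>" k] assms by (simp add: sum_nonneg)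
  qed simp
  from this[of Basis] show ?thesis
    using powr_mono2[of k "norm x" "\<Sum>b\<in>Basis. \<bar>x \<bullet> b\<bar>"] assms norm_le_l1[of x] by simp
qed

abbreviation mom :: "real \<Rightarrow> ('a::euclidean_space \<Rightarrow> real) \<Rightarrow> real" where
  "mom k f \<equiv> (\<integral>x. norm x powr k * \<bar>f x\<bar> \<partial>lborel)"

abbreviation finmom :: "real \<Rightarrow> ('a::euclidean_space \<Rightarrow> real) \<Rightarrow> bool" where
  "finmom k f \<equiv> integrable lborel (\<lambda>x. norm x powr k * \<bar>f x\<bar>)"

lemma finmom_bound:
  assumes "finmom k f" "g \<in> borel_measurable borel" "AE x in lborel. \<bar>g x\<bar> \<le> \<bar>f x\<bar>"
  shows "finmom k g" "mom k g \<le> mom k f"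
proof -
  have [measurable]: "g \<in> borel_measurable borel" by fact
  have le: "AE x in lborel. norm x powr k * \<bar>g x\<bar> \<le> norm x powr k * \<bar>f x\<bar>"
    using assms(3) by eventually_elim (simp add: mult_left_mono)
  show *: "finmom k g"
    by (rule Bochner_Integration.integrable_bound[OF assms(1)]) (use le in auto)
  show "mom k g \<le> mom k f" by (rule integral_mono_AE[OF * assms(1) le])
qed

text \<open>The subadditivity of \<open>norm x powr k\<close> is what makes moments of order at most
  1 behave additively under convolution.\<close>

lemma moment_conv:
  fixes f g :: "'a::euclidean_space \<Rightarrow> real"
  assumes k: "0 < k" "k \<le> 1" and f: "integrable lborel f" "finmom k f" and g: "integrable lborel g" "finmom k g"
  shows "finmom k (conv f g)" and "mom k (conv f g) \<le> mom k f * nrm1 g + nrm1 f * mom k g"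
proof -
  have [measurable]: "f \<in> borel_measurable borel" "g \<in> borel_measurable borel" using f g by auto
  define R where "R = (\<lambda>x. conv (\<lambda>x. norm x powr k * \<bar>f x\<bar>) (\<lambda>x. \<bar>g x\<bar>) x + conv (\<lambda>x. \<bar>f x\<bar>) (\<lambda>x. norm x powr k * \<bar>g x\<bar>) x)"
  have iR: "integrable lborel R" unfolding R_def
    using f g by (intro Bochner_Integration.integrable_add conv_integrable integrable_abs)
  have IR: "(\<integral>x. R x \<partial>lborel) = mom k f * nrm1 g + nrm1 f * mom k g"
    unfolding R_def using f g by (subst Bochner_Integration.integral_add) (simp_all add: conv_integrable conv_integral)
  have le: "AE x in lborel. norm x powr k * \<bar>conv f g x\<bar> \<le> R x"
    using conv_AE_integrable[OF f(2) integrable_abs[OF g(1)]] conv_AE_integrable[OF integrable_abs[OF f(1)] g(2)]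
      conv_AE_integrable[OF integrable_abs[OF f(1)] integrable_abs[OF g(1)]]
  proof eventually_elim
    case (elim x)
    have "norm x powr k * \<bar>conv f g x\<bar> \<le> norm x powr k * (\<integral>y. \<bar>f (x - y)\<bar> * \<bar>g y\<bar> \<partial>lborel)"
      using conv_abs_le[of f g x] by (intro mult_left_mono) (auto simp: conv_def)
    also have "\<dots> = (\<integral>y. norm x powr k * (\<bar>f (x - y)\<bar> * \<bar>g y\<bar>) \<partial>lborel)" by simp
    also have "\<dots> \<le> (\<integral>y. norm (x - y) powr k * \<bar>f (x - y)\<bar> * \<bar>g y\<bar> + \<bar>f (x - y)\<bar> * (norm y powr k * \<bar>g y\<bar>) \<partial>lborel)"
    proof (rule integral_mono)
      fix y
      have "norm x powr k * (\<bar>f (x - y)\<bar> * \<bar>g y\<bar>) \<le> (norm (x - y) powr k + norm y powr k) * (\<bar>f (x - y)\<bar> * \<bar>g y\<bar>)"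
        using norm_powr_subadd[OF k, of "x - y" y] by (intro mult_right_mono) auto
      then show "norm x powr k * (\<bar>f (x - y)\<bar> * \<bar>g y\<bar>) \<le> norm (x - y) powr k * \<bar>f (x - y)\<bar> * \<bar>g y\<bar> + \<bar>f (x - y)\<bar> * (norm y powr k * \<bar>g y\<bar>)"
        by (simp add: algebra_simps)
    qed (use elim in auto)
    also have "\<dots> = R x" unfolding R_def conv_def using elim by simp
    finally show ?case .
  qed
  show *: "finmom k (conv f g)"
    by (rule Bochner_Integration.integrable_bound[OF iR]) (use le in auto)
  show "mom k (conv f g) \<le> mom k f * nrm1 g + nrm1 f * mom k g"
    unfolding IR[symmetric] by (rule integral_mono_AE[OF * iR le])
qed

lemma moment_dil:
  fixes f :: "'a::euclidean_space \<Rightarrow> real"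
  assumes f: "f \<in> borel_measurable borel" "finmom k f"
  shows "finmom k (dil t f)" and "mom k (dil t f) = exp (- k * t) * mom k f"
proof -
  have [measurable]: "f \<in> borel_measurable borel" by fact
  have e: "norm x powr k * \<bar>dil t f x\<bar> = exp (- k * t) * dil t (\<lambda>x. norm x powr k * \<bar>f x\<bar>) x" for x
    by (simp add: dil_def abs_mult powr_mult exp_powr_real exp_minus field_simps flip: exp_add)
  show "finmom k (dil t f)" unfolding e using f(2) by (intro integrable_mult_right dil_integrable)
  show "mom k (dil t f) = exp (- k * t) * mom k f"
    unfolding e by (simp add: integral_dil_1)
qed

text \<open>Only the window from \<open>r\<close> to \<open>2 * r\<close> with
  \<open>r = 1 / |y|\<close> is kept: there \<open>u * |y|\<close> lies between 1 and 2, hence below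
  \<open>pi\<close>, and \<open>1 - cos (u * y)\<close> is at least \<open>1 - cos 1\<close>. The 4
  absorbs \<open>2 powr (1 + \<theta>)\<close>.\<close>

lemma abs_powr_le_cos_integral:
  fixes y \<theta> :: real
  assumes \<theta>: "0 < \<theta>" "\<theta> \<le> 1"
  shows "ennreal (\<bar>y\<bar> powr \<theta>) \<le> ennreal (4 / (1 - cos 1)) *
     (\<integral>\<^sup>+u. indicator {0<..} u * ennreal ((1 - cos (u * y)) * u powr (-1-\<theta>)) \<partial>lborel)"
proof (cases "y = 0")
  case False
  define r where "r = 1 / \<bar>y\<bar>"
  have r: "0 < r" using False by (simp add: r_def)
  have c1: "cos 1 < (1::real)" using cos_monotone_0_pi[of 0 "1::real"] pi_ge_two by simp
  define q where "q = (1 - cos 1) * (2 * r) powr (-1-\<theta>)"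
  have q0: "0 \<le> q" using c1 by (simp add: q_def)
  have le: "ennreal q * indicator {r..2*r} u \<le> indicator {0<..} u * ennreal ((1 - cos (u * y)) * u powr (-1-\<theta>))" for u
  proof (cases "u \<in> {r..2*r}")
    case True
    then have u: "0 < u" using r by auto
    have "r * \<bar>y\<bar> \<le> u * \<bar>y\<bar>" "u * \<bar>y\<bar> \<le> 2 * r * \<bar>y\<bar>" using True by (auto intro: mult_right_mono)
    then have "1 \<le> u * \<bar>y\<bar>" "u * \<bar>y\<bar> \<le> pi" using False pi_ge_two by (auto simp: r_def)
    then have "cos (u * \<bar>y\<bar>) \<le> cos 1" by (intro cos_monotone_0_pi_le) auto
    moreover have "cos (u * y) = cos (u * \<bar>y\<bar>)" by (cases "0 \<le> y") auto
    ultimately have "1 - cos 1 \<le> 1 - cos (u * y)" by simp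
    moreover have "(2 * r) powr (-1-\<theta>) \<le> u powr (-1-\<theta>)"
      using True u \<theta> by (intro powr_mono2') auto
    ultimately have "q \<le> (1 - cos (u * y)) * u powr (-1-\<theta>)"
      unfolding q_def using c1 by (intro mult_mono) auto
    then show ?thesis using True u by (simp add: ennreal_leI)
  qed simp
  have "\<bar>y\<bar> powr \<theta> \<le> 4 / (1 - cos 1) * (q * r)"
  proof -
    have "(2 * r) powr (-1-\<theta>) * r = 2 powr (-1-\<theta>) * (r powr (-1-\<theta>) * r powr 1)"
      using r by (simp add: powr_mult)
    also have "\<dots> = 2 powr (-1-\<theta>) * \<bar>y\<bar> powr \<theta>"
    proof -
      have "r powr (-1-\<theta>) * r powr 1 = r powr (-\<theta>)" by (simp only: powr_add[symmetric]) simp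
      then show ?thesis by (simp add: r_def powr_divide powr_minus_divide)
    qed
    also have "\<dots> \<ge> 2 powr (-2) * \<bar>y\<bar> powr \<theta>" using \<theta> by (intro mult_right_mono powr_mono) auto
    finally have "1/4 * \<bar>y\<bar> powr \<theta> \<le> (2 * r) powr (-1-\<theta>) * r" by (simp add: powr_minus)
    moreover have "4 / (1 - cos 1) * (q * r) = 4 * ((2 * r) powr (-1-\<theta>) * r)" using c1 by (simp add: q_def)
    ultimately show ?thesis by linarith
  qed
  then have "ennreal (\<bar>y\<bar> powr \<theta>) \<le> ennreal (4 / (1 - cos 1) * (q * r))" by (rule ennreal_leI)
  also have "\<dots> = ennreal (4 / (1 - cos 1)) * (ennreal q * ennreal r)"
    using c1 q0 r by (subst ennreal_mult) (auto simp: ennreal_mult)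
  also have "ennreal q * ennreal r = (\<integral>\<^sup>+u. ennreal q * indicator {r..2*r} u \<partial>lborel)"
    using r by (simp add: nn_integral_cmult_indicator)
  also have "ennreal (4 / (1 - cos 1)) * \<dots> \<le> ennreal (4 / (1 - cos 1)) *
     (\<integral>\<^sup>+u. indicator {0<..} u * ennreal ((1 - cos (u * y)) * u powr (-1-\<theta>)) \<partial>lborel)"
    by (intro mult_left_mono nn_integral_mono le) simp
  finally show ?thesis .
qed simp

text \<open>The constant arises by comparing \<open>|y| powr \<theta>\<close> with the integral of \<open>(1 - cos (u * y)) * u powr (- 1 - \<theta>)\<close>
  over \<open>u > 0\<close> and splitting that integral at \<open>u = 1\<close>.\<close>
definition momc :: "real \<Rightarrow> real \<Rightarrow> real \<Rightarrow> real" where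
  "momc B p \<theta> = 4 / (1 - cos 1) * (B / (p - \<theta>) + 2 / \<theta>)"

text \<open>Integrating \<open>abs_powr_le_cos_integral\<close> against \<open>g\<close> along each
  coordinate axis and exchanging the integrals leaves the defect of mass of the transform at
  \<open>u *\<^sub>R b\<close>. For \<open>u \<le> 1\<close> it is bounded by the hypothesis, for
  larger \<open>u\<close> by 2; summing over the axes gives the factor
  \<open>DIM('a)\<close>.\<close>

lemma fourier_moment:
  fixes g :: "'a::euclidean_space \<Rightarrow> real"
  assumes \<theta>: "0 < \<theta>" "\<theta> \<le> 1" "\<theta> < p" and g: "integrable lborel g" "\<And>x. 0 \<le> g x" "(\<integral>x. g x \<partial>lborel) \<le> 1"
    and B: "0 \<le> B" "\<And>\<xi>. norm \<xi> \<le> 1 \<Longrightarrow> (\<integral>x. g x \<partial>lborel) - Re (fourier g \<xi>) \<le> B * norm \<xi> powr p"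
  shows "finmom \<theta> g" and "mom \<theta> g \<le> DIM('a) * momc B p \<theta>"
proof -
  have [measurable]: "g \<in> borel_measurable borel" using g by auto
  have c1: "cos 1 < (1::real)" using cos_monotone_0_pi[of 0 "1::real"] pi_ge_two by simp
  have momc0: "0 \<le> momc B p \<theta>" unfolding momc_def using \<theta> B c1 by (intro mult_nonneg_nonneg add_nonneg_nonneg divide_nonneg_nonneg) auto
  define D where "D = (\<lambda>\<xi>. (\<integral>x. g x \<partial>lborel) - Re (fourier g \<xi>))"
  have D2: "D \<xi> \<le> 2" for \<xi>
  proof -
    have "\<bar>Re (fourier g \<xi>)\<bar> \<le> nrm1 g" using fourier_norm_le[of g \<xi>] abs_Re_le_cmod order_trans by blast
    then show ?thesis using g unfolding D_def by simp
  qed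
  have b: "(\<integral>\<^sup>+x. ennreal (\<bar>x \<bullet> b\<bar> powr \<theta> * g x) \<partial>lborel) \<le> ennreal (momc B p \<theta>)" if b: "b \<in> Basis" for b :: 'a
  proof -
    let ?w = "\<lambda>u::real. indicator {0<..} u * ennreal (u powr (-1-\<theta>))"
    have "(\<integral>\<^sup>+x. ennreal (\<bar>x \<bullet> b\<bar> powr \<theta> * g x) \<partial>lborel)
      \<le> (\<integral>\<^sup>+x. ennreal (4 / (1 - cos 1)) * (\<integral>\<^sup>+u. ?w u * ennreal ((1 - cos (u * (x \<bullet> b))) * g x) \<partial>lborel) \<partial>lborel)"
    proof (rule nn_integral_mono)
      fix x
      have "ennreal (\<bar>x \<bullet> b\<bar> powr \<theta> * g x) = ennreal (\<bar>x \<bullet> b\<bar> powr \<theta>) * ennreal (g x)"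
        using g by (simp add: ennreal_mult)
      also have "\<dots> \<le> (ennreal (4 / (1 - cos 1)) *
     (\<integral>\<^sup>+u. indicator {0<..} u * ennreal ((1 - cos (u * (x \<bullet> b))) * u powr (-1-\<theta>)) \<partial>lborel)) * ennreal (g x)"
        by (rule mult_right_mono[OF abs_powr_le_cos_integral]) (use \<theta> in auto)
      also have "\<dots> = ennreal (4 / (1 - cos 1)) * (\<integral>\<^sup>+u. indicator {0<..} u * ennreal ((1 - cos (u * (x \<bullet> b))) * u powr (-1-\<theta>)) * ennreal (g x) \<partial>lborel)"
        unfolding mult.assoc[of "ennreal (4 / (1 - cos 1))"] 
        by (rule arg_cong[where f="\<lambda>z. _ * z"], rule nn_integral_multc[symmetric]) measurable
      also have "\<dots> = ennreal (4 / (1 - cos 1)) * (\<integral>\<^sup>+u. ?w u * ennreal ((1 - cos (u * (x \<bullet> b))) * g x) \<partial>lborel)"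
        using g by (simp add: ennreal_mult mult_ac)
      finally show "ennreal (\<bar>x \<bullet> b\<bar> powr \<theta> * g x) \<le> ennreal (4 / (1 - cos 1)) * (\<integral>\<^sup>+u. ?w u * ennreal ((1 - cos (u * (x \<bullet> b))) * g x) \<partial>lborel)" .
    qed
    also have "\<dots> = ennreal (4 / (1 - cos 1)) * (\<integral>\<^sup>+x. (\<integral>\<^sup>+u. ?w u * ennreal ((1 - cos (u * (x \<bullet> b))) * g x) \<partial>lborel) \<partial>lborel)"
      by (rule nn_integral_cmult) measurable
    also have "(\<integral>\<^sup>+x. (\<integral>\<^sup>+u. ?w u * ennreal ((1 - cos (u * (x \<bullet> b))) * g x) \<partial>lborel) \<partial>lborel)
      = (\<integral>\<^sup>+u. (\<integral>\<^sup>+x. ?w u * ennreal ((1 - cos (u * (x \<bullet> b))) * g x) \<partial>lborel) \<partial>lborel)"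
      by (rule lborel_pair.Fubini') measurable
    also have "\<dots> = (\<integral>\<^sup>+u. ?w u * ennreal (D (u *\<^sub>R b)) \<partial>lborel)"
    proof (rule nn_integral_cong)
      fix u :: real
      have "(\<integral>\<^sup>+x. ?w u * ennreal ((1 - cos (u * (x \<bullet> b))) * g x) \<partial>lborel) = ?w u * (\<integral>\<^sup>+x. ennreal ((1 - cos (u * (x \<bullet> b))) * g x) \<partial>lborel)"
        by (rule nn_integral_cmult) measurable
      also have "(\<integral>\<^sup>+x. ennreal ((1 - cos (u * (x \<bullet> b))) * g x) \<partial>lborel) = ennreal (D (u *\<^sub>R b))"
        using nn_integral_eq_integral[OF fourier_mass_diff(1)[OF g(1), of "u *\<^sub>R b"]] fourier_mass_diff(2)[OF g(1), of "u *\<^sub>R b"] g(2)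
        by (simp add: D_def)
      finally show "(\<integral>\<^sup>+x. ?w u * ennreal ((1 - cos (u * (x \<bullet> b))) * g x) \<partial>lborel) = ?w u * ennreal (D (u *\<^sub>R b))" .
    qed
    also have "\<dots> \<le> (\<integral>\<^sup>+u. ennreal (indicator {0..1} u * (B * u powr (p-1-\<theta>))) + ennreal (indicator {1..} u * (2 * u powr (-1-\<theta>))) \<partial>lborel)"
    proof (rule nn_integral_mono)
      fix u :: real
      show "?w u * ennreal (D (u *\<^sub>R b)) \<le> ennreal (indicator {0..1} u * (B * u powr (p-1-\<theta>))) + ennreal (indicator {1..} u * (2 * u powr (-1-\<theta>)))"
      proof (cases "u \<le> 0")
        case u: False
        show ?thesis
        proof (cases "u \<le> 1")
          case True
          have "u powr (-1-\<theta>) * D (u *\<^sub>R b) \<le> u powr (-1-\<theta>) * (B * u powr p)"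
            using B(2)[of "u *\<^sub>R b"] u True b by (intro mult_left_mono) (auto simp: D_def)
          also have "\<dots> = B * u powr (p-1-\<theta>)" by (simp flip: powr_add) (simp add: algebra_simps)
          finally have "ennreal (u powr (-1-\<theta>) * D (u *\<^sub>R b)) \<le> ennreal (B * u powr (p-1-\<theta>))" by (rule ennreal_leI)
          then show ?thesis using u True by (simp add: ennreal_mult' add_increasing2)
        next
          case False
          have "u powr (-1-\<theta>) * D (u *\<^sub>R b) \<le> u powr (-1-\<theta>) * 2"
            by (intro mult_left_mono D2) auto
          then have "ennreal (u powr (-1-\<theta>) * D (u *\<^sub>R b)) \<le> ennreal (2 * u powr (-1-\<theta>))" by (intro ennreal_leI) simp
          then show ?thesis using u False by (simp add: ennreal_mult' add_increasing)
        qed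
      qed simp
    qed
    also have "\<dots> = (\<integral>\<^sup>+u. ennreal (indicator {0..1} u * (B * u powr (p-1-\<theta>))) \<partial>lborel) + (\<integral>\<^sup>+u. ennreal (indicator {1..} u * (2 * u powr (-1-\<theta>))) \<partial>lborel)"
      by (rule nn_integral_add) auto
    also have "(\<integral>\<^sup>+u. ennreal (indicator {0..1} u * (B * u powr (p-1-\<theta>))) \<partial>lborel) = ennreal (B / (p - \<theta>))"
    proof -
      have "((\<lambda>u. B * u powr (p-1-\<theta>)) has_integral (B * (1 powr (p-1-\<theta>+1) / (p-1-\<theta>+1)))) {0..1}"
        using \<theta> by (intro has_integral_mult_right has_integral_powr_from_0) auto
      then show ?thesis using nn_integral_has_integral_lebesgue[of "{0..1}" "\<lambda>u. B * u powr (p-1-\<theta>)"] B by simp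
    qed
    also have "(\<integral>\<^sup>+u. ennreal (indicator {1..} u * (2 * u powr (-1-\<theta>))) \<partial>lborel) = ennreal (2 / \<theta>)"
    proof -
      have "((\<lambda>u. 2 * u powr (-1-\<theta>)) has_integral (2 * (-(1 powr (-1-\<theta>+1)) / (-1-\<theta>+1)))) {1..}"
        using \<theta> by (intro has_integral_mult_right has_integral_powr_to_inf) auto
      then show ?thesis using nn_integral_has_integral_lebesgue[of "{1..}" "\<lambda>u. 2 * u powr (-1-\<theta>)"] by simp
    qed
    finally show ?thesis unfolding momc_def using \<theta> B c1
      by (simp add: ennreal_mult'' ennreal_plus flip: ennreal_plus ennreal_mult' del: ennreal_plus)
         (simp add: mult_left_mono ennreal_mult'[symmetric])
  qed
  have "(\<integral>\<^sup>+x. ennreal (norm x powr \<theta> * \<bar>g x\<bar>) \<partial>lborel) \<le> (\<integral>\<^sup>+x. (\<Sum>b\<in>Basis. ennreal (\<bar>x \<bullet> b\<bar> powr \<theta> * g x)) \<partial>lborel)"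
  proof (rule nn_integral_mono)
    fix x :: 'a
    have "norm x powr \<theta> * \<bar>g x\<bar> \<le> (\<Sum>b\<in>Basis. \<bar>x \<bullet> b\<bar> powr \<theta>) * g x"
      using norm_powr_le_sum[of \<theta> x] \<theta> g by (simp add: mult_right_mono)
    then show "ennreal (norm x powr \<theta> * \<bar>g x\<bar>) \<le> (\<Sum>b\<in>Basis. ennreal (\<bar>x \<bullet> b\<bar> powr \<theta> * g x))"
      using g by (subst sum_ennreal) (auto simp: sum_distrib_right intro!: ennreal_leI)
  qed
  also have "\<dots> = (\<Sum>b\<in>Basis. \<integral>\<^sup>+x. ennreal (\<bar>x \<bullet> b\<bar> powr \<theta> * g x) \<partial>lborel)"
    by (rule nn_integral_sum) measurable
  also have "\<dots> \<le> (\<Sum>b\<in>(Basis::'a set). ennreal (momc B p \<theta>))" by (rule sum_mono) (rule b)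
  also have "\<dots> = ennreal (DIM('a) * momc B p \<theta>)" using momc0 by (simp add: sum_ennreal ennreal_of_nat_eq_real_of_nat ennreal_mult)
  finally have le: "(\<integral>\<^sup>+x. ennreal (norm x powr \<theta> * \<bar>g x\<bar>) \<partial>lborel) \<le> ennreal (DIM('a) * momc B p \<theta>)" .
  show *: "finmom \<theta> g"
    by (rule integrableI_bounded) (use le in \<open>auto intro: order.strict_trans1\<close>)
  have "ennreal (mom \<theta> g) \<le> ennreal (DIM('a) * momc B p \<theta>)"
    using le nn_integral_eq_integral[OF *] by simp
  then show "mom \<theta> g \<le> DIM('a) * momc B p \<theta>" using momc0 by simp
qed


section \<open>The semigroup of jumps and dilations\<close>

text \<open>A jump made a time \<open>\<tau>\<close> ago has since been contracted by
  \<open>exp (- \<tau>)\<close>; \<open>a * smear t j\<close> is thus the intensity of all jumps of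
  the period \<open>{0..t}\<close> as they appear at its end.\<close>

definition smear :: "real \<Rightarrow> ('a::euclidean_space \<Rightarrow> real) \<Rightarrow> 'a \<Rightarrow> real" where
  "smear t f x = (LINT \<tau>:{0..t}|lborel. dil \<tau> f x)"

lemma set_lborel_eq_integral:
  fixes f :: "real \<Rightarrow> 'b::euclidean_space"
  assumes "continuous_on {a..b} f"
  shows "(LINT x:{a..b}|lborel. f x) = integral {a..b} f"
  by (rule set_borel_integral_eq_integral(2)[OF borel_integrable_atLeastAtMost'[OF assms]])

context
  fixes f :: "'a::euclidean_space \<Rightarrow> real" and t :: real
  assumes f: "integrable lborel f" and t: "0 \<le> t"
begin

lemma smear_pair_measurable: "(\<lambda>p. dil (fst p) f (snd p)) \<in> borel_measurable (lborel \<Otimes>\<^sub>M lborel)"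
proof -
  have [measurable]: "f \<in> borel_measurable borel" using f by auto
  show ?thesis unfolding dil_def by measurable
qed

lemma smear_bound: "nrm1 (dil \<tau> f) \<le> nrm1 f"
  using f by (subst nrm1_dil) auto

lemma smear_integrable: "integrable lborel (smear t f)"
  unfolding smear_def[abs_def]
  using time_integral_integrable[OF smear_pair_measurable dil_integrable[OF f] smear_bound] .

lemma smear_AE: "AE x in lborel. set_integrable lborel {0..t} (\<lambda>\<tau>. dil \<tau> f x)"
  using time_integral_AE[OF smear_pair_measurable dil_integrable[OF f] smear_bound] .

lemma smear_nonneg: "(\<And>x. 0 \<le> f x) \<Longrightarrow> 0 \<le> smear t f x"
  unfolding smear_def set_lebesgue_integral_def by (auto intro!: Bochner_Integration.integral_nonneg mult_nonneg_nonneg dil_nonneg)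

lemma smear_integral: "(\<integral>x. smear t f x \<partial>lborel) = t * (\<integral>x. f x \<partial>lborel)"
proof -
  have fm: "f \<in> borel_measurable borel" using f by auto
  have "(\<integral>x. smear t f x *\<^sub>R (1::real) \<partial>lborel) = (LINT \<tau>:{0..t}|lborel. (\<integral>x. dil \<tau> f x *\<^sub>R (1::real) \<partial>lborel))"
    unfolding smear_def
    by (rule time_integral_test[OF smear_pair_measurable dil_integrable[OF f] smear_bound, where C=1]) auto
  then show ?thesis using t by (simp add: integral_dil_1[OF fm] set_lebesgue_integral_def)
qed

lemma fourier_dil_continuous: "continuous_on S (\<lambda>\<tau>. fourier f (exp (-\<tau>) *\<^sub>R \<xi>))"
  by (intro continuous_on_compose2[OF fourier_continuous[OF f, of UNIV]] continuous_intros) auto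

lemma smear_fourier: "fourier (smear t f) \<xi> = integral {0..t} (\<lambda>\<tau>. fourier f (exp (-\<tau>) *\<^sub>R \<xi>))"
proof -
  have fm: "f \<in> borel_measurable borel" using f by auto
  have "fourier (smear t f) \<xi> = (LINT \<tau>:{0..t}|lborel. (\<integral>x. dil \<tau> f x *\<^sub>R cis (- (x \<bullet> \<xi>)) \<partial>lborel))"
    unfolding fourier_alt smear_def
    by (rule time_integral_test[OF smear_pair_measurable dil_integrable[OF f] smear_bound, where C=1]) auto
  also have "\<dots> = (LINT \<tau>:{0..t}|lborel. fourier f (exp (-\<tau>) *\<^sub>R \<xi>))"
    unfolding fourier_alt[symmetric] fourier_dil[OF fm] by simp
  also have "\<dots> = integral {0..t} (\<lambda>\<tau>. fourier f (exp (-\<tau>) *\<^sub>R \<xi>))"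
    by (rule set_lborel_eq_integral[OF fourier_dil_continuous])
  finally show ?thesis .
qed

end

text \<open>Mean value inequality: on the right half plane, which is convex, the derivative of
  \<open>exp (- z)\<close> has norm at most 1.\<close>

lemma norm_one_minus_exp_le:
  fixes z :: complex
  assumes "0 \<le> Re z"
  shows "norm (1 - exp (- z)) \<le> norm z"
proof -
  have "norm (exp (- z) - exp (- 0)) \<le> 1 * norm (z - 0)"
  proof (rule field_differentiable_bound[where S="{z. 0 \<le> Re z}" and f'="\<lambda>w. - exp (- w)"])
    show "convex {z. 0 \<le> Re z}" by (rule convex_halfspace_Re_ge)
    show "((\<lambda>z. exp (- z)) has_field_derivative - exp (- w)) (at w within {z. 0 \<le> Re z})" for w :: complex
      by (auto intro!: derivative_eq_intros)
  qed (use assms in \<open>auto simp: norm_exp_eq_Re\<close>)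
  then show ?thesis by (simp add: norm_minus_commute)
qed

text \<open>The equation with jump rate \<open>a\<close> and jump density \<open>j\<close>. Below, \<open>Sop t\<close> is its solution operator and
  \<open>pd t\<close> is the law of the accumulated jumps without its atom at \<open>0\<close>; \<open>ev t f g\<close> says on the Fourier side that
  the data \<open>f\<close> have become \<open>g\<close> at time \<open>t\<close>, independently of the choice of representatives.\<close>
locale jump =
  fixes j :: "'a::euclidean_space \<Rightarrow> real" and a :: real
  assumes j: "prob_density j" and a: "0 < a"
begin

lemma j_int: "integrable lborel j" and j_nonneg: "0 \<le> j x" and j_mass: "(\<integral>x. j x \<partial>lborel) = 1"
  and j_meas [measurable]: "j \<in> borel_measurable borel"
  using j by (auto simp: prob_density_def)

lemma j_nrm1: "nrm1 j = 1" using j_mass j_nonneg by simp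

lemma fourier_j_le: "norm (fourier j \<xi>) \<le> 1" using fourier_norm_le[of j \<xi>] j_nrm1 by simp

definition A :: "real \<Rightarrow> 'a \<Rightarrow> complex" where
  "A t \<xi> = a *\<^sub>R integral {0..t} (\<lambda>\<tau>. 1 - fourier j (exp (-\<tau>) *\<^sub>R \<xi>))"

lemma A_integrand_continuous: "continuous_on S (\<lambda>\<tau>. 1 - fourier j (exp (-\<tau>) *\<^sub>R \<xi>))"
  by (intro continuous_intros continuous_on_compose2[OF fourier_continuous[OF j_int, of UNIV]]) auto

lemma A_integrand_integrable: "(\<lambda>\<tau>. 1 - fourier j (exp (-\<tau>) *\<^sub>R \<xi>)) integrable_on {b..c}"
  by (rule integrable_continuous_interval[OF A_integrand_continuous])

lemma Re_A_eq: "Re (A t \<xi>) = a * integral {0..t} (\<lambda>\<tau>. 1 - Re (fourier j (exp (-\<tau>) *\<^sub>R \<xi>)))"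
  unfolding A_def using integral_linear[OF A_integrand_integrable[where \<xi>=\<xi> and b=0 and c=t] bounded_linear_Re]
  by (simp add: o_def)

lemma A_zero: "A t 0 = 0" unfolding A_def by (simp add: fourier_zero j_mass)

lemma one_minus_Re_fourier_nonneg: "0 \<le> 1 - Re (fourier j \<xi>)"
  using fourier_j_le[of \<xi>] abs_Re_le_cmod[of "fourier j \<xi>"] by linarith

lemma Re_A_nonneg: "0 \<le> Re (A t \<xi>)"
  unfolding Re_A_eq using a
  by (intro mult_nonneg_nonneg integral_nonneg integrable_continuous_interval continuous_intros
      continuous_on_compose2[OF fourier_continuous[OF j_int, of UNIV]]) (use one_minus_Re_fourier_nonneg in auto)

lemma norm_exp_A_le: "norm (exp (- A t \<xi>)) \<le> 1"
  using Re_A_nonneg[of t \<xi>] by (simp add: norm_exp_eq_Re)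

text \<open>A cocycle identity: going back by \<open>t\<close> replaces the frequency by
  \<open>exp (- t) *\<^sub>R \<xi>\<close>, from where the remaining time \<open>r\<close> is
  counted. It is what makes \<open>ev\<close> compose.\<close>

lemma A_add:
  assumes "0 \<le> t" "0 \<le> r"
  shows "A (t + r) \<xi> = A t \<xi> + A r (exp (-t) *\<^sub>R \<xi>)"
proof -
  let ?f = "\<lambda>\<tau>. 1 - fourier j (exp (-\<tau>) *\<^sub>R \<xi>)"
  have "integral {0..t+r} ?f = integral {0..t} ?f + integral {t..t+r} ?f"
    by (rule Henstock_Kurzweil_Integration.integral_combine[symmetric]) (use assms A_integrand_integrable in auto)
  also have "integral {t..t+r} ?f = integral {0..r} (?f \<circ> (\<lambda>\<tau>. \<tau> + t))"
    using integral_shift[of 0 t r ?f] A_integrand_continuous by (simp add: add.commute)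
  also have "?f \<circ> (\<lambda>\<tau>. \<tau> + t) = (\<lambda>\<tau>. 1 - fourier j (exp (-\<tau>) *\<^sub>R exp (-t) *\<^sub>R \<xi>))"
    by (auto simp: fun_eq_iff exp_add[symmetric])
  finally show ?thesis unfolding A_def by (simp add: scaleR_add_right)
qed

definition pd :: "real \<Rightarrow> 'a \<Rightarrow> real" where
  "pd t = cpd (\<lambda>x. a * smear t j x)"

definition Sop :: "real \<Rightarrow> ('a \<Rightarrow> real) \<Rightarrow> 'a \<Rightarrow> real" where
  "Sop t f x = exp (- a * t) * dil t f x + conv (pd t) (dil t f) x"

definition ev :: "real \<Rightarrow> ('a \<Rightarrow> real) \<Rightarrow> ('a \<Rightarrow> real) \<Rightarrow> bool" where
  "ev t f g \<longleftrightarrow> integrable lborel f \<and> integrable lborel g \<and>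
     (\<forall>\<xi>. fourier g \<xi> = fourier f (exp (-t) *\<^sub>R \<xi>) * exp (- A t \<xi>))"

context
  fixes t :: real
  assumes t: "0 \<le> t"
begin

lemma K_int: "integrable lborel (\<lambda>x. a * smear t j x)" and K_nonneg: "0 \<le> a * smear t j x"
  and K_mass: "(\<integral>x. a * smear t j x \<partial>lborel) = a * t"
  using smear_integrable[OF j_int t] smear_nonneg[OF j_int t j_nonneg] a smear_integral[OF j_int t] j_mass by auto

lemma K_fourier: "fourier (\<lambda>x. a * smear t j x) \<xi> = a * t - A t \<xi>"
proof -
  have "A t \<xi> = a *\<^sub>R (integral {0..t} (\<lambda>\<tau>. 1) - integral {0..t} (\<lambda>\<tau>. fourier j (exp (-\<tau>) *\<^sub>R \<xi>)))"
    unfolding A_def by (subst Henstock_Kurzweil_Integration.integral_diff)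
      (auto intro!: integrable_continuous_interval fourier_dil_continuous[OF j_int t])
  then show ?thesis using t
    by (simp add: fourier_cmult smear_fourier[OF j_int t] scaleR_conv_of_real algebra_simps)
qed

lemma pd_nonneg: "0 \<le> pd t x" and pd_int: "integrable lborel (pd t)"
  and pd_meas [measurable]: "pd t \<in> borel_measurable borel"
  and pd_mass: "(\<integral>x. pd t x \<partial>lborel) = 1 - exp (- a * t)"
  and pd_nrm1: "nrm1 (pd t) = 1 - exp (- a * t)"
  and pd_fourier: "fourier (pd t) \<xi> = exp (- A t \<xi>) - exp (- a * t)"
proof -
  show 0: "0 \<le> pd t x" for x unfolding pd_def by (rule cpd_nonneg[OF K_int K_nonneg])
  show "integrable lborel (pd t)" unfolding pd_def by (rule cpd_integrable[OF K_int K_nonneg])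
  then show "pd t \<in> borel_measurable borel" by auto
  show "(\<integral>x. pd t x \<partial>lborel) = 1 - exp (- a * t)"
    unfolding pd_def by (simp only: cpd_integral[OF K_int K_nonneg] K_mass) simp
  then show "nrm1 (pd t) = 1 - exp (- a * t)" using 0 by simp
  show "fourier (pd t) \<xi> = exp (- A t \<xi>) - exp (- a * t)"
    unfolding pd_def by (simp only: cpd_fourier[OF K_int K_nonneg] K_mass K_fourier) (simp add: exp_of_real)
qed

lemma ev_Sop:
  assumes f: "integrable lborel f"
  shows "ev t f (Sop t f)"
proof -
  note d = dil_integrable[OF f, of t]
  note c = conv_integrable[OF pd_int d]
  have fm: "f \<in> borel_measurable borel" using f by auto
  have "fourier (Sop t f) \<xi> = fourier f (exp (-t) *\<^sub>R \<xi>) * exp (- A t \<xi>)" for \<xi>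
    unfolding Sop_def[abs_def] fourier_add[OF integrable_mult_right[OF d] c] fourier_cmult
      fourier_conv[OF pd_int d] fourier_dil[OF fm] pd_fourier
    by (simp add: algebra_simps)
  then show ?thesis unfolding ev_def Sop_def[abs_def] using f d c by auto
qed

lemma Sop_nonneg: "(\<And>x. 0 \<le> f x) \<Longrightarrow> 0 \<le> Sop t f x"
  unfolding Sop_def by (intro add_nonneg_nonneg mult_nonneg_nonneg conv_nonneg dil_nonneg pd_nonneg) auto

lemma ev_AE_Sop: "ev t f g \<Longrightarrow> AE x in lborel. g x = Sop t f x"
  using ev_Sop[of f] by (intro fourier_inject) (auto simp: ev_def)

text \<open>The atom and \<open>pd t\<close> together have mass 1, and dilations preserve the L1
  norm.\<close>

lemma nrm1_ev_le:
  assumes e: "ev t f g"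
  shows "nrm1 g \<le> nrm1 f"
proof -
  have f: "integrable lborel f" and g: "integrable lborel g" using e by (auto simp: ev_def)
  have fm: "f \<in> borel_measurable borel" using f by auto
  have "nrm1 g = nrm1 (Sop t f)"
    by (rule integral_cong_AE) (use ev_AE_Sop[OF e] ev_Sop[OF f] g in \<open>auto simp: ev_def\<close>)
  also have "\<dots> \<le> (\<integral>x. exp (- a * t) * \<bar>dil t f x\<bar> + \<bar>conv (pd t) (dil t f) x\<bar> \<partial>lborel)"
    using ev_Sop[OF f] dil_integrable[OF f, of t] conv_integrable[OF pd_int dil_integrable[OF f, of t]]
    by (intro integral_mono) (auto simp: ev_def Sop_def abs_mult intro: order_trans[OF abs_triangle_ineq])
  also have "\<dots> = exp (- a * t) * nrm1 (dil t f) + nrm1 (conv (pd t) (dil t f))"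
    using dil_integrable[OF f, of t] conv_integrable[OF pd_int dil_integrable[OF f, of t]] by simp
  also have "\<dots> \<le> exp (- a * t) * nrm1 (dil t f) + nrm1 (pd t) * nrm1 (dil t f)"
    using nrm1_conv_le[OF pd_int dil_integrable[OF f, of t]] by simp
  also have "\<dots> = nrm1 f" unfolding pd_nrm1 nrm1_dil[OF fm] by (simp add: algebra_simps)
  finally show ?thesis .
qed

text \<open>The Lyapunov inequality of Harris' argument: the dilation shrinks the old moment by
  \<open>exp (- k * t)\<close>, and the jumps add their own moment in proportion to the
  mass.\<close>

lemma mom_ev_le:
  assumes e: "ev t f g" and k: "0 < k" "k \<le> 1" and fk: "finmom k f" and pk: "finmom k (pd t)"
  shows "finmom k g" and "mom k g \<le> exp (- k * t) * mom k f + mom k (pd t) * nrm1 f"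
proof -
  have f: "integrable lborel f" and g: "integrable lborel g" using e by (auto simp: ev_def)
  have fm: "f \<in> borel_measurable borel" using f by auto
  note d = dil_integrable[OF f, of t] moment_dil[OF fm fk, of t]
  note c = moment_conv[OF k pd_int pk d(1,2)]
  define R where "R = (\<lambda>x. exp (- a * t) * \<bar>dil t f x\<bar> + \<bar>conv (pd t) (dil t f) x\<bar>)"
  have e1: "norm x powr k * \<bar>R x\<bar> = exp (- a * t) * (norm x powr k * \<bar>dil t f x\<bar>) + norm x powr k * \<bar>conv (pd t) (dil t f) x\<bar>" for x
    by (simp add: R_def algebra_simps)
  have R: "finmom k R" unfolding e1 using d(2) c(1) by simp
  have le: "AE x in lborel. \<bar>g x\<bar> \<le> \<bar>R x\<bar>"
    using ev_AE_Sop[OF e]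
    by eventually_elim (simp add: R_def Sop_def abs_mult order_trans[OF abs_triangle_ineq])
  note b = finmom_bound[OF R _ le]
  show "finmom k g" using g by (intro b) auto
  have "mom k g \<le> mom k R" using g by (intro b) auto
  also have "\<dots> = exp (- a * t) * mom k (dil t f) + mom k (conv (pd t) (dil t f))"
    unfolding e1 using d(2) c(1) by simp
  also have "\<dots> \<le> exp (- a * t) * mom k (dil t f) + (mom k (pd t) * nrm1 (dil t f) + nrm1 (pd t) * mom k (dil t f))"
    using c(2) by simp
  also have "\<dots> = exp (- k * t) * mom k f + mom k (pd t) * nrm1 f"
    unfolding pd_nrm1 nrm1_dil[OF fm] d(3) by (simp add: algebra_simps)
  finally show "mom k g \<le> exp (- k * t) * mom k f + mom k (pd t) * nrm1 f" .
qed

text \<open>The atom cancels in the defect of mass of \<open>pd t\<close>, which equals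
  \<open>Re (1 - exp (- A t \<xi>))\<close> and is therefore at most
  \<open>norm (A t \<xi>)\<close>; \<open>fourier_moment\<close> does the rest.\<close>

lemma mom_pd:
  assumes \<theta>: "0 < \<theta>" "\<theta> \<le> 1" "\<theta> < p" and B: "0 \<le> B" "\<And>\<xi>. norm \<xi> \<le> 1 \<Longrightarrow> norm (A t \<xi>) \<le> B * norm \<xi> powr p"
  shows "finmom \<theta> (pd t)" and "mom \<theta> (pd t) \<le> DIM('a) * momc B p \<theta>"
proof -
  have le: "(\<integral>x. pd t x \<partial>lborel) - Re (fourier (pd t) \<xi>) \<le> B * norm \<xi> powr p" if "norm \<xi> \<le> 1" for \<xi>
  proof -
    have "(\<integral>x. pd t x \<partial>lborel) - Re (fourier (pd t) \<xi>) = Re (1 - exp (- A t \<xi>))"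
      by (simp add: pd_mass pd_fourier)
    also have "\<dots> \<le> norm (1 - exp (- A t \<xi>))" by (rule complex_Re_le_cmod)
    also have "\<dots> \<le> norm (A t \<xi>)" by (rule norm_one_minus_exp_le[OF Re_A_nonneg])
    finally show ?thesis using B(2)[OF that] by simp
  qed
  show "finmom \<theta> (pd t)" "mom \<theta> (pd t) \<le> DIM('a) * momc B p \<theta>"
    using fourier_moment[OF \<theta> pd_int pd_nonneg _ B(1) le] by (simp_all add: pd_mass)
qed

end

lemma ev_trans:
  assumes "ev t f g" "ev r g h" "0 \<le> t" "0 \<le> r"
  shows "ev (r + t) f h"
proof -
  have "exp (- (r + t)) = exp (- t) * exp (- r)"
    by (simp add: exp_add[symmetric])
  moreover have "exp (- A (r + t) \<xi>) = exp (- A r \<xi>) * exp (- A t (exp (- r) *\<^sub>R \<xi>))" for \<xi>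
    unfolding A_add[OF assms(4,3)] by (simp add: exp_add[symmetric])
  ultimately show ?thesis using assms(1,2) by (auto simp: ev_def)
qed

lemma ev_diff:
  assumes "ev t f g" "ev t f' g'"
  shows "ev t (\<lambda>x. f x - f' x) (\<lambda>x. g x - g' x)"
  using assms by (auto simp: ev_def fourier_diff algebra_simps)

lemma ev_integral:
  assumes "ev t f g"
  shows "(\<integral>x. g x \<partial>lborel) = (\<integral>x. f x \<partial>lborel)"
proof -
  have "fourier g 0 = fourier f 0" using assms by (auto simp: ev_def A_zero)
  then show ?thesis by (simp only: fourier_zero of_real_eq_iff)
qed

end

section \<open>Smooth minorants of compound Poisson laws\<close>

lemma smear_mono_AE:
  fixes f g :: "'a::euclidean_space \<Rightarrow> real"
  assumes f: "integrable lborel f" and g: "integrable lborel g" and le: "\<And>x. 0 \<le> f x" "\<And>x. f x \<le> g x"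
    and t: "0 \<le> t" "t \<le> t'"
  shows "AE x in lborel. smear t f x \<le> smear t' g x"
proof -
  have t': "0 \<le> t'" using t by simp
  show ?thesis using smear_AE[OF f t(1)] smear_AE[OF g t']
  proof eventually_elim
    case (elim x)
    show ?case unfolding smear_def set_lebesgue_integral_def
      using elim t le order_trans[OF le]
      by (intro integral_mono) (auto simp: set_integrable_def indicator_def dil_def intro!: mult_left_mono)
  qed
qed

text \<open>The Poisson law of a sum of intensities is the convolution of the two Poisson laws. Each
  law is an atom plus a density; expanding the convolution and removing the product of the atoms
  leaves these three terms.\<close>

lemma cpd_split:
  fixes K G R :: "'a::euclidean_space \<Rightarrow> real"
  assumes K: "integrable lborel K" "\<And>x. 0 \<le> K x" and G: "integrable lborel G" "\<And>x. 0 \<le> G x"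
    and R: "integrable lborel R" "\<And>x. 0 \<le> R x" and eq: "AE x in lborel. K x = G x + R x"
  shows "AE x in lborel. cpd K x = exp (- (\<integral>x. G x \<partial>lborel)) * cpd R x + (exp (- (\<integral>x. R x \<partial>lborel)) * cpd G x + conv (cpd G) (cpd R) x)"
proof (rule fourier_inject)
  note i = cpd_integrable[OF K] cpd_integrable[OF G] cpd_integrable[OF R]
  note c = conv_integrable[OF i(2,3)]
  show "integrable lborel (cpd K)" by (rule i)
  show "integrable lborel (\<lambda>x. exp (- (\<integral>x. G x \<partial>lborel)) * cpd R x + (exp (- (\<integral>x. R x \<partial>lborel)) * cpd G x + conv (cpd G) (cpd R) x))"
    using i c by simp
  have fK: "fourier K \<xi> = fourier G \<xi> + fourier R \<xi>" for \<xi>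
    unfolding fourier_add[OF G(1) R(1), symmetric] by (rule fourier_cong_AE) (use K G R eq in auto)
  have mK: "(\<integral>x. K x \<partial>lborel) = (\<integral>x. G x \<partial>lborel) + (\<integral>x. R x \<partial>lborel)"
    unfolding Bochner_Integration.integral_add[OF G(1) R(1), symmetric] by (rule integral_cong_AE) (use K G R eq in auto)
  show "fourier (cpd K) \<xi> = fourier (\<lambda>x. exp (- (\<integral>x. G x \<partial>lborel)) * cpd R x + (exp (- (\<integral>x. R x \<partial>lborel)) * cpd G x + conv (cpd G) (cpd R) x)) \<xi>" for \<xi>
  proof -
    let ?g = "\<integral>x. G x \<partial>lborel" and ?r = "\<integral>x. R x \<partial>lborel"
    have "fourier (\<lambda>x. exp (- ?g) * cpd R x + (exp (- ?r) * cpd G x + conv (cpd G) (cpd R) x)) \<xi>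
      = exp (- ?g) * fourier (cpd R) \<xi> + (exp (- ?r) * fourier (cpd G) \<xi> + fourier (cpd G) \<xi> * fourier (cpd R) \<xi>)"
      using i c by (subst fourier_add, simp, simp, subst fourier_add, simp, simp) (simp add: fourier_cmult fourier_conv)
    also have "\<dots> = exp (fourier K \<xi> - of_real (?g + ?r)) - of_real (exp (- (?g + ?r)))"
    proof -
      have "exp (fourier K \<xi> - of_real (?g + ?r)) = exp (fourier G \<xi> - of_real ?g) * exp (fourier R \<xi> - of_real ?r)"
        unfolding fK by (simp add: exp_add[symmetric] algebra_simps)
      moreover have "complex_of_real (exp (- (?g + ?r))) = of_real (exp (- ?g)) * of_real (exp (- ?r))"
        by (simp add: exp_add[symmetric] flip: of_real_mult)
      ultimately show ?thesis unfolding cpd_fourier[OF G] cpd_fourier[OF R] by (simp add: algebra_simps)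
    qed
    finally show ?thesis unfolding cpd_fourier[OF K] mK by simp
  qed
qed

text \<open>Convolution of the nonempty list \<open>f # gs\<close>. The first factor is kept apart
  because convolution of functions has no unit for the empty list.\<close>

fun convl :: "('a::euclidean_space \<Rightarrow> real) \<Rightarrow> ('a \<Rightarrow> real) list \<Rightarrow> 'a \<Rightarrow> real" where
  "convl f [] = f"
| "convl f (g # gs) = conv g (convl f gs)"

lemma convl_props:
  fixes f :: "'a::euclidean_space \<Rightarrow> real"
  assumes "\<And>h. h \<in> set (f # gs) \<Longrightarrow> integrable lborel h" "\<And>h x. h \<in> set (f # gs) \<Longrightarrow> 0 \<le> h x"
  shows "integrable lborel (convl f gs) \<and> (\<forall>x. 0 \<le> convl f gs x) \<and>
    (\<integral>x. convl f gs x \<partial>lborel) = prod_list (map (\<lambda>h. \<integral>x. h x \<partial>lborel) (f # gs)) \<and>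
    (\<forall>\<xi>. fourier (convl f gs) \<xi> = prod_list (map (\<lambda>h. fourier h \<xi>) (f # gs)))"
  using assms
proof (induction gs)
  case (Cons g gs)
  then have IH: "integrable lborel (convl f gs) \<and> (\<forall>x. 0 \<le> convl f gs x) \<and>
    (\<integral>x. convl f gs x \<partial>lborel) = prod_list (map (\<lambda>h. \<integral>x. h x \<partial>lborel) (f # gs)) \<and>
    (\<forall>\<xi>. fourier (convl f gs) \<xi> = prod_list (map (\<lambda>h. fourier h \<xi>) (f # gs)))" by auto
  have g: "integrable lborel g" "\<And>x. 0 \<le> g x" using Cons.prems by auto
  show ?case using IH g
    by (auto simp: conv_integrable conv_integral fourier_conv mult_ac intro!: conv_nonneg)
qed auto

lemma convl_le_cpow:
  fixes f :: "'a::euclidean_space \<Rightarrow> real"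
  assumes "\<And>h. h \<in> set (f # gs) \<Longrightarrow> integrable lborel h" "\<And>h x. h \<in> set (f # gs) \<Longrightarrow> 0 \<le> h x"
    and G: "integrable lborel G" "\<And>x. 0 \<le> G x" "\<And>h x. h \<in> set (f # gs) \<Longrightarrow> h x \<le> G x"
  shows "AE x in lborel. convl f gs x \<le> cpow G (length gs) x"
  using assms(1,2,5)
proof (induction gs)
  case Nil
  then show ?case by (auto simp: cpow_0)
next
  case (Cons g gs)
  have IH: "AE x in lborel. convl f gs x \<le> cpow G (length gs) x" by (rule Cons.IH) (use Cons.prems in auto)
  have c: "integrable lborel (convl f gs)" "\<And>x. 0 \<le> convl f gs x"
    using convl_props[of f gs] Cons.prems by auto
  have "AE x in lborel. conv g (convl f gs) x \<le> conv G (cpow G (length gs)) x"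
    by (rule conv_mono_AE) (use IH c Cons.prems G cpow_integrable[OF G(1,2)] in auto)
  then show ?case by (simp add: cpow_Suc)
qed

lemma prod_list_concat_replicate:
  fixes h :: "'b \<Rightarrow> 'c::comm_monoid_mult"
  shows "prod_list (map h (concat (replicate N xs))) = prod_list (map h xs) ^ N"
  by (induction N) auto

text \<open>Keep only the term of order \<open>N * card X\<close> in the series for the part \<open>\<Sum>i\<in>X. g i\<close> of \<open>K\<close>; it dominates the
  convolution in which every \<open>g i\<close> occurs \<open>N\<close> times. The rest of \<open>K\<close> is kept to retain its decay.\<close>
lemma cpd_minorant:
  fixes K :: "'a::euclidean_space \<Rightarrow> real" and g :: "'b \<Rightarrow> 'a \<Rightarrow> real"
  assumes K: "integrable lborel K" "\<And>x. 0 \<le> K x"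
    and X: "finite X" "X \<noteq> {}" and g: "\<And>i. i \<in> X \<Longrightarrow> integrable lborel (g i)" "\<And>i x. i \<in> X \<Longrightarrow> 0 \<le> g i x"
    and le: "AE x in lborel. (\<Sum>i\<in>X. g i x) \<le> K x"
    and \<mu>: "0 \<le> \<mu>" "\<And>i. i \<in> X \<Longrightarrow> \<mu> \<le> (\<integral>x. g i x \<partial>lborel)" and one: "(\<Sum>i\<in>X. \<integral>x. g i x \<partial>lborel) \<le> 1" and N: "1 \<le> N"
  shows "\<exists>H. integrable lborel H \<and> (\<forall>x. 0 \<le> H x) \<and> (AE x in lborel. H x \<le> cpd K x) \<and>
     exp (-1) / fact (N * card X) * \<mu> ^ (N * card X) \<le> (\<integral>x. H x \<partial>lborel) \<and>
     (\<forall>\<xi>. norm (fourier H \<xi>) \<le> exp 2 * exp (Re (fourier K \<xi>) - (\<integral>x. K x \<partial>lborel)) * (\<Prod>i\<in>X. norm (fourier (g i) \<xi>)) ^ N)"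
proof -
  define G where "G = (\<lambda>x. \<Sum>i\<in>X. g i x)"
  have G: "integrable lborel G" "\<And>x. 0 \<le> G x" unfolding G_def using g by (auto intro: sum_nonneg)
  define m where "m = (\<integral>x. G x \<partial>lborel)"
  have m1: "0 \<le> m" "m \<le> 1" using one G(2) unfolding m_def G_def using g by (auto simp: sum_nonneg)
  \<comment> \<open>\<open>G\<close> lies below \<open>K\<close> only almost everywhere; the
    \<open>max\<close> keeps \<open>R\<close> nonnegative at every point.\<close>
  define R where "R = (\<lambda>x. max 0 (K x - G x))"
  have R: "integrable lborel R" "\<And>x. 0 \<le> R x" unfolding R_def using K G by auto
  define r where "r = (\<integral>x. R x \<partial>lborel)"
  have r0: "0 \<le> r" unfolding r_def using R by simp
  have eq: "AE x in lborel. K x = G x + R x" using le by eventually_elim (auto simp: R_def G_def)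
  obtain xs where xs: "set xs = X" "distinct xs" using finite_distinct_list[OF X(1)] by auto
  define L where "L = map g (concat (replicate N xs))"
  have lenL: "length L = N * card X" using distinct_card[OF xs(2)] xs(1) by (simp add: L_def length_concat sum_list_replicate)
  have setL: "set L = g ` X" using N xs by (auto simp: L_def)
  have "L \<noteq> []" using setL X by auto
  then obtain f gs where L: "L = f # gs" by (cases L) auto
  have fg: "h \<in> set (f # gs) \<Longrightarrow> integrable lborel h" "h \<in> set (f # gs) \<Longrightarrow> 0 \<le> h x"
    "h \<in> set (f # gs) \<Longrightarrow> h x \<le> G x" for h x
    unfolding L[symmetric] setL G_def using g X(1) by (auto intro!: member_le_sum)
  define q where "q = convl f gs"
  have q: "integrable lborel q" "\<And>x. 0 \<le> q x"
      "(\<integral>x. q x \<partial>lborel) = prod_list (map (\<lambda>h. \<integral>x. h x \<partial>lborel) L)"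
      "\<And>\<xi>. fourier q \<xi> = prod_list (map (\<lambda>h. fourier h \<xi>) L)"
    using convl_props[of f gs] fg unfolding q_def L by auto
  have prodL: "prod_list (map F L) = (\<Prod>i\<in>X. F (g i)) ^ N" for F :: "('a \<Rightarrow> real) \<Rightarrow> 'c::comm_monoid_mult"
    unfolding L_def map_map prod_list_concat_replicate xs(1)[symmetric] prod.distinct_set_conv_list[OF xs(2)] by (simp add: o_def)
  \<comment> \<open>The coefficient of the term that is kept; since \<open>m \<le> 1\<close>, it has
    a lower bound free of \<open>m\<close>.\<close>
  define \<kappa> where "\<kappa> = exp (- m) / fact (N * card X)"
  have \<kappa>: "0 \<le> \<kappa>" "\<kappa> \<le> 1" "exp (-1) / fact (N * card X) \<le> \<kappa>"
  proof -
    show "0 \<le> \<kappa>" by (simp add: \<kappa>_def)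
    have "exp (- m) \<le> 1" using m1 by simp
    moreover have "1 \<le> (fact (N * card X) :: real)" by (rule fact_ge_1)
    ultimately have "exp (- m) \<le> fact (N * card X)" by (rule order_trans)
    then show "\<kappa> \<le> 1" unfolding \<kappa>_def by (simp add: divide_le_eq_1)
    show "exp (-1) / fact (N * card X) \<le> \<kappa>" unfolding \<kappa>_def using m1 by (intro divide_right_mono) auto
  qed
  define q0 where "q0 = (\<lambda>x. \<kappa> * q x)"
  have q0: "integrable lborel q0" "\<And>x. 0 \<le> q0 x" using q \<kappa> by (auto simp: q0_def)
  have q0le: "AE x in lborel. q0 x \<le> cpd G x"
  proof -
    have "AE x in lborel. q x \<le> cpow G (length gs) x"
      unfolding q_def by (rule convl_le_cpow) (use fg G in auto)
    then show ?thesis using cpd_ge_cpow[OF G, of "length gs"]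
    proof eventually_elim
      case (elim x)
      \<comment> \<open>\<open>cpow\<close> is indexed one below the number of factors, so this term
        carries the factorial of \<open>Suc (length gs)\<close>, the length of
        \<open>L\<close>.\<close>
      have S: "Suc (length gs) = N * card X" using lenL L by simp
      have "q0 x \<le> \<kappa> * cpow G (length gs) x" unfolding q0_def using elim \<kappa> by (intro mult_left_mono) auto
      also have "\<dots> \<le> cpd G x" using elim(2) unfolding S \<kappa>_def m_def by simp
      finally show ?case .
    qed
  qed
  \<comment> \<open>In \<open>cpd_split\<close> the term \<open>cpd R\<close> is dropped and
    \<open>cpd G\<close> is replaced by its minorant \<open>q0\<close>. The transform of what
    remains is a product that still contains the full exponential of \<open>R\<close>.\<close>
  define H where "H = (\<lambda>x. exp (- r) * q0 x + conv q0 (cpd R) x)"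
  note cR = cpd_integrable[OF R] cpd_nonneg[OF R]
  note cG = cpd_integrable[OF G] cpd_nonneg[OF G]
  have cq: "integrable lborel (conv q0 (cpd R))" by (rule conv_integrable[OF q0(1) cR(1)])
  have H: "integrable lborel H" "\<And>x. 0 \<le> H x"
    unfolding H_def using q0 cq cR by (auto intro!: add_nonneg_nonneg conv_nonneg)
  have Hle: "AE x in lborel. H x \<le> cpd K x"
  proof -
    have "AE x in lborel. conv q0 (cpd R) x \<le> conv (cpd G) (cpd R) x"
      by (rule conv_mono_AE) (use q0le q0 cR cG in auto)
    then show ?thesis using q0le cpd_split[OF K G R eq]
    proof eventually_elim
      case (elim x)
      have "H x \<le> exp (- r) * cpd G x + conv (cpd G) (cpd R) x" unfolding H_def using elim by (intro add_mono mult_left_mono) auto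
      also have "\<dots> \<le> cpd K x" unfolding elim(3) r_def by (simp add: cR)
      finally show ?case .
    qed
  qed
  have fH: "fourier H \<xi> = \<kappa> * (fourier q \<xi> * exp (fourier R \<xi> - of_real r))" for \<xi>
  proof -
    have "fourier H \<xi> = exp (- r) * fourier q0 \<xi> + fourier q0 \<xi> * fourier (cpd R) \<xi>"
      unfolding H_def using q0 cR cq by (subst fourier_add) (auto simp: fourier_cmult fourier_conv)
    also have "\<dots> = fourier q0 \<xi> * exp (fourier R \<xi> - of_real r)"
      unfolding cpd_fourier[OF R] r_def by (simp add: algebra_simps)
    also have "fourier q0 \<xi> = \<kappa> * fourier q \<xi>" unfolding q0_def by (rule fourier_cmult)
    finally show ?thesis by (simp add: mult.assoc)
  qed
  have mH: "(\<integral>x. H x \<partial>lborel) = \<kappa> * (\<integral>x. q x \<partial>lborel)"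
  proof -
    have "complex_of_real (\<integral>x. H x \<partial>lborel) = of_real (\<kappa> * (\<integral>x. q x \<partial>lborel))"
      using fH[of 0] by (simp add: fourier_zero r_def)
    then show ?thesis by (simp only: of_real_eq_iff)
  qed
  have "\<mu> ^ (N * card X) \<le> (\<integral>x. q x \<partial>lborel)"
  proof -
    have "\<mu> ^ card X \<le> (\<Prod>i\<in>X. \<integral>x. g i x \<partial>lborel)"
      using prod_mono[of X "\<lambda>_. \<mu>" "\<lambda>i. \<integral>x. g i x \<partial>lborel"] \<mu> by simp
    then have "(\<mu> ^ card X) ^ N \<le> (\<Prod>i\<in>X. \<integral>x. g i x \<partial>lborel) ^ N" using \<mu>(1) by (intro power_mono) auto
    then show ?thesis unfolding q(3) prodL by (simp add: power_mult[symmetric] mult.commute)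
  qed
  then have c1: "exp (-1) / fact (N * card X) * \<mu> ^ (N * card X) \<le> (\<integral>x. H x \<partial>lborel)"
    unfolding mH using \<kappa> \<mu> by (intro mult_mono) auto
  have c2: "norm (fourier H \<xi>) \<le> exp 2 * exp (Re (fourier K \<xi>) - (\<integral>x. K x \<partial>lborel)) * (\<Prod>i\<in>X. norm (fourier (g i) \<xi>)) ^ N" for \<xi>
  proof -
    have fK: "fourier K \<xi> = fourier G \<xi> + fourier R \<xi>"
      unfolding fourier_add[OF G(1) R(1), symmetric] by (rule fourier_cong_AE) (use K G R eq in auto)
    have mK: "(\<integral>x. K x \<partial>lborel) = m + r" unfolding m_def r_def
      Bochner_Integration.integral_add[OF G(1) R(1), symmetric] by (rule integral_cong_AE) (use K G R eq in auto)
    have "norm (fourier G \<xi>) \<le> m" using fourier_norm_le[of G \<xi>] G(2) by (simp add: m_def)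
    then have "- Re (fourier G \<xi>) \<le> m" using abs_Re_le_cmod[of "fourier G \<xi>"] by linarith
    \<comment> \<open>Passing from \<open>R\<close> back to \<open>K\<close> costs at most
      \<open>2 * m\<close> in the exponent, whence the factor \<open>exp 2\<close>.\<close>
    then have "Re (fourier R \<xi>) - r \<le> 2 + (Re (fourier K \<xi>) - (\<integral>x. K x \<partial>lborel))"
      using m1 by (simp add: fK mK)
    then have e: "norm (exp (fourier R \<xi> - of_real r)) \<le> exp 2 * exp (Re (fourier K \<xi>) - (\<integral>x. K x \<partial>lborel))"
      by (simp add: norm_exp_eq_Re exp_add[symmetric])
    have "norm (fourier H \<xi>) = \<kappa> * (norm (fourier q \<xi>) * norm (exp (fourier R \<xi> - of_real r)))"
      unfolding fH using \<kappa> by (simp add: norm_mult)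
    also have "\<dots> \<le> 1 * (norm (fourier q \<xi>) * (exp 2 * exp (Re (fourier K \<xi>) - (\<integral>x. K x \<partial>lborel))))"
      using \<kappa> e by (intro mult_mono) auto
    also have "norm (fourier q \<xi>) = (\<Prod>i\<in>X. norm (fourier (g i) \<xi>)) ^ N"
      unfolding q(4) prodL by (simp add: norm_power prod_norm)
    finally show ?thesis by (simp add: mult_ac)
  qed
  show ?thesis using H Hle c1 c2 by blast
qed

text \<open>Integration by parts: \<open>cis (- (exp (- \<tau>) * y))\<close> is, up to a factor of size \<open>exp \<tau> / |y|\<close>, its own derivative.\<close>
lemma osc_integral:
  fixes y :: real
  assumes y: "y \<noteq> 0"
  shows "norm (integral {0..1} (\<lambda>\<tau>. cis (- (exp (-\<tau>) * y)))) \<le> 2 * exp 1 / \<bar>y\<bar>"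
proof -
  define \<Phi> where "\<Phi> = (\<lambda>\<tau>::real. exp \<tau> *\<^sub>R cis (- (exp (-\<tau>) * y)))"
  have cont: "continuous_on {0..1} \<Phi>" unfolding \<Phi>_def by (intro continuous_intros)
  have cc: "continuous_on {0..1} (\<lambda>\<tau>. cis (- (exp (-\<tau>) * y)))" by (intro continuous_intros)
  have der: "(\<Phi> has_vector_derivative (\<Phi> \<tau> + \<i> * y * cis (- (exp (-\<tau>) * y)))) (at \<tau> within {0..1})" for \<tau>
  proof -
    have "((\<lambda>\<tau>. cis (- (exp (-\<tau>) * y))) has_vector_derivative (exp (-\<tau>) * y) *\<^sub>R (\<i> * cis (- (exp (-\<tau>) * y)))) (at \<tau> within {0..1})"
    proof -
      have "((\<lambda>\<tau>. - (exp (-\<tau>) * y)) has_real_derivative (exp (-\<tau>) * y)) (at \<tau> within {0..1})"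
        by (auto intro!: derivative_eq_intros)
      moreover have "(cis has_vector_derivative (\<i> * cis x)) (at x)" for x
      proof -
        have "((\<lambda>x. exp (\<i> * complex_of_real x)) has_vector_derivative (\<i> * exp (\<i> * complex_of_real x))) (at x)"
          by (rule has_vector_derivative_real_field[of "\<lambda>z. exp (\<i> * z)"]) (auto intro!: derivative_eq_intros)
        then show ?thesis by (simp add: cis_conv_exp[abs_def])
      qed
      ultimately show ?thesis
        using vector_diff_chain_within[of "\<lambda>\<tau>. - (exp (-\<tau>) * y)" "exp (-\<tau>) * y" \<tau> "{0..1}" cis]
        by (auto simp: o_def has_real_derivative_iff_has_vector_derivative intro: has_vector_derivative_at_within)
    qed
    then have "(\<Phi> has_vector_derivative (exp \<tau> *\<^sub>R ((exp (-\<tau>) * y) *\<^sub>R (\<i> * cis (- (exp (-\<tau>) * y)))) + exp \<tau> *\<^sub>R cis (- (exp (-\<tau>) * y)))) (at \<tau> within {0..1})"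
      unfolding \<Phi>_def by (rule has_vector_derivative_scaleR[rotated]) (auto intro!: derivative_eq_intros)
    moreover have "exp \<tau> *\<^sub>R ((exp (-\<tau>) * y) *\<^sub>R (\<i> * cis (- (exp (-\<tau>) * y)))) + exp \<tau> *\<^sub>R cis (- (exp (-\<tau>) * y))
      = \<Phi> \<tau> + \<i> * y * cis (- (exp (-\<tau>) * y))"
      by (simp add: \<Phi>_def scaleR_conv_of_real exp_minus field_simps)
    ultimately show ?thesis by simp
  qed
  have "((\<lambda>\<tau>. \<Phi> \<tau> + \<i> * y * cis (- (exp (-\<tau>) * y))) has_integral (\<Phi> 1 - \<Phi> 0)) {0..1}"
    by (rule fundamental_theorem_of_calculus) (use der in auto)
  then have "\<Phi> 1 - \<Phi> 0 = integral {0..1} (\<lambda>\<tau>. \<Phi> \<tau> + \<i> * y * cis (- (exp (-\<tau>) * y)))"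
    by (rule integral_unique[symmetric])
  also have "\<dots> = integral {0..1} \<Phi> + \<i> * y * integral {0..1} (\<lambda>\<tau>. cis (- (exp (-\<tau>) * y)))"
    using cont cc by (subst Henstock_Kurzweil_Integration.integral_add) (auto intro!: integrable_continuous_interval continuous_intros)
  finally have eq: "\<i> * y * integral {0..1} (\<lambda>\<tau>. cis (- (exp (-\<tau>) * y))) = \<Phi> 1 - \<Phi> 0 - integral {0..1} \<Phi>" by simp
  have n: "norm (\<Phi> \<tau>) = exp \<tau>" for \<tau> by (simp add: \<Phi>_def)
  have i1: "norm (integral {0..1} \<Phi>) \<le> exp 1 - exp 0"
  proof -
    have "((\<lambda>\<tau>::real. exp \<tau>) has_integral (exp 1 - exp 0)) {0..1}"
      by (rule fundamental_theorem_of_calculus) (auto intro!: derivative_eq_intros simp: has_real_derivative_iff_has_vector_derivative[symmetric])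
    then show ?thesis
      using integral_norm_bound_integral[OF integrable_continuous_interval[OF cont], of exp] n by (auto simp: has_integral_iff)
  qed
  have "\<bar>y\<bar> * norm (integral {0..1} (\<lambda>\<tau>. cis (- (exp (-\<tau>) * y)))) = norm (\<Phi> 1 - \<Phi> 0 - integral {0..1} \<Phi>)"
    unfolding eq[symmetric] by (simp add: norm_mult)
  also have "\<dots> \<le> norm (\<Phi> 1) + norm (\<Phi> 0) + norm (integral {0..1} \<Phi>)"
    by (meson add_mono norm_triangle_ineq4 order_trans order_refl)
  \<comment> \<open>The three terms are at most \<open>exp 1\<close>, 1 and
    \<open>exp 1 - 1\<close>.\<close>
  also have "\<dots> \<le> 2 * exp 1" using i1 by (simp add: n)
  finally show ?thesis using y by (simp add: field_simps)
qed

text \<open>Exchanging the integrals leaves, for each \<open>z\<close>, an oscillatory integral with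
  phase \<open>z \<bullet> \<eta>\<close>, and this phase stays away from 0 wherever
  \<open>P\<close> is not zero.\<close>

lemma osc_fourier:
  fixes P :: "'a::euclidean_space \<Rightarrow> real"
  assumes P: "integrable lborel P" "\<And>x. 0 \<le> P x" and \<kappa>: "0 < \<kappa>" "\<And>z. P z \<noteq> 0 \<Longrightarrow> \<kappa> \<le> \<bar>z \<bullet> \<eta>\<bar>"
  shows "norm (integral {0..1} (\<lambda>\<tau>. fourier P (exp (-\<tau>) *\<^sub>R \<eta>))) \<le> 2 * exp 1 / \<kappa> * (\<integral>x. P x \<partial>lborel)"
proof -
  have [measurable]: "P \<in> borel_measurable borel" using P by auto
  define F where "F = (\<lambda>(\<tau>,z). indicator {0..1} \<tau> *\<^sub>R (cis (- (exp (-\<tau>) * (z \<bullet> \<eta>))) * complex_of_real (P z)))"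
  have ind: "integrable lborel (indicator {0..1} :: real \<Rightarrow> real)"
    by (rule integrable_real_indicator) (auto simp: emeasure_lborel_Icc_eq)
  have F: "integrable (lborel \<Otimes>\<^sub>M lborel) F"
    by (rule Bochner_Integration.integrable_bound[OF integrable_pair_mult[OF ind P(1)]])
       (auto simp: F_def norm_mult split_beta')
  have "integral {0..1} (\<lambda>\<tau>. fourier P (exp (-\<tau>) *\<^sub>R \<eta>)) = (LINT \<tau>:{0..1}|lborel. fourier P (exp (-\<tau>) *\<^sub>R \<eta>))"
    by (rule set_lborel_eq_integral[symmetric, OF fourier_dil_continuous[OF P(1) order_refl]])
  also have "\<dots> = (\<integral>\<tau>. (\<integral>z. F (\<tau>,z) \<partial>lborel) \<partial>lborel)"
    unfolding set_lebesgue_integral_def fourier_def F_def by simp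
  also have "\<dots> = (\<integral>z. (\<integral>\<tau>. F (\<tau>,z) \<partial>lborel) \<partial>lborel)"
    using lborel_pair.Fubini_integral[of "\<lambda>\<tau> z. F (\<tau>,z)"] F by simp
  also have "\<dots> = (\<integral>z. integral {0..1} (\<lambda>\<tau>. cis (- (exp (-\<tau>) * (z \<bullet> \<eta>)))) * complex_of_real (P z) \<partial>lborel)"
  proof (rule Bochner_Integration.integral_cong[OF refl])
    fix z :: 'a
    have cc: "continuous_on {0..1} (\<lambda>\<tau>. cis (- (exp (-\<tau>) * (z \<bullet> \<eta>))))" by (intro continuous_intros)
    have "(\<integral>\<tau>. F (\<tau>,z) \<partial>lborel) = (LINT \<tau>:{0..1}|lborel. cis (- (exp (-\<tau>) * (z \<bullet> \<eta>)))) * complex_of_real (P z)"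
      unfolding F_def set_lebesgue_integral_def by (simp flip: scaleR_scaleR mult_scaleR_left)
    then show "(\<integral>\<tau>. F (\<tau>,z) \<partial>lborel) = integral {0..1} (\<lambda>\<tau>. cis (- (exp (-\<tau>) * (z \<bullet> \<eta>)))) * complex_of_real (P z)"
      by (simp only: set_lborel_eq_integral[OF cc])
  qed
  finally have eq: "integral {0..1} (\<lambda>\<tau>. fourier P (exp (-\<tau>) *\<^sub>R \<eta>)) = \<dots>" .
  have b: "norm (integral {0..1} (\<lambda>\<tau>. cis (- (exp (-\<tau>) * (z \<bullet> \<eta>)))) * complex_of_real (P z)) \<le> 2 * exp 1 / \<kappa> * P z" for z
  proof (cases "P z = 0")
    case False
    then have k: "\<kappa> \<le> \<bar>z \<bullet> \<eta>\<bar>" using \<kappa> by simp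
    have "norm (integral {0..1} (\<lambda>\<tau>. cis (- (exp (-\<tau>) * (z \<bullet> \<eta>))))) \<le> 2 * exp 1 / \<bar>z \<bullet> \<eta>\<bar>"
      by (rule osc_integral) (use k \<kappa> in auto)
    also have "\<dots> \<le> 2 * exp 1 / \<kappa>" using k \<kappa>(1) by (intro divide_left_mono) auto
    finally have "norm (integral {0..1} (\<lambda>\<tau>. cis (- (exp (-\<tau>) * (z \<bullet> \<eta>))))) * P z \<le> 2 * exp 1 / \<kappa> * P z"
      by (rule mult_right_mono) (rule P(2))
    then show ?thesis using P(2)[of z] by (simp add: norm_mult)
  qed simp
  have "norm (integral {0..1} (\<lambda>\<tau>. fourier P (exp (-\<tau>) *\<^sub>R \<eta>)))
    \<le> (\<integral>z. norm (integral {0..1} (\<lambda>\<tau>. cis (- (exp (-\<tau>) * (z \<bullet> \<eta>)))) * complex_of_real (P z)) \<partial>lborel)"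
    unfolding eq by (rule Bochner_Integration.integral_norm_bound)
  also have "\<dots> \<le> (\<integral>z. 2 * exp 1 / \<kappa> * P z \<partial>lborel)"
  proof (rule integral_mono')
    show "integrable lborel (\<lambda>z. 2 * exp 1 / \<kappa> * P z)" by (rule integrable_mult_right[OF P(1)])
    show "0 \<le> 2 * exp 1 / \<kappa> * P z" for z using P(2)[of z] \<kappa>(1) by simp
  qed (rule b)
  also have "\<dots> = 2 * exp 1 / \<kappa> * (\<integral>x. P x \<partial>lborel)" by (rule integral_mult_right_zero)
  finally show ?thesis .
qed

lemma fourier_resc:
  "f \<in> borel_measurable borel \<Longrightarrow> 0 < \<epsilon> \<Longrightarrow> fourier (resc \<epsilon> f) \<xi> = fourier f (\<epsilon> *\<^sub>R \<xi>)"
  by (simp add: resc_eq_dil fourier_dil)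

lemma one_minus_cos_le: "1 - cos y \<le> y\<^sup>2 / (2::real)"
proof -
  have "1 - cos y = 2 * (sin (y/2))\<^sup>2" using cos_double_sin[of "y/2"] by simp
  also have "(sin (y/2))\<^sup>2 \<le> (y/2)\<^sup>2" by (rule abs_le_square_iff[THEN iffD1]) (rule abs_sin_x_le_abs_x)
  finally show ?thesis by (simp add: power2_eq_square)
qed

text \<open>A single term of the exponential series; it converts exponential decay into decay of any
  given power.\<close>

lemma power_exp_minus_le:
  fixes x :: real
  assumes "0 \<le> x"
  shows "exp (- x) * x ^ n \<le> fact n"
proof -
  have "sum (\<lambda>k. inverse (fact k) *\<^sub>R x ^ k) {n} \<le> (\<Sum>k. inverse (fact k) *\<^sub>R x ^ k)"
    by (rule sum_le_suminf[OF summable_exp_generic]) (use assms in auto)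
  then have "x ^ n / fact n \<le> exp x" by (simp add: exp_def divide_inverse mult.commute)
  then show ?thesis by (simp add: exp_minus field_simps)
qed

section \<open>Upper and lower bounds on the exponent \<open>A\<close>\<close>

context jump
begin

text \<open>A bound on the integrand that decays like \<open>exp (- \<tau>)\<close> integrates to at
  most \<open>D\<close>, so the estimate does not grow with \<open>t\<close>.\<close>

lemma A_le:
  assumes t: "0 \<le> t" and D: "\<And>\<tau>. 0 \<le> \<tau> \<Longrightarrow> norm (1 - fourier j (exp (-\<tau>) *\<^sub>R \<xi>)) \<le> D * exp (-\<tau>)"
  shows "norm (A t \<xi>) \<le> a * D"
proof -
  have D0: "0 \<le> D" using order_trans[OF norm_ge_zero D[of 0]] by simp
  have "((\<lambda>\<tau>. D * exp (-\<tau>)) has_integral (- D * exp (- t) - (- D * exp (- 0)))) {0..t}"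
    by (rule fundamental_theorem_of_calculus)
       (use t in \<open>auto intro!: derivative_eq_intros simp: has_real_derivative_iff_has_vector_derivative[symmetric]\<close>)
  then have "norm (integral {0..t} (\<lambda>\<tau>. 1 - fourier j (exp (-\<tau>) *\<^sub>R \<xi>))) \<le> - D * exp (- t) - (- D * exp (- 0))"
    using Henstock_Kurzweil_Integration.integral_norm_bound_integral[OF A_integrand_integrable[where b=0 and c=t and \<xi>=\<xi>], of "\<lambda>\<tau>. D * exp (-\<tau>)"] D
    by (auto simp: has_integral_iff)
  also have "\<dots> \<le> D" using D0 by simp
  finally show ?thesis unfolding A_def using a by (simp add: mult_left_mono)
qed

text \<open>The integrand of \<open>Re (A t \<xi>)\<close> is nonnegative, so a single time window
  \<open>{b..c}\<close> already gives a lower bound.\<close>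

lemma Re_A_ge:
  assumes "0 \<le> b" "b \<le> c" "c \<le> t" and le: "\<And>\<tau>. \<tau> \<in> {b..c} \<Longrightarrow> q \<le> 1 - Re (fourier j (exp (-\<tau>) *\<^sub>R \<xi>))"
  shows "a * ((c - b) * q) \<le> Re (A t \<xi>)"
proof -
  let ?f = "\<lambda>\<tau>. 1 - Re (fourier j (exp (-\<tau>) *\<^sub>R \<xi>))"
  have i: "?f integrable_on {u..v}" for u v
    by (intro integrable_continuous_interval continuous_intros continuous_on_compose2[OF fourier_continuous[OF j_int, of UNIV]]) auto
  have "(c - b) * q = integral {b..c} (\<lambda>_. q)" using assms by simp
  also have "\<dots> \<le> integral {b..c} ?f" by (rule integral_le[OF _ i]) (use le in auto)
  also have "\<dots> \<le> integral {0..t} ?f" by (rule integral_subset_le[OF _ i i]) (use assms one_minus_Re_fourier_nonneg in auto)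
  finally show ?thesis unfolding Re_A_eq using a by simp
qed

end

section \<open>Consequences of the expansion at the origin, uniform in \<open>s\<close>\<close>

locale kernel_family =
  fixes J :: "real \<Rightarrow> 'a::euclidean_space \<Rightarrow> real" and \<delta> C0 :: real
  assumes Jpd: "s \<in> {1/2<..<1} \<Longrightarrow> prob_density (J s)" and \<delta>: "0 < \<delta>" and C0: "0 < C0"
    and expansion: "s \<in> {1/2<..<1} \<Longrightarrow> norm \<xi> \<le> 1 \<Longrightarrow>
      norm (fourier (J s) \<xi> - complex_of_real (1 - norm \<xi> powr (2 * s))) \<le> C0 * norm \<xi> powr (2 * s + \<delta>)"
begin

lemma J_props:
  assumes "s \<in> {1/2<..<1}"
  shows "integrable lborel (J s)" "0 \<le> J s x" "(\<integral>x. J s x \<partial>lborel) = 1" "J s \<in> borel_measurable borel"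
  using Jpd[OF assms] by (auto simp: prob_density_def)

lemma powr_le_self: "0 \<le> x \<Longrightarrow> x \<le> 1 \<Longrightarrow> 1 \<le> p \<Longrightarrow> x powr p \<le> (x::real)"
  using powr_mono'[of 1 p x] by simp

lemma one_minus_fourier_le:
  assumes s: "s \<in> {1/2<..<1}" and "norm \<xi> \<le> 1"
  shows "norm (1 - fourier (J s) \<xi>) \<le> (1 + C0) * norm \<xi> powr (2 * s)"
proof -
  have "norm \<xi> powr (2 * s + \<delta>) \<le> norm \<xi> powr (2 * s)" using \<delta> assms by (intro powr_mono') auto
  then have "C0 * norm \<xi> powr (2 * s + \<delta>) \<le> C0 * norm \<xi> powr (2 * s)" using C0 by simp
  moreover have "norm (1 - fourier (J s) \<xi>) \<le> norm (complex_of_real (norm \<xi> powr (2 * s)))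
     + norm (fourier (J s) \<xi> - complex_of_real (1 - norm \<xi> powr (2 * s)))"
    by (rule order_trans[OF eq_refl norm_triangle_ineq4]) simp
  ultimately show ?thesis using expansion[OF assms] by (simp add: algebra_simps)
qed

lemma one_minus_Re_fourier_ge:
  obtains r0 where "0 < r0" "r0 \<le> 1"
    "\<And>s \<xi>. s \<in> {1/2<..<1} \<Longrightarrow> norm \<xi> \<le> r0 \<Longrightarrow> 1/2 * norm \<xi> powr (2 * s) \<le> 1 - Re (fourier (J s) \<xi>)"
proof -
  \<comment> \<open>Chosen so that \<open>C0 * r0 powr \<delta> \<le> 1/2\<close>: within this
    radius the remainder is at most half of the main term, for every \<open>s\<close> at
    once.\<close>
  define r0 where "r0 = min 1 ((1 / (2 * C0)) powr (1 / \<delta>))"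
  have r0: "0 < r0" "r0 \<le> 1" using C0 by (auto simp: r0_def)
  have "1/2 * norm \<xi> powr (2 * s) \<le> 1 - Re (fourier (J s) \<xi>)" if s: "s \<in> {1/2<..<1}" and x: "norm \<xi> \<le> r0" for s \<xi>
  proof -
    have "norm \<xi> powr \<delta> \<le> ((1 / (2 * C0)) powr (1 / \<delta>)) powr \<delta>" using x \<delta> by (intro powr_mono2) (auto simp: r0_def)
    also have "\<dots> = 1 / (2 * C0)" using \<delta> C0 by (simp add: powr_powr)
    finally have "C0 * norm \<xi> powr \<delta> \<le> 1/2" using C0 by (simp add: field_simps)
    then have "C0 * norm \<xi> powr \<delta> * norm \<xi> powr (2 * s) \<le> 1/2 * norm \<xi> powr (2 * s)" by (rule mult_right_mono) simp
    then have "C0 * norm \<xi> powr (2 * s + \<delta>) \<le> 1/2 * norm \<xi> powr (2 * s)" by (simp add: powr_add mult_ac)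
    moreover have "norm \<xi> \<le> 1" using x r0 by simp
    ultimately have "norm (fourier (J s) \<xi> - complex_of_real (1 - norm \<xi> powr (2 * s))) \<le> 1/2 * norm \<xi> powr (2 * s)"
      using expansion[OF s] by fastforce
    then have "\<bar>Re (fourier (J s) \<xi> - complex_of_real (1 - norm \<xi> powr (2 * s)))\<bar> \<le> 1/2 * norm \<xi> powr (2 * s)"
      using abs_Re_le_cmod order_trans by blast
    from abs_le_D1[OF this] show ?thesis by simp
  qed
  with r0 that show ?thesis by blast
qed

text \<open>The exponent \<open>p\<close> is left free. With \<open>p = 1\<close> the bound is
  uniform in \<open>s\<close> for orders \<open>\<theta> < 1\<close>; with \<open>p = 2 * s\<close>
  it also covers \<open>\<theta> = 1\<close>, but degenerates as \<open>2 * s\<close> approaches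
  \<open>\<theta>\<close>.\<close>

lemma mom_J:
  assumes s: "s \<in> {1/2<..<1}" and \<theta>: "0 < \<theta>" "\<theta> \<le> 1" and p: "\<theta> < p" "p \<le> 2 * s"
  shows "finmom \<theta> (J s)" and "mom \<theta> (J s) \<le> DIM('a) * momc (1 + C0) p \<theta>"
proof -
  have "(\<integral>x. J s x \<partial>lborel) - Re (fourier (J s) \<xi>) \<le> (1 + C0) * norm \<xi> powr p" if x: "norm \<xi> \<le> 1" for \<xi>
  proof -
    have "(\<integral>x. J s x \<partial>lborel) - Re (fourier (J s) \<xi>) = Re (1 - fourier (J s) \<xi>)" using J_props[OF s] by simp
    also have "\<dots> \<le> norm (1 - fourier (J s) \<xi>)" by (rule complex_Re_le_cmod)
    also have "\<dots> \<le> (1 + C0) * norm \<xi> powr (2 * s)" by (rule one_minus_fourier_le[OF s x])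
    also have "\<dots> \<le> (1 + C0) * norm \<xi> powr p" using C0 x p by (intro mult_left_mono powr_mono') auto
    finally show ?thesis .
  qed
  then show "finmom \<theta> (J s)" "mom \<theta> (J s) \<le> DIM('a) * momc (1 + C0) p \<theta>"
    using fourier_moment[OF \<theta> p(1) J_props(1)[OF s] J_props(2)[OF s], of "1 + C0"] C0 J_props(3)[OF s] by auto
qed

lemma jump_resc:
  assumes "s \<in> {1/2<..<1}" "0 < \<epsilon>"
  shows "jump (resc \<epsilon> (J s)) (\<epsilon> powr (- 2 * s))"
proof
  show "0 < \<epsilon> powr (- 2 * s)" using assms by simp
  show "prob_density (resc \<epsilon> (J s))"
    unfolding prob_density_def resc_eq_dil[OF assms(2)] using J_props[OF assms(1)]
    by (auto intro: dil_integrable dil_nonneg simp: integral_dil_1)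
qed

text \<open>The rate \<open>\<epsilon> powr (- 2 * s)\<close> cancels against the power
  \<open>\<epsilon> powr (2 * s)\<close> of the rescaled frequency, so the bound is free of
  \<open>\<epsilon>\<close>. As \<open>2 * s \<ge> 1\<close>, the dilated frequency supplies the
  decay \<open>exp (- \<tau>)\<close> that \<open>A_le\<close> asks for.\<close>

lemma A_le_powr:
  assumes s: "s \<in> {1/2<..<1}" and \<epsilon>: "0 < \<epsilon>" "\<epsilon> < 1" and t: "0 \<le> t" and x: "norm \<xi> \<le> 1"
  shows "norm (jump.A (resc \<epsilon> (J s)) (\<epsilon> powr (- 2 * s)) t \<xi>) \<le> (1 + C0) * norm \<xi> powr (2 * s)"
proof -
  interpret jump "resc \<epsilon> (J s)" "\<epsilon> powr (- 2 * s)" by (rule jump_resc[OF s \<epsilon>(1)])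
  have "norm (A t \<xi>) \<le> \<epsilon> powr (- 2 * s) * ((1 + C0) * (\<epsilon> powr (2 * s) * norm \<xi> powr (2 * s)))"
  proof (rule A_le[OF t])
    fix \<tau> :: real assume \<tau>: "0 \<le> \<tau>"
    have e: "exp (-\<tau>) \<le> 1" using \<tau> by simp
    have n: "norm (\<epsilon> *\<^sub>R exp (-\<tau>) *\<^sub>R \<xi>) = \<epsilon> * exp (-\<tau>) * norm \<xi>" using \<epsilon> by simp
    have "\<epsilon> * exp (-\<tau>) * norm \<xi> \<le> 1 * 1 * 1" using \<epsilon> e x by (intro mult_mono) auto
    then have "norm (\<epsilon> *\<^sub>R exp (-\<tau>) *\<^sub>R \<xi>) \<le> 1" unfolding n by simp
    from one_minus_fourier_le[OF s this]
    have "norm (1 - fourier (J s) (\<epsilon> *\<^sub>R exp (-\<tau>) *\<^sub>R \<xi>)) \<le> (1 + C0) * (\<epsilon> * exp (-\<tau>) * norm \<xi>) powr (2 * s)"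
      unfolding n .
    also have "(\<epsilon> * exp (-\<tau>) * norm \<xi>) powr (2 * s) = (\<epsilon> powr (2 * s) * norm \<xi> powr (2 * s)) * exp (-\<tau>) powr (2 * s)"
      using \<epsilon> by (simp add: powr_mult)
    also have "\<dots> \<le> (\<epsilon> powr (2 * s) * norm \<xi> powr (2 * s)) * exp (-\<tau>)"
      using e s by (intro mult_left_mono powr_le_self) auto
    finally show "norm (1 - fourier (resc \<epsilon> (J s)) (exp (-\<tau>) *\<^sub>R \<xi>)) \<le> (1 + C0) * (\<epsilon> powr (2 * s) * norm \<xi> powr (2 * s)) * exp (-\<tau>)"
      using C0 by (simp add: fourier_resc[OF J_props(4)[OF s] \<epsilon>(1)] mult_left_mono)
  qed
  also have "\<dots> = (1 + C0) * norm \<xi> powr (2 * s) * (\<epsilon> powr (- 2 * s) * \<epsilon> powr (2 * s))" by (simp only: mult_ac)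
  also have "\<epsilon> powr (- 2 * s) * \<epsilon> powr (2 * s) = 1" using \<epsilon> by (simp flip: powr_add)
  finally show ?thesis by simp
qed

lemma mom_pd_le:
  assumes s: "s \<in> {1/2<..<1}" and \<epsilon>: "0 < \<epsilon>" "\<epsilon> < 1" and t: "0 \<le> t" and \<theta>: "0 < \<theta>" "\<theta> \<le> 1" and p: "\<theta> < p" "p \<le> 2 * s"
  shows "finmom \<theta> (jump.pd (resc \<epsilon> (J s)) (\<epsilon> powr (- 2 * s)) t)"
    and "mom \<theta> (jump.pd (resc \<epsilon> (J s)) (\<epsilon> powr (- 2 * s)) t) \<le> DIM('a) * momc (1 + C0) p \<theta>"
proof -
  interpret jump "resc \<epsilon> (J s)" "\<epsilon> powr (- 2 * s)" by (rule jump_resc[OF s \<epsilon>(1)])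
  have "norm (A t \<xi>) \<le> (1 + C0) * norm \<xi> powr p" if x: "norm \<xi> \<le> 1" for \<xi>
  proof -
    have "norm \<xi> powr (2 * s) \<le> norm \<xi> powr p" using x p by (intro powr_mono') auto
    then show ?thesis using A_le_powr[OF s \<epsilon> t x] C0 mult_left_mono[of "norm \<xi> powr (2 * s)" "norm \<xi> powr p" "1 + C0"] by linarith
  qed
  then show "finmom \<theta> (pd t)" "mom \<theta> (pd t) \<le> DIM('a) * momc (1 + C0) p \<theta>"
    using mom_pd[OF t \<theta> p(1), of "1 + C0"] C0 by auto
qed

text \<open>By the expansion at the origin \<open>J s\<close> is not concentrated near the hyperplane orthogonal to \<open>\<omega>\<close>; the
  moment bound cuts off large jumps.\<close>
lemma direction_mass:
  obtains c M where "0 < c"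
    "\<And>s \<omega>. s \<in> {1/2<..<1} \<Longrightarrow> norm \<omega> = 1 \<Longrightarrow> c \<le> (\<integral>z. J s z * indicator {z. norm z \<le> M \<and> 1/2 \<le> \<bar>z \<bullet> \<omega>\<bar>} z \<partial>lborel)"
proof -
  obtain r0 where r0: "0 < r0" "r0 \<le> 1"
    "\<And>s \<xi>. s \<in> {1/2<..<1} \<Longrightarrow> norm \<xi> \<le> r0 \<Longrightarrow> 1/2 * norm \<xi> powr (2 * s) \<le> 1 - Re (fourier (J s) \<xi>)"
    by (rule one_minus_Re_fourier_ge) blast
  \<comment> \<open>The moment of order 1/2, taken with \<open>p = 1\<close>, is bounded uniformly
    in \<open>s\<close>. The choice of \<open>b\<close> makes \<open>2 / b * (Mc + 1)\<close> equal
    to \<open>r0\<^sup>2 / 8\<close>, and \<open>b\<^sup>2\<close> becomes the cut-off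
    radius.\<close>
  define Mc where "Mc = max 0 (DIM('a) * momc (1 + C0) 1 (1/2))"
  define b where "b = 16 * (Mc + 1) / r0\<^sup>2"
  have Mc0: "0 \<le> Mc" by (simp add: Mc_def)
  have b0: "0 < b" using Mc0 r0 by (simp add: b_def)
  have "r0\<^sup>2 / 8 \<le> (\<integral>z. J s z * indicator {z. norm z \<le> b\<^sup>2 \<and> 1/2 \<le> \<bar>z \<bullet> \<omega>\<bar>} z \<partial>lborel)"
    if s: "s \<in> {1/2<..<1}" and w: "norm \<omega> = 1" for s \<omega>
  proof -
    note Js = J_props[OF s]
    have [measurable]: "J s \<in> borel_measurable borel" by (rule Js)
    have mJ: "finmom (1/2) (J s)" "mom (1/2) (J s) \<le> Mc"
      using mom_J[OF s, of "1/2" 1] s by (auto simp: Mc_def)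
    let ?I = "\<lambda>z. indicator {z. norm z \<le> b\<^sup>2 \<and> 1/2 \<le> \<bar>z \<bullet> \<omega>\<bar>} z :: real"
    have iI: "integrable lborel (\<lambda>z. J s z * ?I z)"
      by (rule integrable_real_mult_indicator) (use Js in auto)
    \<comment> \<open>Near the hyperplane the quadratic bound on \<open>1 - cos\<close> applies; on
      the wanted set \<open>1 - cos\<close> is at most 2; beyond radius \<open>b\<^sup>2\<close> the
      moment term alone is at least 2.\<close>
    have ptw: "(1 - cos (z \<bullet> (r0 *\<^sub>R \<omega>))) * J s z \<le> r0\<^sup>2 / 8 * J s z + 2 * (J s z * ?I z) + 2 / b * (norm z powr (1/2) * \<bar>J s z\<bar>)" for z
    proof -
      have "1 - cos (z \<bullet> (r0 *\<^sub>R \<omega>)) \<le> r0\<^sup>2 / 8 + 2 * ?I z + 2 / b * norm z powr (1/2)"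
      proof (cases "\<bar>z \<bullet> \<omega>\<bar> < 1/2")
        case True
        have "\<bar>z \<bullet> \<omega>\<bar>\<^sup>2 \<le> (1/2)\<^sup>2" using True by (intro power_mono) auto
        then have "(r0 * (z \<bullet> \<omega>))\<^sup>2 / 2 \<le> r0\<^sup>2 / 8"
          using mult_left_mono[of "(z \<bullet> \<omega>)\<^sup>2" "1/4" "r0\<^sup>2"] by (simp add: power_mult_distrib power2_eq_square)
        then have "1 - cos (z \<bullet> (r0 *\<^sub>R \<omega>)) \<le> r0\<^sup>2 / 8" using one_minus_cos_le[of "z \<bullet> (r0 *\<^sub>R \<omega>)"] by simp
        moreover have "0 \<le> 2 * ?I z + 2 / b * norm z powr (1/2)" using b0 by simp
        ultimately show ?thesis by linarith
      next
        case False
        have c2: "1 - cos (z \<bullet> (r0 *\<^sub>R \<omega>)) \<le> 2" using cos_ge_minus_one[of "z \<bullet> (r0 *\<^sub>R \<omega>)"] by linarith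
        have nn: "0 \<le> r0\<^sup>2 / 8" "0 \<le> 2 / b * norm z powr (1/2)" using b0 by auto
        show ?thesis
        proof (cases "norm z \<le> b\<^sup>2")
          case True
          then have "?I z = 1" using False by simp
          then show ?thesis using c2 nn by linarith
        next
          case F2: False
          have "b = (b\<^sup>2) powr (1/2)" using b0 by (simp add: powr_half_sqrt)
          also have "\<dots> \<le> norm z powr (1/2)" using F2 by (intro powr_mono2) auto
          finally have "2 \<le> 2 / b * norm z powr (1/2)" using b0 by (simp add: field_simps)
          moreover have "0 \<le> ?I z" by simp
          ultimately show ?thesis using c2 nn by linarith
        qed
      qed
      from mult_right_mono[OF this Js(2)[of z]] show ?thesis using Js(2)[of z] by (simp add: algebra_simps)
    qed
    \<comment> \<open>The defect of mass is at least \<open>r0\<^sup>2 / 2\<close>. The slab around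
      the hyperplane and the tail account for at most \<open>r0\<^sup>2 / 8\<close> each, which
      leaves a mass of at least \<open>r0\<^sup>2 / 8\<close> for the wanted set.\<close>
    have "1/2 * r0\<^sup>2 \<le> 1/2 * r0 powr (2 * s)"
      using powr_mono'[of "2 * s" 2 r0] s r0 by simp
    also have "\<dots> \<le> 1 - Re (fourier (J s) (r0 *\<^sub>R \<omega>))" using r0(3)[OF s, of "r0 *\<^sub>R \<omega>"] r0 w by simp
    also have "\<dots> = (\<integral>z. (1 - cos (z \<bullet> (r0 *\<^sub>R \<omega>))) * J s z \<partial>lborel)"
      using fourier_mass_diff(2)[OF Js(1), of "r0 *\<^sub>R \<omega>"] Js(3) by simp
    also have "\<dots> \<le> (\<integral>z. r0\<^sup>2 / 8 * J s z + 2 * (J s z * ?I z) + 2 / b * (norm z powr (1/2) * \<bar>J s z\<bar>) \<partial>lborel)"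
      by (rule integral_mono[OF fourier_mass_diff(1)[OF Js(1)] _ ptw])
         (intro Bochner_Integration.integrable_add integrable_mult_right Js iI mJ)
    also have "\<dots> = r0\<^sup>2 / 8 + 2 * (\<integral>z. J s z * ?I z \<partial>lborel) + 2 / b * mom (1/2) (J s)"
      using Js iI mJ by (subst Bochner_Integration.integral_add Bochner_Integration.integral_add, simp, simp)+ simp
    finally have 1: "1/2 * r0\<^sup>2 \<le> r0\<^sup>2 / 8 + 2 * (\<integral>z. J s z * ?I z \<partial>lborel) + 2 / b * mom (1/2) (J s)" .
    have "2 / b * mom (1/2) (J s) \<le> 2 / b * (Mc + 1)" using mJ b0 by (intro mult_left_mono) auto
    also have "\<dots> = r0\<^sup>2 / 8" using Mc0 r0 by (simp add: b_def field_simps)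
    finally show ?thesis using 1 by linarith
  qed
  then show ?thesis using that[of "r0\<^sup>2/8" "b\<^sup>2"] r0 by simp
qed

text \<open>The ball of radius \<open>M\<close> is covered once and for all by finitely many balls
  of radius 1/8. For given \<open>s\<close> and \<open>\<omega>\<close> those that meet the set of
  \<open>direction_mass\<close> carry its mass, so one of them is heavy; its points are within 1/4
  of each other, so all keep distance 1/4 from the hyperplane.\<close>

lemma heavy_pieces:
  obtains c and X :: "'a set" where "0 < c" "finite X"
    "\<And>s \<omega>. s \<in> {1/2<..<1} \<Longrightarrow> norm \<omega> = 1 \<Longrightarrow>
       \<exists>x\<in>X. c \<le> (\<integral>z. J s z * indicator (ball x (1/8)) z \<partial>lborel) \<and> (\<forall>z\<in>ball x (1/8). 1/4 \<le> \<bar>z \<bullet> \<omega>\<bar>)"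
proof -
  obtain c M where c: "0 < c"
    "\<And>s \<omega>. s \<in> {1/2<..<1} \<Longrightarrow> norm \<omega> = 1 \<Longrightarrow> c \<le> (\<integral>z. J s z * indicator {z. norm z \<le> M \<and> 1/2 \<le> \<bar>z \<bullet> \<omega>\<bar>} z \<partial>lborel)"
    by (rule direction_mass) blast
  have "\<forall>e>0. \<exists>k. finite k \<and> cball 0 M \<subseteq> (\<Union>x\<in>k. ball (x::'a) e)"
    using compact_cball[of "0::'a" M] unfolding compact_eq_totally_bounded by blast
  from this[rule_format, of "1/8"] obtain X where X: "finite X" "cball 0 M \<subseteq> (\<Union>x\<in>X. ball (x::'a) (1/8))" by auto
  \<comment> \<open>The extra 1 in the denominator makes the pigeonhole estimate strict.\<close>
  define c' where "c' = c / (card X + 1)"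
  have c'0: "0 < c'" using c by (simp add: c'_def)
  have "\<exists>x\<in>X. c' \<le> (\<integral>z. J s z * indicator (ball x (1/8)) z \<partial>lborel) \<and> (\<forall>z\<in>ball x (1/8). 1/4 \<le> \<bar>z \<bullet> \<omega>\<bar>)"
    if s: "s \<in> {1/2<..<1}" and w: "norm \<omega> = 1" for s and \<omega> :: 'a
  proof (rule ccontr)
    assume no: "\<not> ?thesis"
    note Js = J_props[OF s]
    have [measurable]: "J s \<in> borel_measurable borel" by (rule Js)
    let ?G = "{z. norm z \<le> M \<and> 1/2 \<le> \<bar>z \<bullet> \<omega>\<bar>}"
    define X' where "X' = {x\<in>X. ball x (1/8) \<inter> ?G \<noteq> {}}"
    have X': "finite X'" "X' \<subseteq> X" using X by (auto simp: X'_def)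
    have ii: "integrable lborel (\<lambda>z. J s z * indicator S z)" if "S \<in> sets borel" for S
      by (rule integrable_real_mult_indicator) (use Js that in auto)
    have Gm: "?G \<in> sets borel" by measurable
    have far: "1/4 \<le> \<bar>z \<bullet> \<omega>\<bar>" if x: "x \<in> X'" and z: "z \<in> ball x (1/8)" for x z
    proof -
      obtain y where y: "y \<in> ball x (1/8)" "1/2 \<le> \<bar>y \<bullet> \<omega>\<bar>" using x by (auto simp: X'_def)
      have "dist y z \<le> dist y x + dist x z" by (rule dist_triangle)
      then have "norm (y - z) \<le> 1/4" using y z by (simp add: dist_norm norm_minus_commute dist_commute)
      then have "\<bar>(y - z) \<bullet> \<omega>\<bar> \<le> 1/4" using Cauchy_Schwarz_ineq2[of "y - z" \<omega>] w by simp
      then show ?thesis using y(2) unfolding inner_diff_left by linarith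
    qed
    have small: "(\<integral>z. J s z * indicator (ball x (1/8)) z \<partial>lborel) \<le> c'" if "x \<in> X'" for x
      using no far[OF that] that X'(2) by force
    have "c \<le> (\<integral>z. J s z * indicator ?G z \<partial>lborel)" by (rule c(2)[OF s w])
    also have "\<dots> \<le> (\<integral>z. (\<Sum>x\<in>X'. J s z * indicator (ball x (1/8)) z) \<partial>lborel)"
    proof (rule integral_mono)
      fix z
      show "J s z * indicator ?G z \<le> (\<Sum>x\<in>X'. J s z * indicator (ball x (1/8)) z)"
      proof (cases "z \<in> ?G")
        case True
        then obtain x where x: "x \<in> X" "z \<in> ball x (1/8)" using X(2) by auto
        then have "x \<in> X'" using True by (auto simp: X'_def)
        then have "J s z * indicator (ball x (1/8)) z \<le> (\<Sum>x\<in>X'. J s z * indicator (ball x (1/8)) z)"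
          using X' Js by (intro member_le_sum) auto
        then show ?thesis using x True by simp
      qed (use Js in \<open>auto intro: sum_nonneg\<close>)
    qed (use ii Gm in auto)
    also have "\<dots> = (\<Sum>x\<in>X'. \<integral>z. J s z * indicator (ball x (1/8)) z \<partial>lborel)"
      by (rule Bochner_Integration.integral_sum) (use ii in auto)
    also have "\<dots> \<le> (\<Sum>x\<in>X'. c')" by (rule sum_mono) (rule small)
    also have "\<dots> = card X' * c'" by simp
    also have "\<dots> \<le> card X * c'" using card_mono[OF X(1) X'(2)] c'0 by (intro mult_right_mono) auto
    also have "\<dots> < (card X + 1) * c'" using c'0 by simp
    also have "\<dots> = c" by (simp add: c'_def)
    finally show False by simp
  qed
  then show ?thesis using that[OF c'0 X(1)] by blast
qed

end

section \<open>Minorants of the Poisson law, uniform in \<open>s\<close> and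
  \<open>\<epsilon>\<close>\<close>

context kernel_family
begin

text \<open>One minorant has to serve all directions, so every ball that is heavy for this
  \<open>s\<close> enters, with multiplicity \<open>N\<close>. At a given frequency one of the
  factors decays and the others are at most 1. The two bounds on the transform are meant for
  frequencies below and above the order \<open>1 / \<epsilon>\<close>.\<close>

lemma minorant_fixed:
  fixes X :: "'a set" and N :: nat
  assumes c: "0 < c" and X: "finite X" and N: "1 \<le> N"
    and heavy: "\<And>s \<omega>. s \<in> {1/2<..<1} \<Longrightarrow> norm \<omega> = 1 \<Longrightarrow>
       \<exists>x\<in>X. c \<le> (\<integral>z. J s z * indicator (ball x (1/8)) z \<partial>lborel) \<and> (\<forall>z\<in>ball x (1/8). 1/4 \<le> \<bar>z \<bullet> \<omega>\<bar>)"
    and s: "s \<in> {1/2<..<1}" and \<epsilon>: "0 < \<epsilon>" "\<epsilon> < 1" and T: "1 \<le> T"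
  obtains H where "integrable lborel H" "\<And>x. 0 \<le> H x"
    "AE x in lborel. H x \<le> jump.pd (resc \<epsilon> (J s)) (\<epsilon> powr (- 2 * s)) T x"
    "exp (-1) / fact (N * card X) * (min 1 (c / card X)) ^ (N * card X) \<le> (\<integral>x. H x \<partial>lborel)"
    "\<And>\<xi>. norm (fourier H \<xi>) \<le> exp 2 * exp (- Re (jump.A (resc \<epsilon> (J s)) (\<epsilon> powr (- 2 * s)) T \<xi>))"
    "\<And>\<xi>. 16 * exp 1 \<le> \<epsilon> * norm \<xi> \<Longrightarrow> norm (fourier H \<xi>) \<le> exp 2 * exp (- (c / (2 * \<epsilon>))) * (8 * exp 1 / (\<epsilon> * norm \<xi>)) ^ N"
proof -
  interpret jump "resc \<epsilon> (J s)" "\<epsilon> powr (- 2 * s)" by (rule jump_resc[OF s \<epsilon>(1)])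
  note Js = J_props[OF s]
  have [measurable]: "J s \<in> borel_measurable borel" by (rule Js)
  have T0: "0 \<le> T" using T by simp
  \<comment> \<open>As \<open>2 * s > 1\<close> and \<open>\<epsilon> < 1\<close>, the rate is at
    least \<open>1 / \<epsilon>\<close>; this is the source of the factor
    \<open>exp (- (c / (2 * \<epsilon>)))\<close>.\<close>
  have a1: "1 / \<epsilon> \<le> \<epsilon> powr (- 2 * s)" "1 \<le> \<epsilon> powr (- 2 * s)"
  proof -
    have "1 / \<epsilon> = \<epsilon> powr (-1)" using \<epsilon> by (simp add: powr_minus_divide)
    also have "\<dots> \<le> \<epsilon> powr (- 2 * s)" using \<epsilon> s by (intro powr_mono') auto
    finally show "1 / \<epsilon> \<le> \<epsilon> powr (- 2 * s)" .
    then show "1 \<le> \<epsilon> powr (- 2 * s)" using \<epsilon> by (smt (verit) le_divide_eq_1_pos)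
  qed
  define P where "P = (\<lambda>x z. J s z * indicator (ball x (1/8)) z)"
  have P: "integrable lborel (P x)" "0 \<le> P x z" "P x z \<le> J s z" for x z
  proof -
    show "integrable lborel (P x)" unfolding P_def by (rule integrable_real_mult_indicator) (use Js in auto)
    show "0 \<le> P x z" "P x z \<le> J s z" unfolding P_def using Js(2)[of z] by (auto simp: indicator_def)
  qed
  have Pm[measurable]: "P x \<in> borel_measurable borel" for x using P(1)[of x] by auto
  define p where "p = (\<lambda>x. \<integral>z. P x z \<partial>lborel)"
  have p: "0 \<le> p x" "p x \<le> 1" for x
    using integral_mono[OF P(1) Js(1) P(3), of x] P(2)[of x] Js(3) by (auto simp: p_def)
  \<comment> \<open>The balls that are heavy for this \<open>s\<close>; by \<open>heavy\<close> each
    direction is served by one of them. \<open>Y\<close> varies with \<open>s\<close>, its superset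
    \<open>X\<close> does not.\<close>
  define Y where "Y = {x\<in>X. c \<le> p x}"
  have Y: "finite Y" "Y \<subseteq> X" using X by (auto simp: Y_def)
  obtain e :: 'a where "norm e = 1" using vector_choose_size[of 1] by auto
  with heavy[OF s] have "Y \<noteq> {}" by (auto simp: Y_def p_def P_def)
  then have cX: "1 \<le> card X" "card Y \<le> card X" using Y X card_mono[OF X Y(2)] by (auto simp: Suc_le_eq card_gt_0_iff)
  have rP: "integrable lborel (resc \<epsilon> (P x))" "\<And>y. 0 \<le> resc \<epsilon> (P x) y" "\<And>y. resc \<epsilon> (P x) y \<le> resc \<epsilon> (J s) y" for x
    using P \<epsilon> by (auto simp: resc_eq_dil intro!: dil_integrable dil_nonneg) (auto simp: dil_def intro!: mult_left_mono)
  have rPmass: "(\<integral>y. resc \<epsilon> (P x) y \<partial>lborel) = p x" for x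
    using \<epsilon> by (simp add: resc_eq_dil integral_dil_1 p_def)
  \<comment> \<open>Only the jumps of the last unit of time, whose dilations supply the oscillatory
    integral over \<open>{0..1}\<close>. The factor \<open>1 / card X\<close> keeps the total mass
    at most 1, as \<open>cpd_minorant\<close> asks.\<close>
  define g where "g = (\<lambda>x y. 1 / card X * smear 1 (resc \<epsilon> (P x)) y)"
  have g: "integrable lborel (g x)" "\<And>y. 0 \<le> g x y" "(\<integral>y. g x y \<partial>lborel) = p x / card X" for x
    unfolding g_def using smear_integrable[OF rP(1), of 1 x] smear_nonneg[OF rP(1) _ rP(2), of 1 x] smear_integral[OF rP(1), of 1 x] rPmass[of x] by auto
  have fg: "norm (fourier (g x) \<xi>) = 1 / card X * norm (integral {0..1} (\<lambda>\<tau>. fourier (P x) (exp (-\<tau>) *\<^sub>R \<epsilon> *\<^sub>R \<xi>)))" for x \<xi>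
    unfolding g_def fourier_cmult smear_fourier[OF rP(1), of 1 x, OF zero_le_one] fourier_resc[OF Pm \<epsilon>(1)] by (simp add: norm_mult norm_divide mult.commute)
  have "AE y in lborel. \<forall>x\<in>Y. smear 1 (resc \<epsilon> (P x)) y \<le> smear T (resc \<epsilon> (J s)) y"
    by (rule AE_finite_allI[OF Y(1)]) (rule smear_mono_AE[OF rP(1) j_int rP(2,3) _ T], simp)
  then have le: "AE y in lborel. (\<Sum>x\<in>Y. g x y) \<le> \<epsilon> powr (- 2 * s) * smear T (resc \<epsilon> (J s)) y"
  proof eventually_elim
    case (elim y)
    have s0: "0 \<le> smear T (resc \<epsilon> (J s)) y" by (rule smear_nonneg[OF j_int T0 j_nonneg])
    have "(\<Sum>x\<in>Y. g x y) \<le> (\<Sum>x\<in>Y. 1 / card X * smear T (resc \<epsilon> (J s)) y)"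
      unfolding g_def using elim by (intro sum_mono mult_left_mono) auto
    also have "\<dots> = (card Y / card X) * smear T (resc \<epsilon> (J s)) y" by simp
    also have "\<dots> \<le> \<epsilon> powr (- 2 * s) * smear T (resc \<epsilon> (J s)) y"
      using cX a1(2) s0 by (intro mult_right_mono) (auto simp: divide_le_eq_1 intro: order_trans[of _ 1])
    finally show ?case .
  qed
  have one: "(\<Sum>x\<in>Y. \<integral>y. g x y \<partial>lborel) \<le> 1"
  proof -
    have "(\<Sum>x\<in>Y. \<integral>y. g x y \<partial>lborel) \<le> (\<Sum>x\<in>Y. 1 / card X)" unfolding g(3) using p by (intro sum_mono divide_right_mono) auto
    also have "\<dots> \<le> 1" using cX by (simp add: divide_le_eq_1)
    finally show ?thesis .
  qed
  \<comment> \<open>Capped at 1 so that its powers decrease in the exponent: the mass bound with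
    \<open>card Y\<close> can then be weakened to one with \<open>card X\<close>, which is
    independent of \<open>s\<close>.\<close>
  define \<mu> where "\<mu> = min 1 (c / card X)"
  have \<mu>: "0 \<le> \<mu>" "\<mu> \<le> 1" "\<And>x. x \<in> Y \<Longrightarrow> \<mu> \<le> (\<integral>y. g x y \<partial>lborel)"
    unfolding g(3) \<mu>_def using c by (auto simp: Y_def intro!: min.coboundedI2 divide_right_mono)
  obtain H where H: "integrable lborel H" "\<And>x. 0 \<le> H x" "AE x in lborel. H x \<le> cpd (\<lambda>y. \<epsilon> powr (- 2 * s) * smear T (resc \<epsilon> (J s)) y) x"
     "exp (-1) / fact (N * card Y) * \<mu> ^ (N * card Y) \<le> (\<integral>x. H x \<partial>lborel)"
     "\<And>\<xi>. norm (fourier H \<xi>) \<le> exp 2 * exp (Re (fourier (\<lambda>y. \<epsilon> powr (- 2 * s) * smear T (resc \<epsilon> (J s)) y) \<xi>)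
        - (\<integral>y. \<epsilon> powr (- 2 * s) * smear T (resc \<epsilon> (J s)) y \<partial>lborel)) * (\<Prod>i\<in>Y. norm (fourier (g i) \<xi>)) ^ N"
    using cpd_minorant[OF K_int[OF T0] K_nonneg[OF T0] Y(1) \<open>Y \<noteq> {}\<close> g(1,2) le \<mu>(1,3) one N] by blast
  have fH: "norm (fourier H \<xi>) \<le> exp 2 * exp (- Re (A T \<xi>)) * (\<Prod>i\<in>Y. norm (fourier (g i) \<xi>)) ^ N" for \<xi>
    using H(5)[of \<xi>] unfolding K_fourier[OF T0] K_mass[OF T0] by simp
  have fg1: "norm (fourier (g x) \<xi>) \<le> 1" for x \<xi>
  proof -
    have "norm (fourier (g x) \<xi>) \<le> p x / card X" using fourier_norm_le[of "g x" \<xi>] g(2,3)[of x] by simp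
    also have "\<dots> \<le> 1" using p[of x] cX by (simp add: divide_le_eq)
    finally show ?thesis .
  qed
  have prod_le: "(\<Prod>i\<in>Y. norm (fourier (g i) \<xi>)) \<le> norm (fourier (g x) \<xi>)" if "x \<in> Y" for x \<xi>
  proof -
    have "(\<Prod>i\<in>Y - {x}. norm (fourier (g i) \<xi>)) \<le> 1" using fg1 by (intro prod_le_1) auto
    then show ?thesis unfolding prod.remove[OF Y(1) that] by (rule mult_left_le) simp
  qed
  show ?thesis
  proof (rule that[of H])
    show "integrable lborel H" "0 \<le> H x" for x by (fact H)+
    show "AE x in lborel. H x \<le> pd T x" unfolding pd_def by (rule H(3))
    have "exp (-1) / fact (N * card X) * \<mu> ^ (N * card X) \<le> exp (-1) / fact (N * card Y) * \<mu> ^ (N * card Y)"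
      using cX \<mu> by (intro mult_mono divide_left_mono fact_mono power_decreasing) auto
    then show "exp (-1) / fact (N * card X) * (min 1 (c / card X)) ^ (N * card X) \<le> (\<integral>x. H x \<partial>lborel)"
      using H(4) unfolding \<mu>_def by linarith
    show "norm (fourier H \<xi>) \<le> exp 2 * exp (- Re (A T \<xi>))" for \<xi>
    proof -
      have "(\<Prod>i\<in>Y. norm (fourier (g i) \<xi>)) \<le> 1" using fg1 by (intro prod_le_1) auto
      then have "(\<Prod>i\<in>Y. norm (fourier (g i) \<xi>)) ^ N \<le> 1" by (intro power_le_one prod_nonneg) auto
      then show ?thesis by (intro order_trans[OF fH mult_left_le]) auto
    qed
    show "norm (fourier H \<xi>) \<le> exp 2 * exp (- (c / (2 * \<epsilon>))) * (8 * exp 1 / (\<epsilon> * norm \<xi>)) ^ N"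
      if big: "16 * exp 1 \<le> \<epsilon> * norm \<xi>" for \<xi>
    proof -
      have "0 < 16 * exp (1::real)" by simp
      with big have ex0: "0 < \<epsilon> * norm \<xi>" by linarith
      then have x0: "0 < norm \<xi>" using \<epsilon> by (simp add: zero_less_mult_iff)
      define \<omega> where "\<omega> = (1 / norm \<xi>) *\<^sub>R \<xi>"
      have "norm \<omega> = 1" using x0 by (simp add: \<omega>_def)
      then obtain x where x: "x \<in> X" "c \<le> p x" "\<And>z. z \<in> ball x (1/8) \<Longrightarrow> 1/4 \<le> \<bar>z \<bullet> \<omega>\<bar>"
        using heavy[OF s, of \<omega>] unfolding p_def P_def by blast
      have xY: "x \<in> Y" using x by (simp add: Y_def)
      have far: "\<epsilon> * norm \<xi> / 4 \<le> \<bar>z \<bullet> (\<epsilon> *\<^sub>R \<xi>)\<bar>" if "P x z \<noteq> 0" for z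
      proof -
        have "z \<in> ball x (1/8)" by (rule ccontr) (use that in \<open>simp add: P_def del: mem_ball\<close>)
        then have "1/4 * (\<epsilon> * norm \<xi>) \<le> \<bar>z \<bullet> \<omega>\<bar> * (\<epsilon> * norm \<xi>)" using x(3) ex0 by (intro mult_right_mono) auto
        also have "\<dots> = \<bar>z \<bullet> (\<epsilon> *\<^sub>R \<xi>)\<bar>" using \<epsilon> x0 by (simp add: \<omega>_def abs_mult)
        finally show ?thesis by simp
      qed
      have osc: "norm (integral {0..1} (\<lambda>\<tau>. fourier (P x) (exp (-\<tau>) *\<^sub>R \<epsilon> *\<^sub>R \<xi>))) \<le> 8 * exp 1 / (\<epsilon> * norm \<xi>) * p x"
        using osc_fourier[OF P(1,2) _ far] ex0 by (simp add: p_def)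
      \<comment> \<open>This is what the threshold \<open>16 * exp 1\<close> is for: oscillation
        cancels at most half of the mass \<open>p x\<close> in the real part of the
        exponent.\<close>
      have "8 * exp 1 / (\<epsilon> * norm \<xi>) \<le> 1/2" using big ex0 by (simp add: divide_le_eq)
      then have osc2: "norm (integral {0..1} (\<lambda>\<tau>. fourier (P x) (exp (-\<tau>) *\<^sub>R \<epsilon> *\<^sub>R \<xi>))) \<le> 1/2 * p x"
        using mult_right_mono[OF _ p(1)[of x]] osc order_trans by blast
      have ReA: "c / (2 * \<epsilon>) \<le> Re (A T \<xi>)"
      proof -
        let ?f = "\<lambda>\<tau>. 1 - Re (fourier (resc \<epsilon> (J s)) (exp (-\<tau>) *\<^sub>R \<xi>))"
        let ?h = "\<lambda>\<tau>. fourier (P x) (exp (-\<tau>) *\<^sub>R \<epsilon> *\<^sub>R \<xi>)"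
        have i: "?f integrable_on {u..v}" for u v
          by (intro integrable_continuous_interval continuous_intros continuous_on_compose2[OF fourier_continuous[OF j_int, of UNIV]]) auto
        have ih: "?h integrable_on {0..1}" by (rule integrable_continuous_interval[OF fourier_dil_continuous[OF P(1) order_refl]])
        have ihR: "(\<lambda>\<tau>. Re (?h \<tau>)) integrable_on {0..1}" using integrable_linear[OF ih bounded_linear_Re] by (simp add: o_def)
        \<comment> \<open>As \<open>1 - cos\<close> is nonnegative, the piece \<open>P x\<close>
          alone bounds the integrand of the exponent from below.\<close>
        have hle: "p x - Re (?h \<tau>) \<le> ?f \<tau>" for \<tau>
        proof -
          have "p x - Re (?h \<tau>) = (\<integral>z. (1 - cos (z \<bullet> (exp (-\<tau>) *\<^sub>R \<epsilon> *\<^sub>R \<xi>))) * P x z \<partial>lborel)"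
            unfolding fourier_mass_diff(2)[OF P(1)] p_def ..
          also have "\<dots> \<le> (\<integral>z. (1 - cos (z \<bullet> (exp (-\<tau>) *\<^sub>R \<epsilon> *\<^sub>R \<xi>))) * J s z \<partial>lborel)"
            by (intro integral_mono fourier_mass_diff(1) P(1) Js(1) mult_left_mono P(3)) auto
          also have "\<dots> = 1 - Re (fourier (J s) (exp (-\<tau>) *\<^sub>R \<epsilon> *\<^sub>R \<xi>))"
            unfolding fourier_mass_diff(2)[OF Js(1)] Js(3) ..
          finally show ?thesis unfolding fourier_resc[OF Js(4) \<epsilon>(1)] scaleR_left_commute[of \<epsilon>] .
        qed
        have "p x / 2 \<le> p x - norm (integral {0..1} ?h)" using osc2 by simp
        also have "\<dots> \<le> p x - Re (integral {0..1} ?h)" using complex_Re_le_cmod[of "integral {0..1} ?h"] by simp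
        also have "\<dots> = integral {0..1} (\<lambda>\<tau>. p x - Re (?h \<tau>))"
          using integral_linear[OF ih bounded_linear_Re] ihR
          by (subst Henstock_Kurzweil_Integration.integral_diff) (auto simp: o_def)
        also have "\<dots> \<le> integral {0..1} ?f" by (rule integral_le[OF _ i]) (use ihR hle in \<open>auto intro!: integrable_diff\<close>)
        also have "\<dots> \<le> integral {0..T} ?f" by (rule integral_subset_le[OF _ i i]) (use T one_minus_Re_fourier_nonneg in auto)
        finally have "c / 2 \<le> integral {0..T} ?f" using x(2) by simp
        then have "1 / \<epsilon> * (c / 2) \<le> \<epsilon> powr (- 2 * s) * integral {0..T} ?f" using a1(1) c \<epsilon> by (intro mult_mono) auto
        then show ?thesis unfolding Re_A_eq by simp
      qed
      have gx: "norm (fourier (g x) \<xi>) \<le> 8 * exp 1 / (\<epsilon> * norm \<xi>)"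
      proof -
        have "norm (fourier (g x) \<xi>) \<le> 1 * (8 * exp 1 / (\<epsilon> * norm \<xi>) * p x)"
          unfolding fg using osc cX by (intro mult_mono) auto
        also have "\<dots> \<le> 8 * exp 1 / (\<epsilon> * norm \<xi>)" using p[of x] ex0 by (simp add: divide_right_mono mult_left_le)
        finally show ?thesis .
      qed
      have "(\<Prod>i\<in>Y. norm (fourier (g i) \<xi>)) ^ N \<le> (8 * exp 1 / (\<epsilon> * norm \<xi>)) ^ N"
        by (rule power_mono[OF order_trans[OF prod_le[OF xY] gx]]) (auto intro: prod_nonneg)
      moreover have "exp 2 * exp (- Re (A T \<xi>)) \<le> exp 2 * exp (- (c / (2 * \<epsilon>)))" using ReA by simp
      ultimately have "exp 2 * exp (- Re (A T \<xi>)) * (\<Prod>i\<in>Y. norm (fourier (g i) \<xi>)) ^ N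
        \<le> exp 2 * exp (- (c / (2 * \<epsilon>))) * (8 * exp 1 / (\<epsilon> * norm \<xi>)) ^ N"
        by (intro mult_mono) (auto intro!: prod_nonneg zero_le_power)
      then show ?thesis using fH[of \<xi>] by linarith
    qed
  qed
qed

text \<open>The expansion controls the integrand only while the rescaled frequency is within
  \<open>r0\<close>. Going back in time shrinks it, and the condition on \<open>T\<close> leaves
  room for a unit window after it has entered that ball. If it is there from the start, the rate
  times its power is \<open>norm \<xi> powr (2 * s)\<close>; otherwise the rate, at least
  \<open>1 / \<epsilon> \<ge> norm \<xi> / R\<close>, does the work. Either way the growth is
  linear.\<close>

lemma Re_A_window:
  assumes r0: "0 < r0" "r0 \<le> 1" "\<And>s \<xi>. s \<in> {1/2<..<1} \<Longrightarrow> norm \<xi> \<le> r0 \<Longrightarrow> 1/2 * norm \<xi> powr (2 * s) \<le> 1 - Re (fourier (J s) \<xi>)"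
    and s: "s \<in> {1/2<..<1}" and \<epsilon>: "0 < \<epsilon>" "\<epsilon> < 1" and R: "1 \<le> R" and T: "1 + ln (R / r0) \<le> T"
    and x: "1 \<le> norm \<xi>" "\<epsilon> * norm \<xi> \<le> R"
  shows "1/2 * exp (-2) * (r0\<^sup>2 / R) * norm \<xi> \<le> Re (jump.A (resc \<epsilon> (J s)) (\<epsilon> powr (- 2 * s)) T \<xi>)"
proof -
  interpret jump "resc \<epsilon> (J s)" "\<epsilon> powr (- 2 * s)" by (rule jump_resc[OF s \<epsilon>(1)])
  define y where "y = \<epsilon> * norm \<xi>"
  have x0: "0 < norm \<xi>" using x by linarith
  have y: "0 < y" "y \<le> R" using x mult_pos_pos[OF \<epsilon>(1) x0] by (simp_all add: y_def)
  define m where "m = min y r0"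
  have m: "0 < m" "m \<le> r0" using y r0 by (auto simp: m_def)
  \<comment> \<open>The time at which the rescaled frequency
    \<open>\<epsilon> * exp (- b) * norm \<xi>\<close> has entered the ball of radius
    \<open>r0\<close>; it then equals \<open>m\<close>.\<close>
  define b where "b = max 0 (ln (y / r0))"
  have "ln (y / r0) \<le> ln (R / r0)" using y r0 by (simp add: divide_right_mono)
  moreover have "0 \<le> ln (R / r0)" using R r0 by simp
  ultimately have b: "0 \<le> b" "b + 1 \<le> T" using T by (auto simp: b_def)
  have eb: "exp (- b) * y = m"
  proof (cases "y \<le> r0")
    case True
    then have "ln (y / r0) \<le> 0" using y r0 by simp
    then show ?thesis using True by (simp add: b_def m_def)
  next
    case False
    then have "0 \<le> ln (y / r0)" using y r0 by simp
    then have "exp (- b) = r0 / y" using y r0 by (simp add: b_def exp_minus)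
    then show ?thesis using False y by (simp add: m_def)
  qed
  \<comment> \<open>During the unit window the frequency shrinks by at most the factor
    \<open>exp 1\<close>, so its power \<open>2 * s \<le> 2\<close> shrinks by at most
    \<open>exp 2\<close>.\<close>
  define q where "q = 1/2 * (exp (-2) * m powr (2 * s))"
  have "q \<le> 1 - Re (fourier (resc \<epsilon> (J s)) (exp (-\<tau>) *\<^sub>R \<xi>))" if \<tau>: "\<tau> \<in> {b..b+1}" for \<tau>
  proof -
    have n: "norm (\<epsilon> *\<^sub>R exp (-\<tau>) *\<^sub>R \<xi>) = m * exp (- (\<tau> - b))"
    proof -
      have "norm (\<epsilon> *\<^sub>R exp (-\<tau>) *\<^sub>R \<xi>) = exp (-\<tau>) * y" using \<epsilon> by (simp add: y_def)
      also have "\<dots> = exp (- (\<tau> - b)) * (exp (- b) * y)" by (simp add: exp_add[symmetric] flip: mult.assoc)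
      finally show ?thesis unfolding eb by (simp only: mult.commute)
    qed
    have "m * exp (- (\<tau> - b)) \<le> m * 1" using \<tau> m by (intro mult_left_mono) auto
    then have "norm (\<epsilon> *\<^sub>R exp (-\<tau>) *\<^sub>R \<xi>) \<le> r0" unfolding n using m by linarith
    from r0(3)[OF s this] have "1/2 * (m * exp (- (\<tau> - b))) powr (2 * s) \<le> 1 - Re (fourier (resc \<epsilon> (J s)) (exp (-\<tau>) *\<^sub>R \<xi>))"
      unfolding n fourier_resc[OF J_props(4)[OF s] \<epsilon>(1)] .
    moreover have "exp (-2) * m powr (2 * s) \<le> (m * exp (- (\<tau> - b))) powr (2 * s)"
    proof -
      have "exp (-2) \<le> exp (- (\<tau> - b) * (2 * s))"
      proof -
        have "(\<tau> - b) * (2 * s) \<le> 1 * 2" using \<tau> s by (intro mult_mono) auto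
        then show ?thesis by (simp only: exp_le_cancel_iff mult_minus_left neg_le_iff_le mult_1)
      qed
      then have "m powr (2 * s) * exp (-2) \<le> m powr (2 * s) * exp (- (\<tau> - b) * (2 * s))" by (rule mult_left_mono) simp
      then show ?thesis using m by (simp add: powr_mult exp_powr_real mult.commute)
    qed
    ultimately show ?thesis unfolding q_def by linarith
  qed
  then have "\<epsilon> powr (- 2 * s) * ((b + 1 - b) * q) \<le> Re (A T \<xi>)" using b by (intro Re_A_ge) auto
  then have A: "\<epsilon> powr (- 2 * s) * q \<le> Re (A T \<xi>)" by simp
  have a1: "1 / \<epsilon> \<le> \<epsilon> powr (- 2 * s)"
  proof -
    have "1 / \<epsilon> = \<epsilon> powr (-1)" using \<epsilon> by (simp add: powr_minus_divide)
    also have "\<dots> \<le> \<epsilon> powr (- 2 * s)" using \<epsilon> s by (intro powr_mono') auto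
    finally show ?thesis .
  qed
  have "r0\<^sup>2 / R * norm \<xi> \<le> \<epsilon> powr (- 2 * s) * m powr (2 * s)"
  proof (cases "y \<le> r0")
    case True
    then have "\<epsilon> powr (- 2 * s) * m powr (2 * s) = \<epsilon> powr (- 2 * s) * \<epsilon> powr (2 * s) * norm \<xi> powr (2 * s)"
      using \<epsilon> by (simp add: m_def y_def powr_mult)
    also have "\<dots> = norm \<xi> powr (2 * s)" using \<epsilon> by (simp flip: powr_add)
    also have "\<dots> \<ge> norm \<xi> powr 1" using x s by (intro powr_mono) auto
    finally have "norm \<xi> \<le> \<epsilon> powr (- 2 * s) * m powr (2 * s)" using x by simp
    moreover have "r0\<^sup>2 / R \<le> 1" using r0 R by (simp add: divide_le_eq power_le_one order_trans[of _ 1])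
    ultimately show ?thesis using x mult_right_mono[of "r0\<^sup>2 / R" 1 "norm \<xi>"] by simp
  next
    case False
    have "r0\<^sup>2 = r0 powr 2" using r0 by simp
    also have "\<dots> \<le> r0 powr (2 * s)" using r0 s by (intro powr_mono') auto
    finally have "1 / \<epsilon> * r0\<^sup>2 \<le> \<epsilon> powr (- 2 * s) * m powr (2 * s)" using False a1 \<epsilon> by (intro mult_mono) (auto simp: m_def)
    moreover have "norm \<xi> / R \<le> 1 / \<epsilon>" using x \<epsilon> R by (simp add: field_simps)
    then have "norm \<xi> / R * r0\<^sup>2 \<le> 1 / \<epsilon> * r0\<^sup>2" by (rule mult_right_mono) simp
    ultimately show ?thesis by (simp add: mult.commute)
  qed
  then have "1/2 * exp (-2) * (r0\<^sup>2 / R * norm \<xi>) \<le> 1/2 * exp (-2) * (\<epsilon> powr (- 2 * s) * m powr (2 * s))"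
    by (rule mult_left_mono) simp
  also have "\<dots> = \<epsilon> powr (- 2 * s) * q" by (simp add: q_def)
  also note A
  finally show ?thesis by (simp only: mult.assoc)
qed

text \<open>While \<open>\<epsilon> * norm \<xi> \<le> R\<close>, the linear growth of the exponent
  beats every power. Above that, \<open>(8 * exp 1 / (\<epsilon> * norm \<xi>)) ^ N'\<close>
  supplies the power of \<open>norm \<xi>\<close>, and its \<open>(1 / \<epsilon>) ^ N'\<close> is
  absorbed by \<open>exp (- (c / (2 * \<epsilon>)))\<close>. All constants are fixed before
  \<open>s\<close> and \<open>\<epsilon>\<close>.\<close>

theorem minorant:
  obtains c0 C T0 :: real where "0 < c0" "0 \<le> C" "1 \<le> T0"
    "\<And>s \<epsilon> T. s \<in> {1/2<..<1} \<Longrightarrow> 0 < \<epsilon> \<Longrightarrow> \<epsilon> < 1 \<Longrightarrow> T0 \<le> T \<Longrightarrow>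
      \<exists>H. integrable lborel H \<and> (\<forall>x. 0 \<le> H x) \<and> (AE x in lborel. H x \<le> jump.pd (resc \<epsilon> (J s)) (\<epsilon> powr (- 2 * s)) T x) \<and>
        c0 \<le> (\<integral>x. H x \<partial>lborel) \<and> (\<forall>\<xi>. 1 \<le> norm \<xi> \<longrightarrow> norm (fourier H \<xi>) * norm \<xi> ^ N \<le> C)"
proof -
  \<comment> \<open>\<open>minorant_fixed\<close> wants a positive exponent, while \<open>N\<close>
    may be 0.\<close>
  define N' where "N' = Suc N"
  obtain r0 where r0: "0 < r0" "r0 \<le> 1"
    "\<And>s \<xi>. s \<in> {1/2<..<1} \<Longrightarrow> norm \<xi> \<le> r0 \<Longrightarrow> 1/2 * norm \<xi> powr (2 * s) \<le> 1 - Re (fourier (J s) \<xi>)"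
    by (rule one_minus_Re_fourier_ge) blast
  obtain c and X :: "'a set" where c: "0 < c" and X: "finite X"
    and heavy: "\<And>s \<omega>. s \<in> {1/2<..<1} \<Longrightarrow> norm \<omega> = 1 \<Longrightarrow>
       \<exists>x\<in>X. c \<le> (\<integral>z. J s z * indicator (ball x (1/8)) z \<partial>lborel) \<and> (\<forall>z\<in>ball x (1/8). 1/4 \<le> \<bar>z \<bullet> \<omega>\<bar>)"
    by (rule heavy_pieces) blast
  have X1: "1 \<le> card X"
  proof -
    obtain e :: 'a where "norm e = 1" using vector_choose_size[of 1] by auto
    with heavy[of "3/4" e] have "X \<noteq> {}" by auto
    then show ?thesis using X by (simp add: Suc_le_eq card_gt_0_iff)
  qed
  define R where "R = 16 * exp (1::real)"
  have R: "1 \<le> R" using exp_ge_add_one_self[of 1] by (simp add: R_def)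
  define T0 where "T0 = 1 + ln (R / r0)"
  have T0: "1 \<le> T0" using R r0 by (simp add: T0_def)
  define c0 where "c0 = exp (-1) / fact (N' * card X) * (min 1 (c / card X)) ^ (N' * card X)"
  have c0: "0 < c0" using c X1 by (simp add: c0_def)
  define c1 where "c1 = 1/2 * exp (-2) * (r0\<^sup>2 / R)"
  have c1: "0 < c1" using r0 R by (simp add: c1_def)
  \<comment> \<open>One summand for each frequency range, both obtained from
    \<open>exp (- x) * x ^ N' \<le> fact N'\<close>.\<close>
  define C where "C = exp 2 * (fact N' / c1 ^ N' + (8 * exp 1) ^ N' * (fact N' * (2 / c) ^ N'))"
  have C0: "0 \<le> C" using c1 c by (simp add: C_def)
  have "\<exists>H. integrable lborel H \<and> (\<forall>x. 0 \<le> H x) \<and> (AE x in lborel. H x \<le> jump.pd (resc \<epsilon> (J s)) (\<epsilon> powr (- 2 * s)) T x) \<and>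
        c0 \<le> (\<integral>x. H x \<partial>lborel) \<and> (\<forall>\<xi>. 1 \<le> norm \<xi> \<longrightarrow> norm (fourier H \<xi>) * norm \<xi> ^ N \<le> C)"
    if s: "s \<in> {1/2<..<1}" and \<epsilon>: "0 < \<epsilon>" "\<epsilon> < 1" and T: "T0 \<le> T" for s \<epsilon> T
  proof -
    have "1 \<le> N'" "1 \<le> T" using T T0 by (auto simp: N'_def)
    from minorant_fixed[OF c X this(1) heavy s \<epsilon> this(2)]
    obtain H where H: "integrable lborel H" "\<And>x. 0 \<le> H x"
      "AE x in lborel. H x \<le> jump.pd (resc \<epsilon> (J s)) (\<epsilon> powr (- 2 * s)) T x" "c0 \<le> (\<integral>x. H x \<partial>lborel)"
      "\<And>\<xi>. norm (fourier H \<xi>) \<le> exp 2 * exp (- Re (jump.A (resc \<epsilon> (J s)) (\<epsilon> powr (- 2 * s)) T \<xi>))"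
      "\<And>\<xi>. 16 * exp 1 \<le> \<epsilon> * norm \<xi> \<Longrightarrow> norm (fourier H \<xi>) \<le> exp 2 * exp (- (c / (2 * \<epsilon>))) * (8 * exp 1 / (\<epsilon> * norm \<xi>)) ^ N'"
      unfolding c0_def by blast
    have "norm (fourier H \<xi>) * norm \<xi> ^ N \<le> C" if x: "1 \<le> norm \<xi>" for \<xi>
    proof -
      have "norm (fourier H \<xi>) * norm \<xi> ^ N' \<le> C"
      proof (cases "\<epsilon> * norm \<xi> \<le> R")
        case True
        have "norm (fourier H \<xi>) \<le> exp 2 * exp (- (c1 * norm \<xi>))"
          using H(5)[of \<xi>] Re_A_window[OF r0 s \<epsilon> R _ x True, of T] T unfolding T0_def c1_def
          by (intro order_trans[OF H(5)]) auto
        then have "norm (fourier H \<xi>) * norm \<xi> ^ N' \<le> exp 2 * exp (- (c1 * norm \<xi>)) * norm \<xi> ^ N'"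
          by (rule mult_right_mono) simp
        also have "\<dots> = exp 2 * (exp (- (c1 * norm \<xi>)) * (c1 * norm \<xi>) ^ N') / c1 ^ N'"
          using c1 by (simp add: power_mult_distrib)
        also have "\<dots> \<le> exp 2 * fact N' / c1 ^ N'"
          using power_exp_minus_le[of "c1 * norm \<xi>" N'] c1 by (intro divide_right_mono mult_left_mono) auto
        also have "\<dots> \<le> C" unfolding C_def using c by (simp add: distrib_left)
        finally show ?thesis .
      next
        case False
        then have big: "16 * exp 1 \<le> \<epsilon> * norm \<xi>" by (simp add: R_def)
        have "norm (fourier H \<xi>) * norm \<xi> ^ N' \<le> exp 2 * exp (- (c / (2 * \<epsilon>))) * (8 * exp 1 / (\<epsilon> * norm \<xi>)) ^ N' * norm \<xi> ^ N'"
          by (rule mult_right_mono[OF H(6)[OF big]]) simp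
        also have "\<dots> = exp 2 * ((8 * exp 1) ^ N' * (exp (- (c / (2 * \<epsilon>))) * (c / (2 * \<epsilon>)) ^ N' * (2 / c) ^ N'))"
        proof -
          have n0: "norm \<xi> \<noteq> 0" using x by linarith
          have "8 * exp 1 / (\<epsilon> * norm \<xi>) * norm \<xi> = 8 * exp 1 * (1 / \<epsilon>)"
            using n0 by simp
          then have "(8 * exp 1 / (\<epsilon> * norm \<xi>)) ^ N' * norm \<xi> ^ N' = (8 * exp 1) ^ N' * (1 / \<epsilon>) ^ N'"
            by (simp only: power_mult_distrib[symmetric])
          moreover have "(c / (2 * \<epsilon>)) ^ N' * (2 / c) ^ N' = (1 / \<epsilon>) ^ N'"
          proof -
            have "c / (2 * \<epsilon>) * (2 / c) = 1 / \<epsilon>" using c by simp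
            then show ?thesis by (simp only: power_mult_distrib[symmetric])
          qed
          ultimately show ?thesis by (simp add: mult.assoc)
        qed
        also have "\<dots> \<le> exp 2 * ((8 * exp 1) ^ N' * (fact N' * (2 / c) ^ N'))"
          using power_exp_minus_le[of "c / (2 * \<epsilon>)" N'] c \<epsilon> by (intro mult_left_mono mult_right_mono) auto
        also have "\<dots> \<le> C" unfolding C_def using c1 by (simp add: distrib_left)
        finally show ?thesis .
      qed
      moreover have "norm (fourier H \<xi>) * norm \<xi> ^ N \<le> norm (fourier H \<xi>) * norm \<xi> ^ N'"
        using x by (intro mult_left_mono power_increasing) (auto simp: N'_def)
      ultimately show ?thesis by linarith
    qed
    then show ?thesis using H by blast
  qed
  then show ?thesis using that[OF c0 C0 T0] by blast
qed

end

section \<open>Decay of mean-zero data\<close>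

text \<open>A tensor product, so that its integrability reduces to one dimension; by
  \<open>bump_weight_ge\<close> it dominates the radial power needed for the transforms.\<close>

definition bump_weight :: "'a::euclidean_space \<Rightarrow> real" where
  "bump_weight \<xi> = (\<Prod>b\<in>Basis. inverse (1 + (\<xi> \<bullet> b)\<^sup>2))"

lemma bump_weight_integrable: "integrable lborel (bump_weight :: 'a::euclidean_space \<Rightarrow> real)"
proof -
  have "einterval (-\<infinity>) \<infinity> = UNIV" by (auto simp: einterval_def)
  then have "integrable lborel (\<lambda>x::real. inverse (1 + x\<^sup>2))"
    using integrable_inverse_1_plus_square by (simp add: set_integrable_def)
  then show ?thesis unfolding bump_weight_def[abs_def] by (rule lborel_prod_integral(1))
qed

lemma bump_weight_ge:
  fixes \<xi> :: "'a::euclidean_space"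
  shows "inverse ((1 + (norm \<xi>)\<^sup>2) ^ DIM('a)) \<le> bump_weight \<xi>"
proof -
  have p: "0 < 1 + r\<^sup>2" for r :: real by (rule add_pos_nonneg) auto
  have "(\<Prod>b\<in>Basis. 1 + (\<xi> \<bullet> b)\<^sup>2) \<le> (\<Prod>b\<in>(Basis::'a set). 1 + (norm \<xi>)\<^sup>2)"
  proof (rule prod_mono)
    fix b :: 'a assume "b \<in> Basis"
    then have "\<bar>\<xi> \<bullet> b\<bar>\<^sup>2 \<le> (norm \<xi>)\<^sup>2" by (intro power_mono Basis_le_norm) auto
    then show "0 \<le> 1 + (\<xi> \<bullet> b)\<^sup>2 \<and> 1 + (\<xi> \<bullet> b)\<^sup>2 \<le> 1 + (norm \<xi>)\<^sup>2" by simp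
  qed
  moreover have "0 < (\<Prod>b\<in>Basis. 1 + (\<xi> \<bullet> b)\<^sup>2)" by (rule prod_pos) (rule p)
  moreover have "bump_weight \<xi> = inverse (\<Prod>b\<in>Basis. 1 + (\<xi> \<bullet> b)\<^sup>2)"
    unfolding bump_weight_def by (rule prod_inversef[unfolded o_def])
  ultimately show ?thesis by (simp add: le_imp_inverse_le)
qed

lemma fourier_translate_diff:
  fixes H :: "'a::euclidean_space \<Rightarrow> real"
  assumes H: "integrable lborel H"
  shows "norm (fourier (\<lambda>x. H (x - h) - H x) \<xi>) \<le> norm h * (norm (fourier H \<xi>) * norm \<xi>)"
proof -
  have [measurable]: "H \<in> borel_measurable borel" using H by auto
  have "fourier (\<lambda>x. H (x - h)) \<xi> = (\<integral>x. cis (- (h \<bullet> \<xi>)) * (cis (- ((x - h) \<bullet> \<xi>)) * complex_of_real (H (x - h))) \<partial>lborel)"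
    unfolding fourier_def by (intro Bochner_Integration.integral_cong refl) (simp add: cis_mult inner_diff_left flip: mult.assoc)
  also have "\<dots> = cis (- (h \<bullet> \<xi>)) * (\<integral>x. cis (- ((x - h) \<bullet> \<xi>)) * complex_of_real (H (x - h)) \<partial>lborel)"
    by (rule integral_mult_right_zero)
  also have "(\<integral>x. cis (- ((x - h) \<bullet> \<xi>)) * complex_of_real (H (x - h)) \<partial>lborel) = fourier H \<xi>"
    unfolding fourier_def by (rule lborel_integral_shift[of "\<lambda>x. cis (- (x \<bullet> \<xi>)) * complex_of_real (H x)"]) simp
  finally have "fourier (\<lambda>x. H (x - h) - H x) \<xi> = (cis (- (h \<bullet> \<xi>)) - 1) * fourier H \<xi>"
    by (simp add: fourier_diff[OF lborel_integrable_shift[OF H] H] left_diff_distrib)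
  moreover have "norm (cis (- (h \<bullet> \<xi>)) - 1) \<le> \<bar>h \<bullet> \<xi>\<bar>"
    using iexp_approx1[of "- (h \<bullet> \<xi>)" 0] by (simp add: cis_conv_exp)
  moreover have "\<bar>h \<bullet> \<xi>\<bar> \<le> norm h * norm \<xi>" by (rule Cauchy_Schwarz_ineq2)
  ultimately have "norm (fourier (\<lambda>x. H (x - h) - H x) \<xi>) \<le> norm h * norm \<xi> * norm (fourier H \<xi>)"
    by (simp add: norm_mult mult_right_mono)
  then show ?thesis by (simp add: mult_ac)
qed

text \<open>\<open>fourier_sup_bound\<close> is applied to the difference and to its negative; the
  extra factor \<open>norm \<xi>\<close> pays for the translation. Each \<open>h\<close> has its own
  exceptional null set.\<close>

lemma translate_bound:
  fixes H :: "'a::euclidean_space \<Rightarrow> real"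
  assumes H: "integrable lborel H" and b: "integrable lborel b" "\<And>\<xi>. norm (fourier H \<xi>) * norm \<xi> \<le> b \<xi>"
  shows "AE x in lborel. \<bar>H (x - h) - H x\<bar> \<le> norm h * ((\<integral>\<xi>. b \<xi> \<partial>lborel) / (2 * pi) ^ DIM('a))"
proof -
  note i = lborel_integrable_shift[OF H, of h]
  have le: "norm (fourier (\<lambda>x. H (x - h) - H x) \<xi>) \<le> norm h * b \<xi>" for \<xi>
    using fourier_translate_diff[OF H, of h \<xi>] mult_left_mono[OF b(2)[of \<xi>] norm_ge_zero[of h]] by linarith
  have le': "norm (fourier (\<lambda>x. H x - H (x - h)) \<xi>) \<le> norm h * b \<xi>" for \<xi>
    using le[of \<xi>] unfolding fourier_diff[OF i H] fourier_diff[OF H i] by (simp add: norm_minus_commute)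
  have "AE x in lborel. H (x - h) - H x \<le> (\<integral>\<xi>. norm h * b \<xi> \<partial>lborel) / (2 * pi) ^ DIM('a)"
    by (rule fourier_sup_bound[OF _ _ le]) (use i H b in auto)
  moreover have "AE x in lborel. H x - H (x - h) \<le> (\<integral>\<xi>. norm h * b \<xi> \<partial>lborel) / (2 * pi) ^ DIM('a)"
    by (rule fourier_sup_bound[OF _ _ le']) (use i H b in auto)
  ultimately show ?thesis by eventually_elim auto
qed

text \<open>Inside the ball of radius \<open>2 * \<rho>\<close> the sup bound times the volume is
  used, outside it the moment of order \<open>\<theta>\<close>; for \<open>norm h > 1\<close> the
  trivial bound 2 suffices.\<close>

lemma translate_L1:
  fixes H :: "'a::euclidean_space \<Rightarrow> real"
  assumes H: "integrable lborel H" "\<And>x. 0 \<le> H x" "(\<integral>x. H x \<partial>lborel) \<le> 1"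
    and \<theta>: "0 < \<theta>" "\<theta> \<le> 1" and m: "finmom \<theta> H" "mom \<theta> H \<le> M"
    and B: "0 \<le> B" "\<And>h. AE x in lborel. \<bar>H (x - h) - H x\<bar> \<le> norm h * B"
  shows "nrm1 (\<lambda>x. H (x - h) - H x) \<le> (B * (unit_ball_vol DIM('a) * 2 ^ DIM('a)) + 2 * M + 2) * norm h powr (\<theta> / (2 * real DIM('a)))"
proof -
  let ?d = "real DIM('a)"
  define \<gamma> where "\<gamma> = \<theta> / (2 * ?d)"
  have d1: "1 \<le> ?d" using DIM_positive[where 'a='a] by (simp add: Suc_le_eq)
  have \<gamma>: "0 < \<gamma>" "\<gamma> \<le> 1/2"
  proof -
    have p: "0 < 2 * ?d" using d1 by linarith
    show "0 < \<gamma>" unfolding \<gamma>_def using \<theta> p by (intro divide_pos_pos)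
    show "\<gamma> \<le> 1/2" unfolding \<gamma>_def pos_divide_le_eq[OF p] using \<theta> d1 by linarith
  qed
  have V0: "0 \<le> unit_ball_vol ?d * 2 ^ DIM('a)" by simp
  have M0: "0 \<le> M" by (rule order_trans[OF _ m(2)]) simp
  note i = lborel_integrable_shift[OF H(1), of h]
  have [measurable]: "H \<in> borel_measurable borel" using H by auto
  consider "h = 0" | "0 < norm h" "norm h \<le> 1" | "1 < norm h" by fastforce
  then show ?thesis
  proof cases
    case 1
    then show ?thesis by simp
  next
    case 3
    have "nrm1 (\<lambda>x. H (x - h) - H x) \<le> (\<integral>x. H (x - h) + H x \<partial>lborel)"
      using i H by (intro integral_mono integrable_abs) (auto intro: order_trans[OF abs_triangle_ineq4])
    also have "\<dots> = 2 * (\<integral>x. H x \<partial>lborel)" using i H lborel_integral_shift[of H h] by simp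
    also have "\<dots> \<le> 2 * norm h powr \<gamma>"
      using H(3) ge_one_powr_ge_zero[of "norm h" \<gamma>] 3 \<gamma> by linarith
    also have "\<dots> \<le> (B * (unit_ball_vol ?d * 2 ^ DIM('a)) + 2 * M + 2) * norm h powr \<gamma>"
      using B V0 M0 by (intro mult_right_mono) auto
    finally show ?thesis unfolding \<gamma>_def .
  next
    case 2
    \<comment> \<open>With this radius \<open>norm h * \<rho> ^ DIM('a) = norm h powr (1/2)\<close>
      and \<open>\<rho> powr (- \<theta>) = norm h powr \<gamma>\<close>, where
      \<open>\<gamma> \<le> 1/2\<close>. It is at least 1, so outside the ball of radius
      \<open>2 * \<rho>\<close> both \<open>x\<close> and \<open>x - h\<close> have norm at least
      \<open>\<rho>\<close>.\<close>
    define \<rho> where "\<rho> = norm h powr (- 1 / (2 * ?d))"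
    have \<rho>1: "1 \<le> \<rho>"
    proof -
      have "norm h powr 0 \<le> norm h powr (- 1 / (2 * ?d))" using 2 d1 by (intro powr_mono') auto
      then show ?thesis using 2 by (simp add: \<rho>_def)
    qed
    have \<rho>\<theta>: "\<rho> powr (- \<theta>) = norm h powr \<gamma>" by (simp add: \<rho>_def powr_powr \<gamma>_def)
    have \<rho>d: "\<rho> ^ DIM('a) = norm h powr (- 1/2)"
      using \<rho>1 d1 by (subst powr_realpow[symmetric]) (auto simp: \<rho>_def powr_powr)
    let ?R = "\<lambda>x. norm h * B * indicator (cball 0 (2 * \<rho>)) x + \<rho> powr (- \<theta>) * (norm (x - h) powr \<theta> * \<bar>H (x - h)\<bar> + norm x powr \<theta> * \<bar>H x\<bar>)"
    have iB: "integrable lborel (indicator (cball 0 (2 * \<rho>)) :: 'a \<Rightarrow> real)"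
      using emeasure_compact_finite[OF compact_cball, of "0::'a" "2 * \<rho>"] by (auto simp: less_top)
    have im: "integrable lborel (\<lambda>x. norm (x - h) powr \<theta> * \<bar>H (x - h)\<bar>)"
      by (rule lborel_integrable_shift[OF m(1)])
    have iR: "integrable lborel ?R"
      by (intro Bochner_Integration.integrable_add integrable_mult_right iB im m(1))
    have big: "H y \<le> \<rho> powr (- \<theta>) * (norm y powr \<theta> * \<bar>H y\<bar>)" if "\<rho> \<le> norm y" for y
    proof -
      have "\<rho> powr \<theta> \<le> norm y powr \<theta>" using that \<theta> \<rho>1 by (intro powr_mono2) auto
      then have "1 \<le> \<rho> powr (- \<theta>) * norm y powr \<theta>" using \<rho>1 by (simp add: powr_minus field_simps)
      from mult_right_mono[OF this H(2)[of y]] show ?thesis using H(2)[of y] by (simp add: mult.assoc)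
    qed
    have "AE x in lborel. \<bar>H (x - h) - H x\<bar> \<le> ?R x"
      using B(2)[of h]
    proof eventually_elim
      case (elim x)
      show ?case
      proof (cases "norm x \<le> 2 * \<rho>")
        case True
        then have ind: "indicator (cball 0 (2 * \<rho>)) x = (1::real)" by simp
        have nn: "0 \<le> \<rho> powr (- \<theta>) * (norm (x - h) powr \<theta> * \<bar>H (x - h)\<bar> + norm x powr \<theta> * \<bar>H x\<bar>)" by simp
        show ?thesis unfolding ind mult_1_right by (rule add_increasing2[OF nn elim])
      next
        case False
        then have "\<rho> \<le> norm x" "\<rho> \<le> norm (x - h)" using \<rho>1 2 norm_triangle_ineq2[of x h] by auto
        from big[OF this(1)] big[OF this(2)]
        have "H (x - h) + H x \<le> \<rho> powr (- \<theta>) * (norm (x - h) powr \<theta> * \<bar>H (x - h)\<bar> + norm x powr \<theta> * \<bar>H x\<bar>)"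
          by (simp add: distrib_left)
        moreover have "\<bar>H (x - h) - H x\<bar> \<le> H (x - h) + H x" using H(2)[of x] H(2)[of "x - h"] by linarith
        ultimately show ?thesis using False by simp
      qed
    qed
    then have "nrm1 (\<lambda>x. H (x - h) - H x) \<le> (\<integral>x. ?R x \<partial>lborel)"
      using i H(1) by (intro integral_mono_AE[OF _ iR]) auto
    also have "\<dots> = norm h * B * measure lborel (cball (0::'a) (2 * \<rho>)) + \<rho> powr (- \<theta>) * (mom \<theta> H + mom \<theta> H)"
      using iB im m(1) lborel_integral_shift[of "\<lambda>x. norm x powr \<theta> * \<bar>H x\<bar>" h] by simp
    also have "measure lborel (cball (0::'a) (2 * \<rho>)) = unit_ball_vol ?d * 2 ^ DIM('a) * norm h powr (- 1/2)"
      using content_cball[of "2 * \<rho>" "0::'a"] \<rho>1 by (simp add: power_mult_distrib \<rho>d)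
    also have "norm h * B * (unit_ball_vol ?d * 2 ^ DIM('a) * norm h powr (- 1/2)) = B * (unit_ball_vol ?d * 2 ^ DIM('a)) * norm h powr (1/2)"
    proof -
      have "norm h * norm h powr (- 1/2) = norm h powr 1 * norm h powr (- 1/2)" by simp
      also have "\<dots> = norm h powr (1/2)" by (simp only: powr_add[symmetric]) simp
      finally show ?thesis by (simp add: mult_ac)
    qed
    also have "\<dots> + \<rho> powr (- \<theta>) * (mom \<theta> H + mom \<theta> H) \<le> B * (unit_ball_vol ?d * 2 ^ DIM('a)) * norm h powr \<gamma> + norm h powr \<gamma> * (M + M)"
      unfolding \<rho>\<theta> using B V0 \<gamma> 2 m(2) by (intro add_mono mult_left_mono powr_mono') auto
    also have "\<dots> \<le> (B * (unit_ball_vol ?d * 2 ^ DIM('a)) + 2 * M + 2) * norm h powr \<gamma>" by (simp add: algebra_simps)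
    finally show ?thesis unfolding \<gamma>_def .
  qed
qed

text \<open>As \<open>f\<close> has integral 0, \<open>H x\<close> may be subtracted from the
  kernel: \<open>conv H f x\<close> is the integral of \<open>(H (x - y) - H x) * f y\<close> over
  \<open>y\<close>, and each translation is paid for by the moment of \<open>f\<close>.\<close>

lemma conv_mean_zero_L1:
  fixes H f :: "'a::euclidean_space \<Rightarrow> real"
  assumes H: "integrable lborel H" and f: "integrable lborel f" "(\<integral>x. f x \<partial>lborel) = 0" "finmom \<gamma> f"
    and C: "\<And>h. nrm1 (\<lambda>x. H (x - h) - H x) \<le> C * norm h powr \<gamma>"
  shows "nrm1 (conv H f) \<le> C * mom \<gamma> f"
proof -
  have [measurable]: "H \<in> borel_measurable borel" "f \<in> borel_measurable borel" using H f by auto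
  define F where "F = (\<lambda>(y,x). (H (x - y) - H x) * f y)"
  have Hf: "integrable (lborel \<Otimes>\<^sub>M lborel) (\<lambda>(y,x). H x * f y)"
    using integrable_pair_mult[OF f(1) H] by (simp add: mult.commute split_beta')
  have Feq: "F = (\<lambda>p. (\<lambda>(y,x). H (x - y) * f y) p - (\<lambda>(y,x). H x * f y) p)"
    by (auto simp: F_def left_diff_distrib)
  have F: "integrable (lborel \<Otimes>\<^sub>M lborel) F"
    unfolding Feq by (intro Bochner_Integration.integrable_diff conv_pair_integrable H f Hf)
  have Fa: "integrable (lborel \<Otimes>\<^sub>M lborel) (\<lambda>(y,x). \<bar>F (y,x)\<bar>)" using integrable_abs[OF F] by (simp add: split_beta')
  have "AE x in lborel. \<bar>conv H f x\<bar> \<le> (\<integral>y. \<bar>F (y,x)\<bar> \<partial>lborel)"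
    using conv_AE_integrable[OF H f(1)]
  proof eventually_elim
    case (elim x)
    have "(\<integral>y. F (y,x) \<partial>lborel) = (\<integral>y. H (x - y) * f y \<partial>lborel) - (\<integral>y. H x * f y \<partial>lborel)"
      using elim f(1) by (simp add: F_def left_diff_distrib)
    then have "conv H f x = (\<integral>y. F (y,x) \<partial>lborel)" using f(2) by (simp add: conv_def)
    then show ?case by (simp only: integral_abs_bound)
  qed
  then have "nrm1 (conv H f) \<le> (\<integral>x. (\<integral>y. \<bar>F (y,x)\<bar> \<partial>lborel) \<partial>lborel)"
    using conv_integrable[OF H f(1)] lborel_pair.integrable_snd[OF Fa] by (intro integral_mono_AE) auto
  also have "\<dots> = (\<integral>y. (\<integral>x. \<bar>F (y,x)\<bar> \<partial>lborel) \<partial>lborel)" by (rule lborel_pair.Fubini_integral[OF Fa])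
  also have "\<dots> \<le> (\<integral>y. C * (norm y powr \<gamma> * \<bar>f y\<bar>) \<partial>lborel)"
  proof (rule integral_mono[OF lborel_pair.integrable_fst[OF Fa] integrable_mult_right[OF f(3)]])
    fix y
    have "(\<integral>x. \<bar>F (y,x)\<bar> \<partial>lborel) = nrm1 (\<lambda>x. H (x - y) - H x) * \<bar>f y\<bar>" by (simp add: F_def abs_mult)
    also have "\<dots> \<le> C * norm y powr \<gamma> * \<bar>f y\<bar>" by (intro mult_right_mono C) simp
    finally show "(\<integral>x. \<bar>F (y,x)\<bar> \<partial>lborel) \<le> C * (norm y powr \<gamma> * \<bar>f y\<bar>)" by (simp add: mult.assoc)
  qed
  finally show ?thesis by simp
qed

section \<open>Harris contraction over one time step and its iteration\<close>

context jump
begin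

text \<open>\<open>pd T\<close> is split into \<open>H\<close> and a nonnegative rest. On mean-zero
  data \<open>H\<close> costs only a moment, which the dilation has shrunk by
  \<open>exp (- \<gamma> * T)\<close>; the atom and the rest together have mass one minus that of
  \<open>H\<close>.\<close>

lemma doeblin_step:
  assumes T: "0 \<le> T" and e: "ev T v g" and v: "(\<integral>x. v x \<partial>lborel) = 0" "finmom \<gamma> v"
    and H: "integrable lborel H" "\<And>x. 0 \<le> H x" "AE x in lborel. H x \<le> pd T x" "c0 \<le> (\<integral>x. H x \<partial>lborel)"
    and C: "\<And>h. nrm1 (\<lambda>x. H (x - h) - H x) \<le> C * norm h powr \<gamma>"
  shows "nrm1 g \<le> (1 - c0) * nrm1 v + C * (exp (- \<gamma> * T) * mom \<gamma> v)"
proof -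
  have vi: "integrable lborel v" and gi: "integrable lborel g" using e by (auto simp: ev_def)
  have vm: "v \<in> borel_measurable borel" using vi by auto
  note d = dil_integrable[OF vi, of T]
  note p = pd_int[OF T] pd_nonneg[OF T]
  define E where "E = (\<lambda>x. pd T x - H x)"
  have E: "integrable lborel E" unfolding E_def using p H by simp
  have E0: "AE x in lborel. 0 \<le> E x" using H(3) by eventually_elim (simp add: E_def)
  have nE: "nrm1 E = 1 - exp (- a * T) - (\<integral>x. H x \<partial>lborel)"
  proof -
    have "nrm1 E = (\<integral>x. E x \<partial>lborel)" by (rule integral_cong_AE) (use E E0 in auto)
    then show ?thesis using p H by (simp add: E_def pd_mass[OF T])
  qed
  have cH: "nrm1 (conv H (dil T v)) \<le> C * mom \<gamma> (dil T v)"
    by (rule conv_mean_zero_L1[OF H(1) d _ _ C]) (use v moment_dil(1)[OF vm v(2)] in \<open>auto simp: integral_dil_1[OF vm]\<close>)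
  have "AE x in lborel. \<bar>g x\<bar> \<le> exp (- a * T) * \<bar>dil T v x\<bar> + (\<bar>conv H (dil T v) x\<bar> + \<bar>conv E (dil T v) x\<bar>)"
    using ev_AE_Sop[OF T e] conv_add_left_AE[OF H(1) E d]
  proof eventually_elim
    case (elim x)
    have "(\<lambda>x. H x + E x) = pd T" by (auto simp: E_def)
    then have "g x = exp (- a * T) * dil T v x + (conv H (dil T v) x + conv E (dil T v) x)"
      using elim by (simp add: Sop_def)
    then show ?case by (simp add: abs_mult order_trans[OF abs_triangle_ineq] add_mono)
  qed
  then have "nrm1 g \<le> (\<integral>x. exp (- a * T) * \<bar>dil T v x\<bar> + (\<bar>conv H (dil T v) x\<bar> + \<bar>conv E (dil T v) x\<bar>) \<partial>lborel)"
    using gi d conv_integrable[OF H(1) d] conv_integrable[OF E d] by (intro integral_mono_AE) auto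
  also have "\<dots> = exp (- a * T) * nrm1 (dil T v) + (nrm1 (conv H (dil T v)) + nrm1 (conv E (dil T v)))"
    using d conv_integrable[OF H(1) d] conv_integrable[OF E d] by simp
  also have "\<dots> \<le> exp (- a * T) * nrm1 (dil T v) + (C * mom \<gamma> (dil T v) + nrm1 E * nrm1 (dil T v))"
    using cH nrm1_conv_le[OF E d] by simp
  also have "\<dots> = (1 - (\<integral>x. H x \<partial>lborel)) * nrm1 v + C * (exp (- \<gamma> * T) * mom \<gamma> v)"
    unfolding nE nrm1_dil[OF vm] moment_dil(2)[OF vm v(2)] by (simp add: algebra_simps)
  also have "\<dots> \<le> (1 - c0) * nrm1 v + C * (exp (- \<gamma> * T) * mom \<gamma> v)"
    using H(4) by (intro add_right_mono mult_right_mono) auto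
  finally show ?thesis .
qed

text \<open>The intermediate state is supplied by \<open>Sop\<close>. That it leads on to the given
  \<open>g\<close>, which is determined only up to a null set, is read off from the
  transforms.\<close>

lemma ev_mult_split:
  assumes T: "0 \<le> T" and e: "ev (real (Suc n) * T) v g"
  obtains w where "ev (real n * T) v w" "ev T w g"
proof
  have vi: "integrable lborel v" and gi: "integrable lborel g" using e by (auto simp: ev_def)
  have nT: "0 \<le> real n * T" using T by simp
  show w: "ev (real n * T) v (Sop (real n * T) v)" by (rule ev_Sop[OF nT vi])
  have wi: "integrable lborel (Sop (real n * T) v)" using w by (simp add: ev_def)
  have "ev (T + real n * T) v (Sop T (Sop (real n * T) v))" by (rule ev_trans[OF w ev_Sop[OF T wi] nT T])
  moreover have "real (Suc n) * T = T + real n * T" by (simp add: algebra_simps)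
  ultimately show "ev T (Sop (real n * T) v) g"
    using e ev_Sop[OF T wi] gi by (auto simp: ev_def)
qed

lemma ev_iterate:
  assumes T: "0 \<le> T" and \<kappa>: "0 \<le> \<kappa>" and N: "\<And>v g. ev T v g \<Longrightarrow> (\<integral>x. v x \<partial>lborel) = 0 \<Longrightarrow> finmom \<gamma> v \<Longrightarrow>
      finmom \<gamma> g \<and> nrm1 g + \<beta> * mom \<gamma> g \<le> \<kappa> * (nrm1 v + \<beta> * mom \<gamma> v)"
    and e: "ev (real n * T) v g" and v: "(\<integral>x. v x \<partial>lborel) = 0" "finmom \<gamma> v"
  shows "finmom \<gamma> g \<and> nrm1 g + \<beta> * mom \<gamma> g \<le> \<kappa> ^ n * (nrm1 v + \<beta> * mom \<gamma> v)"
  using e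
proof (induction n arbitrary: g)
  case 0
  have vi: "integrable lborel v" and gi: "integrable lborel g" using 0 by (auto simp: ev_def)
  have "AE x in lborel. g x = v x"
    by (rule fourier_inject[OF gi vi]) (use 0 in \<open>simp add: ev_def A_def\<close>)
  then have "AE x in lborel. \<bar>g x\<bar> \<le> \<bar>v x\<bar>" by eventually_elim simp
  with gi vi have "finmom \<gamma> g" "mom \<gamma> g = mom \<gamma> v" "nrm1 g = nrm1 v"
    using finmom_bound(1)[OF v(2) _ \<open>AE x in lborel. \<bar>g x\<bar> \<le> \<bar>v x\<bar>\<close>] \<open>AE x in lborel. g x = v x\<close>
    by (auto intro!: integral_cong_AE)
  then show ?case by simp
next
  case (Suc n)
  obtain w where w: "ev (real n * T) v w" "ev T w g" by (rule ev_mult_split[OF T Suc.prems]) 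
  note IH = Suc.IH[OF w(1)]
  have "(\<integral>x. w x \<partial>lborel) = 0" using ev_integral[OF w(1)] v by simp
  with N[OF w(2)] IH have "finmom \<gamma> g" "nrm1 g + \<beta> * mom \<gamma> g \<le> \<kappa> * (nrm1 w + \<beta> * mom \<gamma> w)" by auto
  moreover have "\<kappa> * (nrm1 w + \<beta> * mom \<gamma> w) \<le> \<kappa> * (\<kappa> ^ n * (nrm1 v + \<beta> * mom \<gamma> v))" using IH \<kappa> by (intro mult_left_mono) auto
  ultimately show ?case by (simp add: mult.assoc)
qed

end

context kernel_family
begin

text \<open>Harris' argument: the norm \<open>nrm1 v + \<beta> * mom \<gamma> v\<close> with small \<open>\<beta>\<close> is contracted on mean-zero data by a
  fixed time step.\<close>
theorem uniform_decay:
  assumes \<theta>: "0 < \<theta>" "\<theta> < 1"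
  obtains \<gamma> C lam :: real where "0 < \<gamma>" "\<gamma> \<le> \<theta>" "0 \<le> C" "0 < lam"
    "\<And>s \<epsilon> t v g. s \<in> {1/2<..<1} \<Longrightarrow> 0 < \<epsilon> \<Longrightarrow> \<epsilon> < 1 \<Longrightarrow> 0 \<le> t \<Longrightarrow> jump.ev (resc \<epsilon> (J s)) (\<epsilon> powr (- 2 * s)) t v g \<Longrightarrow>
       (\<integral>x. v x \<partial>lborel) = 0 \<Longrightarrow> finmom \<gamma> v \<Longrightarrow> nrm1 g \<le> C * exp (- lam * t) * (nrm1 v + mom \<gamma> v)"
proof -
  let ?d = "DIM('a)"
  \<comment> \<open>Of the power \<open>2 * ?d + 1\<close>, one factor of \<open>norm \<xi>\<close>
    is spent on the translation estimate; the other \<open>2 * ?d\<close> allow domination by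
    \<open>bump_weight\<close>.\<close>
  obtain c0 C0' T0 :: real where c0: "0 < c0" and C0': "0 \<le> C0'" and T0: "1 \<le> T0"
    and min: "\<And>s \<epsilon> T. s \<in> {1/2<..<1} \<Longrightarrow> 0 < \<epsilon> \<Longrightarrow> \<epsilon> < 1 \<Longrightarrow> T0 \<le> T \<Longrightarrow>
      \<exists>H. integrable lborel H \<and> (\<forall>x. 0 \<le> H x) \<and> (AE x in lborel. H x \<le> jump.pd (resc \<epsilon> (J s)) (\<epsilon> powr (- 2 * s)) T x) \<and>
        c0 \<le> (\<integral>x. H x \<partial>lborel) \<and> (\<forall>\<xi>. 1 \<le> norm \<xi> \<longrightarrow> norm (fourier H \<xi>) * norm \<xi> ^ (2 * ?d + 1) \<le> C0')"
    by (rule minorant) blast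
  \<comment> \<open>The Hoelder exponent delivered by \<open>translate_L1\<close>.\<close>
  define \<gamma> where "\<gamma> = \<theta> / (2 * real ?d)"
  have d1: "1 \<le> real ?d" using DIM_positive[where 'a='a] by (simp add: Suc_le_eq)
  have \<gamma>: "0 < \<gamma>" "\<gamma> \<le> \<theta>" "\<gamma> < 1" "\<gamma> \<le> 1"
  proof -
    show "0 < \<gamma>" using \<theta> d1 by (simp add: \<gamma>_def)
    have "1 \<le> 2 * real ?d" using d1 by linarith
    then have "\<theta> * 1 \<le> \<theta> * (2 * ?d)" using \<theta> by (intro mult_left_mono) auto
    then show "\<gamma> \<le> \<theta>" using d1 by (simp add: \<gamma>_def divide_le_eq)
    then show "\<gamma> < 1" "\<gamma> \<le> 1" using \<theta> by auto
  qed
  \<comment> \<open>Both orders are below 1, so the exponent \<open>p = 1\<close> is admissible and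
    the moments are bounded uniformly in \<open>s\<close>, \<open>\<epsilon>\<close> and
    \<open>T\<close>.\<close>
  define M where "M = max 1 (max (?d * momc (1 + C0) 1 \<theta>) (?d * momc (1 + C0) 1 \<gamma>))"
  have M: "1 \<le> M" "?d * momc (1 + C0) 1 \<theta> \<le> M" "?d * momc (1 + C0) 1 \<gamma> \<le> M" by (auto simp: M_def)
  define B where "B = (\<integral>\<xi>. (C0' + 1) * 2 ^ ?d * bump_weight (\<xi>::'a) \<partial>lborel) / (2 * pi) ^ ?d"
  have B0: "0 \<le> B" unfolding B_def using C0' by (auto simp: bump_weight_def intro!: divide_nonneg_nonneg Bochner_Integration.integral_nonneg mult_nonneg_nonneg prod_nonneg)
  define C where "C = B * (unit_ball_vol ?d * 2 ^ ?d) + 2 * M + 2"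
  have C1: "1 \<le> C" unfolding C_def using B0 M by (smt (verit) mult_nonneg_nonneg unit_ball_vol_nonneg of_nat_0_le_iff zero_le_power)
  \<comment> \<open>The moment that the jumps create out of mass then costs
    \<open>\<beta> * M = c0 / 2\<close>, half of what the minorant gains.\<close>
  define \<beta> where "\<beta> = c0 / (2 * M)"
  have \<beta>: "0 < \<beta>" using c0 M by (simp add: \<beta>_def)
  \<comment> \<open>From this time on
    \<open>(C / \<beta> + 1) * exp (- \<gamma> * T) \<le> 1/2\<close>, which covers the old moment
    and the price paid to the minorant.\<close>
  define T1 where "T1 = max T0 (ln (2 * (C / \<beta> + 1)) / \<gamma>)"
  have T1: "T0 \<le> T1" "1 \<le> T1" using T0 by (auto simp: T1_def)
  define \<kappa> where "\<kappa> = 1 - c0 / 2"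
  \<comment> \<open>\<open>c0 \<le> 1\<close> is carried along because it is visible only from an
    actual minorant, whose mass is at most 1.\<close>
  have step: "c0 \<le> 1 \<and> finmom \<gamma> g \<and> nrm1 g + \<beta> * mom \<gamma> g \<le> \<kappa> * (nrm1 v + \<beta> * mom \<gamma> v)"
    if s: "s \<in> {1/2<..<1}" and \<epsilon>: "0 < \<epsilon>" "\<epsilon> < 1" and T: "T1 \<le> T" and e: "jump.ev (resc \<epsilon> (J s)) (\<epsilon> powr (- 2 * s)) T v g"
      and v: "(\<integral>x. v x \<partial>lborel) = 0" "finmom \<gamma> v" for s \<epsilon> T v g
  proof -
    interpret jump "resc \<epsilon> (J s)" "\<epsilon> powr (- 2 * s)" by (rule jump_resc[OF s \<epsilon>(1)])
    have TT: "0 \<le> T" "T0 \<le> T" using T T1 by auto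
    obtain H where H: "integrable lborel H" "\<And>x. 0 \<le> H x" "AE x in lborel. H x \<le> pd T x" "c0 \<le> (\<integral>x. H x \<partial>lborel)"
      "\<And>\<xi>. 1 \<le> norm \<xi> \<Longrightarrow> norm (fourier H \<xi>) * norm \<xi> ^ (2 * ?d + 1) \<le> C0'"
      using min[OF s \<epsilon> TT(2)] by blast
    have H1: "(\<integral>x. H x \<partial>lborel) \<le> 1"
    proof -
      have "(\<integral>x. H x \<partial>lborel) \<le> (\<integral>x. pd T x \<partial>lborel)" by (rule integral_mono_AE[OF H(1) pd_int[OF TT(1)] H(3)])
      also have "\<dots> \<le> 1" unfolding pd_mass[OF TT(1)] by simp
      finally show ?thesis .
    qed
    have p\<theta>: "finmom \<theta> (pd T)" "mom \<theta> (pd T) \<le> M" and p\<gamma>: "finmom \<gamma> (pd T)" "mom \<gamma> (pd T) \<le> M"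
      using mom_pd_le[OF s \<epsilon> TT(1), of \<theta> 1] mom_pd_le[OF s \<epsilon> TT(1), of \<gamma> 1] \<theta> \<gamma> s M by auto
    have Hp: "AE x in lborel. \<bar>H x\<bar> \<le> \<bar>pd T x\<bar>" using H(3) by eventually_elim (use H(2) in auto)
    have mH: "finmom \<theta> H" "mom \<theta> H \<le> M"
      using finmom_bound[OF p\<theta>(1) _ Hp] H(1) p\<theta>(2) by auto
    have bw: "norm (fourier H \<xi>) * norm \<xi> \<le> (C0' + 1) * 2 ^ ?d * bump_weight \<xi>" for \<xi>
    proof -
      have n1: "norm (fourier H \<xi>) \<le> 1" using fourier_norm_le[of H \<xi>] H(2) H1 by simp
      let ?q = "inverse ((1 + (norm \<xi>)\<^sup>2) ^ ?d)"
      have q0: "0 \<le> ?q" by simp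
      have "norm (fourier H \<xi>) * norm \<xi> \<le> (C0' + 1) * (2 ^ ?d * ?q)"
      proof (cases "norm \<xi> \<le> 1")
        case True
        then have "(1 + (norm \<xi>)\<^sup>2) ^ ?d \<le> 2 ^ ?d" by (intro power_mono) (auto simp: power_le_one)
        then have "1 \<le> 2 ^ ?d * ?q" by (simp add: field_simps add_pos_nonneg)
        moreover have "norm (fourier H \<xi>) * norm \<xi> \<le> 1 * 1" using n1 True by (intro mult_mono) auto
        moreover have "1 * 1 \<le> (C0' + 1) * (2 ^ ?d * ?q)" using C0' \<open>1 \<le> 2 ^ ?d * ?q\<close> by (intro mult_mono) auto
        ultimately show ?thesis by linarith
      next
        case False
        then have x: "1 \<le> norm \<xi>" by simp
        then have sq: "1 \<le> (norm \<xi>)\<^sup>2" by (simp add: one_le_power)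
        have "(1 + (norm \<xi>)\<^sup>2) ^ ?d \<le> (2 * (norm \<xi>)\<^sup>2) ^ ?d" using sq by (intro power_mono) auto
        also have "\<dots> = 2 ^ ?d * norm \<xi> ^ (2 * ?d)" by (simp add: power_mult_distrib power_mult)
        finally have "1 \<le> 2 ^ ?d * ?q * norm \<xi> ^ (2 * ?d)" by (simp add: field_simps add_pos_nonneg)
        then have "norm (fourier H \<xi>) * norm \<xi> * 1 \<le> norm (fourier H \<xi>) * norm \<xi> * (2 ^ ?d * ?q * norm \<xi> ^ (2 * ?d))"
          by (rule mult_left_mono) simp
        also have "\<dots> = norm (fourier H \<xi>) * norm \<xi> ^ (2 * ?d + 1) * (2 ^ ?d * ?q)" by (simp add: mult_ac)
        also have "\<dots> \<le> (C0' + 1) * (2 ^ ?d * ?q)" using H(5)[OF x] by (intro mult_right_mono) auto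
        finally show ?thesis by simp
      qed
      also have "\<dots> \<le> (C0' + 1) * (2 ^ ?d * bump_weight \<xi>)" using C0' bump_weight_ge[of \<xi>] by (intro mult_left_mono) auto
      finally show ?thesis by (simp add: mult.assoc)
    qed
    have tb: "AE x in lborel. \<bar>H (x - h) - H x\<bar> \<le> norm h * B" for h
      unfolding B_def by (rule translate_bound[OF H(1) integrable_mult_right[OF bump_weight_integrable] bw])
    have Ch: "nrm1 (\<lambda>x. H (x - h) - H x) \<le> C * norm h powr \<gamma>" for h
      unfolding C_def \<gamma>_def by (rule translate_L1[OF H(1,2) H1 \<theta>(1) less_imp_le[OF \<theta>(2)] mH B0 tb])
    have g1: "nrm1 g \<le> (1 - c0) * nrm1 v + C * (exp (- \<gamma> * T) * mom \<gamma> v)"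
      by (rule doeblin_step[OF TT(1) e v H(1-4) Ch])
    have g2: "finmom \<gamma> g" "mom \<gamma> g \<le> exp (- \<gamma> * T) * mom \<gamma> v + mom \<gamma> (pd T) * nrm1 v"
      using mom_ev_le[OF TT(1) e \<gamma>(1,4) v(2) p\<gamma>(1)] by auto
    define E where "E = exp (- \<gamma> * T)"
    have E: "(C / \<beta> + 1) * E \<le> 1/2"
    proof -
      have p: "0 < 2 * (C / \<beta> + 1)" using C1 \<beta> by (simp add: add_pos_pos)
      have "ln (2 * (C / \<beta> + 1)) \<le> \<gamma> * T" using T \<gamma> unfolding T1_def by (simp add: divide_le_eq mult.commute)
      then have "2 * (C / \<beta> + 1) \<le> exp (\<gamma> * T)" using p by (simp add: ln_le_cancel_iff[symmetric] del: ln_le_cancel_iff)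
      then show ?thesis unfolding E_def by (simp add: exp_minus field_simps)
    qed
    have c01: "c0 \<le> 1" using H(4) H1 by simp
    have n0: "0 \<le> nrm1 v" "0 \<le> mom \<gamma> v" by auto
    have "nrm1 g + \<beta> * mom \<gamma> g \<le> ((1 - c0) * nrm1 v + C * (E * mom \<gamma> v)) + \<beta> * (E * mom \<gamma> v + M * nrm1 v)"
    proof (rule add_mono)
      show "nrm1 g \<le> (1 - c0) * nrm1 v + C * (E * mom \<gamma> v)" using g1 by (simp add: E_def)
      have "mom \<gamma> (pd T) * nrm1 v \<le> M * nrm1 v" using p\<gamma>(2) by (intro mult_right_mono) auto
      then show "\<beta> * mom \<gamma> g \<le> \<beta> * (E * mom \<gamma> v + M * nrm1 v)" using g2(2) \<beta> by (intro mult_left_mono) (auto simp: E_def)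
    qed
    also have "\<dots> = (1 - c0 + \<beta> * M) * nrm1 v + (C / \<beta> + 1) * E * (\<beta> * mom \<gamma> v)"
      using \<beta> by (simp add: algebra_simps)
    also have "\<dots> \<le> \<kappa> * nrm1 v + \<kappa> * (\<beta> * mom \<gamma> v)"
    proof (intro add_mono mult_right_mono)
      show "1 - c0 + \<beta> * M \<le> \<kappa>" using M by (simp add: \<beta>_def \<kappa>_def)
      show "(C / \<beta> + 1) * E \<le> \<kappa>" using E c01 unfolding \<kappa>_def by linarith
    qed (use n0 \<beta> in auto)
    finally show ?thesis using g2 c01 by (simp add: distrib_left)
  qed
  show ?thesis
  proof (cases "c0 \<le> 1")
    \<comment> \<open>Impossible for any admissible \<open>s\<close> and \<open>\<epsilon>\<close>:
      \<open>step\<close> applied to zero data would give \<open>c0 \<le> 1\<close>.\<close>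
    case False
    have no: False if "s \<in> {1/2<..<1}" "0 < \<epsilon>" "\<epsilon> < 1" for s \<epsilon> :: real
    proof -
      interpret jump "resc \<epsilon> (J s)" "\<epsilon> powr (- 2 * s)" by (rule jump_resc) (use that in auto)
      have "ev T1 (\<lambda>_. 0) (Sop T1 (\<lambda>_. 0))" using T1 by (intro ev_Sop) auto
      from step[OF that order_refl this] False show False by simp
    qed
    show ?thesis by (rule that[of \<gamma> 0 1]) (use \<gamma> no in \<open>auto\<close>)
  next
    case c01: True
    have \<kappa>: "0 < \<kappa>" "\<kappa> < 1" using c0 c01 by (auto simp: \<kappa>_def)
    define lam where "lam = - ln \<kappa> / T1"
    have lam: "0 < lam" using \<kappa> T1 by (simp add: lam_def divide_neg_pos)
    have \<beta>1: "\<beta> \<le> 1" using c01 M by (simp add: \<beta>_def divide_le_eq)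
    show ?thesis
    proof (rule that[of \<gamma> "1 / \<kappa>" lam])
      fix s \<epsilon> t :: real and v g :: "'a \<Rightarrow> real"
      assume s: "s \<in> {1/2<..<1}" and \<epsilon>: "0 < \<epsilon>" "\<epsilon> < 1" and t: "0 \<le> t"
        and e: "jump.ev (resc \<epsilon> (J s)) (\<epsilon> powr (- 2 * s)) t v g"
        and v: "(\<integral>x. v x \<partial>lborel) = 0" "finmom \<gamma> v"
      interpret jump "resc \<epsilon> (J s)" "\<epsilon> powr (- 2 * s)" by (rule jump_resc[OF s \<epsilon>(1)])
      have n0: "0 \<le> nrm1 v" "0 \<le> mom \<gamma> v" by auto
      have Nle: "nrm1 v + \<beta> * mom \<gamma> v \<le> nrm1 v + mom \<gamma> v" using \<beta>1 n0 mult_right_mono[of \<beta> 1 "mom \<gamma> v"] by simp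
      have ek: "exp (- lam * T1) = \<kappa>" using \<kappa> T1 by (simp add: lam_def)
      show "nrm1 g \<le> 1 / \<kappa> * exp (- lam * t) * (nrm1 v + mom \<gamma> v)"
      proof (cases "t < T1")
        case True
        have "lam * t \<le> lam * T1" using True lam by simp
        then have "\<kappa> \<le> exp (- lam * t)" unfolding ek[symmetric] by simp
        then have "1 \<le> 1 / \<kappa> * exp (- lam * t)" using \<kappa> by (simp add: field_simps)
        then have "1 * (nrm1 v + mom \<gamma> v) \<le> 1 / \<kappa> * exp (- lam * t) * (nrm1 v + mom \<gamma> v)"
          using n0 by (intro mult_right_mono) auto
        moreover have "nrm1 g \<le> 1 * (nrm1 v + mom \<gamma> v)" unfolding mult_1 by (rule add_increasing2[OF n0(2) nrm1_ev_le[OF t e]])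
        ultimately show ?thesis by (rule order_trans[rotated])
      next
        case False
        \<comment> \<open>The time is cut into \<open>n\<close> equal steps of length at least
          \<open>T1\<close>, so that no shorter step is left over. Rounding \<open>t / T1\<close>
          down is what the factor \<open>1 / \<kappa>\<close> pays for.\<close>
        define n where "n = nat \<lfloor>t / T1\<rfloor>"
        have tT: "1 \<le> t / T1" using False T1 by simp
        have n: "1 \<le> real n" "real n \<le> t / T1" "t / T1 \<le> real n + 1"
          using tT unfolding n_def by (auto simp: le_nat_iff)
        define T where "T = t / n"
        have T: "T1 \<le> T" "0 \<le> T" "real n * T = t" using n T1 t by (auto simp: T_def field_simps)
        have st: "finmom \<gamma> g' \<and> nrm1 g' + \<beta> * mom \<gamma> g' \<le> \<kappa> * (nrm1 v' + \<beta> * mom \<gamma> v')"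
          if "ev T v' g'" "(\<integral>x. v' x \<partial>lborel) = 0" "finmom \<gamma> v'" for v' g'
          using step[OF s \<epsilon> T(1) that] by blast
        have "finmom \<gamma> g \<and> nrm1 g + \<beta> * mom \<gamma> g \<le> \<kappa> ^ n * (nrm1 v + \<beta> * mom \<gamma> v)"
          by (rule ev_iterate[OF T(2) less_imp_le[OF \<kappa>(1)] st _ v]) (use e T(3) in auto)
        then have "nrm1 g \<le> \<kappa> ^ n * (nrm1 v + \<beta> * mom \<gamma> v)" using \<beta> by (smt (verit) mult_nonneg_nonneg Bochner_Integration.integral_nonneg abs_ge_zero powr_ge_zero)
        also have "\<dots> \<le> (1 / \<kappa> * exp (- lam * t)) * (nrm1 v + mom \<gamma> v)"
        proof (rule mult_mono[OF _ Nle])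
          have "\<kappa> ^ n = exp (- lam * T1) ^ n" by (simp only: ek)
          also have "\<dots> = exp (- lam * (real n * T1))" by (simp add: exp_of_nat_mult[symmetric] mult_ac)
          also have "\<dots> \<le> exp (- lam * (t - T1))"
          proof -
            have "t - T1 \<le> real n * T1" using n(3) T1 by (simp add: field_simps)
            then show ?thesis using lam by simp
          qed
          also have "\<dots> = exp (- lam * t) / exp (- lam * T1)" by (simp add: exp_diff[symmetric] algebra_simps)
          finally show "\<kappa> ^ n \<le> 1 / \<kappa> * exp (- lam * t)" unfolding ek by simp
        qed (use \<kappa> \<beta> n0 in auto)
        finally show ?thesis .
      qed
    qed (use \<gamma> \<kappa> lam in auto)
  qed
qed

end

section \<open>Mild solutions\<close>

lemma nrm1_diff_triangle:
  assumes "integrable lborel f" "integrable lborel g" "integrable lborel h"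
  shows "nrm1 (\<lambda>x. f x - h x) \<le> nrm1 (\<lambda>x. f x - g x) + nrm1 (\<lambda>x. g x - h x)"
proof -
  have "nrm1 (\<lambda>x. f x - h x) \<le> (\<integral>x. \<bar>f x - g x\<bar> + \<bar>g x - h x\<bar> \<partial>lborel)"
    using assms by (intro integral_mono) auto
  then show ?thesis using assms by simp
qed

locale L1_curve =
  fixes u :: "real \<Rightarrow> 'a::euclidean_space \<Rightarrow> real"
  assumes u_int: "\<And>t. 0 \<le> t \<Longrightarrow> integrable lborel (u t)"
    and u_cont: "\<And>t0. 0 \<le> t0 \<Longrightarrow> ((\<lambda>t. nrm1 (\<lambda>x. u t x - u t0 x)) \<longlongrightarrow> 0) (at t0 within {0..})"
begin

text \<open>The values are functions with an L1 distance and not points of a metric space type, so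
  the Lebesgue number argument is carried out by hand.\<close>

lemma uniformly_continuous:
  assumes e: "0 < e"
  obtains \<delta> where "0 < \<delta>" "\<And>s t. s \<in> {0..T} \<Longrightarrow> t \<in> {0..T} \<Longrightarrow> \<bar>s - t\<bar> < \<delta> \<Longrightarrow> nrm1 (\<lambda>x. u s x - u t x) < e"
proof -
  have "\<exists>d>0. \<forall>t\<ge>0. \<bar>t - t0\<bar> < d \<longrightarrow> nrm1 (\<lambda>x. u t x - u t0 x) < e / 2" if t0: "0 \<le> t0" for t0
  proof -
    obtain d where d: "d > 0" "\<And>t. t \<ge> 0 \<Longrightarrow> 0 < \<bar>t - t0\<bar> \<Longrightarrow> \<bar>t - t0\<bar> < d \<Longrightarrow> nrm1 (\<lambda>x. u t x - u t0 x) < e / 2"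
      using u_cont[OF t0] e unfolding Lim_within by (auto simp: dist_real_def dest!: spec[of _ "e/2"])
    have "nrm1 (\<lambda>x. u t x - u t0 x) < e / 2" if "t \<ge> 0" "\<bar>t - t0\<bar> < d" for t
      using d(2)[OF that(1)] that e by (cases "t = t0") auto
    then show ?thesis using d(1) by blast
  qed
  then obtain d where d: "\<And>t0. 0 \<le> t0 \<Longrightarrow> 0 < d t0" "\<And>t0 t. 0 \<le> t0 \<Longrightarrow> 0 \<le> t \<Longrightarrow> \<bar>t - t0\<bar> < d t0 \<Longrightarrow> nrm1 (\<lambda>x. u t x - u t0 x) < e / 2"
    by metis
  define \<G> where "\<G> = (\<lambda>t. ball t (d t)) ` {0..T}"
  have "{0..T} \<subseteq> \<Union>\<G>" unfolding \<G>_def using d(1) by fastforce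
  moreover have "\<And>G. G \<in> \<G> \<Longrightarrow> open G" by (auto simp: \<G>_def)
  ultimately obtain \<delta> where \<delta>: "0 < \<delta>" "\<And>t. t \<in> {0..T} \<Longrightarrow> \<exists>G\<in>\<G>. ball t \<delta> \<subseteq> G"
    using Heine_Borel_lemma[OF compact_Icc[of 0 T]] by metis
  have "nrm1 (\<lambda>x. u s x - u t x) < e" if st: "s \<in> {0..T}" "t \<in> {0..T}" "\<bar>s - t\<bar> < \<delta>" for s t
  proof -
    obtain r where r: "r \<in> {0..T}" "ball s \<delta> \<subseteq> ball r (d r)" using \<delta>(2)[OF st(1)] by (auto simp: \<G>_def)
    have "s \<in> ball r (d r)" "t \<in> ball r (d r)" using r(2) st(3) \<delta>(1) by (auto simp: subset_iff dist_real_def)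
    then have "\<bar>s - r\<bar> < d r" "\<bar>t - r\<bar> < d r" by (simp_all add: dist_real_def abs_minus_commute)
    then have 1: "nrm1 (\<lambda>x. u s x - u r x) < e / 2" "nrm1 (\<lambda>x. u t x - u r x) < e / 2"
      using d(2)[of r s] d(2)[of r t] st r(1) by simp_all
    have "nrm1 (\<lambda>x. u s x - u t x) \<le> nrm1 (\<lambda>x. u s x - u r x) + nrm1 (\<lambda>x. u r x - u t x)"
      using st r by (intro nrm1_diff_triangle u_int) auto
    also have "nrm1 (\<lambda>x. u r x - u t x) = nrm1 (\<lambda>x. u t x - u r x)" by (simp add: abs_minus_commute)
    finally show ?thesis using 1 by simp
  qed
  then show ?thesis using that \<delta>(1) by blast
qed

text \<open>A continuous curve in \<open>L\<^sup>1\<close> need not be jointly measurable in \<open>(t, x)\<close>, which Fubini requires.\<close>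
lemma measurable_version:
  obtains v where "(\<lambda>p. v (fst p) (snd p)) \<in> borel_measurable (lborel \<Otimes>\<^sub>M lborel)"
    "\<And>t. v t \<in> borel_measurable borel" "\<And>t. t \<in> {0..T} \<Longrightarrow> AE x in lborel. v t x = u t x"
proof -
  define Q where "Q = (\<lambda>n (N::nat). 0 < N \<and> (\<forall>s\<in>{0..T}. \<forall>t\<in>{0..T}. \<bar>s - t\<bar> \<le> 1 / N \<longrightarrow> nrm1 (\<lambda>x. u s x - u t x) < (1/2) ^ n))"
  have "\<exists>N. Q n N" for n :: nat
  proof -
    have "(0::real) < (1/2) ^ n" by simp
    then obtain \<delta> where \<delta>: "0 < \<delta>" "\<And>s t. s \<in> {0..T} \<Longrightarrow> t \<in> {0..T} \<Longrightarrow> \<bar>s - t\<bar> < \<delta> \<Longrightarrow> nrm1 (\<lambda>x. u s x - u t x) < (1/2) ^ n"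
      by (rule uniformly_continuous[where T=T]) blast
    obtain N where "1 / real (Suc N) < \<delta>" using nat_approx_posE[OF \<delta>(1)] .
    then have "nrm1 (\<lambda>x. u s x - u t x) < (1/2) ^ n" if "s \<in> {0..T}" "t \<in> {0..T}" "\<bar>s - t\<bar> \<le> 1 / real (Suc N)" for s t
      using \<delta>(2)[OF that(1,2)] that(3) by linarith
    then have "Q n (Suc N)" unfolding Q_def by simp
    then show ?thesis by blast
  qed
  then obtain N :: "nat \<Rightarrow> nat" where Q: "\<And>n. Q n (N n)" by metis
  have N: "0 < N n" "s \<in> {0..T} \<Longrightarrow> t \<in> {0..T} \<Longrightarrow> \<bar>s - t\<bar> \<le> 1 / N n \<Longrightarrow> nrm1 (\<lambda>x. u s x - u t x) < (1/2) ^ n" for n s t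
    using Q[of n] unfolding Q_def by simp_all
  \<comment> \<open>Piecewise constant interpolation on a grid of width \<open>1 / N n\<close>,
    within \<open>(1/2) ^ n\<close> of the curve in L1. These errors are summable, so for each
    \<open>t\<close> the interpolants converge almost everywhere.\<close>
  define w where "w = (\<lambda>(n::nat) (t::real) x. u (real (nat \<lfloor>t * N n\<rfloor>) / N n) x)"
  have um: "u (real k / N n) \<in> borel_measurable borel" for k n using u_int[of "real k / N n"] by auto
  have wm: "(\<lambda>p. w n (fst p) (snd p)) \<in> borel_measurable (lborel \<Otimes>\<^sub>M lborel)" for n
    unfolding w_def
  proof (rule measurable_compose_countable[where f="\<lambda>k p. u (real k / N n) (snd p)"])
    show "(\<lambda>p. u (real k / N n) (snd p)) \<in> borel_measurable (lborel \<Otimes>\<^sub>M lborel)" for k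
      using um[of k n] by measurable
    show "(\<lambda>p. nat \<lfloor>fst p * real (N n)\<rfloor>) \<in> lborel \<Otimes>\<^sub>M lborel \<rightarrow>\<^sub>M count_space UNIV"
      by measurable
  qed
  define v where "v = (\<lambda>t x. lim (\<lambda>n. w n t x))"
  show ?thesis
  proof (rule that[of v])
    show "(\<lambda>p. v (fst p) (snd p)) \<in> borel_measurable (lborel \<Otimes>\<^sub>M lborel)"
      unfolding v_def by (rule borel_measurable_lim_metric) (rule wm)
    show "v t \<in> borel_measurable borel" for t
      unfolding v_def by (rule borel_measurable_lim_metric) (simp add: w_def um)
    show "AE x in lborel. v t x = u t x" if t: "t \<in> {0..T}" for t
    proof -
      have wi: "integrable lborel (\<lambda>x. w n t x - u t x)" for n
        unfolding w_def using t by (intro Bochner_Integration.integrable_diff u_int) auto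
      have b: "nrm1 (\<lambda>x. w n t x - u t x) \<le> (1/2) ^ n" for n
      proof -
        have p: "0 < real (N n)" using N by simp
        have f: "real (nat \<lfloor>t * N n\<rfloor>) = of_int \<lfloor>t * N n\<rfloor>" using t by simp
        have le: "real (nat \<lfloor>t * N n\<rfloor>) / N n \<le> t" unfolding f using p by (simp add: divide_le_eq)
        have ge: "t - 1 / N n \<le> real (nat \<lfloor>t * N n\<rfloor>) / N n"
        proof -
          have "t * N n - 1 \<le> of_int \<lfloor>t * N n\<rfloor>" by linarith
          then have "(t * N n - 1) / N n \<le> of_int \<lfloor>t * N n\<rfloor> / N n" using p by (intro divide_right_mono) auto
          then show ?thesis unfolding f using p by (simp add: diff_divide_distrib)
        qed
        show ?thesis unfolding w_def
          by (rule less_imp_le, rule N(2)) (use t le ge in auto)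
      qed
      have "summable (\<lambda>n. nrm1 (\<lambda>x. w n t x - u t x))"
        by (rule summable_comparison_test'[of "\<lambda>n. (1/2) ^ n" 0]) (use b in \<open>auto simp: summable_geometric\<close>)
      from L1_series_AE[OF wi this] show ?thesis
      proof eventually_elim
        case (elim x)
        have "(\<lambda>n. w n t x - u t x) \<longlonglongrightarrow> 0" using summable_LIMSEQ_zero[OF summable_rabs_cancel[OF elim]] .
        then have "(\<lambda>n. w n t x) \<longlonglongrightarrow> u t x" by (simp add: LIM_zero_iff)
        then show ?case unfolding v_def by (rule limI)
      qed
    qed
  qed
qed

lemma nrm1_bounded:
  obtains M where "\<And>t. t \<in> {0..T} \<Longrightarrow> nrm1 (u t) \<le> M"
proof -
  have "continuous_on {0..T} (\<lambda>t. nrm1 (u t))"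
    unfolding continuous_on_iff
  proof (intro ballI allI impI)
    fix t0 e :: real assume t0: "t0 \<in> {0..T}" and e: "0 < e"
    obtain \<delta> where \<delta>: "0 < \<delta>" "\<And>s t. s \<in> {0..T} \<Longrightarrow> t \<in> {0..T} \<Longrightarrow> \<bar>s - t\<bar> < \<delta> \<Longrightarrow> nrm1 (\<lambda>x. u s x - u t x) < e"
      using uniformly_continuous[OF e] by blast
    have "\<bar>nrm1 (u t) - nrm1 (u t0)\<bar> < e" if t: "t \<in> {0..T}" "\<bar>t - t0\<bar> < \<delta>" for t
    proof -
      have i: "integrable lborel (u t)" "integrable lborel (u t0)" using t t0 u_int by auto
      have "\<bar>nrm1 (u t) - nrm1 (u t0)\<bar> = \<bar>\<integral>x. \<bar>u t x\<bar> - \<bar>u t0 x\<bar> \<partial>lborel\<bar>" using i by simp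
      also have "\<dots> \<le> (\<integral>x. \<bar>\<bar>u t x\<bar> - \<bar>u t0 x\<bar>\<bar> \<partial>lborel)" by (rule integral_abs_bound)
      also have "\<dots> \<le> nrm1 (\<lambda>x. u t x - u t0 x)" using i by (intro integral_mono) auto
      finally show ?thesis using \<delta>(2)[OF t(1) t0 t(2)] by simp
    qed
    then show "\<exists>d>0. \<forall>t\<in>{0..T}. dist t t0 < d \<longrightarrow> dist (nrm1 (u t)) (nrm1 (u t0)) < e"
      using \<delta>(1) by (auto simp: dist_real_def)
  qed
  then have "bounded ((\<lambda>t. nrm1 (u t)) ` {0..T})" by (intro compact_imp_bounded compact_continuous_image) auto
  then obtain M where "\<forall>x\<in>(\<lambda>t. nrm1 (u t)) ` {0..T}. norm x \<le> M" unfolding bounded_iff by blast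
  then show ?thesis by (intro that[of M]) force
qed

lemma fourier_curve_continuous:
  "continuous_on {0..T} (\<lambda>t. fourier (u t) (exp t *\<^sub>R \<eta>))"
  unfolding continuous_on_iff
proof (intro ballI allI impI)
  fix t0 e :: real assume t0: "t0 \<in> {0..T}" and e: "0 < e"
  then have e2: "0 < e / 2" by simp
  obtain \<delta> where \<delta>: "0 < \<delta>" "\<And>s t. s \<in> {0..T} \<Longrightarrow> t \<in> {0..T} \<Longrightarrow> \<bar>s - t\<bar> < \<delta> \<Longrightarrow> nrm1 (\<lambda>x. u s x - u t x) < e / 2"
    using uniformly_continuous[OF e2] by blast
  have i0: "integrable lborel (u t0)" using t0 u_int by auto
  have "continuous_on UNIV (\<lambda>t. fourier (u t0) (exp t *\<^sub>R \<eta>))"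
    by (intro continuous_on_compose2[OF fourier_continuous[OF i0, of UNIV]] continuous_intros) auto
  then obtain \<delta>' where \<delta>': "0 < \<delta>'" "\<And>t. \<bar>t - t0\<bar> < \<delta>' \<Longrightarrow> norm (fourier (u t0) (exp t *\<^sub>R \<eta>) - fourier (u t0) (exp t0 *\<^sub>R \<eta>)) < e / 2"
    using e2 unfolding continuous_on_iff by (metis UNIV_I dist_norm real_norm_def)
  have "dist (fourier (u t) (exp t *\<^sub>R \<eta>)) (fourier (u t0) (exp t0 *\<^sub>R \<eta>)) < e"
    if t: "t \<in> {0..T}" "\<bar>t - t0\<bar> < min \<delta> \<delta>'" for t
  proof -
    have i: "integrable lborel (u t)" using t u_int by auto
    have "norm (fourier (u t) (exp t *\<^sub>R \<eta>) - fourier (u t0) (exp t *\<^sub>R \<eta>)) \<le> nrm1 (\<lambda>x. u t x - u t0 x)"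
      using fourier_norm_le[of "\<lambda>x. u t x - u t0 x"] by (simp add: fourier_diff[OF i i0])
    also have "\<dots> < e / 2" using \<delta>(2)[OF t(1) t0] t(2) by simp
    finally show ?thesis using \<delta>'(2)[of t] t(2)
      norm_triangle_lt[of "fourier (u t) (exp t *\<^sub>R \<eta>) - fourier (u t0) (exp t *\<^sub>R \<eta>)" "fourier (u t0) (exp t *\<^sub>R \<eta>) - fourier (u t0) (exp t0 *\<^sub>R \<eta>)" e]
      by (simp add: dist_norm)
  qed
  then show "\<exists>d>0. \<forall>t\<in>{0..T}. dist t t0 < d \<longrightarrow> dist (fourier (u t) (exp t *\<^sub>R \<eta>)) (fourier (u t0) (exp t0 *\<^sub>R \<eta>)) < e"
    using \<delta>(1) \<delta>'(1) by (intro exI[of _ "min \<delta> \<delta>'"]) (auto simp: dist_real_def)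
qed

end

text \<open>Integrating factor. Uniqueness turns the mild equation on a characteristic into an
  explicit formula; the converse verifies that the formula solves the equation.\<close>

lemma linear_ode:
  fixes \<beta> w :: "real \<Rightarrow> complex"
  assumes \<beta>: "continuous_on {0..T} \<beta>" and T: "0 \<le> T"
  shows linear_ode_unique: "continuous_on {0..T} w \<Longrightarrow> (\<And>t. t \<in> {0..T} \<Longrightarrow> w t = w0 + integral {0..t} (\<lambda>\<tau>. \<beta> \<tau> * w \<tau>)) \<Longrightarrow>
      w T = w0 * exp (integral {0..T} \<beta>)"
    and linear_ode_solution: "(\<And>t. t \<in> {0..T} \<Longrightarrow> w t = w0 * exp (integral {0..t} \<beta>)) \<Longrightarrow>
      w T = w0 + integral {0..T} (\<lambda>\<tau>. \<beta> \<tau> * w \<tau>)"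
proof -
  have B: "((\<lambda>t. integral {0..t} \<beta>) has_vector_derivative \<beta> t) (at t within {0..T})" if "t \<in> {0..T}" for t
    by (rule integral_has_vector_derivative[OF \<beta> that])
  have E: "((\<lambda>t. exp (c * integral {0..t} \<beta>)) has_vector_derivative c * \<beta> t * exp (c * integral {0..t} \<beta>)) (at t within {0..T})"
    if "t \<in> {0..T}" for t and c :: complex
  proof -
    have "((\<lambda>t. c * integral {0..t} \<beta>) has_vector_derivative c * \<beta> t) (at t within {0..T})"
      by (rule has_vector_derivative_mult_right[OF B[OF that]])
    moreover have "(exp has_field_derivative exp (c * integral {0..t} \<beta>)) (at (c * integral {0..t} \<beta>) within S)" for S
      by (rule DERIV_subset[OF DERIV_exp]) simp
    ultimately show ?thesis using field_vector_diff_chain_within[of "\<lambda>t. c * integral {0..t} \<beta>" "c * \<beta> t" t "{0..T}" exp]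
      by (simp add: o_def)
  qed
  show "w T = w0 * exp (integral {0..T} \<beta>)"
    if w: "continuous_on {0..T} w" and eq: "\<And>t. t \<in> {0..T} \<Longrightarrow> w t = w0 + integral {0..t} (\<lambda>\<tau>. \<beta> \<tau> * w \<tau>)"
  proof -
    define z where "z = (\<lambda>t. w t * exp (- 1 * integral {0..t} \<beta>))"
    have "(z has_vector_derivative 0) (at t within {0..T})" if t: "t \<in> {0..T}" for t
    proof -
      have "((\<lambda>t. integral {0..t} (\<lambda>\<tau>. \<beta> \<tau> * w \<tau>)) has_vector_derivative \<beta> t * w t) (at t within {0..T})"
        by (rule integral_has_vector_derivative[OF _ t]) (intro continuous_intros \<beta> w)
      from has_vector_derivative_add[OF has_vector_derivative_const[of w0] this]
      have "((\<lambda>t. w0 + integral {0..t} (\<lambda>\<tau>. \<beta> \<tau> * w \<tau>)) has_vector_derivative \<beta> t * w t) (at t within {0..T})" by simp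
      then have "(w has_vector_derivative \<beta> t * w t) (at t within {0..T})"
        by (rule has_vector_derivative_transform[OF t, rotated]) (simp_all add: eq[symmetric])
      from has_vector_derivative_mult[OF this E[OF t, of "-1"]]
      show ?thesis unfolding z_def by (simp add: algebra_simps)
    qed
    then obtain c where c: "\<And>t. t \<in> {0..T} \<Longrightarrow> z t = c"
      using has_vector_derivative_zero_constant[of "{0..T}" z] by auto
    have "z 0 = w0" using eq[of 0] T by (simp add: z_def)
    then have "z T = w0" using c[of 0] c[of T] T by simp
    then have "w T * exp (- integral {0..T} \<beta>) * exp (integral {0..T} \<beta>) = w0 * exp (integral {0..T} \<beta>)" by (simp add: z_def)
    then show ?thesis by (simp add: mult.assoc exp_add[symmetric])
  qed
  show "w T = w0 + integral {0..T} (\<lambda>\<tau>. \<beta> \<tau> * w \<tau>)"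
    if eq: "\<And>t. t \<in> {0..T} \<Longrightarrow> w t = w0 * exp (integral {0..t} \<beta>)"
  proof -
    have "(w has_vector_derivative \<beta> t * w t) (at t within {0..T})" if t: "t \<in> {0..T}" for t
    proof -
      have "((\<lambda>t. w0 * exp (1 * integral {0..t} \<beta>)) has_vector_derivative w0 * (1 * \<beta> t * exp (1 * integral {0..t} \<beta>))) (at t within {0..T})"
        by (rule has_vector_derivative_mult_right[OF E[OF t, of 1]])
      then have "((\<lambda>t. w0 * exp (integral {0..t} \<beta>)) has_vector_derivative \<beta> t * w t) (at t within {0..T})"
        using eq[OF t] by (simp add: mult_ac)
      then show ?thesis by (rule has_vector_derivative_transform[OF t, rotated]) (simp_all add: eq)
    qed
    then have "((\<lambda>t. \<beta> t * w t) has_integral (w T - w 0)) {0..T}"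
      by (intro fundamental_theorem_of_calculus T)
    then show ?thesis using eq[of 0] T by (simp add: integral_unique)
  qed
qed

lemma integral_reverse:
  fixes g :: "real \<Rightarrow> 'b::euclidean_space"
  assumes "continuous_on UNIV g"
  shows "integral {0..T} (\<lambda>\<tau>. g (T - \<tau>)) = integral {0..T} g"
proof -
  have "integral {0..T} (\<lambda>\<tau>. g (T - \<tau>)) = integral {- T..0} (\<lambda>x. g (T + x))"
    using Henstock_Kurzweil_Integration.integral_reflect_real[of 0 "-T" "\<lambda>x. g (T + x)"] by simp
  also have "\<dots> = integral {0..T} g"
    using integral_shift[of "-T" T 0 g] continuous_on_subset[OF assms] by (simp add: o_def add.commute)
  finally show ?thesis .
qed

text \<open>The Duhamel formula expressed through \<open>dil\<close>; \<open>Tsg_eq_dil\<close>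
  identifies it with the right-hand side in \<open>mild_solution\<close>.\<close>

definition mild_rhs :: "('a::euclidean_space \<Rightarrow> real) \<Rightarrow> real \<Rightarrow> ('a \<Rightarrow> real) \<Rightarrow> (real \<Rightarrow> 'a \<Rightarrow> real) \<Rightarrow> real \<Rightarrow> 'a \<Rightarrow> real" where
  "mild_rhs j a u0 u t x = exp (- a * t) * dil t u0 x
     + a * (LINT \<tau>:{0..t}|lborel. exp (- a * (t - \<tau>)) * dil (t - \<tau>) (conv j (u \<tau>)) x)"

locale jump_curve = jump j a + L1_curve u
  for j :: "'a::euclidean_space \<Rightarrow> real" and a :: real and u :: "real \<Rightarrow> 'a \<Rightarrow> real" +
  fixes u0 :: "'a \<Rightarrow> real"
  assumes u0_int: "integrable lborel u0"
begin

lemma mild_rhs_facts: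
  fixes h :: "'a \<Rightarrow> 'b::{banach,second_countable_topology}"
  assumes t: "0 \<le> t"
  shows mild_rhs_integrable: "integrable lborel (mild_rhs j a u0 u t)"
    and mild_rhs_test: "h \<in> borel_measurable borel \<Longrightarrow> (\<And>x. norm (h x) \<le> C) \<Longrightarrow>
      (\<integral>x. mild_rhs j a u0 u t x *\<^sub>R h x \<partial>lborel) = exp (- a * t) *\<^sub>R (\<integral>x. u0 x *\<^sub>R h (exp (-t) *\<^sub>R x) \<partial>lborel)
        + a *\<^sub>R (LINT \<tau>:{0..t}|lborel. exp (- a * (t - \<tau>)) *\<^sub>R (\<integral>x. conv j (u \<tau>) x *\<^sub>R h (exp (- (t - \<tau>)) *\<^sub>R x) \<partial>lborel))"
proof -
  obtain v where v: "(\<lambda>p. v (fst p) (snd p)) \<in> borel_measurable (lborel \<Otimes>\<^sub>M lborel)"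
    "\<And>s. v s \<in> borel_measurable borel" "\<And>s. s \<in> {0..t} \<Longrightarrow> AE x in lborel. v s x = u s x"
    by (rule measurable_version[of t]) blast
  obtain M where M: "\<And>s. s \<in> {0..t} \<Longrightarrow> nrm1 (u s) \<le> M" by (rule nrm1_bounded[of t]) blast
  \<comment> \<open>Convolution does not see null sets, so the jointly measurable \<open>v\<close>
    can replace \<open>u\<close> without altering the mild formula at any point.\<close>
  have cv: "conv j (v s) = conv j (u s)" if "s \<in> {0..t}" for s
    by (rule ext, rule conv_cong_AE_right) (use v that u_int[of s] in auto)
  have u0m: "u0 \<in> borel_measurable borel" using u0_int by auto
  define \<phi> where "\<phi> = (\<lambda>s x. exp (- a * (t - s)) * dil (t - s) (conv j (v s)) x)"
  have eq: "(LINT \<tau>:{0..t}|lborel. exp (- a * (t - \<tau>)) * dil (t - \<tau>) (conv j (u \<tau>)) x) = (LINT \<tau>:{0..t}|lborel. \<phi> \<tau> x)" for x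
    by (rule set_lebesgue_integral_cong) (auto simp: \<phi>_def cv)
  have pm: "(\<lambda>p. \<phi> (fst p) (snd p)) \<in> borel_measurable (lborel \<Otimes>\<^sub>M lborel)"
  proof -
    have v2: "(\<lambda>q. v (fst (fst q)) (snd q)) \<in> borel_measurable ((lborel \<Otimes>\<^sub>M lborel) \<Otimes>\<^sub>M lborel)"
    proof -
      have "(\<lambda>q. (fst (fst q), snd q)) \<in> (lborel \<Otimes>\<^sub>M lborel) \<Otimes>\<^sub>M lborel \<rightarrow>\<^sub>M (lborel :: real measure) \<Otimes>\<^sub>M (lborel :: 'a measure)"
        by measurable
      from measurable_compose[OF this v(1)] show ?thesis by simp
    qed
    have "(\<lambda>(p,y). j (exp (t - fst p) *\<^sub>R snd p - y) * v (fst p) y) \<in> borel_measurable ((lborel \<Otimes>\<^sub>M lborel) \<Otimes>\<^sub>M lborel)"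
      unfolding split_beta' using v2 by measurable
    then have "(\<lambda>p. \<integral>y. j (exp (t - fst p) *\<^sub>R snd p - y) * v (fst p) y \<partial>lborel) \<in> borel_measurable (lborel \<Otimes>\<^sub>M lborel)"
      by (rule lborel.borel_measurable_lebesgue_integral)
    then show ?thesis unfolding \<phi>_def dil_def conv_def by measurable
  qed
  have ci: "integrable lborel (conv j (u s))" if "s \<in> {0..t}" for s
    using that u_int by (intro conv_integrable j_int) auto
  have pi: "integrable lborel (\<phi> s)" if "s \<in> {0..t}" for s
    unfolding \<phi>_def cv[OF that] using ci[OF that] by (intro integrable_mult_right dil_integrable)
  have pM: "nrm1 (\<phi> s) \<le> M" if s: "s \<in> {0..t}" for s
  proof -
    have cm: "conv j (u s) \<in> borel_measurable borel" using ci[OF s] by auto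
    have "nrm1 (\<phi> s) = exp (- a * (t - s)) * nrm1 (conv j (u s))"
      unfolding \<phi>_def cv[OF s] by (simp add: abs_mult nrm1_dil[OF cm])
    also have "\<dots> \<le> 1 * (nrm1 j * nrm1 (u s))"
      using s a by (intro mult_mono nrm1_conv_le j_int u_int) (auto simp: mult_nonneg_nonneg)
    also have "\<dots> \<le> M" using M[OF s] j_nrm1 by simp
    finally show ?thesis .
  qed
  have ti1: "integrable lborel (\<lambda>x. LINT \<tau>:{0..t}|lborel. \<phi> \<tau> x)"
    by (rule time_integral_integrable[OF pm pi pM])
  have rhs: "mild_rhs j a u0 u t = (\<lambda>x. exp (- a * t) * dil t u0 x + a * (LINT \<tau>:{0..t}|lborel. \<phi> \<tau> x))"
    by (rule ext) (simp only: mild_rhs_def eq)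
  show "integrable lborel (mild_rhs j a u0 u t)"
    unfolding rhs using ti1 dil_integrable[OF u0_int] by simp
  assume h[measurable]: "h \<in> borel_measurable borel" and hC: "\<And>x. norm (h x) \<le> C"
  have hint: "integrable lborel (\<lambda>x. f x *\<^sub>R h x)" if "integrable lborel f" for f :: "'a \<Rightarrow> real"
  proof (rule Bochner_Integration.integrable_bound[OF integrable_mult_left[OF that, of C]])
    have "f \<in> borel_measurable borel" using that by auto
    then show "(\<lambda>x. f x *\<^sub>R h x) \<in> borel_measurable lborel" by measurable
    show "AE x in lborel. norm (f x *\<^sub>R h x) \<le> norm (f x * C)"
      using hC by (auto simp: abs_mult intro!: mult_left_mono order_trans[OF hC])
  qed
  have "(\<integral>x. mild_rhs j a u0 u t x *\<^sub>R h x \<partial>lborel) =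
    (\<integral>x. exp (- a * t) *\<^sub>R (dil t u0 x *\<^sub>R h x) + a *\<^sub>R ((LINT \<tau>:{0..t}|lborel. \<phi> \<tau> x) *\<^sub>R h x) \<partial>lborel)"
    unfolding rhs by (simp add: scaleR_add_left)
  also have "\<dots> = exp (- a * t) *\<^sub>R (\<integral>x. dil t u0 x *\<^sub>R h x \<partial>lborel) + a *\<^sub>R (\<integral>x. (LINT \<tau>:{0..t}|lborel. \<phi> \<tau> x) *\<^sub>R h x \<partial>lborel)"
    using hint[OF dil_integrable[OF u0_int, of t]] hint[OF ti1]
    by (simp only: Bochner_Integration.integral_add integrable_scaleR_right integral_scaleR_right)
  also have "(\<integral>x. dil t u0 x *\<^sub>R h x \<partial>lborel) = (\<integral>x. u0 x *\<^sub>R h (exp (-t) *\<^sub>R x) \<partial>lborel)"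
    by (rule integral_dil[OF u0m h])
  also have "(\<integral>x. (LINT \<tau>:{0..t}|lborel. \<phi> \<tau> x) *\<^sub>R h x \<partial>lborel) = (LINT \<tau>:{0..t}|lborel. (\<integral>x. \<phi> \<tau> x *\<^sub>R h x \<partial>lborel))"
    by (rule time_integral_test[OF pm pi pM h hC])
  also have "\<dots> = (LINT \<tau>:{0..t}|lborel. exp (- a * (t - \<tau>)) *\<^sub>R (\<integral>x. conv j (u \<tau>) x *\<^sub>R h (exp (- (t - \<tau>)) *\<^sub>R x) \<partial>lborel))"
  proof (rule set_lebesgue_integral_cong)
    show "\<forall>s. s \<in> {0..t} \<longrightarrow> (\<integral>x. \<phi> s x *\<^sub>R h x \<partial>lborel) = exp (- a * (t - s)) *\<^sub>R (\<integral>x. conv j (u s) x *\<^sub>R h (exp (- (t - s)) *\<^sub>R x) \<partial>lborel)"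
    proof (intro allI impI)
      fix s assume s: "s \<in> {0..t}"
      have cm: "conv j (u s) \<in> borel_measurable borel" using ci[OF s] by auto
      have "(\<integral>x. \<phi> s x *\<^sub>R h x \<partial>lborel) = (\<integral>x. exp (- a * (t - s)) *\<^sub>R (dil (t - s) (conv j (u s)) x *\<^sub>R h x) \<partial>lborel)"
        unfolding \<phi>_def cv[OF s] by simp
      then show "(\<integral>x. \<phi> s x *\<^sub>R h x \<partial>lborel) = exp (- a * (t - s)) *\<^sub>R (\<integral>x. conv j (u s) x *\<^sub>R h (exp (- (t - s)) *\<^sub>R x) \<partial>lborel)"
        unfolding integral_scaleR_right integral_dil[OF cm h] .
    qed
  qed simp
  finally show "(\<integral>x. mild_rhs j a u0 u t x *\<^sub>R h x \<partial>lborel) = exp (- a * t) *\<^sub>R (\<integral>x. u0 x *\<^sub>R h (exp (-t) *\<^sub>R x) \<partial>lborel)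
        + a *\<^sub>R (LINT \<tau>:{0..t}|lborel. exp (- a * (t - \<tau>)) *\<^sub>R (\<integral>x. conv j (u \<tau>) x *\<^sub>R h (exp (- (t - \<tau>)) *\<^sub>R x) \<partial>lborel))" .
qed

text \<open>On the characteristic \<open>exp t *\<^sub>R \<eta>\<close>, and after multiplication by
  \<open>exp (a * t)\<close>, the mild equation becomes the scalar integral equation of
  \<open>linear_ode\<close>, with \<open>\<eta>\<close> as a parameter.\<close>

lemma mild_rhs_fourier:
  assumes t: "0 \<le> t"
  shows "exp (of_real (a * t)) * fourier (mild_rhs j a u0 u t) (exp t *\<^sub>R \<eta>) = fourier u0 \<eta> +
    integral {0..t} (\<lambda>\<tau>. (a * fourier j (exp \<tau> *\<^sub>R \<eta>)) * (exp (of_real (a * \<tau>)) * fourier (u \<tau>) (exp \<tau> *\<^sub>R \<eta>)))"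
proof -
  let ?h = "\<lambda>x. cis (- (x \<bullet> (exp t *\<^sub>R \<eta>)))"
  let ?g = "\<lambda>\<tau>. (a * fourier j (exp \<tau> *\<^sub>R \<eta>)) * (exp (of_real (a * \<tau>)) * fourier (u \<tau>) (exp \<tau> *\<^sub>R \<eta>))"
  have gc: "continuous_on {0..t} ?g"
    by (intro continuous_intros fourier_curve_continuous continuous_on_compose2[OF fourier_continuous[OF j_int, of UNIV]]) auto
  have sc: "(exp (- s) *\<^sub>R x) \<bullet> (exp t *\<^sub>R \<eta>) = x \<bullet> (exp (t - s) *\<^sub>R \<eta>)" for x and s
    by (simp add: exp_minus exp_diff field_simps)
  have "fourier (mild_rhs j a u0 u t) (exp t *\<^sub>R \<eta>) = exp (- a * t) *\<^sub>R fourier u0 \<eta>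
     + a *\<^sub>R (LINT \<tau>:{0..t}|lborel. exp (- a * (t - \<tau>)) *\<^sub>R fourier (conv j (u \<tau>)) (exp \<tau> *\<^sub>R \<eta>))"
    unfolding fourier_alt by (subst mild_rhs_test[OF t, of ?h 1], simp, simp) (simp only: sc, simp)
  also have "(LINT \<tau>:{0..t}|lborel. exp (- a * (t - \<tau>)) *\<^sub>R fourier (conv j (u \<tau>)) (exp \<tau> *\<^sub>R \<eta>))
     = (LINT \<tau>:{0..t}|lborel. (exp (- complex_of_real (a * t)) / complex_of_real a) * ?g \<tau>)"
  proof (rule set_lebesgue_integral_cong)
    show "\<forall>s. s \<in> {0..t} \<longrightarrow> exp (- a * (t - s)) *\<^sub>R fourier (conv j (u s)) (exp s *\<^sub>R \<eta>) = (exp (- complex_of_real (a * t)) / complex_of_real a) * ?g s"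
    proof (intro allI impI)
      fix s assume "s \<in> {0..t}"
      then have i: "integrable lborel (u s)" using u_int by auto
      have "complex_of_real (exp (- a * (t - s))) = exp (- of_real (a * t)) * exp (of_real (a * s))"
        by (simp add: exp_add[symmetric] algebra_simps flip: exp_of_real)
      then show "exp (- a * (t - s)) *\<^sub>R fourier (conv j (u s)) (exp s *\<^sub>R \<eta>) = (exp (- complex_of_real (a * t)) / complex_of_real a) * ?g s"
        by (simp only: fourier_conv[OF j_int i] scaleR_conv_of_real) (use a in \<open>simp add: field_simps\<close>)
    qed
  qed simp
  also have "\<dots> = exp (- complex_of_real (a * t)) / complex_of_real a * integral {0..t} ?g"
  proof -
    have "(LINT \<tau>:{0..t}|lborel. (exp (- complex_of_real (a * t)) / complex_of_real a) * ?g \<tau>)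
      = integral {0..t} (\<lambda>\<tau>. (exp (- complex_of_real (a * t)) / complex_of_real a) * ?g \<tau>)"
      by (rule set_lborel_eq_integral) (intro continuous_on_mult continuous_on_const gc)
    then show ?thesis by (simp only: Henstock_Kurzweil_Integration.integral_mult_right)
  qed
  finally have "fourier (mild_rhs j a u0 u t) (exp t *\<^sub>R \<eta>) = exp (- of_real (a * t)) * (fourier u0 \<eta> + integral {0..t} ?g)"
    using a by (simp add: scaleR_conv_of_real distrib_left flip: exp_of_real)
  then show ?thesis by (simp add: mult.assoc[symmetric] exp_add[symmetric])
qed

text \<open>The exponent seen from the starting frequency \<open>\<eta>\<close> instead of the final
  one; reversing time turns the backward characteristic into the forward one.\<close>

lemma A_forward: "exp (of_real (a * t)) * exp (- A t (exp t *\<^sub>R \<eta>)) = exp (integral {0..t} (\<lambda>\<tau>. a * fourier j (exp \<tau> *\<^sub>R \<eta>)))" if "0 \<le> t"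
proof -
  have c: "continuous_on S (\<lambda>\<tau>. fourier j (exp \<tau> *\<^sub>R \<eta>))" for S
    by (intro continuous_intros continuous_on_compose2[OF fourier_continuous[OF j_int, of UNIV]]) auto
  have "A t (exp t *\<^sub>R \<eta>) = a *\<^sub>R integral {0..t} (\<lambda>\<tau>. 1 - fourier j (exp (t - \<tau>) *\<^sub>R \<eta>))"
    unfolding A_def by (simp add: exp_add[symmetric])
  also have "integral {0..t} (\<lambda>\<tau>. 1 - fourier j (exp (t - \<tau>) *\<^sub>R \<eta>)) = integral {0..t} (\<lambda>\<tau>. 1 - fourier j (exp \<tau> *\<^sub>R \<eta>))"
    by (rule integral_reverse[of "\<lambda>\<tau>. 1 - fourier j (exp \<tau> *\<^sub>R \<eta>)"]) (intro continuous_intros c)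
  also have "\<dots> = of_real t - integral {0..t} (\<lambda>\<tau>. fourier j (exp \<tau> *\<^sub>R \<eta>))"
    using that by (subst Henstock_Kurzweil_Integration.integral_diff) (auto intro!: integrable_continuous_interval c simp: scaleR_conv_of_real)
  finally have "of_real (a * t) + - A t (exp t *\<^sub>R \<eta>) = integral {0..t} (\<lambda>\<tau>. a * fourier j (exp \<tau> *\<^sub>R \<eta>))"
    by (simp add: scaleR_conv_of_real algebra_simps)
  then show ?thesis by (simp only: exp_add[symmetric])
qed

text \<open>On each characteristic the scalar equation has only one continuous solution; the
  continuity needed here comes from the L1 continuity of the curve.\<close>

lemma mild_imp_ev:
  assumes mild: "\<And>t. 0 \<le> t \<Longrightarrow> AE x in lborel. u t x = mild_rhs j a u0 u t x" and t: "0 \<le> t"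
  shows "ev t u0 (u t)"
proof -
  have "fourier (u t) \<xi> = fourier u0 (exp (- t) *\<^sub>R \<xi>) * exp (- A t \<xi>)" for \<xi>
  proof -
    define \<eta> where "\<eta> = exp (- t) *\<^sub>R \<xi>"
    have \<xi>: "\<xi> = exp t *\<^sub>R \<eta>" by (simp add: \<eta>_def exp_add[symmetric])
    let ?w = "\<lambda>t. exp (of_real (a * t)) * fourier (u t) (exp t *\<^sub>R \<eta>)"
    have eq: "?w s = fourier u0 \<eta> + integral {0..s} (\<lambda>\<tau>. (a * fourier j (exp \<tau> *\<^sub>R \<eta>)) * ?w \<tau>)" if "s \<in> {0..t}" for s
    proof -
      have s: "0 \<le> s" using that by simp
      have "fourier (u s) (exp s *\<^sub>R \<eta>) = fourier (mild_rhs j a u0 u s) (exp s *\<^sub>R \<eta>)"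
        by (rule fourier_cong_AE) (use mild[OF s] u_int[OF s] mild_rhs_integrable[OF s] in auto)
      then show ?thesis using mild_rhs_fourier[OF s, of \<eta>] by simp
    qed
    have "?w t = fourier u0 \<eta> * exp (integral {0..t} (\<lambda>\<tau>. a * fourier j (exp \<tau> *\<^sub>R \<eta>)))"
      by (rule linear_ode_unique[OF _ t _ eq])
         (intro continuous_intros fourier_curve_continuous continuous_on_compose2[OF fourier_continuous[OF j_int, of UNIV]]; simp)+
    then have "exp (of_real (a * t)) * fourier (u t) \<xi> = exp (of_real (a * t)) * (fourier u0 \<eta> * exp (- A t \<xi>))"
      unfolding \<xi> A_forward[OF t, symmetric] by (simp add: mult_ac)
    then show ?thesis unfolding \<eta>_def by simp
  qed
  then show ?thesis unfolding ev_def using u0_int u_int[OF t] by simp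
qed

text \<open>The explicit formula solves the scalar equation on every characteristic, and injectivity
  of the transform leads back to functions.\<close>

lemma ev_imp_mild:
  assumes ev: "\<And>t. 0 \<le> t \<Longrightarrow> ev t u0 (u t)" and t: "0 \<le> t"
  shows "AE x in lborel. u t x = mild_rhs j a u0 u t x"
proof (rule fourier_inject[OF u_int[OF t] mild_rhs_integrable[OF t]])
  fix \<xi> :: 'a
  define \<eta> where "\<eta> = exp (- t) *\<^sub>R \<xi>"
  have \<xi>: "\<xi> = exp t *\<^sub>R \<eta>" by (simp add: \<eta>_def exp_add[symmetric])
  let ?w = "\<lambda>t. exp (of_real (a * t)) * fourier (u t) (exp t *\<^sub>R \<eta>)"
  have eq: "?w s = fourier u0 \<eta> * exp (integral {0..s} (\<lambda>\<tau>. a * fourier j (exp \<tau> *\<^sub>R \<eta>)))" if "s \<in> {0..t}" for s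
  proof -
    have s: "0 \<le> s" using that by simp
    have "fourier (u s) (exp s *\<^sub>R \<eta>) = fourier u0 \<eta> * exp (- A s (exp s *\<^sub>R \<eta>))"
      using ev[OF s] by (simp add: ev_def exp_add[symmetric])
    then show ?thesis unfolding A_forward[OF s, symmetric] by (simp add: mult_ac)
  qed
  have "?w t = fourier u0 \<eta> + integral {0..t} (\<lambda>\<tau>. (a * fourier j (exp \<tau> *\<^sub>R \<eta>)) * ?w \<tau>)"
    by (rule linear_ode_solution[OF _ t eq])
       (intro continuous_intros continuous_on_compose2[OF fourier_continuous[OF j_int, of UNIV]]; simp)+
  also have "\<dots> = exp (of_real (a * t)) * fourier (mild_rhs j a u0 u t) (exp t *\<^sub>R \<eta>)"
    by (rule mild_rhs_fourier[OF t, symmetric])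
  finally show "fourier (u t) \<xi> = fourier (mild_rhs j a u0 u t) \<xi>" unfolding \<xi> by simp
qed

end

section \<open>Test functions and weak equilibria\<close>

text \<open>For \<open>m = 0\<close> the classical smooth function that is flat at 0. Powers of
  \<open>1 / y\<close> are what differentiation produces, so the derivatives stay in the linear span
  of the family.\<close>

definition flat_exp :: "nat \<Rightarrow> real \<Rightarrow> real" where
  "flat_exp m y = (if y \<le> 0 then 0 else exp (- (1 / y)) * (1 / y) ^ m)"

lemma flat_exp_le:
  assumes "0 < y"
  shows "flat_exp m y \<le> fact (m + 2) * y\<^sup>2"
proof -
  have "exp (- (1 / y)) * (1 / y) ^ (m + 2) \<le> fact (m + 2)" using assms by (intro power_exp_minus_le) auto
  then have "exp (- (1 / y)) * (1 / y) ^ (m + 2) * y\<^sup>2 \<le> fact (m + 2) * y\<^sup>2" by (rule mult_right_mono) simp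
  also have "exp (- (1 / y)) * (1 / y) ^ (m + 2) * y\<^sup>2 = flat_exp m y"
    using assms by (simp add: flat_exp_def power_add power_divide power2_eq_square)
  finally show ?thesis .
qed

lemma flat_exp_deriv:
  "(flat_exp m has_real_derivative (flat_exp (m + 2) y - real m * flat_exp (m + 1) y)) (at y)"
proof -
  consider "y < 0" | "y = 0" | "0 < y" by linarith
  then show ?thesis
  proof cases
    case 1
    have "((\<lambda>_. 0) has_real_derivative 0) (at y)" by simp
    then have "(flat_exp m has_real_derivative 0) (at y)"
      by (rule has_field_derivative_transform_within_open[where S="{..<0}"]) (use 1 in \<open>auto simp: flat_exp_def\<close>)
    then show ?thesis using 1 by (simp add: flat_exp_def)
  next
    case 3
    have "((\<lambda>y. exp (- (1 / y)) * (1 / y) ^ m) has_real_derivative (flat_exp (m + 2) y - real m * flat_exp (m + 1) y)) (at y)"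
    proof -
      have i: "((\<lambda>y. 1 / y) has_real_derivative - ((1 / y)\<^sup>2)) (at y)"
        using 3 by (auto intro!: derivative_eq_intros simp: power2_eq_square)
      have e: "((\<lambda>y. exp (- (1 / y))) has_real_derivative exp (- (1 / y)) * (1 / y)\<^sup>2) (at y)"
        using DERIV_fun_exp[OF DERIV_minus[OF i]] by simp
      have eq: "real m * (- ((1 / y)\<^sup>2) * (1 / y) ^ (m - Suc 0)) = - (real m * (1 / y) ^ (m + 1))"
        by (cases m) (simp_all add: power2_eq_square)
      show ?thesis
        by (rule DERIV_cong[OF DERIV_mult[OF e DERIV_power[OF i, of m]]], unfold eq)
           (use 3 in \<open>simp add: flat_exp_def power_add power2_eq_square algebra_simps\<close>)
    qed
    then show ?thesis
      by (rule has_field_derivative_transform_within_open[where S="{0<..}"]) (use 3 in \<open>auto simp: flat_exp_def\<close>)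
  next
    case 2
    have f0: "flat_exp n 0 = 0" for n by (simp add: flat_exp_def)
    \<comment> \<open>The quadratic bound \<open>flat_exp_le\<close> makes the difference quotient
      at 0 tend to 0.\<close>
    have "((\<lambda>h. flat_exp m h / h) \<longlongrightarrow> 0) (at 0)"
    proof (rule Lim_null_comparison)
      have "norm (flat_exp m h / h) \<le> fact (m + 2) * \<bar>h\<bar>" if "h \<noteq> 0" for h
      proof (cases "h \<le> 0")
        case False
        then have "flat_exp m h / h \<le> fact (m + 2) * h" using flat_exp_le[of h m] by (simp add: divide_le_eq power2_eq_square)
        moreover have "0 \<le> flat_exp m h / h" using False by (simp add: flat_exp_def)
        ultimately show ?thesis using False by simp
      next
        case True
        then have "flat_exp m h / h = 0" by (simp add: flat_exp_def)
        then show ?thesis by (simp only: norm_zero) (intro mult_nonneg_nonneg fact_ge_zero abs_ge_zero)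
      qed
      then show "\<forall>\<^sub>F h in at 0. norm (flat_exp m h / h) \<le> fact (m + 2) * \<bar>h\<bar>"
        by (auto simp: eventually_at_filter)
      show "((\<lambda>h. fact (m + 2) * \<bar>h\<bar>) \<longlongrightarrow> (0::real)) (at 0)" by (auto intro!: tendsto_eq_intros)
    qed
    then show ?thesis unfolding 2 by (simp add: has_field_derivative_iff f0)
  qed
qed

text \<open>A class of smooth functions that contains a bump function and is visibly closed under partial derivatives.\<close>
inductive_set smooth_class :: "('a::euclidean_space \<Rightarrow> real) set" where
  const: "(\<lambda>_. c) \<in> smooth_class"
| inner: "(\<lambda>x. x \<bullet> b) \<in> smooth_class"
| add: "f \<in> smooth_class \<Longrightarrow> g \<in> smooth_class \<Longrightarrow> (\<lambda>x. f x + g x) \<in> smooth_class"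
| mult: "f \<in> smooth_class \<Longrightarrow> g \<in> smooth_class \<Longrightarrow> (\<lambda>x. f x * g x) \<in> smooth_class"
| flat: "(\<lambda>x. flat_exp m (1 - x \<bullet> x)) \<in> smooth_class"

lemma smooth_class_derivative:
  assumes "f \<in> smooth_class"
  shows "\<exists>f'. (\<forall>x. (f has_derivative f' x) (at x)) \<and> (\<forall>i. (\<lambda>x. f' x i) \<in> smooth_class)"
  using assms
proof induction
  case (const c)
  show ?case by (rule exI[of _ "\<lambda>x i. 0"]) (auto intro: smooth_class.const)
next
  case (inner b)
  show ?case
    by (rule exI[of _ "\<lambda>x i. i \<bullet> b"]) (auto intro!: smooth_class.const derivative_eq_intros)
next
  case (add f g)
  then obtain f' g' where "\<And>x. (f has_derivative f' x) (at x)" "\<And>i. (\<lambda>x. f' x i) \<in> smooth_class"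
    "\<And>x. (g has_derivative g' x) (at x)" "\<And>i. (\<lambda>x. g' x i) \<in> smooth_class" by blast
  then show ?case by (intro exI[of _ "\<lambda>x i. f' x i + g' x i"]) (auto intro!: smooth_class.add has_derivative_add)
next
  case (mult f g)
  then obtain f' g' where "\<And>x. (f has_derivative f' x) (at x)" "\<And>i. (\<lambda>x. f' x i) \<in> smooth_class"
    "\<And>x. (g has_derivative g' x) (at x)" "\<And>i. (\<lambda>x. g' x i) \<in> smooth_class" by blast
  then show ?case using mult by (intro exI[of _ "\<lambda>x i. f x * g' x i + f' x i * g x"]) (auto intro!: smooth_class.add smooth_class.mult has_derivative_mult)
next
  case (flat m)
  have "((\<lambda>x. flat_exp m (1 - x \<bullet> x)) has_derivative (\<lambda>i. (flat_exp (m + 2) (1 - x \<bullet> x) + (- real m) * flat_exp (m + 1) (1 - x \<bullet> x)) * ((-2) * (x \<bullet> i)))) (at x)" for x :: 'a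
  proof -
    have "((\<lambda>x. 1 - x \<bullet> x) has_derivative (\<lambda>i. (-2) * (x \<bullet> i))) (at x)"
      by (auto intro!: derivative_eq_intros simp: inner_commute)
    from has_derivative_compose[OF this flat_exp_deriv[of m "1 - x \<bullet> x", unfolded has_field_derivative_def]]
    show ?thesis by (simp add: algebra_simps)
  qed
  then show ?case
    by (intro exI[of _ "\<lambda>x i. (flat_exp (m + 2) (1 - x \<bullet> x) + (- real m) * flat_exp (m + 1) (1 - x \<bullet> x)) * ((-2) * (x \<bullet> i))"])
       (intro conjI allI smooth_class.intros)
qed

lemma smooth_class_Ck: "f \<in> smooth_class \<Longrightarrow> Ck n f"
proof (induction n arbitrary: f)
  case 0
  then obtain f' where "\<And>x. (f has_derivative f' x) (at x)" using smooth_class_derivative by blast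
  then have "isCont f x" for x using has_derivative_continuous by blast
  then show ?case by (simp add: continuous_at_imp_continuous_on)
next
  case (Suc n)
  then obtain f' where f': "\<And>x. (f has_derivative f' x) (at x)" "\<And>i. (\<lambda>x. f' x i) \<in> smooth_class"
    using smooth_class_derivative by blast
  have "frechet_derivative f (at x) = f' x" for x using frechet_derivative_at[OF f'(1)] by simp
  then show ?case using f' Suc.IH by (auto simp: differentiable_def)
qed

text \<open>The outer factor \<open>b\<close> takes up the \<open>c\<close> that the chain rule
  produces at each differentiation, so that the induction closes.\<close>

lemma Ck_affine:
  fixes f :: "'a::euclidean_space \<Rightarrow> real"
  assumes "Ck n f"
  shows "Ck n (\<lambda>x. b * f (c *\<^sub>R x + d))"
  using assms
proof (induction n arbitrary: f b)
  case 0
  then show ?case by (auto intro!: continuous_intros continuous_on_compose2[of UNIV f])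
next
  case (Suc n)
  have f': "(f has_derivative frechet_derivative f (at y)) (at y)" for y
    using Suc.prems by (simp add: frechet_derivative_works)
  have der: "((\<lambda>x. b * f (c *\<^sub>R x + d)) has_derivative (\<lambda>i. b * frechet_derivative f (at (c *\<^sub>R x + d)) (c *\<^sub>R i))) (at x)" for x
  proof -
    have "((\<lambda>x. c *\<^sub>R x + d) has_derivative (\<lambda>i. c *\<^sub>R i)) (at x)" by (auto intro!: derivative_eq_intros)
    from has_derivative_mult_right[OF has_derivative_compose[OF this f']] show ?thesis by simp
  qed
  have eq: "frechet_derivative (\<lambda>x. b * f (c *\<^sub>R x + d)) (at x) i = (b * c) * frechet_derivative f (at (c *\<^sub>R x + d)) i" for x i
  proof -
    have "linear (frechet_derivative f (at y))" for y using f' has_derivative_linear by blast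
    then show ?thesis using frechet_derivative_at[OF der[of x], symmetric] by (simp add: linear_scale)
  qed
  have "Ck n (\<lambda>x. frechet_derivative (\<lambda>x. b * f (c *\<^sub>R x + d)) (at x) i)" if "i \<in> Basis" for i
    unfolding eq using Suc.IH[of "\<lambda>x. frechet_derivative f (at x) i" "b * c"] Suc.prems that by simp
  moreover have "(\<lambda>x. b * f (c *\<^sub>R x + d)) differentiable (at x)" for x using der unfolding differentiable_def by blast
  ultimately show ?case unfolding Ck.simps by blast
qed

lemma test_fun_affine:
  fixes \<phi> :: "'a::euclidean_space \<Rightarrow> real"
  assumes \<phi>: "test_fun \<phi>" and c: "c \<noteq> 0"
  shows "test_fun (\<lambda>x. \<phi> (c *\<^sub>R x + d))"
  unfolding test_fun_def
proof
  show "\<forall>n. Ck n (\<lambda>x. \<phi> (c *\<^sub>R x + d))" using Ck_affine[of _ \<phi> 1 c d] \<phi> by (simp add: test_fun_def)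
  let ?S = "closure {x. \<phi> x \<noteq> 0}"
  have cS: "compact ((\<lambda>y. (1 / c) *\<^sub>R (y - d)) ` ?S)"
    using \<phi> unfolding test_fun_def by (intro compact_continuous_image continuous_intros) auto
  have "{x. \<phi> (c *\<^sub>R x + d) \<noteq> 0} \<subseteq> (\<lambda>y. (1 / c) *\<^sub>R (y - d)) ` ?S"
  proof
    fix x assume "x \<in> {x. \<phi> (c *\<^sub>R x + d) \<noteq> 0}"
    then have "c *\<^sub>R x + d \<in> ?S" using closure_subset[of "{x. \<phi> x \<noteq> 0}"] by auto
    moreover have "x = (1 / c) *\<^sub>R ((c *\<^sub>R x + d) - d)" using c by simp
    ultimately show "x \<in> (\<lambda>y. (1 / c) *\<^sub>R (y - d)) ` ?S" by blast
  qed
  then show "compact (closure {x. \<phi> (c *\<^sub>R x + d) \<noteq> 0})"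
    using cS by (meson bounded_subset closure_minimal compact_closure compact_imp_bounded)
qed

context
  fixes \<phi> :: "'a::euclidean_space \<Rightarrow> real"
  assumes \<phi>: "test_fun \<phi>"
begin

lemma test_fun_has_derivative: "(\<phi> has_derivative frechet_derivative \<phi> (at x)) (at x)"
proof -
  have "Ck (Suc 0) \<phi>" using \<phi> unfolding test_fun_def by blast
  then show ?thesis by (simp add: frechet_derivative_works)
qed

lemma test_fun_continuous: "continuous_on S \<phi>"
  using test_fun_has_derivative by (meson continuous_at_imp_continuous_on has_derivative_continuous)

lemma compact_support_bounded:
  fixes f :: "'a \<Rightarrow> real"
  assumes "continuous_on UNIV f" "\<And>x. x \<notin> closure {x. \<phi> x \<noteq> 0} \<Longrightarrow> f x = 0"
  obtains C where "0 \<le> C" "\<And>x. \<bar>f x\<bar> \<le> C"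
proof -
  have "compact (closure {x. \<phi> x \<noteq> 0})" using \<phi> by (simp add: test_fun_def)
  then have "bounded (f ` closure {x. \<phi> x \<noteq> 0})"
    using assms(1) by (intro compact_imp_bounded compact_continuous_image) (auto intro: continuous_on_subset)
  then obtain C where C: "\<forall>y\<in>f ` closure {x. \<phi> x \<noteq> 0}. norm y \<le> C" unfolding bounded_iff by blast
  have "\<bar>f x\<bar> \<le> max C 0" for x
    by (cases "x \<in> closure {x. \<phi> x \<noteq> 0}") (use C assms(2) in \<open>force+\<close>)
  then show ?thesis using that[of "max C 0"] by simp
qed

lemma test_fun_bounded: obtains C where "0 \<le> C" "\<And>x. \<bar>\<phi> x\<bar> \<le> C"
proof (rule compact_support_bounded[OF test_fun_continuous])
  show "x \<notin> closure {x. \<phi> x \<noteq> 0} \<Longrightarrow> \<phi> x = 0" for x using closure_subset[of "{x. \<phi> x \<noteq> 0}"] by auto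
qed (rule that)

lemma test_fun_drift_continuous: "continuous_on UNIV (\<lambda>x. frechet_derivative \<phi> (at x) x)"
proof -
  have C1: "Ck (Suc 0) \<phi>" using \<phi> unfolding test_fun_def by blast
  have lin: "linear (frechet_derivative \<phi> (at x))" for x using test_fun_has_derivative has_derivative_linear by blast
  have "frechet_derivative \<phi> (at x) x = (\<Sum>i\<in>Basis. (x \<bullet> i) * frechet_derivative \<phi> (at x) i)" for x
  proof -
    have "frechet_derivative \<phi> (at x) x = frechet_derivative \<phi> (at x) (\<Sum>i\<in>Basis. (x \<bullet> i) *\<^sub>R i)" by (simp add: euclidean_representation)
    then show ?thesis by (simp only: linear_sum[OF lin] linear_scale[OF lin] real_scaleR_def)
  qed
  moreover have "continuous_on UNIV (\<lambda>x. \<Sum>i\<in>Basis. (x \<bullet> i) * frechet_derivative \<phi> (at x) i)"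
    using C1 by (intro continuous_intros) auto
  ultimately show ?thesis by simp
qed

lemma test_fun_drift_bounded: obtains C where "0 \<le> C" "\<And>x. \<bar>frechet_derivative \<phi> (at x) x\<bar> \<le> C"
proof (rule compact_support_bounded[OF test_fun_drift_continuous])
  fix x assume x: "x \<notin> closure {x. \<phi> x \<noteq> 0}"
  have "((\<lambda>_. 0) has_derivative (\<lambda>_. 0)) (at x)" by simp
  then have "(\<phi> has_derivative (\<lambda>_. 0)) (at x)"
    by (rule has_derivative_transform_within_open[where s="- closure {x. \<phi> x \<noteq> 0}"])
       (use x closure_subset[of "{x. \<phi> x \<noteq> 0}"] in auto)
  then show "frechet_derivative \<phi> (at x) x = 0" using frechet_derivative_at by metis
qed (rule that)

lemma test_fun_dilation_deriv:
  "((\<lambda>\<sigma>. \<phi> (exp (- \<sigma>) *\<^sub>R x)) has_real_derivative - frechet_derivative \<phi> (at (exp (- \<sigma>) *\<^sub>R x)) (exp (- \<sigma>) *\<^sub>R x)) (at \<sigma>)"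
proof -
  have lin: "linear (frechet_derivative \<phi> (at x))" for x using test_fun_has_derivative has_derivative_linear by blast
  have "((\<lambda>\<sigma>. exp (- \<sigma>) *\<^sub>R x) has_derivative (\<lambda>h. (- h) *\<^sub>R exp (- \<sigma>) *\<^sub>R x)) (at \<sigma>)"
    by (auto intro!: derivative_eq_intros)
  from has_derivative_compose[OF this test_fun_has_derivative]
  have "((\<lambda>\<sigma>. \<phi> (exp (- \<sigma>) *\<^sub>R x)) has_derivative (\<lambda>h. (- h) * frechet_derivative \<phi> (at (exp (- \<sigma>) *\<^sub>R x)) (exp (- \<sigma>) *\<^sub>R x))) (at \<sigma>)"
    by (simp only: linear_scale[OF lin] real_scaleR_def)
  then show ?thesis by (rule has_derivative_imp_has_field_derivative) simp
qed

lemma drift_dilation: "frechet_derivative (\<lambda>x. \<phi> (c *\<^sub>R x)) (at x) x = frechet_derivative \<phi> (at (c *\<^sub>R x)) (c *\<^sub>R x)"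
proof -
  have "((\<lambda>x. c *\<^sub>R x) has_derivative (\<lambda>i. c *\<^sub>R i)) (at x)" by (auto intro!: derivative_eq_intros)
  from frechet_derivative_at[OF has_derivative_compose[OF this test_fun_has_derivative]]
  show ?thesis by metis
qed

text \<open>The drift term of the weak form is minus the derivative of the pairing along dilations.
  The drift of \<open>\<phi>\<close> is bounded, so its dilates are Lipschitz in
  \<open>\<sigma>\<close> uniformly in \<open>x\<close>; this dominates the difference
  quotients.\<close>

lemma pairing_deriv:
  assumes G: "integrable lborel G"
  shows "((\<lambda>\<sigma>. \<integral>x. G x * \<phi> (exp (- \<sigma>) *\<^sub>R x) \<partial>lborel) has_real_derivative
     - (\<integral>x. G x * frechet_derivative \<phi> (at (exp (- \<sigma>) *\<^sub>R x)) (exp (- \<sigma>) *\<^sub>R x) \<partial>lborel)) (at \<sigma>)"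
proof -
  have [measurable]: "G \<in> borel_measurable borel" using G by auto
  have [measurable]: "\<phi> \<in> borel_measurable borel" by (rule borel_measurable_continuous_onI[OF test_fun_continuous])
  define D where "D = (\<lambda>x. frechet_derivative \<phi> (at x) x)"
  have [measurable]: "D \<in> borel_measurable borel" unfolding D_def by (rule borel_measurable_continuous_onI[OF test_fun_drift_continuous])
  obtain C where C: "0 \<le> C" "\<And>x. \<bar>D x\<bar> \<le> C" unfolding D_def by (rule test_fun_drift_bounded) blast
  obtain C1 where C1: "0 \<le> C1" "\<And>x. \<bar>\<phi> x\<bar> \<le> C1" by (rule test_fun_bounded) blast
  have int: "integrable lborel (\<lambda>x. G x * \<phi> (exp (- s) *\<^sub>R x))" for s
    by (rule Bochner_Integration.integrable_bound[OF integrable_mult_left[OF G, of C1]])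
       (use C1 in \<open>auto simp: abs_mult intro!: mult_left_mono\<close>)
  have lip: "\<bar>\<phi> (exp (- s) *\<^sub>R x) - \<phi> (exp (- \<sigma>) *\<^sub>R x)\<bar> \<le> C * \<bar>s - \<sigma>\<bar>" for s x
  proof -
    have "norm (\<phi> (exp (- s) *\<^sub>R x) - \<phi> (exp (- \<sigma>) *\<^sub>R x)) \<le> C * norm (s - \<sigma>)"
      by (rule field_differentiable_bound[where S=UNIV and f'="\<lambda>\<sigma>. - D (exp (- \<sigma>) *\<^sub>R x)"])
         (use C test_fun_dilation_deriv in \<open>auto simp: D_def\<close>)
    then show ?thesis by simp
  qed
  have "((\<lambda>s. ((\<integral>x. G x * \<phi> (exp (- s) *\<^sub>R x) \<partial>lborel) - (\<integral>x. G x * \<phi> (exp (- \<sigma>) *\<^sub>R x) \<partial>lborel)) / (s - \<sigma>)) \<longlongrightarrow>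
     (\<integral>x. - (G x * D (exp (- \<sigma>) *\<^sub>R x)) \<partial>lborel)) (at \<sigma>)"
    unfolding tendsto_at_iff_sequentially comp_def
  proof (intro allI impI)
    fix X assume X: "\<forall>i. X i \<in> UNIV - {\<sigma>}" "X \<longlonglongrightarrow> \<sigma>"
    have "((\<integral>x. G x * \<phi> (exp (- X i) *\<^sub>R x) \<partial>lborel) - (\<integral>x. G x * \<phi> (exp (- \<sigma>) *\<^sub>R x) \<partial>lborel)) / (X i - \<sigma>)
      = (\<integral>x. G x * ((\<phi> (exp (- X i) *\<^sub>R x) - \<phi> (exp (- \<sigma>) *\<^sub>R x)) / (X i - \<sigma>)) \<partial>lborel)" for i
    proof -
      have "((\<integral>x. G x * \<phi> (exp (- X i) *\<^sub>R x) \<partial>lborel) - (\<integral>x. G x * \<phi> (exp (- \<sigma>) *\<^sub>R x) \<partial>lborel)) / (X i - \<sigma>)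
        = (\<integral>x. G x * \<phi> (exp (- X i) *\<^sub>R x) - G x * \<phi> (exp (- \<sigma>) *\<^sub>R x) \<partial>lborel) / (X i - \<sigma>)"
        by (simp only: Bochner_Integration.integral_diff[OF int int])
      also have "\<dots> = (\<integral>x. (G x * \<phi> (exp (- X i) *\<^sub>R x) - G x * \<phi> (exp (- \<sigma>) *\<^sub>R x)) / (X i - \<sigma>) \<partial>lborel)"
        by (rule integral_divide_zero[symmetric])
      finally show ?thesis by (simp only: right_diff_distrib[symmetric] times_divide_eq_right)
    qed
    moreover have "(\<lambda>i. \<integral>x. G x * ((\<phi> (exp (- X i) *\<^sub>R x) - \<phi> (exp (- \<sigma>) *\<^sub>R x)) / (X i - \<sigma>)) \<partial>lborel) \<longlonglongrightarrow> (\<integral>x. - (G x * D (exp (- \<sigma>) *\<^sub>R x)) \<partial>lborel)"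
    proof (rule integral_dominated_convergence[where w="\<lambda>x. \<bar>G x\<bar> * C"])
      show "AE x in lborel. (\<lambda>i. G x * ((\<phi> (exp (- X i) *\<^sub>R x) - \<phi> (exp (- \<sigma>) *\<^sub>R x)) / (X i - \<sigma>))) \<longlonglongrightarrow> - (G x * D (exp (- \<sigma>) *\<^sub>R x))"
      proof (rule AE_I2)
        fix x
        have "((\<lambda>s. (\<phi> (exp (- s) *\<^sub>R x) - \<phi> (exp (- \<sigma>) *\<^sub>R x)) / (s - \<sigma>)) \<longlongrightarrow> - D (exp (- \<sigma>) *\<^sub>R x)) (at \<sigma>)"
          using test_fun_dilation_deriv[of x \<sigma>] unfolding has_field_derivative_iff D_def .
        then have "(\<lambda>i. (\<phi> (exp (- X i) *\<^sub>R x) - \<phi> (exp (- \<sigma>) *\<^sub>R x)) / (X i - \<sigma>)) \<longlonglongrightarrow> - D (exp (- \<sigma>) *\<^sub>R x)"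
          using X unfolding tendsto_at_iff_sequentially comp_def by blast
        from tendsto_mult_left[OF this, of "G x"]
        show "(\<lambda>i. G x * ((\<phi> (exp (- X i) *\<^sub>R x) - \<phi> (exp (- \<sigma>) *\<^sub>R x)) / (X i - \<sigma>))) \<longlonglongrightarrow> - (G x * D (exp (- \<sigma>) *\<^sub>R x))" by simp
      qed
      show "AE x in lborel. norm (G x * ((\<phi> (exp (- X i) *\<^sub>R x) - \<phi> (exp (- \<sigma>) *\<^sub>R x)) / (X i - \<sigma>))) \<le> \<bar>G x\<bar> * C" for i
      proof (rule AE_I2)
        fix x
        have "0 < \<bar>X i - \<sigma>\<bar>" using X(1) by auto
        then have "\<bar>(\<phi> (exp (- X i) *\<^sub>R x) - \<phi> (exp (- \<sigma>) *\<^sub>R x)) / (X i - \<sigma>)\<bar> \<le> C"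
          using lip[of "X i" x] by (simp only: abs_divide pos_divide_le_eq)
        then show "norm (G x * ((\<phi> (exp (- X i) *\<^sub>R x) - \<phi> (exp (- \<sigma>) *\<^sub>R x)) / (X i - \<sigma>))) \<le> \<bar>G x\<bar> * C"
          unfolding real_norm_def abs_mult by (rule mult_left_mono) simp
      qed
    qed (use G in auto)
    ultimately show "(\<lambda>i. ((\<integral>x. G x * \<phi> (exp (- X i) *\<^sub>R x) \<partial>lborel) - (\<integral>x. G x * \<phi> (exp (- \<sigma>) *\<^sub>R x) \<partial>lborel)) / (X i - \<sigma>)) \<longlonglongrightarrow> (\<integral>x. - (G x * D (exp (- \<sigma>) *\<^sub>R x)) \<partial>lborel)"
      by (simp only:)
  qed
  then show ?thesis unfolding has_field_derivative_iff D_def by simp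
qed

end

lemma bump_exists:
  obtains \<beta> :: "'a::euclidean_space \<Rightarrow> real" where "test_fun \<beta>" "integrable lborel \<beta>" "0 < (\<integral>x. \<beta> x \<partial>lborel)"
proof -
  define \<beta> :: "'a \<Rightarrow> real" where "\<beta> = (\<lambda>x. flat_exp 0 (1 - x \<bullet> x))"
  have supp: "{x. \<beta> x \<noteq> 0} \<subseteq> cball 0 1"
  proof
    fix x assume "x \<in> {x. \<beta> x \<noteq> 0}"
    then have "x \<bullet> x < 1" by (auto simp: \<beta>_def flat_exp_def split: if_splits)
    then have "(norm x)\<^sup>2 \<le> 1" by (simp add: power2_norm_eq_inner)
    then show "x \<in> cball 0 1" by (simp add: power_le_one_iff abs_square_le_1)
  qed
  have t: "test_fun \<beta>" unfolding test_fun_def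
  proof
    show "\<forall>n. Ck n \<beta>" unfolding \<beta>_def by (intro allI smooth_class_Ck smooth_class.flat)
    show "compact (closure {x. \<beta> x \<noteq> 0})"
      using supp by (meson bounded_cball bounded_subset compact_closure)
  qed
  have nn: "0 \<le> \<beta> x" and le: "\<beta> x \<le> indicator (cball 0 1) x" for x
  proof -
    show "0 \<le> \<beta> x" by (simp add: \<beta>_def flat_exp_def)
    show "\<beta> x \<le> indicator (cball 0 1) x"
    proof (cases "\<beta> x = 0")
      case False
      then have "x \<in> cball 0 1" using supp by auto
      moreover have "\<beta> x \<le> 1" by (simp add: \<beta>_def flat_exp_def)
      ultimately show ?thesis by simp
    qed simp
  qed
  have m[measurable]: "\<beta> \<in> borel_measurable borel" by (rule borel_measurable_continuous_onI[OF test_fun_continuous[OF t]])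
  have iball: "integrable lborel (indicator (cball 0 1) :: 'a \<Rightarrow> real)"
    using emeasure_compact_finite[OF compact_cball, of "0::'a" 1] by (auto simp: less_top)
  have i: "integrable lborel \<beta>"
    by (rule Bochner_Integration.integrable_bound[OF iball]) (use nn le in auto)
  have "(\<integral>x. \<beta> x \<partial>lborel) \<noteq> 0"
  proof
    assume "(\<integral>x. \<beta> x \<partial>lborel) = 0"
    then have "AE x in lborel. \<beta> x = 0" using integral_nonneg_eq_0_iff_AE[OF i] nn by auto
    moreover have "\<beta> x \<noteq> 0" if "x \<in> ball 0 1" for x
    proof -
      have "(norm x)\<^sup>2 < 1" using that by (simp add: abs_square_less_1)
      then show ?thesis by (simp add: \<beta>_def flat_exp_def power2_norm_eq_inner)
    qed
    ultimately have "AE x in lborel. x \<notin> ball (0::'a) 1" by (auto elim: eventually_mono)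
    then have "ball (0::'a) 1 \<in> null_sets lborel" by (intro AE_iff_null_sets[THEN iffD2]) auto
    then have "emeasure lborel (ball (0::'a) 1) = 0" by (rule null_setsD1)
    then have "ennreal (unit_ball_vol (real DIM('a))) = 0" using emeasure_ball[of 1 "0::'a"] by simp
    then have "unit_ball_vol (real DIM('a)) \<le> 0" by (simp only: ennreal_eq_0_iff)
    then show False using unit_ball_vol_pos[of "real DIM('a)"] by linarith
  qed
  then have "0 < (\<integral>x. \<beta> x \<partial>lborel)" using Bochner_Integration.integral_nonneg[of lborel \<beta>] nn by fastforce
  with t i that show ?thesis by blast
qed

text \<open>Each value of the convolution of \<open>g\<close> with a rescaled bump is a pairing with
  a test function, hence 0. Thus
  \<open>fourier \<beta> (w *\<^sub>R \<xi>) * fourier g \<xi> = 0\<close> for all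
  \<open>w > 0\<close>; as \<open>w\<close> tends to 0 the first factor tends to the integral of the
  bump, which is positive.\<close>

lemma test_fun_separates:
  fixes g :: "'a::euclidean_space \<Rightarrow> real"
  assumes g: "integrable lborel g" and zero: "\<And>\<phi>. test_fun \<phi> \<Longrightarrow> (\<integral>x. g x * \<phi> x \<partial>lborel) = 0"
  shows "AE x in lborel. g x = 0"
proof -
  obtain \<beta> :: "'a \<Rightarrow> real" where \<beta>: "test_fun \<beta>" "integrable lborel \<beta>" "0 < (\<integral>x. \<beta> x \<partial>lborel)" by (rule bump_exists)
  have \<beta>m: "\<beta> \<in> borel_measurable borel" using \<beta>(2) by auto
  have "fourier g \<xi> = 0" for \<xi>
  proof (rule ccontr)
    assume ne: "fourier g \<xi> \<noteq> 0"
    have z: "fourier \<beta> (w *\<^sub>R \<xi>) = 0" if w: "0 < w" for w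
    proof -
      have "conv (resc w \<beta>) g x = 0" for x
      proof -
        have "(\<integral>y. g y * \<beta> ((- (1 / w)) *\<^sub>R y + (1 / w) *\<^sub>R x) \<partial>lborel) = 0"
          by (rule zero[OF test_fun_affine[OF \<beta>(1)]]) (use w in simp)
        moreover have "conv (resc w \<beta>) g x = w powr (- real DIM('a)) * (\<integral>y. g y * \<beta> ((- (1 / w)) *\<^sub>R y + (1 / w) *\<^sub>R x) \<partial>lborel)"
          unfolding conv_def resc_def by (subst integral_mult_right_zero[symmetric]) (simp add: scaleR_diff_right mult_ac)
        ultimately show ?thesis by simp
      qed
      then have "fourier (conv (resc w \<beta>) g) \<xi> = 0" unfolding fourier_def by simp
      then have "fourier (resc w \<beta>) \<xi> * fourier g \<xi> = 0"
        using fourier_conv[of "resc w \<beta>" g \<xi>] dil_integrable[OF \<beta>(2)] g w by (simp add: resc_eq_dil)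
      then show ?thesis using ne fourier_resc[OF \<beta>m w] by simp
    qed
    have "(\<lambda>n. fourier \<beta> ((1 / Suc n) *\<^sub>R \<xi>)) \<longlonglongrightarrow> fourier \<beta> (0 *\<^sub>R \<xi>)"
    proof (rule continuous_on_tendsto_compose[OF fourier_continuous[OF \<beta>(2), of UNIV]])
      show "(\<lambda>n. (1 / real (Suc n)) *\<^sub>R \<xi>) \<longlonglongrightarrow> 0 *\<^sub>R \<xi>" by (intro tendsto_intros LIMSEQ_Suc[OF lim_1_over_n])
    qed auto
    moreover have "fourier \<beta> ((1 / real (Suc n)) *\<^sub>R \<xi>) = 0" for n by (rule z) simp
    ultimately have "fourier \<beta> 0 = 0" by (simp add: LIMSEQ_const_iff)
    then show False using \<beta>(3) by (simp add: fourier_zero)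
  qed
  then show ?thesis using fourier_inject[OF g, of "\<lambda>_. 0"] by (simp add: fourier_def)
qed

section \<open>Weak equilibria as constant mild solutions\<close>

locale jump_stationary = jump j a
  for j :: "'a::euclidean_space \<Rightarrow> real" and a :: real +
  fixes G :: "'a \<Rightarrow> real"
  assumes G_int: "integrable lborel G"
begin

text \<open>\<open>G\<close> is viewed as a constant curve that starts at itself, so the results on
  mild solutions apply to stationary states.\<close>

sublocale jump_curve j a "\<lambda>_. G" G
  by unfold_locales (auto simp: G_int)

definition weak_equilibrium :: bool where
  "weak_equilibrium \<longleftrightarrow> (\<forall>\<phi>. test_fun \<phi> \<longrightarrow>
     (\<integral>x. a * (conv j G x - G x) * \<phi> x \<partial>lborel) - (\<integral>x. G x * frechet_derivative \<phi> (at x) x \<partial>lborel) = 0)"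

context
  fixes \<phi> :: "'a \<Rightarrow> real"
  assumes \<phi>: "test_fun \<phi>"
begin

text \<open>Pairings of \<open>G\<close>, of \<open>conv j G\<close> and of the drift with the
  dilates of \<open>\<phi>\<close>. By \<open>pairing_deriv\<close> the derivative of
  \<open>hh\<close> is \<open>- dd\<close>, and the weak equation for all dilates reads
  \<open>a * (mm \<sigma> - hh \<sigma>) = dd \<sigma>\<close>.\<close>

abbreviation (input) "hh \<sigma> \<equiv> (\<integral>x. G x * \<phi> (exp (- \<sigma>) *\<^sub>R x) \<partial>lborel)"
abbreviation (input) "mm \<sigma> \<equiv> (\<integral>x. conv j G x * \<phi> (exp (- \<sigma>) *\<^sub>R x) \<partial>lborel)"
abbreviation (input) "dd \<sigma> \<equiv> (\<integral>x. G x * frechet_derivative \<phi> (at (exp (- \<sigma>) *\<^sub>R x)) (exp (- \<sigma>) *\<^sub>R x) \<partial>lborel)"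

lemma mm_continuous: "continuous_on S (\<lambda>\<sigma>. mm \<sigma>)"
  by (rule DERIV_continuous_on) (rule DERIV_subset[OF pairing_deriv[OF \<phi> conv_integrable[OF j_int G_int]]], simp)

lemma mild_rhs_pairing:
  assumes t: "0 \<le> t"
  shows "(\<integral>x. mild_rhs j a G (\<lambda>_. G) t x * \<phi> x \<partial>lborel) = exp (- a * t) * hh t + a * integral {0..t} (\<lambda>\<tau>. exp (- a * \<tau>) * mm \<tau>)"
proof -
  obtain C where C: "\<And>x. norm (\<phi> x) \<le> C" using test_fun_bounded[OF \<phi>] by (metis real_norm_def)
  have \<phi>m: "\<phi> \<in> borel_measurable borel" by (rule borel_measurable_continuous_onI[OF test_fun_continuous[OF \<phi>]])
  have "(\<integral>x. mild_rhs j a G (\<lambda>_. G) t x *\<^sub>R \<phi> x \<partial>lborel) = exp (- a * t) *\<^sub>R hh t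
        + a *\<^sub>R (LINT \<tau>:{0..t}|lborel. exp (- a * (t - \<tau>)) *\<^sub>R mm (t - \<tau>))"
    using mild_rhs_test[OF t \<phi>m C] by simp
  also have "(LINT \<tau>:{0..t}|lborel. exp (- a * (t - \<tau>)) *\<^sub>R mm (t - \<tau>)) = integral {0..t} (\<lambda>\<tau>. exp (- a * (t - \<tau>)) *\<^sub>R mm (t - \<tau>))"
    by (rule set_lborel_eq_integral) (intro continuous_intros continuous_on_compose2[OF mm_continuous[of UNIV]]; simp)+
  also have "\<dots> = integral {0..t} (\<lambda>\<tau>. exp (- a * \<tau>) *\<^sub>R mm \<tau>)"
    by (rule integral_reverse[of "\<lambda>\<tau>. exp (- a * \<tau>) *\<^sub>R mm \<tau>"]) (intro continuous_intros mm_continuous)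
  finally show ?thesis by simp
qed

lemma weak_form_dilated:
  "(\<integral>x. a * (conv j G x - G x) * \<phi> (exp (- \<sigma>) *\<^sub>R x) \<partial>lborel) = a * (mm \<sigma> - hh \<sigma>)"
proof -
  obtain C where C: "\<And>x. \<bar>\<phi> x\<bar> \<le> C" using test_fun_bounded[OF \<phi>] by metis
  have [measurable]: "\<phi> \<in> borel_measurable borel" by (rule borel_measurable_continuous_onI[OF test_fun_continuous[OF \<phi>]])
  have i: "integrable lborel (\<lambda>x. f x * \<phi> (exp (- \<sigma>) *\<^sub>R x))" if f: "integrable lborel f" for f :: "'a \<Rightarrow> real"
  proof (rule Bochner_Integration.integrable_bound[OF integrable_mult_left[OF f, of C]])
    have "f \<in> borel_measurable borel" using f by auto
    then show "(\<lambda>x. f x * \<phi> (exp (- \<sigma>) *\<^sub>R x)) \<in> borel_measurable lborel" by measurable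
    show "AE x in lborel. norm (f x * \<phi> (exp (- \<sigma>) *\<^sub>R x)) \<le> norm (f x * C)"
      by (auto simp: abs_mult intro!: mult_left_mono order_trans[OF C])
  qed
  have "(\<integral>x. a * (conv j G x - G x) * \<phi> (exp (- \<sigma>) *\<^sub>R x) \<partial>lborel)
    = (\<integral>x. a * (conv j G x * \<phi> (exp (- \<sigma>) *\<^sub>R x) - G x * \<phi> (exp (- \<sigma>) *\<^sub>R x)) \<partial>lborel)"
    by (simp add: algebra_simps)
  then show ?thesis using i[OF G_int] i[OF conv_integrable[OF j_int G_int]] by simp
qed

text \<open>Dilates of test functions are test functions, so the weak equation becomes a linear
  differential equation for \<open>hh\<close>. Integrating it with the factor
  \<open>exp (- a * \<sigma>)\<close> gives the mild equation tested against
  \<open>\<phi>\<close>.\<close>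

lemma weak_imp_pairing:
  assumes w: "weak_equilibrium" and t: "0 \<le> t"
  shows "hh 0 = exp (- a * t) * hh t + a * integral {0..t} (\<lambda>\<tau>. exp (- a * \<tau>) * mm \<tau>)"
proof -
  have eq: "a * (mm \<sigma> - hh \<sigma>) = dd \<sigma>" for \<sigma>
  proof -
    have "test_fun (\<lambda>x. \<phi> (exp (- \<sigma>) *\<^sub>R x))" using test_fun_affine[OF \<phi>, of "exp (- \<sigma>)" 0] by simp
    then have "(\<integral>x. a * (conv j G x - G x) * \<phi> (exp (- \<sigma>) *\<^sub>R x) \<partial>lborel)
       - (\<integral>x. G x * frechet_derivative (\<lambda>x. \<phi> (exp (- \<sigma>) *\<^sub>R x)) (at x) x \<partial>lborel) = 0"
      using w unfolding weak_equilibrium_def by blast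
    then show ?thesis unfolding drift_dilation[OF \<phi>] weak_form_dilated by simp
  qed
  have "((\<lambda>\<sigma>. exp (- a * \<sigma>) * hh \<sigma>) has_vector_derivative - (a * (exp (- a * \<sigma>) * mm \<sigma>))) (at \<sigma> within {0..t})" for \<sigma>
  proof -
    have "((\<lambda>\<sigma>. exp (- a * \<sigma>)) has_real_derivative - a * exp (- a * \<sigma>)) (at \<sigma>)" by (auto intro!: derivative_eq_intros)
    from DERIV_mult[OF this pairing_deriv[OF \<phi> G_int]]
    have "((\<lambda>\<sigma>. exp (- a * \<sigma>) * hh \<sigma>) has_real_derivative - (a * (exp (- a * \<sigma>) * mm \<sigma>))) (at \<sigma>)"
      unfolding eq[symmetric] by (simp add: algebra_simps)
    then show ?thesis by (simp add: has_real_derivative_iff_has_vector_derivative has_vector_derivative_at_within)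
  qed
  then have "((\<lambda>\<sigma>. - (a * (exp (- a * \<sigma>) * mm \<sigma>))) has_integral (exp (- a * t) * hh t - exp (- a * 0) * hh 0)) {0..t}"
    by (intro fundamental_theorem_of_calculus t)
  then have "integral {0..t} (\<lambda>\<sigma>. - (a * (exp (- a * \<sigma>) * mm \<sigma>))) = exp (- a * t) * hh t - exp (- a * 0) * hh 0"
    by (rule integral_unique)
  then show ?thesis by simp
qed

text \<open>The tested mild equation is differentiated at \<open>t = 0\<close> from the right; its
  left side is constant, so the derivative of the right side vanishes, and this is the weak
  equation.\<close>

lemma pairing_imp_weak:
  assumes eq: "\<And>t. 0 \<le> t \<Longrightarrow> hh 0 = exp (- a * t) * hh t + a * integral {0..t} (\<lambda>\<tau>. exp (- a * \<tau>) * mm \<tau>)"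
  shows "(\<integral>x. a * (conv j G x - G x) * \<phi> x \<partial>lborel) - (\<integral>x. G x * frechet_derivative \<phi> (at x) x \<partial>lborel) = 0"
proof -
  have d1: "((\<lambda>\<sigma>. exp (- a * \<sigma>) * hh \<sigma>) has_vector_derivative (- a * hh 0 - dd 0)) (at 0 within {0..1})"
  proof -
    have "((\<lambda>\<sigma>. exp (- a * \<sigma>)) has_real_derivative - a * exp (- a * 0)) (at 0)" by (auto intro!: derivative_eq_intros)
    from DERIV_mult[OF this pairing_deriv[OF \<phi> G_int]]
    have "((\<lambda>\<sigma>. exp (- a * \<sigma>) * hh \<sigma>) has_real_derivative (- a * hh 0 - dd 0)) (at 0)"
      by simp
    then show ?thesis by (simp add: has_real_derivative_iff_has_vector_derivative has_vector_derivative_at_within)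
  qed
  have d2: "((\<lambda>t. integral {0..t} (\<lambda>\<tau>. exp (- a * \<tau>) * mm \<tau>)) has_vector_derivative exp (- a * 0) * mm 0) (at 0 within {0..1})"
    by (rule integral_has_vector_derivative) (intro continuous_intros mm_continuous, simp)
  have "((\<lambda>t. exp (- a * t) * hh t + a * integral {0..t} (\<lambda>\<tau>. exp (- a * \<tau>) * mm \<tau>)) has_vector_derivative
     (- a * hh 0 - dd 0) + a * (exp (- a * 0) * mm 0)) (at 0 within {0..1})"
    by (rule has_vector_derivative_add[OF d1 has_vector_derivative_mult_right[OF d2]])
  then have "((\<lambda>t::real. hh 0) has_vector_derivative (- a * hh 0 - dd 0) + a * (exp (- a * 0) * mm 0)) (at 0 within {0..1})"
    by (rule has_vector_derivative_transform[rotated 2]) (simp, rule eq, simp)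
  then have "((\<lambda>t::real. hh 0) has_vector_derivative (- a * hh 0 - dd 0) + a * (exp (- a * 0) * mm 0)) (at 0 within cbox 0 1)"
    by (simp only: cbox_interval)
  from vector_derivative_unique_within_closed_interval[OF zero_less_one _ this has_vector_derivative_const]
  have "(- a * hh 0 - dd 0) + a * (exp (- a * 0) * mm 0) = 0" by simp
  then show ?thesis using weak_form_dilated[of 0] by (simp add: algebra_simps)
qed

end

lemma weak_imp_mild:
  assumes w: "weak_equilibrium" and t: "0 \<le> t"
  shows "AE x in lborel. G x = mild_rhs j a G (\<lambda>_. G) t x"
proof -
  note mi = mild_rhs_integrable[OF t]
  have "AE x in lborel. G x - mild_rhs j a G (\<lambda>_. G) t x = 0"
  proof (rule test_fun_separates)
    show "integrable lborel (\<lambda>x. G x - mild_rhs j a G (\<lambda>_. G) t x)" using G_int mi by simp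
    fix \<phi> :: "'a \<Rightarrow> real" assume \<phi>: "test_fun \<phi>"
    obtain C where C: "\<And>x. \<bar>\<phi> x\<bar> \<le> C" using test_fun_bounded[OF \<phi>] by metis
    have [measurable]: "\<phi> \<in> borel_measurable borel" by (rule borel_measurable_continuous_onI[OF test_fun_continuous[OF \<phi>]])
    have i: "integrable lborel (\<lambda>x. f x * \<phi> x)" if f: "integrable lborel f" for f :: "'a \<Rightarrow> real"
    proof (rule Bochner_Integration.integrable_bound[OF integrable_mult_left[OF f, of C]])
      have "f \<in> borel_measurable borel" using f by auto
      then show "(\<lambda>x. f x * \<phi> x) \<in> borel_measurable lborel" by measurable
      show "AE x in lborel. norm (f x * \<phi> x) \<le> norm (f x * C)"
        by (auto simp: abs_mult intro!: mult_left_mono order_trans[OF C])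
    qed
    show "(\<integral>x. (G x - mild_rhs j a G (\<lambda>_. G) t x) * \<phi> x \<partial>lborel) = 0"
      using weak_imp_pairing[OF \<phi> w t] mild_rhs_pairing[OF \<phi> t] i[OF G_int] i[OF mi] by (simp add: left_diff_distrib)
  qed
  then show ?thesis by eventually_elim simp
qed

lemma mild_imp_weak:
  assumes m: "\<And>t. 0 \<le> t \<Longrightarrow> AE x in lborel. G x = mild_rhs j a G (\<lambda>_. G) t x"
  shows "weak_equilibrium"
  unfolding weak_equilibrium_def
proof (intro allI impI)
  fix \<phi> :: "'a \<Rightarrow> real" assume \<phi>: "test_fun \<phi>"
  have [measurable]: "\<phi> \<in> borel_measurable borel" by (rule borel_measurable_continuous_onI[OF test_fun_continuous[OF \<phi>]])
  have [measurable]: "G \<in> borel_measurable borel" using G_int by auto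
  show "(\<integral>x. a * (conv j G x - G x) * \<phi> x \<partial>lborel) - (\<integral>x. G x * frechet_derivative \<phi> (at x) x \<partial>lborel) = 0"
  proof (rule pairing_imp_weak[OF \<phi>])
    fix t :: real assume t: "0 \<le> t"
    have [measurable]: "mild_rhs j a G (\<lambda>_. G) t \<in> borel_measurable borel" using mild_rhs_integrable[OF t] by auto
    have "(\<integral>x. G x * \<phi> (exp (- 0) *\<^sub>R x) \<partial>lborel) = (\<integral>x. mild_rhs j a G (\<lambda>_. G) t x * \<phi> x \<partial>lborel)"
      by (rule integral_cong_AE) (use m[OF t] in auto)
    then show "(\<integral>x. G x * \<phi> (exp (- 0) *\<^sub>R x) \<partial>lborel) = exp (- a * t) * (\<integral>x. G x * \<phi> (exp (- t) *\<^sub>R x) \<partial>lborel)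
        + a * integral {0..t} (\<lambda>\<tau>. exp (- a * \<tau>) * (\<integral>x. conv j G x * \<phi> (exp (- \<tau>) *\<^sub>R x) \<partial>lborel))"
      using mild_rhs_pairing[OF \<phi> t] by simp
  qed
qed

theorem weak_equilibrium_iff_ev: "weak_equilibrium \<longleftrightarrow> (\<forall>t\<ge>0. ev t G G)"
  using weak_imp_mild mild_imp_ev ev_imp_mild mild_imp_weak by metis

end

section \<open>Existence of a stationary density\<close>

context jump
begin

text \<open>The cocycle identity \<open>A_add\<close> read backwards: a common first stretch of time
  can be cancelled.\<close>

lemma ev_factor:
  assumes h: "ev (t + r) f h" and g: "ev r f g" and tr: "0 \<le> t" "0 \<le> r"
  shows "ev t g h"
proof -
  have "exp (- (t + r)) = exp (- r) * exp (- t)" by (simp flip: exp_add)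
  moreover have "exp (- A (t + r) \<xi>) = exp (- A t \<xi>) * exp (- A r (exp (- t) *\<^sub>R \<xi>))" for \<xi>
    using A_add[OF tr, of \<xi>] by (simp flip: exp_add)
  ultimately show ?thesis using h g by (simp add: ev_def)
qed

text \<open>The states at integer times form a Cauchy sequence: consecutive differences evolve from
  the mean-zero function \<open>f 1 - f 0\<close> and decay geometrically. Summability also provides
  almost everywhere convergence and a common integrable majorant.\<close>

lemma stationary_exists:
  fixes f0 :: "'a \<Rightarrow> real"
  assumes f0: "prob_density f0" "finmom k f0" and k: "0 < k" "k \<le> 1"
    and pk: "\<And>t. 0 \<le> t \<Longrightarrow> finmom k (pd t)" "\<And>t. 0 \<le> t \<Longrightarrow> mom k (pd t) \<le> M"
    and A0: "\<And>t \<xi>. 0 \<le> t \<Longrightarrow> norm \<xi> \<le> 1 \<Longrightarrow> norm (A t \<xi>) \<le> B * norm \<xi> powr p" "0 < p"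
    and lam: "0 < lam" and decay: "\<And>t v g. 0 \<le> t \<Longrightarrow> ev t v g \<Longrightarrow> (\<integral>x. v x \<partial>lborel) = 0 \<Longrightarrow> finmom k v
      \<Longrightarrow> nrm1 g \<le> C v * exp (- lam * t)"
  obtains F where "prob_density F" "finmom k F" "\<And>t. 0 \<le> t \<Longrightarrow> ev t F F"
proof -
  have f0i: "integrable lborel f0" and f0n: "\<And>x. 0 \<le> f0 x" and f01: "(\<integral>x. f0 x \<partial>lborel) = 1"
    using f0 by (auto simp: prob_density_def)
  define f where "f = (\<lambda>n::nat. Sop (real n) f0)"
  have evf: "ev (real n) f0 (f n)" for n unfolding f_def by (rule ev_Sop[OF _ f0i]) simp
  have fi: "integrable lborel (f n)" for n using evf[of n] by (simp add: ev_def)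
  have [measurable]: "f n \<in> borel_measurable borel" for n using fi[of n] by auto
  have fn: "0 \<le> f n x" for n x unfolding f_def by (rule Sop_nonneg) (auto simp: f0n)
  have f1: "(\<integral>x. f n x \<partial>lborel) = 1" for n using ev_integral[OF evf[of n]] f01 by simp
  have fk: "finmom k (f n)" and fM: "mom k (f n) \<le> mom k f0 + M" for n
  proof -
    note m = mom_ev_le[OF _ evf[of n] k f0(2) pk(1)]
    show "finmom k (f n)" using m by simp
    have n0: "nrm1 f0 = 1" using f01 f0n by simp
    have "mom k (f n) \<le> exp (- k * real n) * mom k f0 + mom k (pd (real n)) * nrm1 f0" using m by simp
    also have "\<dots> \<le> 1 * mom k f0 + M * 1" unfolding n0 using k
      by (intro add_mono mult_right_mono pk) auto
    finally show "mom k (f n) \<le> mom k f0 + M" by simp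
  qed
  define v where "v = (\<lambda>x. f 1 x - f 0 x)"
  have vk: "finmom k v"
    by (rule finmom_bound(1)[of k "\<lambda>x. \<bar>f 1 x\<bar> + \<bar>f 0 x\<bar>"])
       (use fk[of 1] fk[of 0] in \<open>auto simp: v_def algebra_simps\<close>)
  have v0: "(\<integral>x. v x \<partial>lborel) = 0" unfolding v_def using fi f1 by simp
  have evv: "ev (real n) v (\<lambda>x. f (Suc n) x - f n x)" for n
  proof -
    have a: "ev (real n) (f 1) (f (Suc n))"
      by (rule ev_factor[of _ "1" f0]) (use evf[of "Suc n"] evf[of 1] in \<open>simp_all add: add.commute\<close>)
    have b: "ev (real n) (f 0) (f n)"
      by (rule ev_factor[of _ "0" f0]) (use evf[of n] evf[of 0] in simp_all)
    show ?thesis unfolding v_def by (rule ev_diff[OF a b])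
  qed
  have q: "norm (exp (- lam)) < 1" using lam by simp
  have sm: "summable (\<lambda>n. nrm1 (\<lambda>x. f (Suc n) x - f n x))"
  proof (rule summable_comparison_test')
    show "summable (\<lambda>n. C v * exp (- lam) ^ n)" by (intro summable_mult summable_geometric q)
    show "norm (nrm1 (\<lambda>x. f (Suc n) x - f n x)) \<le> C v * exp (- lam) ^ n" if "0 \<le> n" for n
      using decay[OF _ evv v0 vk, of n] by (simp add: exp_of_nat_mult[symmetric] mult.commute)
  qed
  have di: "integrable lborel (\<lambda>x. f (Suc n) x - f n x)" for n using fi by simp
  have AEs: "AE x in lborel. summable (\<lambda>n. \<bar>f (Suc n) x - f n x\<bar>)" by (rule L1_series_AE[OF di sm])
  define w where "w = (\<lambda>x. f 0 x + (\<Sum>n. \<bar>f (Suc n) x - f n x\<bar>))"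
  have wi: "integrable lborel w" unfolding w_def
    by (intro Bochner_Integration.integrable_add fi integrable_suminf integrable_abs di) (use AEs sm in simp_all)
  \<comment> \<open>\<open>prob_density\<close> asks for nonnegativity at every point, also where
    the sequence does not converge.\<close>
  define F where "F = (\<lambda>x. max 0 (lim (\<lambda>n. f n x)))"
  have [measurable]: "F \<in> borel_measurable borel" unfolding F_def by measurable
  have conv: "AE x in lborel. (\<lambda>n. f n x) \<longlonglongrightarrow> F x \<and> (\<forall>n. \<bar>f n x\<bar> \<le> w x)"
    using AEs
  proof eventually_elim
    fix x assume s: "summable (\<lambda>n. \<bar>f (Suc n) x - f n x\<bar>)"
    have s': "summable (\<lambda>n. f (Suc n) x - f n x)" by (rule summable_rabs_cancel[OF s])
    have tel: "(\<Sum>i<n. f (Suc i) x - f i x) = f n x - f 0 x" for n by (rule sum_lessThan_telescope)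
    have "(\<lambda>n. f n x - f 0 x) \<longlonglongrightarrow> (\<Sum>n. f (Suc n) x - f n x)"
      using summable_LIMSEQ[OF s'] unfolding tel .
    from tendsto_add[OF this tendsto_const[of "f 0 x"]]
    have l: "(\<lambda>n. f n x) \<longlonglongrightarrow> (\<Sum>n. f (Suc n) x - f n x) + f 0 x" by simp
    have "0 \<le> (\<Sum>n. f (Suc n) x - f n x) + f 0 x" by (rule LIMSEQ_le_const[OF l]) (use fn in auto)
    then have c: "(\<lambda>n. f n x) \<longlonglongrightarrow> F x" using l limI[OF l] by (simp add: F_def)
    have "\<bar>f n x\<bar> \<le> w x" for n
    proof -
      have "f n x = f 0 x + (\<Sum>i<n. f (Suc i) x - f i x)" unfolding tel by simp
      also have "\<dots> \<le> f 0 x + (\<Sum>i<n. \<bar>f (Suc i) x - f i x\<bar>)" by (intro add_left_mono sum_mono) simp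
      also have "\<dots> \<le> w x" unfolding w_def by (intro add_left_mono sum_le_suminf s) auto
      finally show ?thesis using fn[of n x] by simp
    qed
    with c show "(\<lambda>n. f n x) \<longlonglongrightarrow> F x \<and> (\<forall>n. \<bar>f n x\<bar> \<le> w x)" by blast
  qed
  have c1: "AE x in lborel. (\<lambda>n. f n x) \<longlonglongrightarrow> F x" using conv by eventually_elim simp
  have c2: "AE x in lborel. norm (f n x) \<le> w x" for n using conv by eventually_elim simp
  have Fi: "integrable lborel F"
    by (rule integrable_dominated_convergence[OF _ _ wi c1 c2]) auto
  have four: "(\<lambda>n. fourier (f n) \<xi>) \<longlonglongrightarrow> fourier F \<xi>" for \<xi>
    unfolding fourier_def
  proof (rule integral_dominated_convergence[OF _ _ wi])
    show "AE x in lborel. (\<lambda>n. cis (- (x \<bullet> \<xi>)) * complex_of_real (f n x)) \<longlonglongrightarrow> cis (- (x \<bullet> \<xi>)) * complex_of_real (F x)"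
      using c1 by eventually_elim (intro tendsto_intros)
    show "AE x in lborel. norm (cis (- (x \<bullet> \<xi>)) * complex_of_real (f n x)) \<le> w x" for n
      using c2[of n] by (simp add: norm_mult)
  qed (use fourier_integrable fi Fi in \<open>blast dest: borel_measurable_integrable\<close>)+
  have F1: "(\<integral>x. F x \<partial>lborel) = 1"
  proof -
    have "(\<lambda>n. \<integral>x. f n x \<partial>lborel) \<longlonglongrightarrow> (\<integral>x. F x \<partial>lborel)"
      by (rule integral_dominated_convergence[OF _ _ wi c1 c2]) auto
    then show ?thesis using f1 by (simp add: LIMSEQ_const_iff)
  qed
  have Fp: "prob_density F" using Fi F1 by (auto simp: prob_density_def F_def)
  \<comment> \<open>The moments of the \<open>f n\<close> are uniformly bounded, and Fatou's lemma
    passes the bound to the limit.\<close>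
  have Fk: "finmom k F"
  proof (rule integrableI_bounded)
    have "(\<integral>\<^sup>+x. ennreal (norm (norm x powr k * \<bar>F x\<bar>)) \<partial>lborel)
      = (\<integral>\<^sup>+x. liminf (\<lambda>n. ennreal (norm x powr k * \<bar>f n x\<bar>)) \<partial>lborel)"
    proof (rule nn_integral_cong_AE)
      show "AE x in lborel. ennreal (norm (norm x powr k * \<bar>F x\<bar>)) = liminf (\<lambda>n. ennreal (norm x powr k * \<bar>f n x\<bar>))"
        using c1
      proof eventually_elim
        fix x :: 'a assume "(\<lambda>n. f n x) \<longlonglongrightarrow> F x"
        then have "(\<lambda>n. ennreal (norm x powr k * \<bar>f n x\<bar>)) \<longlonglongrightarrow> ennreal (norm x powr k * \<bar>F x\<bar>)"
          by (intro tendsto_intros tendsto_ennrealI)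
        from lim_imp_Liminf[OF _ this]
        show "ennreal (norm (norm x powr k * \<bar>F x\<bar>)) = liminf (\<lambda>n. ennreal (norm x powr k * \<bar>f n x\<bar>))" by simp
      qed
    qed
    also have "\<dots> \<le> liminf (\<lambda>n. \<integral>\<^sup>+x. ennreal (norm x powr k * \<bar>f n x\<bar>) \<partial>lborel)"
      by (rule nn_integral_liminf) measurable
    also have "\<dots> \<le> liminf (\<lambda>n::nat. ennreal (mom k f0 + M))"
    proof (rule Liminf_mono, intro always_eventually allI)
      fix n
      have "(\<integral>\<^sup>+x. ennreal (norm x powr k * \<bar>f n x\<bar>) \<partial>lborel) = ennreal (mom k (f n))"
        by (rule nn_integral_eq_integral) (use fk in auto)
      then show "(\<integral>\<^sup>+x. ennreal (norm x powr k * \<bar>f n x\<bar>) \<partial>lborel) \<le> ennreal (mom k f0 + M)"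
        using fM[of n] ennreal_leI by simp
    qed
    also have "\<dots> < \<infinity>" by (simp add: Liminf_const)
    finally show "(\<integral>\<^sup>+x. ennreal (norm (norm x powr k * \<bar>F x\<bar>)) \<partial>lborel) < \<infinity>" .
  qed measurable
  have "ev t F F" if t: "0 \<le> t" for t
  proof -
    have "fourier F \<xi> = fourier F (exp (- t) *\<^sub>R \<xi>) * exp (- A t \<xi>)" for \<xi>
    proof -
      \<comment> \<open>Convergence is known along integer times, invariance is wanted for every
        real \<open>t\<close>. By \<open>A_add\<close> in both orders, letting \<open>f n\<close>
        evolve for a further time \<open>t\<close> changes its transform from
        \<open>a n * b n\<close> to \<open>a n * c n\<close>. Both \<open>b n\<close> and
        \<open>c n\<close> tend to 1, because the frequencies in them tend to 0, and
        \<open>a n\<close> is bounded.\<close>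
      define a where "a = (\<lambda>n::nat. exp (- A (real n) \<xi>))"
      define b where "b = (\<lambda>n::nat. fourier f0 (exp (- real n) *\<^sub>R \<xi>))"
      define c where "c = (\<lambda>n::nat. fourier f0 (exp (- real n) *\<^sub>R exp (- t) *\<^sub>R \<xi>) * exp (- A t (exp (- real n) *\<^sub>R \<xi>)))"
      have e0: "(\<lambda>n. exp (- real n)) \<longlonglongrightarrow> 0"
        by (rule filterlim_compose[OF exp_at_bot]) (rule filterlim_compose[OF filterlim_uminus_at_bot_at_top filterlim_real_sequentially])
      have e: "(\<lambda>n. exp (- real n) *\<^sub>R \<eta>) \<longlonglongrightarrow> 0" for \<eta> :: 'a
        using tendsto_scaleR[OF e0 tendsto_const[of \<eta>]] by simp
      have f0c: "(\<lambda>n. fourier f0 (exp (- real n) *\<^sub>R \<eta>)) \<longlonglongrightarrow> 1" for \<eta>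
      proof -
        have "isCont (fourier f0) 0" using fourier_continuous[OF f0i, of UNIV] by (simp add: continuous_on_eq_continuous_at)
        from isCont_tendsto_compose[OF this e, of \<eta>] show ?thesis by (simp add: fourier_zero f01)
      qed
      have Ac: "(\<lambda>n. A t (exp (- real n) *\<^sub>R \<xi>)) \<longlonglongrightarrow> 0"
      proof (rule Lim_null_comparison)
        have "eventually (\<lambda>n. norm (exp (- real n) *\<^sub>R \<xi>) < 1) sequentially"
          using tendsto_norm[OF e[of \<xi>]] by (rule order_tendstoD) simp
        then show "eventually (\<lambda>n. norm (A t (exp (- real n) *\<^sub>R \<xi>)) \<le> B * norm (exp (- real n) *\<^sub>R \<xi>) powr p) sequentially"
          by eventually_elim (rule A0(1)[OF t], simp)
        have "(\<lambda>n. norm (exp (- real n) *\<^sub>R \<xi>) powr p) \<longlonglongrightarrow> 0 powr p"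
          by (rule tendsto_powr2[OF _ tendsto_const]) (use tendsto_norm[OF e[of \<xi>]] A0(2) in auto)
        from tendsto_mult_left[OF this, of B]
        show "(\<lambda>n. B * norm (exp (- real n) *\<^sub>R \<xi>) powr p) \<longlonglongrightarrow> 0" using A0(2) by simp
      qed
      have "(\<lambda>n. b n - c n) \<longlonglongrightarrow> 1 - 1 * exp (- 0)" unfolding b_def c_def
        by (intro tendsto_intros f0c Ac)
      then have bc: "(\<lambda>n. b n - c n) \<longlonglongrightarrow> 0" by simp
      have d0: "(\<lambda>n. a n * (b n - c n)) \<longlonglongrightarrow> 0"
      proof (rule Lim_null_comparison[OF _ tendsto_norm_zero[OF bc]], intro always_eventually allI)
        fix n
        have "norm (a n) * norm (b n - c n) \<le> 1 * norm (b n - c n)"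
          unfolding a_def by (intro mult_right_mono norm_exp_A_le) auto
        then show "norm (a n * (b n - c n)) \<le> norm (b n - c n)" by (simp add: norm_mult)
      qed
      have ab: "fourier (f n) \<xi> = a n * b n" for n using evf[of n] by (simp add: ev_def a_def b_def mult.commute)
      have ac: "fourier (f n) (exp (- t) *\<^sub>R \<xi>) * exp (- A t \<xi>) = a n * c n" for n
      proof -
        have "A t \<xi> + A (real n) (exp (- t) *\<^sub>R \<xi>) = A (real n) \<xi> + A t (exp (- real n) *\<^sub>R \<xi>)"
          using A_add[OF t, of "real n" \<xi>] A_add[of "real n" t \<xi>] t by (simp add: add.commute)
        moreover have "exp (- x) * exp (- y) = exp (- (x + y))" for x y :: complex by (simp flip: exp_add)
        ultimately have "exp (- A t \<xi>) * exp (- A (real n) (exp (- t) *\<^sub>R \<xi>)) = exp (- A (real n) \<xi>) * exp (- A t (exp (- real n) *\<^sub>R \<xi>))"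
          by (simp only:)
        moreover have "fourier (f n) (exp (- t) *\<^sub>R \<xi>)
            = fourier f0 (exp (- real n) *\<^sub>R exp (- t) *\<^sub>R \<xi>) * exp (- A (real n) (exp (- t) *\<^sub>R \<xi>))"
          using evf[of n] unfolding ev_def by blast
        ultimately show ?thesis unfolding a_def c_def by (metis mult.assoc mult.commute)
      qed
      have "(\<lambda>n. a n * b n - a n * c n) \<longlonglongrightarrow> fourier F \<xi> - fourier F (exp (- t) *\<^sub>R \<xi>) * exp (- A t \<xi>)"
        unfolding ab[symmetric] ac[symmetric] by (intro tendsto_intros four)
      then have "(\<lambda>n. a n * (b n - c n)) \<longlonglongrightarrow> fourier F \<xi> - fourier F (exp (- t) *\<^sub>R \<xi>) * exp (- A t \<xi>)"
        by (simp add: right_diff_distrib)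
      from LIMSEQ_unique[OF this d0] show ?thesis by simp
    qed
    then show ?thesis using Fi unfolding ev_def by blast
  qed
  then show ?thesis using that Fp Fk by blast
qed

end

section \<open>Relaxation in the weighted norm\<close>

text \<open>A converse to \<open>moment_conv\<close>: for nonnegative functions,
  \<open>norm (x - y) powr k \<le> norm x powr k + norm y powr k\<close> recovers the moment of one
  factor from those of the convolution and of the other factor. It serves to bound the jumps by the
  equilibrium.\<close>

lemma moment_conv_left:
  fixes f g :: "'a::euclidean_space \<Rightarrow> real"
  assumes k: "0 < k" "k \<le> 1" and f: "integrable lborel f" "finmom k f" "\<And>x. 0 \<le> f x"
    and g: "integrable lborel g" "finmom k g" "\<And>x. 0 \<le> g x"
  shows "mom k f * (\<integral>x. g x \<partial>lborel) \<le> mom k (conv f g) + (\<integral>x. f x \<partial>lborel) * mom k g"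
proof -
  let ?h = "\<lambda>x. norm x powr k * \<bar>f x\<bar>"
  let ?R = "\<lambda>x. norm x powr k * \<bar>conv f g x\<bar> + conv f (\<lambda>x. norm x powr k * \<bar>g x\<bar>) x"
  have c: "finmom k (conv f g)" by (rule moment_conv[OF k f(1,2) g(1,2)])
  have "mom k f * (\<integral>x. g x \<partial>lborel) = (\<integral>x. conv ?h g x \<partial>lborel)" using f g by (simp add: conv_integral)
  also have "\<dots> \<le> (\<integral>x. ?R x \<partial>lborel)"
  proof (rule integral_mono_AE)
    show "AE x in lborel. conv ?h g x \<le> ?R x"
      using conv_AE_integrable[OF f(2) g(1)] conv_AE_integrable[OF f(1) g(2)] conv_AE_integrable[OF f(1) g(1)]
    proof eventually_elim
      case (elim x)
      have "conv ?h g x \<le> (\<integral>y. norm x powr k * (f (x - y) * g y) + f (x - y) * (norm y powr k * \<bar>g y\<bar>) \<partial>lborel)"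
        unfolding conv_def
      proof (rule integral_mono)
        fix y
        have "norm (x - y) powr k * (f (x - y) * g y) \<le> (norm x powr k + norm y powr k) * (f (x - y) * g y)"
          using norm_powr_subadd[OF k, of x "- y"] f g by (intro mult_right_mono) auto
        then show "norm (x - y) powr k * \<bar>f (x - y)\<bar> * g y \<le> norm x powr k * (f (x - y) * g y) + f (x - y) * (norm y powr k * \<bar>g y\<bar>)"
          using f g by (simp add: algebra_simps)
      qed (use elim in auto)
      also have "\<dots> = ?R x" unfolding conv_def[of f "\<lambda>x. norm x powr k * \<bar>g x\<bar>"]
        using elim conv_nonneg[of f g x] f g by (subst Bochner_Integration.integral_add) (auto simp: conv_def)
      finally show ?case .
    qed
  qed (use f g c in \<open>auto intro!: Bochner_Integration.integrable_add conv_integrable\<close>)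
  also have "\<dots> = mom k (conv f g) + (\<integral>x. f x \<partial>lborel) * mom k g"
    using f g c by (subst Bochner_Integration.integral_add) (simp_all add: conv_integrable conv_integral)
  finally show ?thesis .
qed

lemma
  fixes x :: "'a::euclidean_space"
  assumes "0 \<le> k"
  shows jbr_powr_ge_1: "1 \<le> jbr x powr k" and jbr_powr_ge: "norm x powr k \<le> jbr x powr k"
    and jbr_powr_mono: "\<gamma> \<le> k \<Longrightarrow> jbr x powr \<gamma> \<le> jbr x powr k"
proof -
  have j1: "1 \<le> jbr x" by (simp add: jbr_def)
  have j2: "norm x \<le> jbr x" unfolding jbr_def by (rule real_le_rsqrt) simp
  show "1 \<le> jbr x powr k" using ge_one_powr_ge_zero[OF j1 assms] .
  show "norm x powr k \<le> jbr x powr k" using j2 assms by (intro powr_mono2) auto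
  show "\<gamma> \<le> k \<Longrightarrow> jbr x powr \<gamma> \<le> jbr x powr k" using j1 by (intro powr_mono) auto
qed

lemma jbr_powr_le:
  fixes x :: "'a::euclidean_space"
  assumes "0 < k" "k \<le> 1"
  shows "jbr x powr k \<le> 1 + norm x powr k"
proof -
  have "jbr x \<le> 1 + norm x" unfolding jbr_def by (rule real_le_lsqrt) (auto simp: power2_eq_square algebra_simps)
  then have "jbr x powr k \<le> (1 + norm x) powr k" using assms by (intro powr_mono2) (auto simp: jbr_def)
  also have "\<dots> \<le> 1 powr k + norm x powr k" using assms by (intro powr_subadd) auto
  finally show ?thesis by simp
qed

lemma jbr_measurable [measurable]: "(jbr :: 'a::euclidean_space \<Rightarrow> real) \<in> borel_measurable borel"
  unfolding jbr_def by measurable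

lemma L1k_mom:
  fixes f :: "'a::euclidean_space \<Rightarrow> real"
  assumes f: "L1k k f" and k: "0 \<le> \<gamma>" "\<gamma> \<le> k"
  shows "integrable lborel f" "finmom \<gamma> f" "nrm1 f \<le> normL1k k f" "mom \<gamma> f \<le> normL1k k f"
proof -
  have [measurable]: "f \<in> borel_measurable borel" and i: "integrable lborel (\<lambda>x. jbr x powr k * \<bar>f x\<bar>)"
    using f by (auto simp: L1k_def)
  have a: "\<bar>f x\<bar> \<le> jbr x powr k * \<bar>f x\<bar>" for x
    using mult_right_mono[OF jbr_powr_ge_1[of k x] abs_ge_zero[of "f x"]] k by simp
  have b: "norm x powr \<gamma> * \<bar>f x\<bar> \<le> jbr x powr k * \<bar>f x\<bar>" for x
    using k jbr_powr_ge[of \<gamma> x] jbr_powr_mono[of k \<gamma> x] by (intro mult_right_mono) auto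
  show 1: "integrable lborel f" by (rule Bochner_Integration.integrable_bound[OF i]) (use a in auto)
  show 2: "finmom \<gamma> f" by (rule Bochner_Integration.integrable_bound[OF i]) (use b in auto)
  show "nrm1 f \<le> normL1k k f" unfolding normL1k_def using 1 i a by (intro integral_mono) auto
  show "mom \<gamma> f \<le> normL1k k f" unfolding normL1k_def using 2 i b by (intro integral_mono) auto
qed

lemma mom_L1k:
  fixes f :: "'a::euclidean_space \<Rightarrow> real"
  assumes f: "integrable lborel f" "finmom k f" and k: "0 < k" "k \<le> 1"
  shows "L1k k f" "normL1k k f \<le> nrm1 f + mom k f"
proof -
  have [measurable]: "f \<in> borel_measurable borel" using f by auto
  have a: "jbr x powr k * \<bar>f x\<bar> \<le> \<bar>f x\<bar> + norm x powr k * \<bar>f x\<bar>" for x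
    using mult_right_mono[OF jbr_powr_le[OF k, of x] abs_ge_zero[of "f x"]] by (simp add: algebra_simps)
  have s: "integrable lborel (\<lambda>x. \<bar>f x\<bar> + norm x powr k * \<bar>f x\<bar>)" using f by simp
  have i: "integrable lborel (\<lambda>x. jbr x powr k * \<bar>f x\<bar>)"
    by (rule Bochner_Integration.integrable_bound[OF s]) (use a in auto)
  then show "L1k k f" by (simp add: L1k_def)
  have "normL1k k f \<le> (\<integral>x. \<bar>f x\<bar> + norm x powr k * \<bar>f x\<bar> \<partial>lborel)"
    unfolding normL1k_def using i s a by (intro integral_mono) auto
  then show "normL1k k f \<le> nrm1 f + mom k f" using f by simp
qed

lemma finmom_diff:
  assumes "integrable lborel f" "integrable lborel g" "finmom k f" "finmom k g"
  shows "finmom k (\<lambda>x. f x - g x)" "mom k (\<lambda>x. f x - g x) \<le> mom k f + mom k g"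
proof -
  have [measurable]: "f \<in> borel_measurable borel" "g \<in> borel_measurable borel" using assms by auto
  have le: "norm x powr k * \<bar>f x - g x\<bar> \<le> norm x powr k * \<bar>f x\<bar> + norm x powr k * \<bar>g x\<bar>" for x
    unfolding distrib_left[symmetric] by (intro mult_left_mono abs_triangle_ineq4) auto
  have s: "integrable lborel (\<lambda>x. norm x powr k * \<bar>f x\<bar> + norm x powr k * \<bar>g x\<bar>)" using assms by simp
  show i: "finmom k (\<lambda>x. f x - g x)"
    by (rule Bochner_Integration.integrable_bound[OF s]) (use le in auto)
  have "mom k (\<lambda>x. f x - g x) \<le> (\<integral>x. norm x powr k * \<bar>f x\<bar> + norm x powr k * \<bar>g x\<bar> \<partial>lborel)"
    using i s le by (intro integral_mono) auto
  then show "mom k (\<lambda>x. f x - g x) \<le> mom k f + mom k g" using assms by simp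
qed

lemma finmom_mono:
  fixes f :: "'a::euclidean_space \<Rightarrow> real"
  assumes f: "integrable lborel f" "finmom k f" and k: "0 < \<gamma>" "\<gamma> \<le> k" "k \<le> 1"
  shows "finmom \<gamma> f"
  using L1k_mom(2)[OF mom_L1k(1)[OF f]] k by simp

text \<open>The two moment bounds have different roles. \<open>M\<close>, for the small order
  \<open>\<gamma>\<close>, is uniform over the family and enters the final constant.
  \<open>M'\<close>, for the order \<open>k\<close>, may vary with \<open>s\<close> and only
  guarantees finiteness.\<close>

locale contractive_jump = jump j a for j :: "'a::euclidean_space \<Rightarrow> real" and a :: real +
  fixes k \<gamma> C lam M M' :: real
  assumes k: "0 < k" "k \<le> 1" and \<gamma>: "0 < \<gamma>" "\<gamma> \<le> k" and C: "0 \<le> C" and lam: "0 < lam"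
    and pk: "0 \<le> t \<Longrightarrow> finmom k (pd t)" "0 \<le> t \<Longrightarrow> mom k (pd t) \<le> M'"
    and p\<gamma>: "0 \<le> t \<Longrightarrow> mom \<gamma> (pd t) \<le> M"
    and decay: "0 \<le> t \<Longrightarrow> ev t v g \<Longrightarrow> (\<integral>x. v x \<partial>lborel) = 0 \<Longrightarrow> finmom \<gamma> v
      \<Longrightarrow> nrm1 g \<le> C * exp (- lam * t) * (nrm1 v + mom \<gamma> v)"
begin

text \<open>The difference of two equilibria is stationary with integral 0, so the decay forces it
  to vanish.\<close>

lemma stationary_unique:
  assumes F: "prob_density F" "finmom k F" "\<And>t. 0 \<le> t \<Longrightarrow> ev t F F"
    and G: "prob_density G" "finmom k G" "\<And>t. 0 \<le> t \<Longrightarrow> ev t G G"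
  shows "AE x in lborel. G x = F x"
proof -
  have i: "integrable lborel F" "integrable lborel G" "(\<integral>x. F x \<partial>lborel) = 1" "(\<integral>x. G x \<partial>lborel) = 1"
    using F(1) G(1) by (auto simp: prob_density_def)
  let ?v = "\<lambda>x. G x - F x"
  have v0: "(\<integral>x. ?v x \<partial>lborel) = 0" using i by simp
  have vg: "finmom \<gamma> ?v"
    by (rule finmom_diff(1)[OF i(2,1) finmom_mono[OF i(2) G(2) \<gamma> k(2)] finmom_mono[OF i(1) F(2) \<gamma> k(2)]])
  let ?N = "C * (nrm1 ?v + mom \<gamma> ?v)"
  have le: "nrm1 ?v \<le> exp (- lam * t) * ?N" if "0 \<le> t" for t
    using decay[OF that ev_diff[OF G(3)[OF that] F(3)[OF that]] v0 vg] by (simp only: mult_ac)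
  have "((\<lambda>t. exp (- lam * t)) \<longlongrightarrow> 0) at_top" using lam by real_asymp
  from tendsto_mult_right[OF this, of ?N] have l: "((\<lambda>t. exp (- lam * t) * ?N) \<longlongrightarrow> 0) at_top" by simp
  have "nrm1 ?v \<le> 0"
    by (rule tendsto_lowerbound[OF l eventually_mono[OF eventually_ge_at_top le] trivial_limit_at_top_linorder])
  moreover have "0 \<le> nrm1 ?v" by simp
  ultimately have "nrm1 ?v = 0" by linarith
  then have "AE x in lborel. \<bar>?v x\<bar> = 0"
    using i by (subst (asm) integral_nonneg_eq_0_iff_AE) auto
  then show ?thesis by eventually_elim simp
qed

text \<open>The constant must contain neither \<open>M'\<close> nor the moment \<open>mF\<close> of
  the equilibrium. The jumps are bounded by \<open>2 * mF\<close>, and \<open>mF\<close> occurs only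
  in the product \<open>mF * N0\<close>. If \<open>mF\<close> is comparable with the moment of
  \<open>u0\<close>, then \<open>N0 \<le> 2 * V\<close> is used; otherwise \<open>mF\<close> itself
  is at most \<open>2 * V\<close>, and \<open>N0 \<le> D\<close>.\<close>

lemma relaxation:
  assumes u0: "prob_density u0" "finmom k u0"
    and F: "prob_density F" "finmom k F" "\<And>t. 0 \<le> t \<Longrightarrow> ev t F F"
    and u: "\<And>t. 0 \<le> t \<Longrightarrow> ev t u0 (u t)" and t: "0 \<le> t"
  shows "normL1k k (\<lambda>x. u t x - F x)
    \<le> (1 + 2 * C + 4 * (1 + C) * (2 * mom k u0 + (2 + mom \<gamma> u0 + M))) * exp (- (min lam k / 2) * t) * normL1k k (\<lambda>x. u0 x - F x)"
proof -
  have i: "integrable lborel F" "integrable lborel u0" "(\<integral>x. F x \<partial>lborel) = 1" "(\<integral>x. u0 x \<partial>lborel) = 1"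
    and nn: "\<And>x. 0 \<le> F x" "\<And>x. 0 \<le> u0 x"
    using F(1) u0(1) by (auto simp: prob_density_def)
  have n1: "nrm1 F = 1" "nrm1 u0 = 1" using nn i by auto
  define v where "v = (\<lambda>t x. u t x - F x)"
  define v0 where "v0 = (\<lambda>x. u0 x - F x)"
  define V where "V = normL1k k v0"
  define N0 where "N0 = nrm1 v0 + mom \<gamma> v0"
  define D where "D = 2 + mom \<gamma> u0 + M"
  have evv: "ev t v0 (v t)" if "0 \<le> t" for t
    unfolding v_def v0_def by (rule ev_diff[OF u[OF that] F(3)[OF that]])
  have v0i: "integrable lborel v0" unfolding v0_def using i by simp
  have v00: "(\<integral>x. v0 x \<partial>lborel) = 0" unfolding v0_def using i by simp
  have v0k: "finmom k v0" unfolding v0_def by (intro finmom_diff(1) i F u0)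
  have v0L: "L1k k v0" by (rule mom_L1k(1)[OF v0i v0k k])
  have g0: "0 \<le> \<gamma>" and k0: "0 \<le> k" using \<gamma> k by auto
  note Vb = L1k_mom[OF v0L g0 \<gamma>(2), folded V_def] L1k_mom[OF v0L k0 order.refl, folded V_def]
  have N2V: "N0 \<le> 2 * V" unfolding N0_def using Vb by linarith
  have Fg: "finmom \<gamma> F" and ug: "finmom \<gamma> u0" 
    by (rule finmom_mono[OF i(1) F(2) \<gamma> k(2)], rule finmom_mono[OF i(2) u0(2) \<gamma> k(2)])
  have pg: "finmom \<gamma> (pd t)" if "0 \<le> t" for t by (rule finmom_mono[OF pd_int[OF that] pk(1)[OF that] \<gamma> k(2)])
  \<comment> \<open>In \<open>mom_ev_le\<close> for the stationary \<open>F\<close>, letting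
    \<open>t\<close> tend to infinity removes the initial moment.\<close>
  have MF: "mom \<gamma> F \<le> M"
  proof -
    have "((\<lambda>t. exp (- \<gamma> * t)) \<longlongrightarrow> 0) at_top" using \<gamma> by real_asymp
    from tendsto_add[OF tendsto_mult_right[OF this, of "mom \<gamma> F"] tendsto_const[of M]]
    have l: "((\<lambda>t. exp (- \<gamma> * t) * mom \<gamma> F + M) \<longlongrightarrow> M) at_top" by simp
    have "mom \<gamma> F \<le> exp (- \<gamma> * t) * mom \<gamma> F + M" if "0 \<le> t" for t
      using mom_ev_le(2)[OF that F(3)[OF that] \<gamma>(1) order_trans[OF \<gamma>(2) k(2)] Fg pg[OF that]] p\<gamma>[OF that] by (simp only: n1 mult_1_right)
    then show ?thesis
      by (intro tendsto_lowerbound[OF l]) (auto intro!: eventually_mono[OF eventually_ge_at_top[of 0]])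
  qed
  have D0: "N0 \<le> D"
  proof -
    have "nrm1 v0 \<le> (\<integral>x. \<bar>u0 x\<bar> + \<bar>F x\<bar> \<partial>lborel)" unfolding v0_def
      using i by (intro integral_mono) auto
    also have "\<dots> = 2" using i n1 by simp
    finally have "nrm1 v0 \<le> 2" .
    moreover have "mom \<gamma> v0 \<le> mom \<gamma> u0 + mom \<gamma> F" unfolding v0_def by (rule finmom_diff(2)[OF i(2,1) ug Fg])
    ultimately show ?thesis unfolding N0_def D_def using MF by linarith
  qed
  define mF where "mF = mom k F"
  define m where "m = mom k u0"
  have m0: "0 \<le> mF" "0 \<le> m" unfolding mF_def m_def by simp_all
  have N00: "0 \<le> nrm1 v0" "0 \<le> mom \<gamma> v0" "0 \<le> V" "0 \<le> mom k v0" using Vb(3) by (auto simp: order_trans[OF _ Vb(3)])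
  then have N0: "0 \<le> N0" "nrm1 v0 \<le> N0" unfolding N0_def by linarith+
  \<comment> \<open>By stationarity \<open>conv (pd t) (dil t F)\<close> lies below
    \<open>F\<close>, so \<open>moment_conv_left\<close> bounds the moment of \<open>pd t\<close> by
    that of \<open>F\<close>, with no recourse to \<open>M'\<close>.\<close>
  have m2: "mom k (pd t) \<le> 2 * mF" if t: "0 \<le> t" for t
  proof -
    have di: "integrable lborel (dil t F)" by (rule dil_integrable[OF i(1)])
    have Fm: "F \<in> borel_measurable borel" using i by auto
    note dk = moment_dil[OF Fm F(2), of t]
    have d1: "(\<integral>x. dil t F x \<partial>lborel) = 1" using i by (simp add: integral_dil_1)
    have dm: "mom k (dil t F) \<le> mF" unfolding dk(2) mF_def using k t m0(1) by (intro mult_left_le_one_le) auto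
    have "mom k (pd t) * 1 \<le> mom k (conv (pd t) (dil t F)) + (\<integral>x. pd t x \<partial>lborel) * mom k (dil t F)"
      using moment_conv_left[OF k pd_int[OF t] pk(1)[OF t] pd_nonneg[OF t] di dk(1) dil_nonneg[OF nn(1)]] unfolding d1 .
    also have "(\<integral>x. pd t x \<partial>lborel) * mom k (dil t F) \<le> 1 * mF"
      by (intro mult_mono dm) (use m0 in \<open>auto simp: pd_mass[OF t]\<close>)
    also have "mom k (conv (pd t) (dil t F)) \<le> mF" unfolding mF_def
    proof (rule finmom_bound(2)[OF F(2)])
      show "AE x in lborel. \<bar>conv (pd t) (dil t F) x\<bar> \<le> \<bar>F x\<bar>"
        using ev_AE_Sop[OF t F(3)[OF t]]
      proof eventually_elim
        fix x assume *: "F x = Sop t F x"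
        have "0 \<le> conv (pd t) (dil t F) x" by (intro conv_nonneg pd_nonneg[OF t] dil_nonneg nn)
        moreover have "0 \<le> exp (- a * t) * dil t F x" by (intro mult_nonneg_nonneg dil_nonneg nn) simp
        ultimately show "\<bar>conv (pd t) (dil t F) x\<bar> \<le> \<bar>F x\<bar>" using nn(1)[of x] * unfolding Sop_def by linarith
      qed
    qed (use conv_integrable[OF pd_int[OF t] di] in auto)
    finally show ?thesis by linarith
  qed
  \<comment> \<open>During the first half of the time the L1 norm decays while the moment of order
    \<open>k\<close> stays bounded; during the second half the moment contracts, with a source term
    that is already small.\<close>
  define r where "r = t / 2"
  have r: "0 \<le> r" using t by (simp add: r_def)
  let ?\<mu> = "min lam k"
  have vr: "finmom k (v r)" "mom k (v r) \<le> V + 2 * mF * N0"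
  proof -
    note e = mom_ev_le[OF r evv[OF r] k v0k pk(1)[OF r]]
    show "finmom k (v r)" by (rule e(1))
    have "exp (- k * r) * mom k v0 \<le> 1 * V" using Vb k r N00 by (intro mult_mono) auto
    moreover have "mom k (pd r) * nrm1 v0 \<le> 2 * mF * N0"
      using m2[OF r] m0 N00 N0 by (intro mult_mono) auto
    ultimately show "mom k (v r) \<le> V + 2 * mF * N0" using e(2) by linarith
  qed
  have e2: "ev r (v r) (v t)"
  proof -
    have "r + r = t" by (simp add: r_def)
    then show ?thesis using ev_factor[OF _ evv[OF r] r r, of "v t"] evv[OF t] by simp
  qed
  have v0g: "finmom \<gamma> v0" by (rule finmom_mono[OF v0i v0k \<gamma> k(2)])
  have dec: "nrm1 (v \<tau>) \<le> C * exp (- ?\<mu> * r) * N0" if "r \<le> \<tau>" for \<tau>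
  proof -
    have t0: "0 \<le> \<tau>" using that r by linarith
    have "?\<mu> * r \<le> lam * \<tau>" using that r lam k by (intro mult_mono) auto
    then have "C * exp (- lam * \<tau>) * N0 \<le> C * exp (- ?\<mu> * r) * N0"
      using C N0 by (intro mult_right_mono mult_left_mono) auto
    then show ?thesis using decay[OF t0 evv[OF t0] v00 v0g] unfolding N0_def[symmetric] by linarith
  qed
  define E where "E = exp (- ?\<mu> * r)"
  have E: "0 < E" "exp (- k * r) \<le> E" unfolding E_def using r by (auto intro!: mult_right_mono)
  have tr: "r \<le> t" using t by (simp add: r_def)
  note e = mom_ev_le[OF r e2 k vr(1) pk(1)[OF r]]
  have mv: "mom k (v t) \<le> E * (V + 2 * mF * N0) + 2 * mF * (C * E * N0)"
  proof -
    have "exp (- k * r) * mom k (v r) \<le> E * (V + 2 * mF * N0)" using E vr by (intro mult_mono) auto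
    moreover have "mom k (pd r) * nrm1 (v r) \<le> 2 * mF * (C * E * N0)"
      using m2[OF r] dec[OF order.refl] m0 unfolding E_def by (intro mult_mono) auto
    ultimately show ?thesis using e(2) by linarith
  qed
  have nv: "nrm1 (v t) \<le> C * E * (2 * V)"
    using dec[OF tr] mult_left_mono[OF N2V, of "C * E"] C E unfolding E_def by simp
  \<comment> \<open>An equilibrium with a large moment is far from \<open>u0\<close>, so \<open>V\<close> is then comparable with \<open>mF\<close>.\<close>
  have mN: "mF * N0 \<le> (4 * m + 2 * D) * V"
  proof (cases "mF \<le> 2 * m")
    case True
    have "mF * N0 \<le> (2 * m) * (2 * V)" using True N2V N0 m0 by (intro mult_mono) auto
    moreover have "0 \<le> 2 * D * V" using D0 N0(1) N00(3) by (intro mult_nonneg_nonneg) linarith+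
    ultimately show ?thesis by (simp add: algebra_simps)
  next
    case False
    have "mom k F \<le> mom k (\<lambda>x. u0 x - v0 x)" by (simp add: v0_def)
    also have "\<dots> \<le> m + mom k v0" unfolding m_def by (rule finmom_diff(2)[OF i(2) v0i u0(2) v0k])
    finally have "mF \<le> 2 * V" using False Vb(8) unfolding mF_def by linarith
    then have "mF * N0 \<le> (2 * V) * D" using D0 N0(1) N00(3) by (intro mult_mono) linarith+
    moreover have "0 \<le> 4 * m * V" using m0 N00 by simp
    ultimately show ?thesis by (simp add: algebra_simps)
  qed
  have "integrable lborel (v t)" using e2 by (simp add: ev_def)
  from mom_L1k(2)[OF this e(1) k]
  have "normL1k k (v t) \<le> C * E * (2 * V) + (E * (V + 2 * mF * N0) + 2 * mF * (C * E * N0))"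
    using mv nv by linarith
  also have "\<dots> = E * ((1 + 2 * C) * V + 2 * (1 + C) * (mF * N0))" by (simp add: algebra_simps)
  also have "\<dots> \<le> E * ((1 + 2 * C) * V + 2 * (1 + C) * ((4 * m + 2 * D) * V))"
    using E C mN by (intro mult_left_mono add_left_mono) auto
  also have "\<dots> = (1 + 2 * C + 4 * (1 + C) * (2 * m + D)) * E * V" by (simp add: algebra_simps)
  also have "E = exp (- (?\<mu> / 2) * t)" unfolding E_def r_def by simp
  finally show ?thesis unfolding V_def m_def D_def v_def v0_def .
qed

end

section \<open>Constants uniform over the family\<close>

context kernel_family
begin

text \<open>\<open>uniform_decay\<close> is applied with the order \<open>k / 2\<close>, which is
  strictly below 1 even for \<open>k = 1\<close>, so that its constants are uniform. The order
  \<open>k\<close> itself takes the exponent \<open>2 * s\<close>, and its bound is allowed to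
  depend on \<open>s\<close>.\<close>

theorem uniform_contraction:
  assumes k: "0 < k" "k \<le> 1"
  obtains \<gamma> C lam M where "0 \<le> C" "0 < lam" "0 \<le> M"
    "\<And>s \<epsilon>. s \<in> {1/2<..<1} \<Longrightarrow> 0 < \<epsilon> \<Longrightarrow> \<epsilon> < 1 \<Longrightarrow>
      \<exists>M'. contractive_jump (resc \<epsilon> (J s)) (\<epsilon> powr (- 2 * s)) k \<gamma> C lam M M'"
proof -
  have k2: "0 < k / 2" "k / 2 < 1" using k by auto
  obtain \<gamma> C lam where \<gamma>: "0 < \<gamma>" "\<gamma> \<le> k / 2" and C: "0 \<le> C" and lam: "0 < lam"
    and dec: "\<And>s \<epsilon> t v g. s \<in> {1/2<..<1} \<Longrightarrow> 0 < \<epsilon> \<Longrightarrow> \<epsilon> < 1 \<Longrightarrow> 0 \<le> t \<Longrightarrow> jump.ev (resc \<epsilon> (J s)) (\<epsilon> powr (- 2 * s)) t v g \<Longrightarrow>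
       (\<integral>x. v x \<partial>lborel) = 0 \<Longrightarrow> finmom \<gamma> v \<Longrightarrow> nrm1 g \<le> C * exp (- lam * t) * (nrm1 v + mom \<gamma> v)"
    by (rule uniform_decay[OF k2]) blast
  have \<gamma>1: "\<gamma> \<le> 1" "\<gamma> < 1" "\<gamma> \<le> k" using \<gamma> k by auto
  define M where "M = \<bar>DIM('a) * momc (1 + C0) 1 \<gamma>\<bar>"
  have "contractive_jump (resc \<epsilon> (J s)) (\<epsilon> powr (- 2 * s)) k \<gamma> C lam M (DIM('a) * momc (1 + C0) (2 * s) k)"
    if s: "s \<in> {1/2<..<1}" and \<epsilon>: "0 < \<epsilon>" "\<epsilon> < 1" for s \<epsilon>
  proof -
    have s1: "k < 2 * s" "1 \<le> 2 * s" using s k by auto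
    have "mom \<gamma> (jump.pd (resc \<epsilon> (J s)) (\<epsilon> powr (- 2 * s)) t) \<le> M" if "0 \<le> t" for t
      using mom_pd_le(2)[OF s \<epsilon> that \<gamma>(1) \<gamma>1(1,2) s1(2)] unfolding M_def by linarith
    then show ?thesis
      by (intro contractive_jump.intro jump_resc s \<epsilon> contractive_jump_axioms.intro
          k \<gamma> \<gamma>1 C lam mom_pd_le[OF s \<epsilon> _ k s1(1) order.refl] dec[OF s \<epsilon>])
  qed
  then show ?thesis using that[of C lam M \<gamma>] C lam unfolding M_def by auto
qed

lemma stationary_density:
  assumes s: "s \<in> {1/2<..<1}" and \<epsilon>: "0 < \<epsilon>" "\<epsilon> < 1" and k: "0 < k" "k \<le> 1"
    and cj: "contractive_jump (resc \<epsilon> (J s)) (\<epsilon> powr (- 2 * s)) k \<gamma> C lam M M'"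
  obtains F where "prob_density F" "finmom k F"
    "\<And>t. 0 \<le> t \<Longrightarrow> jump.ev (resc \<epsilon> (J s)) (\<epsilon> powr (- 2 * s)) t F F"
proof -
  note result = that
  define a where "a = \<epsilon> powr (- 2 * s)"
  define j where "j = resc \<epsilon> (J s)"
  interpret contractive_jump j a k \<gamma> C lam M M' unfolding a_def j_def by (rule cj)
  have s1: "k < 2 * s" "0 < 2 * s" using s k by auto
  show ?thesis
  proof (rule stationary_exists)
    \<comment> \<open>The iteration starts from \<open>J s\<close> itself, whose moment of order
      \<open>k\<close> is finite because \<open>k < 2 * s\<close>.\<close>
    show "prob_density (J s)" by (rule Jpd[OF s])
    show "finmom k (J s)" by (rule mom_J(1)[OF s k s1(1) order.refl])
    show "norm (A t \<xi>) \<le> (1 + C0) * norm \<xi> powr (2 * s)" if "0 \<le> t" "norm \<xi> \<le> 1" for t \<xi>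
      unfolding a_def j_def by (rule A_le_powr[OF s \<epsilon> that])
    show "nrm1 g \<le> (C * (nrm1 v + mom \<gamma> v)) * exp (- lam * t)"
      if "0 \<le> t" "ev t v g" "(\<integral>x. v x \<partial>lborel) = 0" "finmom k v" for t v g
    proof -
      have "integrable lborel v" using that(2) by (simp add: ev_def)
      from decay[OF that(1-3) finmom_mono[OF this that(4) \<gamma> k(2)]] show ?thesis by (simp only: mult_ac)
    qed
    show thesis if "prob_density F" "finmom k F" "\<And>t. 0 \<le> t \<Longrightarrow> ev t F F" for F
      by (rule result[OF that(1,2) that(3)[unfolded a_def j_def]])
  qed (fact k pk s1 lam)+
qed

end

lemma equilibrium_iff_ev:
  assumes j: "jump (resc \<epsilon> J) (\<epsilon> powr (- 2 * s))"
  shows "equilibrium \<epsilon> J F s \<longleftrightarrow> prob_density F \<and> (\<forall>t\<ge>0. jump.ev (resc \<epsilon> J) (\<epsilon> powr (- 2 * s)) t F F)"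
proof (cases "prob_density F")
  case True
  then have "integrable lborel F" by (simp add: prob_density_def)
  then have js: "jump_stationary (resc \<epsilon> J) (\<epsilon> powr (- 2 * s)) F"
    using j by (simp add: jump_stationary_def jump_stationary_axioms_def)
  show ?thesis
    unfolding jump_stationary.weak_equilibrium_iff_ev[OF js, symmetric] jump_stationary.weak_equilibrium_def[OF js] equilibrium_def ..
qed (simp add: equilibrium_def)

lemma L1k_diff:
  assumes "L1k k f" "L1k k g" "0 < k" "k \<le> 1"
  shows "L1k k (\<lambda>x. f x - g x)"
proof -
  note f = L1k_mom[OF assms(1) less_imp_le[OF assms(3)] order.refl] and g = L1k_mom[OF assms(2) less_imp_le[OF assms(3)] order.refl]
  show ?thesis using f g by (intro mom_L1k(1) finmom_diff(1) assms) auto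
qed

lemma mild_solution_ev:
  assumes j: "jump (resc \<epsilon> J) (\<epsilon> powr (- 2 * s))" and k: "0 < k" "k \<le> 1"
    and u: "mild_solution \<epsilon> s J k u0 u" and u0: "integrable lborel u0" and t: "0 \<le> t"
  shows "jump.ev (resc \<epsilon> J) (\<epsilon> powr (- 2 * s)) t u0 (u t)"
proof -
  have uL: "L1k k (u t)" if "0 \<le> t" for t using u that by (simp add: mild_solution_def)
  have k0: "0 \<le> k" using k by simp
  have "jump_curve (resc \<epsilon> J) (\<epsilon> powr (- 2 * s)) u u0"
  proof (intro jump_curve.intro j jump_curve_axioms.intro u0 L1_curve.intro)
    show "integrable lborel (u t)" if "0 \<le> t" for t using L1k_mom(1)[OF uL[OF that] k0 order.refl] .
    show "((\<lambda>t. nrm1 (\<lambda>x. u t x - u t0 x)) \<longlongrightarrow> 0) (at t0 within {0..})" if t0: "0 \<le> t0" for t0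
    proof (rule Lim_null_comparison)
      show "((\<lambda>t. normL1k k (\<lambda>x. u t x - u t0 x)) \<longlongrightarrow> 0) (at t0 within {0..})"
        using u t0 by (simp add: mild_solution_def)
      have "norm (nrm1 (\<lambda>x. u t x - u t0 x)) \<le> normL1k k (\<lambda>x. u t x - u t0 x)" if "0 \<le> t" for t
        using L1k_mom(3)[OF L1k_diff[OF uL[OF that] uL[OF t0] k] k0 order.refl] by simp
      then show "\<forall>\<^sub>F t in at t0 within {0..}. norm (nrm1 (\<lambda>x. u t x - u t0 x)) \<le> normL1k k (\<lambda>x. u t x - u t0 x)"
        unfolding eventually_at_filter by (intro always_eventually) simp
    qed
  qed
  then show ?thesis
  proof (rule jump_curve.mild_imp_ev[OF _ _ t])
    show "AE x in lborel. u t x = mild_rhs (resc \<epsilon> J) (\<epsilon> powr (- 2 * s)) u0 u t x" if "0 \<le> t" for t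
      using u that unfolding mild_solution_def mild_rhs_def Tsg_eq_dil by blast
  qed
qed

theorem theorem1p2:
  fixes J :: "real \<Rightarrow> 'a::euclidean_space \<Rightarrow> real"
  assumes "H1 J"
  shows
    "(\<forall>\<epsilon>\<in>{0<..<1}. \<forall>s\<in>{1/2<..<1}. \<forall>k\<in>{0<..1}.
        \<exists>F. equilibrium \<epsilon> (J s) F s \<and> L1k k F \<and>
          (\<forall>G. equilibrium \<epsilon> (J s) G s \<and> L1k k G \<longrightarrow> (AE x in lborel. G x = F x)))
   \<and> (\<forall>k\<in>{0<..1}. \<forall>u0. prob_density u0 \<and> L1k k u0 \<longrightarrow>
        (\<exists>C>0. \<exists>lam>0. \<forall>\<epsilon>\<in>{0<..<1}. \<forall>s\<in>{1/2<..<1}. \<forall>F u.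
           equilibrium \<epsilon> (J s) F s \<and> L1k k F \<and> mild_solution \<epsilon> s (J s) k u0 u \<longrightarrow>
           (\<forall>t\<ge>0. normL1k k (\<lambda>x. u t x - F x)
                    \<le> C * exp (- lam * t) * normL1k k (\<lambda>x. u0 x - F x))))"
proof -
  have "\<forall>s\<in>{1/2<..<1}. prob_density (J s)" using assms unfolding H1_def by blast
  moreover obtain \<delta> C0 where "0 < \<delta>" "0 < C0" "\<forall>s\<in>{1/2<..<1}. \<forall>\<xi>::'a. norm \<xi> \<le> 1 \<longrightarrow>
        norm (fourier (J s) \<xi> - complex_of_real (1 - norm \<xi> powr (2 * s))) \<le> C0 * norm \<xi> powr (2 * s + \<delta>)"
    using assms unfolding H1_def by blast
  ultimately interpret kernel_family J \<delta> C0 by (intro kernel_family.intro) blast+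
  have pdi: "integrable lborel f" if "prob_density f" for f :: "'a \<Rightarrow> real" using that by (simp add: prob_density_def)
  have mk: "finmom k f" if "L1k k f" "0 < k" for k and f :: "'a \<Rightarrow> real"
    using L1k_mom(2)[OF that(1) less_imp_le[OF that(2)] order.refl] .
  have part1: "\<exists>F. equilibrium \<epsilon> (J s) F s \<and> L1k k F \<and>
          (\<forall>G. equilibrium \<epsilon> (J s) G s \<and> L1k k G \<longrightarrow> (AE x in lborel. G x = F x))"
    if "\<epsilon> \<in> {0<..<1}" and s: "s \<in> {1/2<..<1}" and "k \<in> {0<..1}" for \<epsilon> s k
  proof -
    have \<epsilon>: "0 < \<epsilon>" "\<epsilon> < 1" and k: "0 < k" "k \<le> 1" using that by auto
    obtain \<gamma> C lam M M' where cj: "contractive_jump (resc \<epsilon> (J s)) (\<epsilon> powr (- 2 * s)) k \<gamma> C lam M M'"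
      by (rule uniform_contraction[OF k]) (use s \<epsilon> in blast)
    note eq = equilibrium_iff_ev[OF jump_resc[OF s \<epsilon>(1)]]
    obtain F where F: "prob_density F" "finmom k F" "\<And>t. 0 \<le> t \<Longrightarrow> jump.ev (resc \<epsilon> (J s)) (\<epsilon> powr (- 2 * s)) t F F"
      by (rule stationary_density[OF s \<epsilon> k cj]) blast
    have "AE x in lborel. G x = F x" if G: "equilibrium \<epsilon> (J s) G s" "L1k k G" for G
      using contractive_jump.stationary_unique[OF cj F _ mk[OF G(2) k(1)]] G(1) unfolding eq by blast
    then show ?thesis using F mom_L1k(1)[OF pdi[OF F(1)] F(2) k] unfolding eq by blast
  qed
  have part2: "\<exists>C>0. \<exists>lam>0. \<forall>\<epsilon>\<in>{0<..<1}. \<forall>s\<in>{1/2<..<1}. \<forall>F u.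
           equilibrium \<epsilon> (J s) F s \<and> L1k k F \<and> mild_solution \<epsilon> s (J s) k u0 u \<longrightarrow>
           (\<forall>t\<ge>0. normL1k k (\<lambda>x. u t x - F x) \<le> C * exp (- lam * t) * normL1k k (\<lambda>x. u0 x - F x))"
    if "k \<in> {0<..1}" and u0: "prob_density u0" "L1k k u0" for k u0
  proof -
    have k: "0 < k" "k \<le> 1" using that by auto
    obtain \<gamma> C lam M where C: "0 \<le> C" and lam: "0 < lam" and M: "0 \<le> M"
      and cj: "\<And>s \<epsilon>. s \<in> {1/2<..<1} \<Longrightarrow> 0 < \<epsilon> \<Longrightarrow> \<epsilon> < 1 \<Longrightarrow>
        \<exists>M'. contractive_jump (resc \<epsilon> (J s)) (\<epsilon> powr (- 2 * s)) k \<gamma> C lam M M'"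
      by (rule uniform_contraction[OF k]) blast
    \<comment> \<open>Fixed before \<open>\<epsilon>\<close>, \<open>s\<close> and the equilibrium:
      besides \<open>u0\<close> and \<open>k\<close>, only the constants of the family
      enter.\<close>
    define K where "K = 1 + 2 * C + 4 * (1 + C) * (2 * mom k u0 + (2 + mom \<gamma> u0 + M))"
    define \<mu> where "\<mu> = min lam k / 2"
    have "0 \<le> mom k u0" "0 \<le> mom \<gamma> u0" by simp_all
    then have "0 \<le> 4 * (1 + C) * (2 * mom k u0 + (2 + mom \<gamma> u0 + M))"
      using C M by (intro mult_nonneg_nonneg) linarith+
    then have K: "0 < K" unfolding K_def using C by linarith
    have \<mu>: "0 < \<mu>" unfolding \<mu>_def using lam k by simp
    have "normL1k k (\<lambda>x. u t x - F x) \<le> K * exp (- \<mu> * t) * normL1k k (\<lambda>x. u0 x - F x)"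
      if "\<epsilon> \<in> {0<..<1}" and s: "s \<in> {1/2<..<1}" and F: "equilibrium \<epsilon> (J s) F s" "L1k k F"
        and u: "mild_solution \<epsilon> s (J s) k u0 u" and t: "0 \<le> t" for \<epsilon> s F u t
    proof -
      have \<epsilon>: "0 < \<epsilon>" "\<epsilon> < 1" using that by auto
      obtain M' where c: "contractive_jump (resc \<epsilon> (J s)) (\<epsilon> powr (- 2 * s)) k \<gamma> C lam M M'"
        using cj[OF s \<epsilon>] by blast
      note jr = jump_resc[OF s \<epsilon>(1)]
      from F(1) have Fe: "prob_density F" "\<And>t. 0 \<le> t \<Longrightarrow> jump.ev (resc \<epsilon> (J s)) (\<epsilon> powr (- 2 * s)) t F F"
        unfolding equilibrium_iff_ev[OF jr] by blast+
      show ?thesis unfolding K_def \<mu>_def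
        by (rule contractive_jump.relaxation[OF c u0(1) mk[OF u0(2) k(1)] Fe(1) mk[OF F(2) k(1)] Fe(2)
              mild_solution_ev[OF jr k u pdi[OF u0(1)]] t])
    qed
    with K \<mu> show ?thesis by blast
  qed
  show ?thesis using part1 part2 by blast
qed

end
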